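(* Let $\mathcal{U}_0$ denote either $\mathcal{U}_{\mathbf v_0,\mathbf g_0}$ or $\mathcal{U}_{\mathbf v_0}$. There exists a constant $C$, independent of $\varepsilon\in(0,1)$ and $\beta>0$, such that for every $\varepsilon\in(0,1)$ and $\beta>0$ every minimizer $\mathbf v=\mathbf v_{\varepsilon,\beta}$ of $\mathcal{F}_{\varepsilon,\beta}$ in $\mathcal{U}_0$ satisfies $$\int_\tau^{\tau+T}\!\!\int_\Omega\left\{|\nabla\mathbf v|^2+\beta\langle\mathbf v^2,A\mathbf v^2\rangle\right\}dx\,dt\le CT\qquad\forall\,\tau\ge0,\ \forall\,T\ge\varepsilon,$$ $$\|\mathbf v\|_{L^\infty(\Omega\times\mathbb{R}^+)^k}\le C,$$ $$\int_0^\infty\!\!\int_\Omega|\partial_t\mathbf v|^2\,dx\,dt\le C.$$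
   Context: $\Omega\subset\mathbb{R}^N$ is a bounded domain with smooth boundary, $\mathbb{R}^+=(0,+\infty)$, $k\ge 2$, and $A=(a_{ij})$ is a symmetric $k\times k$ matrix with $a_{ii}=0$ and $a_{ij}>0$ for $i\ne j$. The functions $F_i:\mathbb{R}\to\mathbb{R}$, $i=1,\dots,k$, are continuous on $\mathbb{R}$, differentiable in $[0,1)$, non-decreasing in $(-\infty,0)$, non-increasing in $(1,+\infty)$, and satisfy $F_i'(0)=0$. For $\mathbf v=(v_1,\dots,v_k)$ write $|\partial_t\mathbf v|^2=\sum_i|\partial_t v_i|^2$, $|\nabla\mathbf v|^2=\sum_i|\nabla v_i|^2$ ($\nabla$ is the gradient in $x$), $\langle\mathbf v^2,A\mathbf v^2\rangle=\sum_{i,j=1}^k a_{ij}v_i^2v_j^2$, $F(\mathbf v)=\sum_i F_i(v_i)$. Let $\mathcal{U}=\bigcap_{T>0}H^1(\Omega\times(0,T))^k$. For $\varepsilon,\beta>0$ define $\mathcal{F}_{\varepsilon,\beta}:\mathcal{U}\to(-\infty,+\infty]$ by $$\mathcal{F}_{\varepsilon,\beta}(\mathbf v)=\int_0^\infty\!\!\int_\Omega\frac{e^{-t/\varepsilon}}{\varepsilon}\Big\{\varepsilon|\partial_t\mathbf v|^2+|\nabla\mathbf v|^2-2F(\mathbf v)+\frac{\beta}{2}\langle\mathbf v^2,A\mathbf v^2\rangle\Big\}\,dx\,dt .$$ The datum $\mathbf v_0=(v_{01},\dots,v_{0k})\in H^1(\Omega)^k$ satisfies $0\le v_{0i}\le1$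 for all $i$ and $v_{0i}v_{0j}=0$ a.e. in $\Omega$ for all $i\neq j$; $\mathbf g_0\in H^{1/2}(\partial\Omega)^k$ is the trace of $\mathbf v_0$ on $\partial\Omega$. In the sense of traces, $\mathcal{U}_{\mathbf v_0}=\{\mathbf v\in\mathcal{U}:\mathbf v(\cdot,0)=\mathbf v_0\}$ and $\mathcal{U}_{\mathbf v_0,\mathbf g_0}=\{\mathbf v\in\mathcal{U}:\mathbf v(\cdot,0)=\mathbf v_0,\ \mathbf v(\cdot,t)=\mathbf g_0\text{ on }\partial\Omega\text{ for a.e. }t>0\}$. A minimizer means an absolute minimizer. *)

theory Defs
  imports "HOL-Probability.Essential_Supremum"
begin

section \<open>Smooth functions and smooth domains\<close>

primrec C_k :: "nat \<Rightarrow> ('a::euclidean_space \<Rightarrow> real) \<Rightarrow> bool" where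
  "C_k 0 f \<longleftrightarrow> continuous_on UNIV f"
| "C_k (Suc m) f \<longleftrightarrow> (\<forall>x. f differentiable (at x)) \<and>
     (\<forall>b\<in>Basis. C_k m (\<lambda>x. frechet_derivative f (at x) b))"

definition smooth_fun :: "('a::euclidean_space \<Rightarrow> real) \<Rightarrow> bool" where
  "smooth_fun f \<longleftrightarrow> (\<forall>m. C_k m f)"

(* Near each boundary point the set is the strict epigraph, in the direction of a unit
   vector n, of a smooth function of the coordinates orthogonal to n; the vector
   x - (x \<bullet> n) n is the orthogonal projection of x onto the hyperplane orthogonal to n. *)
definition smooth_boundary :: "'a::euclidean_space set \<Rightarrow> bool" where
  "smooth_boundary D \<longleftrightarrow> (\<forall>p\<in>frontier D. \<exists>r>0. \<exists>n \<gamma>. norm n = 1 \<and> smooth_fun \<gamma> \<and>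
     D \<inter> ball p r = {x \<in> ball p r. \<gamma> (x - (x \<bullet> n) *\<^sub>R n) < x \<bullet> n})"

definition bounded_smooth_domain :: "'a::euclidean_space set \<Rightarrow> bool" where
  "bounded_smooth_domain D \<longleftrightarrow>
     open D \<and> connected D \<and> D \<noteq> {} \<and> bounded D \<and> smooth_boundary D"


section \<open>Surface measure\<close>

(* The test for emptiness matters only for d = 0, where a nonempty set of diameter 0
   has to count 1 and the empty members of a cover 0. *)
definition hausdorff_outer :: "nat \<Rightarrow> 'a::metric_space set \<Rightarrow> ennreal" where
  "hausdorff_outer d S = (SUP \<delta>\<in>{0<..}. INF E\<in>{E :: nat \<Rightarrow> 'a set.
       S \<subseteq> (\<Union>m. E m) \<and> (\<forall>m. bounded (E m) \<and> diameter (E m) \<le> \<delta>)}.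
     (\<Sum>m. if E m = {} then 0
           else ennreal (unit_ball_vol (real d) * (diameter (E m) / 2) ^ d)))"

definition hausdorff_measure :: "nat \<Rightarrow> 'a::metric_space measure" where
  "hausdorff_measure d =
     measure_of UNIV (lambda_system UNIV UNIV (hausdorff_outer d)) (hausdorff_outer d)"

definition surface_measure :: "'a::euclidean_space set \<Rightarrow> 'a measure" where
  "surface_measure D = restrict_space (hausdorff_measure (DIM('a) - 1)) (frontier D)"


section \<open>Weak derivatives and $H^1$\<close>

definition L2 :: "'a measure \<Rightarrow> ('a \<Rightarrow> real) set" where
  "L2 M = {u \<in> borel_measurable M. integrable M (\<lambda>x. (u x)\<^sup>2)}"

definition loc_integrable :: "'a::euclidean_space set \<Rightarrow> ('a \<Rightarrow> real) \<Rightarrow> bool" where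
  "loc_integrable D u \<longleftrightarrow> (\<forall>K. compact K \<and> K \<subseteq> D \<longrightarrow> set_integrable lebesgue K u)"

definition test_functions :: "'a::euclidean_space set \<Rightarrow> ('a \<Rightarrow> real) set" where
  "test_functions D = {\<phi>. smooth_fun \<phi> \<and>
     compact (closure {x. \<phi> x \<noteq> 0}) \<and> closure {x. \<phi> x \<noteq> 0} \<subseteq> D}"

definition has_weak_partial ::
  "'a::euclidean_space set \<Rightarrow> 'a \<Rightarrow> ('a \<Rightarrow> real) \<Rightarrow> ('a \<Rightarrow> real) \<Rightarrow> bool" where
  "has_weak_partial D b u g \<longleftrightarrow> loc_integrable D u \<and> loc_integrable D g \<and>
     (\<forall>\<phi>\<in>test_functions D.
        (LINT x:D|lebesgue. u x * frechet_derivative \<phi> (at x) b)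
          = - (LINT x:D|lebesgue. g x * \<phi> x))"

(* A representative of the weak partial derivative, which is unique up to null sets. *)
definition weak_partial ::
  "'a::euclidean_space set \<Rightarrow> 'a \<Rightarrow> ('a \<Rightarrow> real) \<Rightarrow> 'a \<Rightarrow> real" where
  "weak_partial D b u = (SOME g. has_weak_partial D b u g)"

definition H1 :: "'a::euclidean_space set \<Rightarrow> ('a \<Rightarrow> real) set" where
  "H1 D = {u \<in> L2 (lebesgue_on D).
     \<forall>b\<in>Basis. \<exists>g\<in>L2 (lebesgue_on D). has_weak_partial D b u g}"

definition H1_norm :: "'a::euclidean_space set \<Rightarrow> ('a \<Rightarrow> real) \<Rightarrow> real" where
  "H1_norm D u = sqrt ((LINT x|lebesgue_on D. (u x)\<^sup>2) +
     (\<Sum>b\<in>Basis. LINT x|lebesgue_on D. (weak_partial D b u x)\<^sup>2))"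


section \<open>Traces\<close>

(* The trace operator is the continuous extension to H1 D of the restriction map on functions
   of H1 D that are continuous up to the boundary. The portion of the boundary
   on which the trace is taken is given as the image under j of a measure space M: for
   the whole boundary, j is the identity and M the surface measure; for the bottom
   of the cylinder D = G x (0,T), j x = (x,0) and M is the Lebesgue measure on G. *)
definition has_trace :: "'a::euclidean_space set \<Rightarrow> 'b measure \<Rightarrow> ('b \<Rightarrow> 'a) \<Rightarrow>
    ('a \<Rightarrow> real) \<Rightarrow> ('b \<Rightarrow> real) \<Rightarrow> bool" where
  "has_trace D M j u g \<longleftrightarrow> u \<in> H1 D \<and> g \<in> L2 M \<and>
     (\<exists>\<phi> :: nat \<Rightarrow> 'a \<Rightarrow> real. (\<forall>m. \<phi> m \<in> H1 D \<and> continuous_on (closure D) (\<phi> m)) \<and>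
        (\<lambda>m. H1_norm D (\<lambda>x. \<phi> m x - u x)) \<longlonglongrightarrow> 0 \<and>
        (\<lambda>m. \<integral>\<^sup>+ y. ennreal ((\<phi> m (j y) - g y)\<^sup>2) \<partial>M) \<longlonglongrightarrow> 0)"

definition has_boundary_trace ::
  "'a::euclidean_space set \<Rightarrow> ('a \<Rightarrow> real) \<Rightarrow> ('a \<Rightarrow> real) \<Rightarrow> bool" where
  "has_boundary_trace D u g \<longleftrightarrow> has_trace D (surface_measure D) (\<lambda>x. x) u g"

definition has_initial_trace :: "'a::euclidean_space set \<Rightarrow> real \<Rightarrow>
    ('a \<times> real \<Rightarrow> real) \<Rightarrow> ('a \<Rightarrow> real) \<Rightarrow> bool" where
  "has_initial_trace D T u g \<longleftrightarrow>
     has_trace (D \<times> {0<..<T}) (lebesgue_on D) (\<lambda>x. (x, 0)) u g"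


section \<open>The functional and its domain\<close>

definition U_space :: "'a::euclidean_space set \<Rightarrow> ('a \<times> real \<Rightarrow> real^'k) set" where
  "U_space D = {v. \<forall>T>0. \<forall>i. (\<lambda>z. v z $ i) \<in> H1 (D \<times> {0<..<T})}"

definition U_init ::
  "'a::euclidean_space set \<Rightarrow> ('a \<Rightarrow> real^'k) \<Rightarrow> ('a \<times> real \<Rightarrow> real^'k) set" where
  "U_init D v0 = {v \<in> U_space D.
     \<forall>T>0. \<forall>i. has_initial_trace D T (\<lambda>z. v z $ i) (\<lambda>x. v0 x $ i)}"

definition U_init_bdry :: "'a::euclidean_space set \<Rightarrow> ('a \<Rightarrow> real^'k) \<Rightarrow> ('a \<Rightarrow> real^'k)
    \<Rightarrow> ('a \<times> real \<Rightarrow> real^'k) set" where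
  "U_init_bdry D v0 g0 = {v \<in> U_init D v0.
     AE t in lebesgue. t > 0 \<longrightarrow>
       (\<forall>i. has_boundary_trace D (\<lambda>x. v (x, t) $ i) (\<lambda>x. g0 x $ i))}"

definition dt_sq :: "'a::euclidean_space set \<Rightarrow> ('a \<times> real \<Rightarrow> real^'k) \<Rightarrow> 'a \<times> real \<Rightarrow> real" where
  "dt_sq D v z = (\<Sum>i\<in>UNIV. (weak_partial (D \<times> {0<..}) (0, 1) (\<lambda>z. v z $ i) z)\<^sup>2)"

definition grad_sq :: "'a::euclidean_space set \<Rightarrow> ('a \<times> real \<Rightarrow> real^'k) \<Rightarrow> 'a \<times> real \<Rightarrow> real" where
  "grad_sq D v z = (\<Sum>i\<in>UNIV. \<Sum>b\<in>Basis.
     (weak_partial (D \<times> {0<..}) (b, 0) (\<lambda>z. v z $ i) z)\<^sup>2)"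

definition competition :: "real^'k^'k \<Rightarrow> real^'k \<Rightarrow> real" where
  "competition A y = (\<Sum>i\<in>UNIV. \<Sum>j\<in>UNIV. A $ i $ j * (y $ i)\<^sup>2 * (y $ j)\<^sup>2)"

(* Lebesgue integral with values in the extended reals. It is meaningful as soon as one of
   the two parts is finite; in the functional below the negative part is finite, since F
   is bounded above and D is bounded. *)
definition ext_integral :: "'a measure \<Rightarrow> ('a \<Rightarrow> real) \<Rightarrow> ereal" where
  "ext_integral M f =
     enn2ereal (\<integral>\<^sup>+ x. ennreal (f x) \<partial>M) - enn2ereal (\<integral>\<^sup>+ x. ennreal (- f x) \<partial>M)"

definition energy :: "'a::euclidean_space set \<Rightarrow> real^'k^'k \<Rightarrow> ('k \<Rightarrow> real \<Rightarrow> real) \<Rightarrow>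
    real \<Rightarrow> real \<Rightarrow> ('a \<times> real \<Rightarrow> real^'k) \<Rightarrow> ereal" where
  "energy D A F \<epsilon> \<beta> v = ext_integral (lebesgue_on (D \<times> {0<..}))
     (\<lambda>z. exp (- snd z / \<epsilon>) / \<epsilon> *
        (\<epsilon> * dt_sq D v z + grad_sq D v z - 2 * (\<Sum>i\<in>UNIV. F i (v z $ i))
          + \<beta> / 2 * competition A (v z)))"

end

theory Submission
  imports Defs
begin

text \<open>Up to an additive constant the functional is \<open>J v\<close>, the integral of
  \<open>exp (- t / \<epsilon>) / \<epsilon> * (\<epsilon> |\<partial>\<^sub>t v|\<^sup>2 + r)\<close> with \<open>r = |\<nabla>v|\<^sup>2 + 2 (const - F(v)) + \<beta> / 2 * \<langle>v\<^sup>2, A v\<^sup>2\<rangle>\<close> nonnegative.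
  Comparison of a minimizer \<open>v\<close> with the time-independent extension of \<open>v\<^sub>0\<close>, whose competition term
  vanishes, bounds \<open>J v\<close> independently of \<open>\<epsilon>\<close> and \<open>\<beta>\<close>. Comparison with a smooth truncation of \<open>v\<close>
  yields \<open>0 \<le> v\<^sub>i \<le> 1\<close>. Comparison with \<open>v\<close> after the time change \<open>t + \<delta> \<eta>(t)\<close> gives, as \<open>\<delta>\<close> tends to 0,
  that the integral of \<open>exp (- t / \<epsilon>) / \<epsilon> * ((\<eta> / \<epsilon> + \<eta>') \<epsilon> |\<partial>\<^sub>t v|\<^sup>2 + (\<eta> / \<epsilon> - \<eta>') r)\<close> is at most 0. For the logistic
  profile \<open>\<eta> = \<epsilon> (L - (L + 1) \<sigma>)\<close>, \<open>\<sigma> = L / (exp (t / \<epsilon>) + L)\<close>, with \<open>L\<close> of the order of \<open>exp n\<close>, this bounds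
  the energy on the time interval from \<open>n \<epsilon>\<close> to \<open>(n + 1) \<epsilon>\<close> by a multiple of \<open>\<epsilon>\<close>, and \<open>|\<partial>\<^sub>t v|\<^sup>2\<close> up to time \<open>n \<epsilon>\<close>.\<close>

text \<open>Truncation and time changes are smooth because all rests on two rules for weak
  derivatives, composition with a C1 function of bounded slope and substitution in time. Both must
  also preserve traces, which are limits of values of continuous functions. Truncating is not known
  to decrease the potential or the competition term strictly, so equality of the energies yields
  only that v_i - trunc(v_i) has zero time derivative. Its zero initial trace then finishes without
  any lateral boundary condition, so both admissible classes are treated alike. The profile must
  compensate the weight exp(-t/\<epsilon>) at time n \<epsilon>, hence reach the size \<epsilon> exp
  n, yet stay bounded so that id + \<delta> \<eta> is a bijection with slopes between positive
  constants. The logistic \<sigma> solves \<epsilon> \<sigma>' = -\<sigma> (1 - \<sigma>), so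
  \<eta>' is a polynomial in \<sigma>, and \<eta>/\<epsilon> - \<eta>' plus the constant L/(1 + L)
  is a product of two factors that are nonnegative for t >= 0. The added constant costs at most one
  copy of J v.\<close>

subsection \<open>Smooth functions\<close>

abbreviation pd :: "'a::real_normed_vector \<Rightarrow> ('a \<Rightarrow> real) \<Rightarrow> 'a \<Rightarrow> real" where
  "pd b f x \<equiv> frechet_derivative f (at x) b"

lemma C_k_SucI:
  assumes "\<And>x. (f has_derivative f' x) (at x)"
    and "\<And>b. b \<in> Basis \<Longrightarrow> C_k m (\<lambda>x. f' x b)"
  shows "C_k (Suc m) f"
proof -
  have "frechet_derivative f (at x) = f' x" for x
    using frechet_derivative_at[OF assms(1)] by simp
  then show ?thesis
    using assms by (auto simp: differentiable_def)
qed

lemma C_k_SucD: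
  assumes "C_k (Suc m) f"
  shows "(f has_derivative frechet_derivative f (at x)) (at x)"
    and "b \<in> Basis \<Longrightarrow> C_k m (\<lambda>x. pd b f x)"
  using assms by (auto simp: frechet_derivative_works)

lemma C_k_imp_continuous: "C_k m f \<Longrightarrow> continuous_on UNIV f"
  by (cases m) (auto intro!: differentiable_imp_continuous_on simp: differentiable_on_def)

lemma C_k_pred: "C_k (Suc m) f \<Longrightarrow> C_k m f"
proof (induction m arbitrary: f)
  case 0
  then show ?case using C_k_imp_continuous by fastforce
next
  case (Suc m)
  show ?case
    by (rule C_k_SucI[OF C_k_SucD(1)[OF Suc.prems]])
      (rule Suc.IH[OF C_k_SucD(2)[OF Suc.prems]])
qed

lemma C_k_const [simp]: "C_k m (\<lambda>x. c)"
proof (induction m arbitrary: c)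
  case (Suc m)
  show ?case by (rule C_k_SucI[where f' = "\<lambda>_ _. 0"]) (auto simp: Suc)
qed auto

lemma C_k_add: "C_k m f \<Longrightarrow> C_k m g \<Longrightarrow> C_k m (\<lambda>x. f x + g x)"
proof (induction m arbitrary: f g)
  case (Suc m)
  show ?case
    by (rule C_k_SucI[OF has_derivative_add[OF C_k_SucD(1)[OF Suc.prems(1)] C_k_SucD(1)[OF Suc.prems(2)]]])
      (rule Suc.IH[OF C_k_SucD(2)[OF Suc.prems(1)] C_k_SucD(2)[OF Suc.prems(2)]])
qed (auto intro: continuous_intros)

lemma C_k_mult: "C_k m f \<Longrightarrow> C_k m g \<Longrightarrow> C_k m (\<lambda>x. f x * g x)"
proof (induction m arbitrary: f g)
  case (Suc m)
  show ?case
    by (rule C_k_SucI[OF has_derivative_mult[OF C_k_SucD(1)[OF Suc.prems(1)] C_k_SucD(1)[OF Suc.prems(2)]]])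
      (intro C_k_add Suc.IH C_k_pred[OF Suc.prems(1)] C_k_pred[OF Suc.prems(2)]
        C_k_SucD(2)[OF Suc.prems(1)] C_k_SucD(2)[OF Suc.prems(2)])
qed (auto intro: continuous_intros)

lemma C_k_sum: "(\<And>i. i \<in> I \<Longrightarrow> C_k m (f i)) \<Longrightarrow> C_k m (\<lambda>x. \<Sum>i\<in>I. f i x)"
  by (induction I rule: infinite_finite_induct) (auto intro: C_k_add)

lemma C_k_prod: "(\<And>i. i \<in> I \<Longrightarrow> C_k m (f i)) \<Longrightarrow> C_k m (\<lambda>x. \<Prod>i\<in>I. f i x)"
  by (induction I rule: infinite_finite_induct) (auto intro: C_k_mult)

lemma C_k_inner: "C_k m (\<lambda>x. x \<bullet> c)"
proof (cases m)
  case (Suc n)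
  show ?thesis unfolding Suc
    by (rule C_k_SucI[where f' = "\<lambda>_ h. h \<bullet> c"]) (auto intro!: derivative_eq_intros)
qed (auto intro: continuous_intros)

text \<open>The chain rule is expanded over \<open>Basis\<close> so that every directional
  derivative of the composition is a sum of products of a coordinate of p' and a partial derivative
  of f composed with p. To this form the induction in \<open>C_k_compose\<close> applies
  again.\<close>

lemma frechet_derivative_compose_basis:
  fixes f :: "'a::euclidean_space \<Rightarrow> real" and p :: "'b::euclidean_space \<Rightarrow> 'a"
  assumes "(f has_derivative f') (at (p x))" "(p has_derivative p') (at x)"
  shows "((\<lambda>x. f (p x)) has_derivative (\<lambda>h. \<Sum>c\<in>Basis. (p' h \<bullet> c) * f' c)) (at x)"
proof -
  have lin: "linear f'" using assms(1) by (rule has_derivative_linear)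
  have "f' (p' h) = (\<Sum>c\<in>Basis. (p' h \<bullet> c) * f' c)" for h
  proof -
    have "f' (p' h) = f' (\<Sum>c\<in>Basis. (p' h \<bullet> c) *\<^sub>R c)" by (simp add: euclidean_representation)
    also have "\<dots> = (\<Sum>c\<in>Basis. (p' h \<bullet> c) * f' c)"
      by (simp add: linear_sum[OF lin] linear_cmul[OF lin])
    finally show ?thesis .
  qed
  with has_derivative_compose[OF assms(2,1)] show ?thesis by simp
qed

lemma C_k_compose:
  fixes f :: "'a::euclidean_space \<Rightarrow> real" and p :: "'b::euclidean_space \<Rightarrow> 'a"
  assumes p: "\<And>x. (p has_derivative p' x) (at x)"
    and p': "\<And>b c m. b \<in> Basis \<Longrightarrow> c \<in> Basis \<Longrightarrow> C_k m (\<lambda>x. p' x b \<bullet> c)"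
  shows "C_k m f \<Longrightarrow> C_k m (\<lambda>x. f (p x))"
proof (induction m arbitrary: f)
  case 0
  have "continuous_on UNIV p"
    using p by (meson continuous_at_imp_continuous_on has_derivative_continuous)
  then show ?case using 0 by (auto intro: continuous_on_compose2)
next
  case (Suc m)
  show ?case
    by (rule C_k_SucI[OF frechet_derivative_compose_basis[OF C_k_SucD(1)[OF Suc.prems] p]])
      (intro C_k_sum C_k_mult p' Suc.IH C_k_SucD(2)[OF Suc.prems])
qed

lemma C_k_real_SucI:
  fixes f :: "real \<Rightarrow> real"
  assumes "\<And>x. (f has_real_derivative f' x) (at x)" "C_k m f'"
  shows "C_k (Suc m) f"
  by (rule C_k_SucI[where f' = "\<lambda>x h. h * f' x"])
    (use assms in \<open>auto simp: has_field_derivative_def mult_commute_abs\<close>)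

lemma smooth_fun_frechet:
  "smooth_fun f \<Longrightarrow> (f has_derivative frechet_derivative f (at x)) (at x)"
  "smooth_fun f \<Longrightarrow> b \<in> Basis \<Longrightarrow> smooth_fun (\<lambda>x. pd b f x)"
  unfolding smooth_fun_def using C_k_SucD by blast+

lemma smooth_fun_continuous: "smooth_fun f \<Longrightarrow> continuous_on S f"
  unfolding smooth_fun_def using C_k_imp_continuous continuous_on_subset by blast

lemma smooth_fun_continuous_deriv:
  "smooth_fun f \<Longrightarrow> b \<in> Basis \<Longrightarrow> continuous_on S (\<lambda>x. pd b f x)"
  using smooth_fun_frechet(2) smooth_fun_continuous by blast

lemma smooth_fun_compose:
  fixes f :: "'a::euclidean_space \<Rightarrow> real" and p :: "'b::euclidean_space \<Rightarrow> 'a"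
  assumes "\<And>x. (p has_derivative p' x) (at x)"
    and "\<And>b c. b \<in> Basis \<Longrightarrow> c \<in> Basis \<Longrightarrow> smooth_fun (\<lambda>x. p' x b \<bullet> c)"
    and "smooth_fun f"
  shows "smooth_fun (\<lambda>x. f (p x))"
  using assms C_k_compose[of p p'] unfolding smooth_fun_def by blast

lemma smooth_fun_compose_real:
  fixes f :: "real \<Rightarrow> real" and q :: "'b::euclidean_space \<Rightarrow> real"
  assumes "smooth_fun f" "smooth_fun q"
  shows "smooth_fun (\<lambda>x. f (q x))"
  by (rule smooth_fun_compose[OF smooth_fun_frechet(1)[OF assms(2)] _ assms(1)])
    (use smooth_fun_frechet(2)[OF assms(2)] in auto)

lemma smooth_fun_intros:
  "smooth_fun (\<lambda>x. c)"
  "smooth_fun f \<Longrightarrow> smooth_fun g \<Longrightarrow> smooth_fun (\<lambda>x. f x + g x)"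
  "smooth_fun f \<Longrightarrow> smooth_fun g \<Longrightarrow> smooth_fun (\<lambda>x. f x * g x)"
  "(\<And>i. i \<in> I \<Longrightarrow> smooth_fun (F i)) \<Longrightarrow> smooth_fun (\<lambda>x. \<Prod>i\<in>I. F i x)"
  "smooth_fun (\<lambda>x. x \<bullet> a)"
  by (auto simp: smooth_fun_def intro: C_k_add C_k_mult C_k_prod C_k_inner)

lemma smooth_fun_diff:
  "smooth_fun f \<Longrightarrow> smooth_fun g \<Longrightarrow> smooth_fun (\<lambda>x. f x - g x)"
  using smooth_fun_intros(2)[OF _ smooth_fun_intros(3)[OF smooth_fun_intros(1)[of "-1"]], of f g]
  by simp

lemma smooth_fun_exp: "smooth_fun (exp :: real \<Rightarrow> real)"
proof -
  have "C_k m (exp :: real \<Rightarrow> real)" for m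
    by (induction m) (auto intro!: C_k_real_SucI[where f' = exp] continuous_intros simp del: C_k.simps(2))
  then show ?thesis by (simp add: smooth_fun_def)
qed

text \<open>The factor $x^{-n}$ makes the family closed under differentiation.\<close>

definition flat :: "nat \<Rightarrow> real \<Rightarrow> real" where
  "flat n x = (if 0 < x then exp (- (1 / x)) / x ^ n else 0)"

lemma flat_tendsto_0: "(flat n \<longlongrightarrow> 0) (at 0)"
proof -
  have "((\<lambda>x. inverse x ^ n / exp (inverse x)) \<longlongrightarrow> (0::real)) (at_right 0)"
    by (rule filterlim_compose[OF tendsto_power_div_exp_0 filterlim_inverse_at_top_right])
  then have "(flat n \<longlongrightarrow> 0) (at_right 0)"
    by (rule Lim_transform_eventually)
      (auto simp: eventually_at_filter flat_def exp_minus divide_simps power_inverse)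
  moreover have "(flat n \<longlongrightarrow> 0) (at_left 0)"
    by (rule tendsto_eventually) (auto simp: eventually_at_filter flat_def)
  ultimately show ?thesis by (simp add: filterlim_at_split)
qed

lemma flat_has_derivative:
  "(flat n has_real_derivative (flat (n + 2) x - real n * flat (Suc n) x)) (at x)"
proof (cases "x = 0")
  case True
  \<comment> \<open>At the origin the difference quotient of \<open>flat n\<close> is
    \<open>flat (Suc n)\<close> itself.\<close>
  have "((\<lambda>y. flat (Suc n) y) \<longlongrightarrow> 0) (at 0)" by (rule flat_tendsto_0)
  then have "((\<lambda>h. (flat n (0 + h) - flat n 0) / h) \<longlongrightarrow> 0) (at 0)"
    by (rule Lim_transform_eventually) (auto simp: flat_def eventually_at_filter)
  then show ?thesis unfolding True by (simp add: DERIV_def flat_def)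
next
  case False
  show ?thesis
  proof (cases "x > 0")
    case pos: True
    have "((\<lambda>x. exp (- (1 / x)) / x ^ n) has_real_derivative
        (flat (n + 2) x - real n * flat (Suc n) x)) (at x)"
      using pos
      apply (auto intro!: derivative_eq_intros simp: flat_def)
      apply (cases n)
       apply (auto simp: divide_simps power2_eq_square algebra_simps)
      done
    then show ?thesis
      by (rule DERIV_cong_ev[THEN iffD1, rotated -1])
        (use pos in \<open>auto simp: flat_def intro!: eventually_nhds_in_open[of "{0<..}", THEN eventually_mono]\<close>)
  next
    case neg: False
    have "((\<lambda>x. 0) has_real_derivative (flat (n + 2) x - real n * flat (Suc n) x)) (at x)"
      using neg by (auto simp: flat_def)
    then show ?thesis
      by (rule DERIV_cong_ev[THEN iffD1, rotated -1])
        (use neg False in \<open>auto simp: flat_def intro!: eventually_nhds_in_open[of "{..<0}", THEN eventually_mono]\<close>)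
  qed
qed

lemma smooth_fun_flat: "smooth_fun (flat n)"
proof -
  have "C_k m (flat n)" for m n
  proof (induction m arbitrary: n)
    case 0
    show ?case using DERIV_continuous_on[OF flat_has_derivative] by auto
  next
    case (Suc m)
    have "C_k m (\<lambda>x. flat (n + 2) x + (- real n) * flat (Suc n) x)"
      by (intro C_k_add C_k_mult Suc C_k_const)
    then show ?case by (intro C_k_real_SucI[OF flat_has_derivative]) simp
  qed
  then show ?thesis by (simp add: smooth_fun_def)
qed

section \<open>Bump functions and test functions\<close>

text \<open>A product over coordinates rather than a radial bump: it is positive exactly on an open
  box, and boxes are the generator on which measures are compared in the fundamental lemma.\<close>

definition box_bump :: "'a::euclidean_space \<Rightarrow> 'a \<Rightarrow> 'a \<Rightarrow> real" where
  "box_bump l u x = (\<Prod>b\<in>Basis. flat 0 (x \<bullet> b - l \<bullet> b) * flat 0 (u \<bullet> b - x \<bullet> b))"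

lemma smooth_box_bump: "smooth_fun (box_bump l u)"
proof -
  have "smooth_fun (\<lambda>x. \<Prod>b\<in>Basis. flat 0 (x \<bullet> b - l \<bullet> b) * flat 0 (u \<bullet> b - x \<bullet> b))"
    by (intro smooth_fun_intros smooth_fun_diff smooth_fun_compose_real[OF smooth_fun_flat])
  then show ?thesis by (simp add: box_bump_def[abs_def])
qed

lemma box_bump_pos_iff: "box_bump l u x > 0 \<longleftrightarrow> x \<in> box l u"
  and box_bump_nonneg: "box_bump l u x \<ge> 0"
proof -
  have nn: "flat 0 y \<ge> 0" for y by (simp add: flat_def)
  show "box_bump l u x \<ge> 0" unfolding box_bump_def by (intro prod_nonneg mult_nonneg_nonneg nn)
  show "box_bump l u x > 0 \<longleftrightarrow> x \<in> box l u"
  proof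
    assume "x \<in> box l u"
    then show "box_bump l u x > 0" by (auto simp: box_bump_def flat_def mem_box intro!: prod_pos)
  next
    assume *: "box_bump l u x > 0"
    show "x \<in> box l u"
    proof (rule ccontr)
      assume "x \<notin> box l u"
      then obtain b where "b \<in> Basis" "flat 0 (x \<bullet> b - l \<bullet> b) * flat 0 (u \<bullet> b - x \<bullet> b) = 0"
        by (auto simp: mem_box flat_def)
      then have "box_bump l u x = 0" by (auto simp: box_bump_def intro!: prod_zero)
      with * show False by simp
    qed
  qed
qed

lemma test_functionsI:
  assumes "smooth_fun \<phi>" "compact K" "K \<subseteq> D" "\<And>x. x \<notin> K \<Longrightarrow> \<phi> x = 0"
  shows "\<phi> \<in> test_functions D"
proof -
  have "closure {x. \<phi> x \<noteq> 0} \<subseteq> K"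
    using assms by (intro closure_minimal) (auto intro: compact_imp_closed)
  moreover from this have "compact (closure {x. \<phi> x \<noteq> 0})"
    using assms(2) closed_closure by (metis compact_Int_closed inf.absorb_iff2)
  ultimately show ?thesis using assms by (auto simp: test_functions_def)
qed

lemma test_functionsE:
  assumes "\<phi> \<in> test_functions D"
  obtains K where "compact K" "K \<subseteq> D" "\<And>x. x \<notin> K \<Longrightarrow> \<phi> x = 0"
    "\<And>x b. x \<notin> K \<Longrightarrow> pd b \<phi> x = 0" "smooth_fun \<phi>"
proof (rule that[of "closure {x. \<phi> x \<noteq> 0}"])
  let ?K = "closure {x. \<phi> x \<noteq> 0}"
  show *: "\<phi> x = 0" if "x \<notin> ?K" for x using that closure_subset[of "{x. \<phi> x \<noteq> 0}"] by auto
  show "pd b \<phi> x = 0" if "x \<notin> ?K" for x b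
  proof -
    have "(\<phi> has_derivative (\<lambda>_. 0)) (at x)"
    proof (rule has_derivative_transform_within_open)
      show "((\<lambda>_. 0) has_derivative (\<lambda>_. 0)) (at x)" by simp
      show "open (- ?K)" by (rule open_Compl) simp
      show "x \<in> - ?K" using that by simp
      show "0 = \<phi> y" if "y \<in> - ?K" for y using *[of y] that by simp
    qed
    from fun_cong[OF frechet_derivative_at[OF this], of b] show ?thesis by simp
  qed
qed (use assms in \<open>auto simp: test_functions_def\<close>)

lemma test_functions_mono: "D \<subseteq> D' \<Longrightarrow> test_functions D \<subseteq> test_functions D'"
  by (auto simp: test_functions_def)

text \<open>The maps y -> 1 - exp(- j y) turn the nonnegative bump into smooth functions with values
  in [0, 1) that converge pointwise to the indicator of the open box, ready for dominated
  convergence.\<close>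

lemma box_bump_test:
  assumes "cbox l u \<subseteq> D"
  shows "(\<lambda>x. 1 - exp (- (real j * box_bump l u x))) \<in> test_functions D"
proof (rule test_functionsI[OF _ compact_cbox assms])
  have "smooth_fun (\<lambda>x. 1 - exp ((- real j) * box_bump l u x))"
    by (intro smooth_fun_diff smooth_fun_intros smooth_fun_compose_real[OF smooth_fun_exp] smooth_box_bump)
  then show "smooth_fun (\<lambda>x. 1 - exp (- (real j * box_bump l u x)))" by simp
  fix x assume "x \<notin> cbox l u"
  then have "x \<notin> box l u" using box_subset_cbox by blast
  then have "box_bump l u x = 0" using box_bump_pos_iff[of l u x] box_bump_nonneg[of l u x] by linarith
  then show "1 - exp (- (real j * box_bump l u x)) = 0" by simp
qed

lemma box_bump_tendsto_indicator:
  "(\<lambda>j. 1 - exp (- (real j * box_bump l u x))) \<longlonglongrightarrow> indicator (box l u) x"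
proof (cases "x \<in> box l u")
  case True
  then have "box_bump l u x > 0" by (simp add: box_bump_pos_iff)
  then have "(\<lambda>j. 1 - exp (- (real j * box_bump l u x))) \<longlonglongrightarrow> 1 - 0"
    by (intro tendsto_intros filterlim_compose[OF exp_at_bot] filterlim_uminus_at_bot_at_top[THEN filterlim_compose])
      (auto intro!: filterlim_tendsto_pos_mult_at_top[OF tendsto_const _ filterlim_real_sequentially]
        simp: mult.commute[of "real _"])
  with True show ?thesis by simp
next
  case False
  then have "box_bump l u x = 0" using box_bump_pos_iff[of l u x] box_bump_nonneg[of l u x] by linarith
  with False show ?thesis by simp
qed

subsection \<open>The fundamental lemma of the calculus of variations\<close>

lemma set_integrable_mult_test:
  fixes f \<phi> :: "'a::euclidean_space \<Rightarrow> real"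
  assumes f: "set_integrable lebesgue K f" and K: "compact K"
    and \<phi>: "continuous_on UNIV \<phi>" "\<And>x. x \<notin> K \<Longrightarrow> \<phi> x = 0"
  shows "integrable lebesgue (\<lambda>x. f x * \<phi> x)"
proof -
  have "bounded (\<phi> ` K)"
    using \<phi>(1) K by (meson compact_continuous_image compact_imp_bounded continuous_on_subset top_greatest)
  then obtain B where B: "\<And>x. x \<in> K \<Longrightarrow> \<bar>\<phi> x\<bar> \<le> B" by (auto simp: bounded_iff)
  have m: "\<phi> \<in> borel_measurable lebesgue"
    using \<phi>(1) by (simp add: borel_measurable_continuous_onI measurable_completion)
  have fi: "integrable lebesgue (\<lambda>x. indicator K x *\<^sub>R f x)"
    using f by (simp add: set_integrable_def)
  have "integrable lebesgue (\<lambda>x. B * (indicator K x *\<^sub>R f x))"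
    using fi by simp
  then have "integrable lebesgue (\<lambda>x. (indicator K x *\<^sub>R f x) * \<phi> x)"
  proof (rule Bochner_Integration.integrable_bound)
    show "(\<lambda>x. (indicator K x *\<^sub>R f x) * \<phi> x) \<in> borel_measurable lebesgue"
      by (rule borel_measurable_times[OF borel_measurable_integrable[OF fi] m])
    have "\<bar>f x\<bar> * \<bar>\<phi> x\<bar> \<le> \<bar>f x\<bar> * \<bar>B\<bar>" if "x \<in> K" for x
      using B[OF that] by (intro mult_left_mono) auto
    then show "AE x in lebesgue. norm ((indicator K x *\<^sub>R f x) * \<phi> x) \<le> norm (B * (indicator K x *\<^sub>R f x))"
      by (auto simp: indicator_def abs_mult mult.commute)
  qed
  moreover have "(\<lambda>x. (indicator K x *\<^sub>R f x) * \<phi> x) = (\<lambda>x. f x * \<phi> x)"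
    using \<phi>(2) by (force simp: indicator_def)
  ultimately show ?thesis by simp
qed

lemma loc_integrable_mult_test:
  fixes f \<phi> :: "'a::euclidean_space \<Rightarrow> real"
  assumes f: "loc_integrable D f" and K: "compact K" "K \<subseteq> D"
    and \<phi>: "continuous_on UNIV \<phi>" "\<And>x. x \<notin> K \<Longrightarrow> \<phi> x = 0"
  shows "integrable lebesgue (\<lambda>x. f x * \<phi> x)"
    and "(LINT x:D|lebesgue. f x * \<phi> x) = (LINT x|lebesgue. f x * \<phi> x)"
proof -
  show "integrable lebesgue (\<lambda>x. f x * \<phi> x)"
    using f K by (intro set_integrable_mult_test[OF _ K(1) \<phi>]) (auto simp: loc_integrable_def)
  show "(LINT x:D|lebesgue. f x * \<phi> x) = (LINT x|lebesgue. f x * \<phi> x)"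
    unfolding set_lebesgue_integral_def
    by (rule Bochner_Integration.integral_cong) (use K \<phi>(2) in \<open>auto simp: indicator_def\<close>)
qed

lemma enn2real_inject: "enn2real x = enn2real y \<Longrightarrow> x \<noteq> \<infinity> \<Longrightarrow> y \<noteq> \<infinity> \<Longrightarrow> x = y"
  by (cases x rule: ennreal_cases; cases y rule: ennreal_cases) auto

text \<open>The measures with the positive and the negative part of f as densities agree on boxes,
  an intersection-stable generator, hence everywhere; a finite density is determined almost
  everywhere by its measure.\<close>

lemma integral_zero_on_boxes_imp_AE_zero:
  fixes f :: "'a::euclidean_space \<Rightarrow> real"
  assumes f: "integrable lborel f"
    and z: "\<And>l u. (LINT x|lborel. indicator (box l u) x * f x) = 0"
  shows "AE x in lborel. f x = 0"
proof -
  let ?p = "\<lambda>x. ennreal (max 0 (f x))" and ?n = "\<lambda>x. ennreal (max 0 (- f x))"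
  have [measurable]: "f \<in> borel_measurable borel" using f by (auto dest: borel_measurable_integrable)
  have fin: "(\<integral>\<^sup>+x. ?p x \<partial>lborel) < \<infinity>" "(\<integral>\<^sup>+x. ?n x \<partial>lborel) < \<infinity>"
    using f by (auto simp: real_integrable_def ennreal_max_0 top.not_eq_extremum)
  have eqb: "emeasure (density lborel ?p) (box l u) = emeasure (density lborel ?n) (box l u)" for l u
  proof -
    let ?g = "\<lambda>x. indicator (box l u) x * f x"
    have gi: "integrable lborel ?g"
      using integrable_real_mult_indicator[OF _ f, of "box l u"] by (simp add: mult.commute)
    have "enn2real (\<integral>\<^sup>+x. ennreal (?g x) \<partial>lborel) = enn2real (\<integral>\<^sup>+x. ennreal (- ?g x) \<partial>lborel)"
      using real_lebesgue_integral_def[OF gi] z by simp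
    moreover have "(\<integral>\<^sup>+x. ennreal (?g x) \<partial>lborel) \<noteq> \<infinity>" "(\<integral>\<^sup>+x. ennreal (- ?g x) \<partial>lborel) \<noteq> \<infinity>"
      using gi by (auto simp: real_integrable_def)
    ultimately have "(\<integral>\<^sup>+x. ennreal (?g x) \<partial>lborel) = (\<integral>\<^sup>+x. ennreal (- ?g x) \<partial>lborel)"
      using enn2real_inject by blast
    moreover have "(\<integral>\<^sup>+x. ennreal (?g x) \<partial>lborel) = (\<integral>\<^sup>+x. ?p x * indicator (box l u) x \<partial>lborel)"
      by (rule nn_integral_cong) (auto simp: indicator_def ennreal_max_0)
    moreover have "(\<integral>\<^sup>+x. ennreal (- ?g x) \<partial>lborel) = (\<integral>\<^sup>+x. ?n x * indicator (box l u) x \<partial>lborel)"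
      by (rule nn_integral_cong) (auto simp: indicator_def ennreal_max_0)
    ultimately show ?thesis by (simp add: emeasure_density)
  qed
  have "density lborel ?p = density lborel ?n"
  proof (rule measure_eqI_generator_eq)
    let ?E = "range (\<lambda>(a, b). box a b::'a set)"
    show "Int_stable ?E" by (auto simp: Int_stable_def box_Int_box)
    show "?E \<subseteq> Pow UNIV" "sets (density lborel ?p) = sigma_sets UNIV ?E"
      "sets (density lborel ?n) = sigma_sets UNIV ?E"
      by (simp_all add: borel_eq_box)
    let ?A = "\<lambda>n::nat. box (- (real n *\<^sub>R One)) (real n *\<^sub>R One) :: 'a set"
    show "range ?A \<subseteq> ?E" "(\<Union>i. ?A i) = UNIV" unfolding UN_box_eq_UNIV by auto
    show "emeasure (density lborel ?p) (?A i) \<noteq> \<infinity>" for i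
    proof -
      have "emeasure (density lborel ?p) (?A i) \<le> (\<integral>\<^sup>+x. ?p x \<partial>lborel)"
        by (subst emeasure_density) (auto intro!: nn_integral_mono simp: indicator_def)
      also have "\<dots> < \<infinity>" by (rule fin)
      finally show ?thesis by simp
    qed
    show "emeasure (density lborel ?p) X = emeasure (density lborel ?n) X" if "X \<in> ?E" for X
      using that eqb by auto
  qed
  then have "AE x in lborel. ?p x = ?n x"
    using finite_density_unique[of ?p lborel ?n] fin by auto
  then show ?thesis by eventually_elim (auto simp: max_def split: if_splits)
qed

text \<open>The local form asks for test functions vanishing off the box only. The Steklov formula
  below needs this, because there the identity is available only for test functions living in a
  small set.\<close>

lemma fundamental_lemma_cbox:
  fixes f :: "'a::euclidean_space \<Rightarrow> real"
  assumes f: "set_integrable lebesgue (cbox p q) f" and D: "cbox p q \<subseteq> D"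
    and z: "\<And>\<phi>. \<phi> \<in> test_functions D \<Longrightarrow> (\<And>x. x \<notin> cbox p q \<Longrightarrow> \<phi> x = 0) \<Longrightarrow>
      (LINT x|lebesgue. f x * \<phi> x) = 0"
  shows "AE x in lebesgue. x \<in> cbox p q \<longrightarrow> f x = 0"
proof -
  let ?f = "\<lambda>x. indicator (box p q) x * f x"
  have fi: "integrable lebesgue (\<lambda>x. indicator (cbox p q) x * f x)"
    using f by (simp add: set_integrable_def)
  have fi: "integrable lebesgue ?f"
  proof -
    have "integrable lebesgue (\<lambda>x. (indicator (cbox p q) x * f x) * indicator (box p q) x)"
      by (rule integrable_real_mult_indicator[OF _ fi]) auto
    also have "(\<lambda>x. (indicator (cbox p q) x * f x) * indicator (box p q) x) = ?f"
      using box_subset_cbox[of p q] by (auto simp: indicator_def fun_eq_iff)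
    finally show ?thesis .
  qed
  have [measurable]: "?f \<in> borel_measurable lebesgue" using fi by auto
  \<comment> \<open>A Borel representative is needed because measures on boxes are compared for
    \<open>lborel\<close>.\<close>
  obtain g where g: "g \<in> borel_measurable lborel" "AE x in lborel. ?f x = g x"
    using completion_ex_borel_measurable_real[of ?f lborel] by auto
  have [measurable]: "g \<in> borel_measurable lborel" by fact
  have ae: "AE x in lebesgue. ?f x = g x" using g(2) by (simp add: AE_completion)
  have gl: "g \<in> borel_measurable lebesgue" using g(1) by (simp add: measurable_completion)
  have "integrable lebesgue g"
    using integrable_cong_AE[THEN iffD1, OF _ gl ae fi] by simp
  then have gi: "integrable lborel g" using g(1) by (simp add: integrable_completion)
  have "(LINT x|lborel. indicator (box l u) x * g x) = 0" for l u
  proof -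
    \<comment> \<open>Intersecting with \<open>box p q\<close> gives a box again; unless it is
      empty, its closure lies in \<open>cbox p q\<close>, so its bumps are admissible test
      functions.\<close>
    obtain a b where ab: "box l u \<inter> box p q = box a b"
      by (meson box_Int_box)
    have sub: "cbox a b \<subseteq> cbox p q" if "box a b \<noteq> {}"
    proof -
      have "closure (box a b) \<subseteq> closure (box p q)" using ab by (intro closure_mono) auto
      moreover have "box p q \<noteq> {}" using that ab by auto
      ultimately show ?thesis using that by (simp add: closure_box)
    qed
    have "(LINT x|lebesgue. indicator (box l u) x * g x) = (LINT x|lebesgue. indicator (box a b) x * f x)"
    proof (rule integral_cong_AE)
      have *: "indicator (box a b) x * f x = indicator (box l u) x * ?f x" for x
        by (simp flip: ab add: indicator_inter_arith)
      have i: "indicator (box l u) \<in> borel_measurable lebesgue" by (rule borel_measurable_indicator) simp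
      show "(\<lambda>x. indicator (box l u) x * g x) \<in> borel_measurable lebesgue"
        by (rule borel_measurable_times[OF i gl])
      show "(\<lambda>x. indicator (box a b) x * f x) \<in> borel_measurable lebesgue"
        unfolding * by (rule borel_measurable_times[OF i]) (use fi in auto)
      show "AE x in lebesgue. indicator (box l u) x * g x = indicator (box a b) x * f x"
        using ae unfolding * by eventually_elim simp
    qed
    also have "\<dots> = 0"
    proof (cases "box a b = {}")
      case False
      let ?\<phi> = "\<lambda>j x. 1 - exp (- (real j * box_bump a b x))"
      have z: "\<And>x. x \<notin> cbox a b \<Longrightarrow> ?\<phi> j x = 0" for j
      proof -
        fix x assume "x \<notin> cbox a b"
        then have "box_bump a b x = 0"
          using box_bump_pos_iff[of a b x] box_bump_nonneg[of a b x] box_subset_cbox[of a b] by force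
        then show "?\<phi> j x = 0" by simp
      qed
      have *: "(LINT x|lebesgue. f x * ?\<phi> j x) = 0" for j
      proof (rule assms(3)[OF box_bump_test])
        show "cbox a b \<subseteq> D" using sub False D by blast
        show "?\<phi> j x = 0" if "x \<notin> cbox p q" for x using sub False z that by blast
      qed
      have eq: "f x * ?\<phi> j x = ?f x * ?\<phi> j x" for j x
      proof (cases "x \<in> box p q")
        case False
        then have "x \<notin> box a b" using ab by auto
        then have "box_bump a b x = 0"
          using box_bump_pos_iff[of a b x] box_bump_nonneg[of a b x] by linarith
        then show ?thesis by simp
      qed auto
      have "(\<lambda>j. LINT x|lebesgue. ?f x * ?\<phi> j x) \<longlonglongrightarrow> (LINT x|lebesgue. ?f x * indicator (box a b) x)"
      proof (rule integral_dominated_convergence[where w = "\<lambda>x. norm (?f x)"])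
        have c: "continuous_on UNIV (?\<phi> j)" for j
          using box_bump_test[of a b UNIV j] by (auto simp: test_functions_def smooth_fun_continuous)
        show "(\<lambda>x. ?f x * ?\<phi> j x) \<in> borel_measurable lebesgue" for j
          using borel_measurable_continuous_onI[OF c[of j]]
          by (intro borel_measurable_times borel_measurable_integrable[OF fi]) (simp add: measurable_completion)
        show "AE x in lebesgue. (\<lambda>j. ?f x * ?\<phi> j x) \<longlonglongrightarrow> ?f x * indicator (box a b) x"
          by (intro AE_I2 tendsto_intros box_bump_tendsto_indicator)
        show "AE x in lebesgue. norm (?f x * ?\<phi> j x) \<le> norm (?f x)" for j
        proof (rule AE_I2)
          fix x
          have "\<bar>?\<phi> j x\<bar> \<le> 1" using box_bump_nonneg[of a b x] by simp
          then show "norm (?f x * ?\<phi> j x) \<le> norm (?f x)"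
            unfolding real_norm_def abs_mult[of "?f x"] by (intro mult_left_le) auto
        qed
        show "(\<lambda>x. ?f x * indicator (box a b) x) \<in> borel_measurable lebesgue"
          by (intro borel_measurable_times borel_measurable_integrable[OF fi] borel_measurable_indicator) simp
        show "integrable lebesgue (\<lambda>x. norm (?f x))" by (rule integrable_norm[OF fi])
      qed
      moreover have "(LINT x|lebesgue. ?f x * ?\<phi> j x) = 0" for j using * eq by simp
      ultimately have "(LINT x|lebesgue. ?f x * indicator (box a b) x) = 0"
        by (simp add: LIMSEQ_const_iff)
      moreover have "?f x * indicator (box a b) x = indicator (box a b) x * f x" for x
        using ab by (auto simp: indicator_def)
      ultimately show ?thesis by simp
    qed simp
    finally show ?thesis by (subst (asm) integral_completion) auto
  qed
  then have "AE x in lborel. g x = 0" by (rule integral_zero_on_boxes_imp_AE_zero[OF gi])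
  then have "AE x in lebesgue. g x = 0" by (rule AE_completion)
  \<comment> \<open>The argument so far sees only the open box; the boundary is a null set.\<close>
  moreover have "AE x in lebesgue. x \<notin> cbox p q - box p q"
    by (rule AE_not_in) (simp flip: negligible_iff_null_sets add: negligible_frontier_interval)
  ultimately show ?thesis using ae by eventually_elim (auto simp: indicator_def)
qed

lemma AE_open_cboxI:
  fixes D :: "'a::euclidean_space set"
  assumes "open D" "\<And>p q. cbox p q \<subseteq> D \<Longrightarrow> AE x in lebesgue. x \<in> cbox p q \<longrightarrow> P x"
  shows "AE x in lebesgue. x \<in> D \<longrightarrow> P x"
proof -
  obtain \<C> where \<C>: "countable \<C>" "\<C> \<subseteq> Pow D" "\<And>X. X \<in> \<C> \<Longrightarrow> \<exists>a b. X = cbox a b" "\<Union>\<C> = D"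
    using open_countable_Union_open_cbox[OF assms(1)] by metis
  have "AE x in lebesgue. \<forall>X\<in>\<C>. x \<in> X \<longrightarrow> P x"
  proof (subst AE_ball_countable[OF \<C>(1)], intro ballI)
    fix X assume "X \<in> \<C>"
    then obtain a b where "X = cbox a b" "cbox a b \<subseteq> D" using \<C>(2,3) by blast
    then show "AE x in lebesgue. x \<in> X \<longrightarrow> P x" using assms(2) by simp
  qed
  then show ?thesis by eventually_elim (use \<C>(4) in auto)
qed

lemma fundamental_lemma:
  fixes f :: "'a::euclidean_space \<Rightarrow> real"
  assumes "open D" "loc_integrable D f"
    and z: "\<And>\<phi>. \<phi> \<in> test_functions D \<Longrightarrow> (LINT x:D|lebesgue. f x * \<phi> x) = 0"
  shows "AE x in lebesgue. x \<in> D \<longrightarrow> f x = 0"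
proof (rule AE_open_cboxI[OF assms(1)])
  fix p q assume c: "cbox p q \<subseteq> D"
  show "AE x in lebesgue. x \<in> cbox p q \<longrightarrow> f x = 0"
  proof (rule fundamental_lemma_cbox[OF _ c])
    show "set_integrable lebesgue (cbox p q) f" using assms(2) c by (auto simp: loc_integrable_def)
    fix \<phi> assume \<phi>: "\<phi> \<in> test_functions D" "\<And>x. x \<notin> cbox p q \<Longrightarrow> \<phi> x = 0"
    have "continuous_on UNIV \<phi>" using \<phi>(1) by (auto simp: test_functions_def smooth_fun_continuous)
    from loc_integrable_mult_test(2)[OF assms(2) compact_cbox c this \<phi>(2)] z[OF \<phi>(1)]
    show "(LINT x|lebesgue. f x * \<phi> x) = 0" by simp
  qed
qed

subsection \<open>Elementary properties of weak derivatives\<close>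

lemma borel_measurable_lebesgue_on_iff:
  fixes f :: "'a::euclidean_space \<Rightarrow> real"
  assumes "S \<in> sets lebesgue"
  shows "f \<in> borel_measurable (lebesgue_on S) \<longleftrightarrow> (\<lambda>x. indicator S x * f x) \<in> borel_measurable lebesgue"
  using borel_measurable_restrict_space_iff[of S lebesgue f] assms by simp

lemma AE_lebesgue_on_iff:
  "S \<in> sets lebesgue \<Longrightarrow> (AE x in lebesgue_on S. P x) \<longleftrightarrow> (AE x in lebesgue. x \<in> S \<longrightarrow> P x)"
  by (simp add: AE_restrict_space_iff)

lemma open_sets_lebesgue: "open S \<Longrightarrow> S \<in> sets lebesgue"
  by auto

text \<open>\<open>loc_integrable\<close> speaks of compact sets only; measurability on all of D is
  glued from a countable cover by closed boxes.\<close>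

lemma loc_integrable_measurable:
  assumes D: "open D" and u: "loc_integrable D u"
  shows "u \<in> borel_measurable (lebesgue_on D)"
proof -
  obtain \<C> where \<C>: "countable \<C>" "\<C> \<subseteq> Pow D" "\<And>X. X \<in> \<C> \<Longrightarrow> \<exists>a b. X = cbox a b" "\<Union>\<C> = D"
    using open_countable_Union_open_cbox[OF D] by metis
  have D': "D \<in> sets lebesgue" using D by (rule open_sets_lebesgue)
  show ?thesis
  proof (rule measurable_piecewise_restrict[OF \<C>(1)])
    fix X assume X: "X \<in> \<C>"
    then obtain a b where ab: "X = cbox a b" using \<C>(3) by blast
    have XD: "X \<subseteq> D" using X \<C>(2) by blast
    have Xs: "X \<in> sets lebesgue" by (simp add: ab)
    show "X \<inter> space (lebesgue_on D) \<in> sets (lebesgue_on D)"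
      using XD Xs D' by (auto simp: sets_restrict_space)
    have "restrict_space (lebesgue_on D) X = lebesgue_on (D \<inter> X)"
      by (rule restrict_restrict_space) (use D' Xs in auto)
    also have "D \<inter> X = X" using XD by blast
    finally have e: "restrict_space (lebesgue_on D) X = lebesgue_on X" .
    have "set_integrable lebesgue X u" using u XD ab by (auto simp: loc_integrable_def)
    then have "(\<lambda>x. indicator X x * u x) \<in> borel_measurable lebesgue"
      by (auto simp: set_integrable_def dest: borel_measurable_integrable)
    then show "u \<in> borel_measurable (restrict_space (lebesgue_on D) X)"
      unfolding e by (subst borel_measurable_lebesgue_on_iff[OF Xs])
  qed (use \<C>(4) D' in auto)
qed

lemma L2_square_integrable:
  assumes "u \<in> L2 (lebesgue_on D)" "D \<in> sets lebesgue"
  shows "integrable lebesgue (\<lambda>x. indicator D x * (u x)\<^sup>2)"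
    "(\<lambda>x. indicator D x * u x) \<in> borel_measurable lebesgue"
  using assms by (auto simp: L2_def integrable_restrict_space borel_measurable_lebesgue_on_iff)

lemma L2_set_integrable:
  assumes u: "u \<in> L2 (lebesgue_on D)" and D: "D \<in> sets lebesgue" and K: "K \<in> lmeasurable" "K \<subseteq> D"
  shows "set_integrable lebesgue K u"
  unfolding set_integrable_def
proof (rule Bochner_Integration.integrable_bound)
  have Ks: "K \<in> sets lebesgue" using K(1) by auto
  have "integrable lebesgue (indicator K :: _ \<Rightarrow> real)"
    using K(1) by (intro integrable_real_indicator) (auto simp: fmeasurable_def)
  with L2_square_integrable(1)[OF u D]
  show "integrable lebesgue (\<lambda>x. indicator K x + indicator D x * (u x)\<^sup>2)"
    by (rule Bochner_Integration.integrable_add[rotated])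
  have "(\<lambda>x. indicator K x * (indicator D x * u x)) \<in> borel_measurable lebesgue"
    by (rule borel_measurable_times[OF borel_measurable_indicator[OF Ks] L2_square_integrable(2)[OF u D]])
  moreover have "(\<lambda>x. indicator K x * (indicator D x * u x)) = (\<lambda>x. indicator K x *\<^sub>R u x)"
    using K(2) by (auto simp: indicator_def fun_eq_iff)
  ultimately show "(\<lambda>x. indicator K x *\<^sub>R u x) \<in> borel_measurable lebesgue" by simp
  have "\<bar>y\<bar> \<le> 1 + y\<^sup>2" for y :: real
    using zero_le_power2[of "\<bar>y\<bar> - 1"] by (simp add: power2_diff)
  then show "AE x in lebesgue. norm (indicator K x *\<^sub>R u x) \<le> norm (indicator K x + indicator D x * (u x)\<^sup>2)"
    using K(2) by (intro AE_I2) (auto simp: indicator_def)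
qed

lemma L2_loc_integrable:
  "u \<in> L2 (lebesgue_on D) \<Longrightarrow> D \<in> sets lebesgue \<Longrightarrow> loc_integrable D u"
  unfolding loc_integrable_def using L2_set_integrable lmeasurable_compact by blast

lemma loc_integrable_AE:
  assumes u: "loc_integrable D u" and D: "open D"
    and ae: "AE x in lebesgue. x \<in> D \<longrightarrow> u x = u' x"
  shows "loc_integrable D u'"
  unfolding loc_integrable_def
proof (intro allI impI)
  fix K assume K: "compact K \<and> K \<subseteq> D"
  have a: "AE x in lebesgue. indicator K x *\<^sub>R u x = indicator K x *\<^sub>R u' x"
    using ae by eventually_elim (use K in \<open>auto simp: indicator_def\<close>)
  have i: "integrable lebesgue (\<lambda>x. indicator K x *\<^sub>R u x)"
    using u K by (auto simp: loc_integrable_def set_integrable_def)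
  show "set_integrable lebesgue K u'"
    unfolding set_integrable_def
    using integrable_cong_AE[THEN iffD1, OF _ _ a i] borel_measurable_AE[OF borel_measurable_integrable[OF i] a]
      borel_measurable_integrable[OF i] by blast
qed

lemma has_weak_partialD:
  assumes "has_weak_partial D b u g" "\<phi> \<in> test_functions D" "b \<in> Basis"
  shows "integrable lebesgue (\<lambda>x. u x * pd b \<phi> x)"
    "integrable lebesgue (\<lambda>x. g x * \<phi> x)"
    "(LINT x|lebesgue. u x * pd b \<phi> x) = - (LINT x|lebesgue. g x * \<phi> x)"
proof -
  obtain K where K: "compact K" "K \<subseteq> D" "\<And>x. x \<notin> K \<Longrightarrow> \<phi> x = 0"
    "\<And>x b. x \<notin> K \<Longrightarrow> pd b \<phi> x = 0" "smooth_fun \<phi>"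
    using test_functionsE[OF assms(2)] by blast
  have u: "loc_integrable D u" and g: "loc_integrable D g"
    using assms(1) by (auto simp: has_weak_partial_def)
  note 1 = loc_integrable_mult_test[OF u K(1,2) smooth_fun_continuous_deriv[OF K(5) assms(3)] K(4)]
  note 2 = loc_integrable_mult_test[OF g K(1,2) smooth_fun_continuous[OF K(5)] K(3)]
  show "integrable lebesgue (\<lambda>x. u x * pd b \<phi> x)"
    "integrable lebesgue (\<lambda>x. g x * \<phi> x)" using 1(1) 2(1) by auto
  show "(LINT x|lebesgue. u x * pd b \<phi> x) = - (LINT x|lebesgue. g x * \<phi> x)"
    using assms(1,2) 1(2) 2(2) by (auto simp: has_weak_partial_def)
qed

lemma has_weak_partialI:
  assumes u: "loc_integrable D u" and g: "loc_integrable D g" and b: "b \<in> Basis"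
    and z: "\<And>\<phi>. \<phi> \<in> test_functions D \<Longrightarrow>
      (LINT x|lebesgue. u x * pd b \<phi> x) = - (LINT x|lebesgue. g x * \<phi> x)"
  shows "has_weak_partial D b u g"
  unfolding has_weak_partial_def
proof (intro conjI ballI u g)
  fix \<phi> assume \<phi>: "\<phi> \<in> test_functions D"
  obtain K where K: "compact K" "K \<subseteq> D" "\<And>x. x \<notin> K \<Longrightarrow> \<phi> x = 0"
    "\<And>x b. x \<notin> K \<Longrightarrow> pd b \<phi> x = 0" "smooth_fun \<phi>"
    using test_functionsE[OF \<phi>] by blast
  show "(LINT x:D|lebesgue. u x * pd b \<phi> x) = - (LINT x:D|lebesgue. g x * \<phi> x)"
    using z[OF \<phi>] loc_integrable_mult_test(2)[OF u K(1,2) smooth_fun_continuous_deriv[OF K(5) b] K(4)]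
      loc_integrable_mult_test(2)[OF g K(1,2) smooth_fun_continuous[OF K(5)] K(3)] by simp
qed

lemma has_weak_partial_AE:
  assumes w: "has_weak_partial D b u g" and D: "open D" and b: "b \<in> Basis"
    and u: "AE x in lebesgue. x \<in> D \<longrightarrow> u x = u' x"
    and g: "AE x in lebesgue. x \<in> D \<longrightarrow> g x = g' x"
  shows "has_weak_partial D b u' g'"
proof -
  have l: "loc_integrable D u" "loc_integrable D g" using w by (auto simp: has_weak_partial_def)
  have l': "loc_integrable D u'" "loc_integrable D g'"
    using loc_integrable_AE[OF l(1) D u] loc_integrable_AE[OF l(2) D g] by auto
  show ?thesis
  proof (rule has_weak_partialI[OF l' b])
    fix \<phi> assume \<phi>: "\<phi> \<in> test_functions D"
    obtain K where K: "compact K" "K \<subseteq> D" "\<And>x. x \<notin> K \<Longrightarrow> \<phi> x = 0"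
      "\<And>x b. x \<notin> K \<Longrightarrow> pd b \<phi> x = 0" "smooth_fun \<phi>"
      using test_functionsE[OF \<phi>] by blast
    note ii = loc_integrable_mult_test(1)[OF _ K(1,2) smooth_fun_continuous_deriv[OF K(5) b] K(4)]
      loc_integrable_mult_test(1)[OF _ K(1,2) smooth_fun_continuous[OF K(5)] K(3)]
    note m = ii(1)[OF l(1), THEN borel_measurable_integrable] ii(1)[OF l'(1), THEN borel_measurable_integrable]
      ii(2)[OF l(2), THEN borel_measurable_integrable] ii(2)[OF l'(2), THEN borel_measurable_integrable]
    have "(LINT x|lebesgue. u' x * pd b \<phi> x)
        = (LINT x|lebesgue. u x * pd b \<phi> x)"
    proof (rule integral_cong_AE)
      show "AE x in lebesgue. u' x * pd b \<phi> x = u x * pd b \<phi> x"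
        using u
      proof eventually_elim
        case (elim x)
        then show ?case using K(2) K(4)[of x b] by (cases "x \<in> K") auto
      qed
    qed (use m in auto)
    moreover have "(LINT x|lebesgue. g' x * \<phi> x) = (LINT x|lebesgue. g x * \<phi> x)"
    proof (rule integral_cong_AE)
      show "AE x in lebesgue. g' x * \<phi> x = g x * \<phi> x"
        using g
      proof eventually_elim
        case (elim x)
        then show ?case using K(2) K(3)[of x] by (cases "x \<in> K") auto
      qed
    qed (use m in auto)
    ultimately show "(LINT x|lebesgue. u' x * pd b \<phi> x) = - (LINT x|lebesgue. g' x * \<phi> x)"
      using has_weak_partialD(3)[OF w \<phi> b] by simp
  qed
qed

lemma loc_integrable_lin:
  assumes "loc_integrable D u" "loc_integrable D u'"
  shows "loc_integrable D (\<lambda>x. c * u x + d * u' x)"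
  using assms unfolding loc_integrable_def
  by (auto intro!: set_integral_add(1) set_integrable_mult_right)

lemma has_weak_partial_lin:
  assumes w: "has_weak_partial D b u g" "has_weak_partial D b u' g'" and b: "b \<in> Basis"
  shows "has_weak_partial D b (\<lambda>x. c * u x + d * u' x) (\<lambda>x. c * g x + d * g' x)"
proof (rule has_weak_partialI[OF _ _ b])
  show "loc_integrable D (\<lambda>x. c * u x + d * u' x)" "loc_integrable D (\<lambda>x. c * g x + d * g' x)"
    using w by (auto simp: has_weak_partial_def intro: loc_integrable_lin)
  fix \<phi> assume \<phi>: "\<phi> \<in> test_functions D"
  let ?d = "\<lambda>x. pd b \<phi> x"
  note 1 = has_weak_partialD[OF w(1) \<phi> b] and 2 = has_weak_partialD[OF w(2) \<phi> b]
  have "(LINT x|lebesgue. (c * u x + d * u' x) * ?d x) = (LINT x|lebesgue. c * (u x * ?d x) + d * (u' x * ?d x))"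
    by (simp add: algebra_simps)
  also have "\<dots> = c * (LINT x|lebesgue. u x * ?d x) + d * (LINT x|lebesgue. u' x * ?d x)"
    using 1(1) 2(1) by (simp add: Bochner_Integration.integral_add)
  also have "\<dots> = - (c * (LINT x|lebesgue. g x * \<phi> x) + d * (LINT x|lebesgue. g' x * \<phi> x))"
    unfolding 1(3) 2(3) by simp
  also have "c * (LINT x|lebesgue. g x * \<phi> x) + d * (LINT x|lebesgue. g' x * \<phi> x)
      = (LINT x|lebesgue. c * (g x * \<phi> x) + d * (g' x * \<phi> x))"
    using 1(2) 2(2) by (simp add: Bochner_Integration.integral_add)
  also have "\<dots> = (LINT x|lebesgue. (c * g x + d * g' x) * \<phi> x)"
    by (simp add: algebra_simps)
  finally show "(LINT x|lebesgue. (c * u x + d * u' x) * ?d x) = - (LINT x|lebesgue. (c * g x + d * g' x) * \<phi> x)" .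
qed

lemma has_weak_partial_unique:
  assumes w: "has_weak_partial D b u g" "has_weak_partial D b u g'" and D: "open D" and b: "b \<in> Basis"
  shows "AE x in lebesgue. x \<in> D \<longrightarrow> g x = g' x"
proof -
  have w': "has_weak_partial D b (\<lambda>x. 1 * u x + (-1) * u x) (\<lambda>x. 1 * g x + (-1) * g' x)"
    by (rule has_weak_partial_lin[OF w b])
  have "AE x in lebesgue. x \<in> D \<longrightarrow> 1 * g x + (-1) * g' x = 0"
  proof (rule fundamental_lemma[OF D])
    show "loc_integrable D (\<lambda>x. 1 * g x + (-1) * g' x)" using w' by (simp add: has_weak_partial_def)
    fix \<phi> assume "\<phi> \<in> test_functions D"
    then show "(LINT x:D|lebesgue. (1 * g x + (-1) * g' x) * \<phi> x) = 0"
      using w' by (simp add: has_weak_partial_def)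
  qed
  then show ?thesis by eventually_elim auto
qed

lemma has_weak_partial_weak_partial:
  "has_weak_partial D b u g \<Longrightarrow> has_weak_partial D b u (weak_partial D b u)"
  unfolding weak_partial_def by (rule someI[where P = "has_weak_partial D b u"])

text \<open>This makes the choice operator in \<open>weak_partial\<close> harmless: any explicitly
  known weak derivative may replace it under an integral.\<close>

lemma weak_partial_AE_eq:
  assumes "has_weak_partial D b u g" "open D" "b \<in> Basis"
  shows "AE x in lebesgue. x \<in> D \<longrightarrow> weak_partial D b u x = g x"
  using has_weak_partial_unique[OF has_weak_partial_weak_partial[OF assms(1)] assms] .

lemma has_weak_partial_subset:
  assumes w: "has_weak_partial D b u g" and "D' \<subseteq> D" and b: "b \<in> Basis"
  shows "has_weak_partial D' b u g"
proof (rule has_weak_partialI[OF _ _ b])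
  show "loc_integrable D' u" "loc_integrable D' g"
    using w \<open>D' \<subseteq> D\<close> by (auto simp: has_weak_partial_def loc_integrable_def)
  show "(LINT x|lebesgue. u x * pd b \<phi> x) = - (LINT x|lebesgue. g x * \<phi> x)"
    if "\<phi> \<in> test_functions D'" for \<phi>
    using has_weak_partialD(3)[OF w _ b] test_functions_mono[OF \<open>D' \<subseteq> D\<close>] that by blast
qed

subsection \<open>Translations\<close>

lemma lborel_shift:
  fixes f :: "'a::euclidean_space \<Rightarrow> real"
  assumes "f \<in> borel_measurable borel"
  shows "integrable lborel (\<lambda>x. f (a + x)) \<longleftrightarrow> integrable lborel f"
    "(LINT x|lborel. f (a + x)) = (LINT x|lborel. f x)"
proof -
  have "integrable (distr lborel borel ((+) a)) f \<longleftrightarrow> integrable lborel (\<lambda>x. f (a + x))"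
    by (rule integrable_distr_eq) (use assms in auto)
  then show "integrable lborel (\<lambda>x. f (a + x)) \<longleftrightarrow> integrable lborel f" by (simp add: lborel_distr_plus)
  have "integral\<^sup>L (distr lborel borel ((+) a)) f = (LINT x|lborel. f (a + x))"
    by (rule integral_distr) (use assms in auto)
  then show "(LINT x|lborel. f (a + x)) = (LINT x|lborel. f x)" by (simp add: lborel_distr_plus)
qed

definition L1_dist :: "('a::euclidean_space \<Rightarrow> real) \<Rightarrow> ('a \<Rightarrow> real) \<Rightarrow> real" where
  "L1_dist f g = (LINT x|lborel. \<bar>f x - g x\<bar>)"

lemma L1_dist_nonneg: "0 \<le> L1_dist f g"
  unfolding L1_dist_def by (rule integral_nonneg_AE) simp

lemma L1_dist_commute: "L1_dist f g = L1_dist g f"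
  by (simp add: L1_dist_def abs_minus_commute)

lemma L1_dist_triangle:
  assumes "integrable lborel f" "integrable lborel g" "integrable lborel h"
  shows "L1_dist f h \<le> L1_dist f g + L1_dist g h"
proof -
  have "L1_dist f h \<le> (LINT x|lborel. \<bar>f x - g x\<bar> + \<bar>g x - h x\<bar>)"
    unfolding L1_dist_def using assms by (intro integral_mono) auto
  also have "\<dots> = L1_dist f g + L1_dist g h"
    unfolding L1_dist_def using assms by (intro Bochner_Integration.integral_add) auto
  finally show ?thesis .
qed

text \<open>A three-epsilon argument: translation is an isometry for \<open>L1_dist\<close>, so its
  continuity passes to L1 limits.\<close>

lemma translation_tendsto_approx:
  assumes f: "integrable lborel f"
    and g: "\<And>e. 0 < e \<Longrightarrow> \<exists>g. integrable lborel g \<and> L1_dist f g < e \<and> (\<lambda>n. L1_dist (\<lambda>x. g (t n + x)) g) \<longlonglongrightarrow> 0"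
  shows "(\<lambda>n. L1_dist (\<lambda>x. f (t n + x)) f) \<longlonglongrightarrow> 0"
proof (rule LIMSEQ_I)
  fix r :: real assume r: "0 < r"
  then obtain g where g: "integrable lborel g" "L1_dist f g < r / 3" "(\<lambda>n. L1_dist (\<lambda>x. g (t n + x)) g) \<longlonglongrightarrow> 0"
    using g[of "r / 3"] by auto
  have m: "f \<in> borel_measurable borel" "g \<in> borel_measurable borel"
    using f g by (auto dest: borel_measurable_integrable)
  have i: "integrable lborel (\<lambda>x. f (t n + x))" "integrable lborel (\<lambda>x. g (t n + x))" for n
    using f g m by (simp_all add: lborel_shift(1))
  have le: "L1_dist (\<lambda>x. f (t n + x)) f \<le> L1_dist (\<lambda>x. g (t n + x)) g + 2 * L1_dist f g" for n
  proof -
    have "L1_dist (\<lambda>x. f (t n + x)) (\<lambda>x. g (t n + x)) = L1_dist f g"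
      unfolding L1_dist_def by (rule lborel_shift(2)[of "\<lambda>x. \<bar>f x - g x\<bar>"]) (use m in measurable)
    then show ?thesis
      using L1_dist_triangle[OF i(1)[of n] i(2)[of n] f] L1_dist_triangle[OF i(2)[of n] g(1) f] L1_dist_commute[of g f]
      by linarith
  qed
  have "\<forall>\<^sub>F n in sequentially. L1_dist (\<lambda>x. g (t n + x)) g < r / 3"
    using order_tendstoD(2)[OF g(3), of "r / 3"] r by simp
  then have "\<forall>\<^sub>F n in sequentially. norm (L1_dist (\<lambda>x. f (t n + x)) f - 0) < r"
  proof eventually_elim
    case (elim n)
    then show ?case using le[of n] g(2) L1_dist_nonneg[of "\<lambda>x. f (t n + x)" f] by simp
  qed
  then show "\<exists>n0. \<forall>n\<ge>n0. norm (L1_dist (\<lambda>x. f (t n + x)) f - 0) < r"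
    unfolding eventually_sequentially .
qed

text \<open>For open \<open>U\<close> of finite measure, \<open>U\<close> and its translate have the same measure, hence the symmetric
  difference has twice the measure of the part of \<open>U\<close> that leaves \<open>U\<close>.\<close>
lemma translation_tendsto_open:
  assumes U: "open U" "emeasure lborel U < \<infinity>" and t: "t \<longlonglongrightarrow> 0"
  shows "(\<lambda>n. L1_dist (\<lambda>x. indicator U (t n + x)) (indicator U)) \<longlonglongrightarrow> 0"
proof -
  have Ub: "U \<in> sets borel" using U(1) by auto
  let ?W = "\<lambda>n x. indicator U x * (1 - indicator U (t n + x)) :: real"
  have iU: "integrable lborel (indicator U :: _ \<Rightarrow> real)" using Ub U(2) by (auto intro!: integrable_real_indicator)
  have m: "(indicator U :: _ \<Rightarrow> real) \<in> borel_measurable borel" using Ub by simp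
  have iS: "integrable lborel (\<lambda>x. indicator U (t n + x) :: real)" for n
    using iU by (simp add: lborel_shift(1)[OF m])
  have iW: "integrable lborel (?W n)" for n
    by (rule Bochner_Integration.integrable_bound[OF iU]) (use Ub in \<open>measurable, auto simp: indicator_def\<close>)
  have "(\<lambda>n. LINT x|lborel. ?W n x) \<longlonglongrightarrow> (LINT x::'a|lborel. 0)"
  proof (rule integral_dominated_convergence[where w = "indicator U"])
    show "AE x in lborel. (\<lambda>n. ?W n x) \<longlonglongrightarrow> 0"
    proof (rule AE_I2)
      fix x
      show "(\<lambda>n. ?W n x) \<longlonglongrightarrow> 0"
      proof (cases "x \<in> U")
        case True
        have "(\<lambda>n. t n + x) \<longlonglongrightarrow> 0 + x" by (intro tendsto_intros t)
        then have "\<forall>\<^sub>F n in sequentially. t n + x \<in> U"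
          using U(1) True by (auto dest: topological_tendstoD)
        then have "\<forall>\<^sub>F n in sequentially. ?W n x = 0" by eventually_elim simp
        then show ?thesis by (rule tendsto_eventually)
      qed simp
    qed
    show "?W n \<in> borel_measurable lborel" for n using iW by (rule borel_measurable_integrable)
    show "AE x in lborel. norm (?W n x) \<le> indicator U x" for n
      by (intro AE_I2) (auto simp: indicator_def)
  qed (use iU in auto)
  from tendsto_mult_left[OF this, of 2] have "(\<lambda>n. 2 * (LINT x|lborel. ?W n x)) \<longlonglongrightarrow> 0" by simp
  moreover have "L1_dist (\<lambda>x. indicator U (t n + x)) (indicator U) = 2 * (LINT x|lborel. ?W n x)" for n
  proof -
    have "L1_dist (\<lambda>x. indicator U (t n + x)) (indicator U) = (LINT x|lborel. 2 * ?W n x + (indicator U (t n + x) - indicator U x))"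
      unfolding L1_dist_def by (rule Bochner_Integration.integral_cong) (auto simp: indicator_def)
    also have "\<dots> = 2 * (LINT x|lborel. ?W n x)"
      using iW[of n] iU iS[of n] lborel_shift(2)[OF m, of "t n"] by simp
    finally show ?thesis .
  qed
  ultimately show ?thesis by simp
qed

text \<open>Induction over integrable functions: indicators of measurable sets are approximated by
  those of open sets, sums are immediate, and limits are covered by
  \<open>translation_tendsto_approx\<close>.\<close>

lemma L1_continuous_translation:
  fixes f :: "'a::euclidean_space \<Rightarrow> real"
  assumes "integrable lborel f" "t \<longlonglongrightarrow> 0"
  shows "(\<lambda>n. L1_dist (\<lambda>x. f (t n + x)) f) \<longlonglongrightarrow> 0"
  using assms
proof (induction rule: integrable_induct)
  case (base A c)
  have A: "A \<in> sets borel" "emeasure lborel A < \<infinity>" using base by auto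
  have iA: "integrable lborel (indicator A :: 'a \<Rightarrow> real)" using A by (auto intro!: integrable_real_indicator)
  have "(\<lambda>n. L1_dist (\<lambda>x. indicator A (t n + x)) (indicator A)) \<longlonglongrightarrow> 0"
  proof (rule translation_tendsto_approx[OF iA])
    fix e :: real assume "0 < e"
    \<comment> \<open>Outer regularity reduces a set of finite measure to an open one.\<close>
    then obtain U where U: "open U" "A \<subseteq> U" "emeasure lborel (U - A) < ennreal e"
      by (rule outer_regular_lborel[OF A(1)])
    have Ub: "U \<in> sets borel" using U(1) by auto
    have "emeasure lborel U \<le> emeasure lborel A + emeasure lborel (U - A)"
      using emeasure_subadditive[of A lborel "U - A"] A(1) Ub U(2) by (simp add: Un_absorb1)
    also have "\<dots> < \<infinity>" using A(2) order.strict_trans[OF U(3) ennreal_less_top] by simp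
    finally have fin: "emeasure lborel U < \<infinity>" .
    have "L1_dist (indicator A) (indicator U) = (LINT x|lborel. indicator (U - A) x)"
      unfolding L1_dist_def by (rule Bochner_Integration.integral_cong) (use U(2) in \<open>auto simp: indicator_def\<close>)
    also have "\<dots> = measure lborel (U - A)" by simp
    also have "\<dots> < e"
    proof -
      have "emeasure lborel (U - A) = ennreal (measure lborel (U - A))"
        using order.strict_trans[OF U(3) ennreal_less_top] by (intro emeasure_eq_ennreal_measure) auto
      then show ?thesis using U(3) by (simp add: ennreal_less_iff)
    qed
    finally have "L1_dist (indicator A) (indicator U) < e" .
    moreover have "integrable lborel (indicator U :: 'a \<Rightarrow> real)" using Ub fin by (auto intro!: integrable_real_indicator)
    ultimately show "\<exists>g. integrable lborel g \<and> L1_dist (indicator A) g < e \<and> (\<lambda>n. L1_dist (\<lambda>x. g (t n + x)) g) \<longlonglongrightarrow> 0"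
      using translation_tendsto_open[OF U(1) fin base(3)] by blast
  qed
  from tendsto_mult_left_zero[OF this, of "\<bar>c\<bar>"]
  show ?case
    by (simp add: L1_dist_def abs_mult flip: integral_mult_left_zero left_diff_distrib)
next
  case (add f g)
  have "f \<in> borel_measurable borel" "g \<in> borel_measurable borel"
    using add.hyps by (auto dest: borel_measurable_integrable)
  then have i: "integrable lborel (\<lambda>x. f (t n + x))" "integrable lborel (\<lambda>x. g (t n + x))" for n
    using add.hyps by (simp_all add: lborel_shift(1))
  have le: "L1_dist (\<lambda>x. f (t n + x) + g (t n + x)) (\<lambda>x. f x + g x) \<le> L1_dist (\<lambda>x. f (t n + x)) f + L1_dist (\<lambda>x. g (t n + x)) g" for n
  proof -
    have "L1_dist (\<lambda>x. f (t n + x) + g (t n + x)) (\<lambda>x. f x + g x)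
      \<le> (LINT x|lborel. \<bar>f (t n + x) - f x\<bar> + \<bar>g (t n + x) - g x\<bar>)"
      unfolding L1_dist_def using i[of n] add.hyps by (intro integral_mono) auto
    also have "\<dots> = L1_dist (\<lambda>x. f (t n + x)) f + L1_dist (\<lambda>x. g (t n + x)) g"
      unfolding L1_dist_def using i[of n] add.hyps by (intro Bochner_Integration.integral_add) auto
    finally show ?thesis .
  qed
  have l0: "(\<lambda>n. L1_dist (\<lambda>x. f (t n + x)) f + L1_dist (\<lambda>x. g (t n + x)) g) \<longlonglongrightarrow> 0"
    using tendsto_add[OF add.IH(1) add.IH(2)] add.prems by simp
  show ?case
    by (rule tendsto_sandwich[OF _ _ tendsto_const l0]) (use L1_dist_nonneg le in \<open>blast intro: always_eventually\<close>)+
next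
  case (lim f s)
  show ?case
  proof (rule translation_tendsto_approx[OF lim.hyps(4)])
    fix e :: real assume e: "0 < e"
    have "(\<lambda>i. LINT x|lborel. \<bar>f x - s i x\<bar>) \<longlonglongrightarrow> (LINT x::'a|lborel. 0)"
    \<comment> \<open>The approximations satisfy |s i x| <= 2 |f x|, hence the majorant 3
      |f|.\<close>
    proof (rule integral_dominated_convergence[where w = "\<lambda>x. 3 * norm (f x)"])
      show "AE x in lborel. (\<lambda>i. \<bar>f x - s i x\<bar>) \<longlonglongrightarrow> 0"
      proof (rule AE_I2)
        fix x
        have "(\<lambda>i. s i x) \<longlonglongrightarrow> f x" using lim.hyps by simp
        from tendsto_rabs[OF tendsto_diff[OF tendsto_const[of "f x"] this]] show "(\<lambda>i. \<bar>f x - s i x\<bar>) \<longlonglongrightarrow> 0" by simp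
      qed
      show "AE x in lborel. norm \<bar>f x - s i x\<bar> \<le> 3 * norm (f x)" for i
      proof (rule AE_I2)
        fix x
        have "norm (s i x) \<le> 2 * norm (f x)" using lim.hyps by simp
        then show "norm \<bar>f x - s i x\<bar> \<le> 3 * norm (f x)" by simp
      qed
    qed (use lim.hyps in auto)
    then obtain i where "L1_dist f (s i) < e"
      using order_tendstoD(2)[of _ 0 sequentially e] e by (auto simp: eventually_sequentially L1_dist_def)
    then show "\<exists>g. integrable lborel g \<and> L1_dist f g < e \<and> (\<lambda>n. L1_dist (\<lambda>x. g (t n + x)) g) \<longlonglongrightarrow> 0"
      using lim.hyps(1) lim.IH lim.prems by blast
  qed
qed

subsection \<open>Difference quotients of weakly differentiable functions\<close>

lemma frechet_zero_off_closed:
  assumes "closed S" "\<And>x. x \<notin> S \<Longrightarrow> \<phi> x = 0" "x \<notin> S"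
  shows "pd b \<phi> x = 0"
proof -
  have "(\<phi> has_derivative (\<lambda>_. 0)) (at x)"
  proof (rule has_derivative_transform_within_open)
    show "((\<lambda>_. 0) has_derivative (\<lambda>_. 0)) (at x)" by simp
    show "open (- S)" using assms(1) by (rule open_Compl)
    show "x \<in> - S" using assms(3) by simp
    show "0 = \<phi> y" if "y \<in> - S" for y using assms(2)[of y] that by simp
  qed
  from fun_cong[OF frechet_derivative_at[OF this], of b] show ?thesis by simp
qed

lemma test_function_bounded:
  assumes "\<phi> \<in> test_functions D" "b \<in> Basis"
  obtains M where "\<And>x. \<bar>\<phi> x\<bar> \<le> M" "\<And>x. \<bar>pd b \<phi> x\<bar> \<le> M" "0 \<le> M"
proof -
  obtain K where K: "compact K" "K \<subseteq> D" "\<And>x. x \<notin> K \<Longrightarrow> \<phi> x = 0"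
    "\<And>x b. x \<notin> K \<Longrightarrow> pd b \<phi> x = 0" "smooth_fun \<phi>"
    using test_functionsE[OF assms(1)] by blast
  have "bounded (\<phi> ` K)" "bounded ((\<lambda>x. pd b \<phi> x) ` K)"
    by (intro compact_imp_bounded compact_continuous_image K smooth_fun_continuous[OF K(5)]
      smooth_fun_continuous_deriv[OF K(5) assms(2)])+
  then obtain M1 M2 where M: "\<And>x. x \<in> K \<Longrightarrow> \<bar>\<phi> x\<bar> \<le> M1"
    "\<And>x. x \<in> K \<Longrightarrow> \<bar>pd b \<phi> x\<bar> \<le> M2"
    by (auto simp: bounded_iff)
  show thesis
  proof (rule that[of "max 0 (max M1 M2)"])
    show "\<bar>\<phi> x\<bar> \<le> max 0 (max M1 M2)" for x
      using M(1)[of x] K(3)[of x] by (cases "x \<in> K") auto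
    show "\<bar>pd b \<phi> x\<bar> \<le> max 0 (max M1 M2)" for x
      using M(2)[of x] K(4)[of x b] by (cases "x \<in> K") auto
  qed simp
qed

lemma smooth_fun_shift: "smooth_fun \<phi> \<Longrightarrow> smooth_fun (\<lambda>y. \<phi> (y - c))"
  by (rule smooth_fun_compose[where p' = "\<lambda>_ h. h"])
    (auto intro!: derivative_eq_intros smooth_fun_intros)

lemma frechet_shift:
  assumes "smooth_fun \<phi>"
  shows "frechet_derivative (\<lambda>y. \<phi> (y - c)) (at y) = frechet_derivative \<phi> (at (y - c))"
proof -
  have "((\<lambda>y. y - c) has_derivative (\<lambda>h. h)) (at y)" by (auto intro!: derivative_eq_intros)
  from has_derivative_compose[OF this smooth_fun_frechet(1)[OF assms]]
  have "((\<lambda>y. \<phi> (y - c)) has_derivative frechet_derivative \<phi> (at (y - c))) (at y)" by simp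
  then show ?thesis by (rule frechet_derivative_at[symmetric])
qed

lemma test_function_shift:
  assumes "\<phi> \<in> test_functions D"
  shows "(\<lambda>y. \<phi> (y - c)) \<in> test_functions UNIV"
proof -
  obtain K where K: "compact K" "K \<subseteq> D" "\<And>x. x \<notin> K \<Longrightarrow> \<phi> x = 0"
    "\<And>x b. x \<notin> K \<Longrightarrow> pd b \<phi> x = 0" "smooth_fun \<phi>"
    using test_functionsE[OF assms(1)] by blast
  show ?thesis
  proof (rule test_functionsI)
    show "smooth_fun (\<lambda>y. \<phi> (y - c))" by (rule smooth_fun_shift[OF K(5)])
    show "compact ((+) c ` K)" by (rule compact_translation[OF K(1)])
    show "\<phi> (y - c) = 0" if "y \<notin> (+) c ` K" for y
    proof (rule K(3))
      show "y - c \<notin> K"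
      proof
        assume "y - c \<in> K"
        then have "c + (y - c) \<in> (+) c ` K" by (rule imageI)
        with that show False by simp
      qed
    qed
  qed simp
qed

lemma integral_along:
  fixes \<phi> :: "'a::euclidean_space \<Rightarrow> real"
  assumes \<phi>: "smooth_fun \<phi>" and b: "b \<in> Basis"
  shows "(LINT r|lborel. indicator {0..1} r * (h * pd b \<phi> (x - (r * h) *\<^sub>R b)))
      = \<phi> x - \<phi> (x - h *\<^sub>R b)"
proof -
  let ?F = "\<lambda>r. - \<phi> (x - (r * h) *\<^sub>R b)" and ?f = "\<lambda>r. h * pd b \<phi> (x - (r * h) *\<^sub>R b)"
  have "(LINT r|lborel. indicator {0..1} r *\<^sub>R ?f r) = ?F 1 - ?F 0"
  proof (rule integral_FTC_Icc)
    show "(?F has_vector_derivative ?f r) (at r within {0..1})" for r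
    proof -
      have lin: "linear (frechet_derivative \<phi> (at (x - (r * h) *\<^sub>R b)))"
        using smooth_fun_frechet(1)[OF \<phi>] by (rule has_derivative_linear)
      have "((\<lambda>r. x - (r * h) *\<^sub>R b) has_derivative (\<lambda>s. - ((s * h) *\<^sub>R b))) (at r)"
        by (auto intro!: derivative_eq_intros)
      from has_derivative_minus[OF has_derivative_compose[OF this smooth_fun_frechet(1)[OF \<phi>]]]
      have "(?F has_derivative (\<lambda>s. - pd (- ((s * h) *\<^sub>R b)) \<phi> (x - (r * h) *\<^sub>R b))) (at r)" .
      also have "(\<lambda>s. - pd (- ((s * h) *\<^sub>R b)) \<phi> (x - (r * h) *\<^sub>R b)) = (\<lambda>s. s *\<^sub>R ?f r)"
        by (simp add: linear_neg[OF lin] linear_cmul[OF lin] mult.assoc)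
      finally show ?thesis
        unfolding has_vector_derivative_def by (rule has_derivative_at_withinI)
    qed
    have "continuous_on UNIV (\<lambda>r. pd b \<phi> (x - (r * h) *\<^sub>R b))"
      by (rule continuous_on_compose2[OF smooth_fun_continuous_deriv[OF \<phi> b, of UNIV]])
        (auto intro!: continuous_intros)
    then show "continuous_on {0..1} ?f"
      by (intro continuous_intros) (rule continuous_on_subset, auto)
  qed simp
  then show ?thesis by simp
qed

abbreviation seg :: "'a::euclidean_space \<Rightarrow> real \<Rightarrow> ('a \<Rightarrow> real) \<Rightarrow> real \<times> 'a \<Rightarrow> real" where
  "seg b h g \<equiv> (\<lambda>(r, x). indicator {0..1} r * g (x + (r * h) *\<^sub>R b))"

text \<open>For fixed r the slice is a translate of g and has the same L1 norm, so the iterated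
  integral over [0, 1] is finite and Tonelli applies.\<close>

lemma integrable_pair_shift:
  fixes g :: "'a::euclidean_space \<Rightarrow> real"
  assumes g: "integrable lborel g"
  shows "integrable (lborel \<Otimes>\<^sub>M lborel) (seg b h g)"
proof -
  have [measurable]: "g \<in> borel_measurable borel" using g by (auto dest: borel_measurable_integrable)
  have sh: "integrable lborel (\<lambda>x. g (x + c))" for c
    using lborel_shift(1)[of g c] g by (simp add: add.commute)
  have shn: "(LINT x|lborel. norm (g (x + c))) = (LINT x|lborel. norm (g x))" for c
    using lborel_shift(2)[of "\<lambda>x. norm (g x)" c] by (simp add: add.commute)
  show ?thesis
  proof (rule lborel_pair.Fubini_integrable)
    have eq: "(LINT x|lborel. norm (case (r, x) of (r, x) \<Rightarrow> indicator {0..1} r * g (x + (r * h) *\<^sub>R b)))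
        = indicator {0..1} r * (LINT x|lborel. norm (g x))" for r
      by (simp add: abs_mult shn[unfolded real_norm_def])
    show "integrable lborel (\<lambda>r. LINT x|lborel. norm (case (r, x) of (r, x) \<Rightarrow> indicator {0..1} r * g (x + (r * h) *\<^sub>R b)))"
      unfolding eq by simp
    show "AE r in lborel. integrable lborel (\<lambda>x. case (r, x) of (r, x) \<Rightarrow> indicator {0..1} r * g (x + (r * h) *\<^sub>R b))"
      using sh by simp
  qed measurable
qed

text \<open>The Steklov average of g: its mean over the segment from x to x + h b. For g a weak
  derivative of u in direction b it plays the role of the difference quotient of u.\<close>

definition line_avg :: "'a::euclidean_space \<Rightarrow> real \<Rightarrow> ('a \<Rightarrow> real) \<Rightarrow> 'a \<Rightarrow> real" where
  "line_avg b h g x = (LINT r|lborel. indicator {0..1} r * g (x + (r * h) *\<^sub>R b))"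

lemma integrable_line_avg:
  assumes "integrable lborel g"
  shows "integrable lborel (line_avg b h g)"
  using lborel_pair.integrable_snd[OF integrable_pair_shift[OF assms, of h b]] by (simp add: line_avg_def[abs_def])

text \<open>Fubini lets the average act on \<phi> instead of g. For fixed r the shifted \<phi>
  vanishes off S, because points of C stay in S along the segment, so the weak identity applies;
  integrating the derivative of the shifted \<phi> over r leaves the difference of \<phi>.\<close>

lemma line_avg_test:
  fixes u g :: "'a::euclidean_space \<Rightarrow> real"
  assumes u: "integrable lborel u" and g: "integrable lborel g" and b: "b \<in> Basis"
    and CS: "\<And>x r. x \<in> C \<Longrightarrow> 0 \<le> r \<Longrightarrow> r \<le> 1 \<Longrightarrow> x + (r * h) *\<^sub>R b \<in> S"
    and weak: "\<And>\<phi>. \<phi> \<in> test_functions UNIV \<Longrightarrow> (\<And>x. x \<notin> S \<Longrightarrow> \<phi> x = 0) \<Longrightarrow>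
      (LINT x|lborel. u x * pd b \<phi> x) = - (LINT x|lborel. g x * \<phi> x)"
    and \<phi>: "\<phi> \<in> test_functions UNIV" and \<phi>C: "\<And>x. x \<notin> C \<Longrightarrow> \<phi> x = 0"
  shows "h * (LINT x|lborel. line_avg b h g x * \<phi> x) = - (LINT x|lborel. u x * (\<phi> x - \<phi> (x - h *\<^sub>R b)))"
proof -
  have sm: "smooth_fun \<phi>" using \<phi> by (auto simp: test_functions_def)
  obtain M where M: "\<And>x. \<bar>\<phi> x\<bar> \<le> M" "\<And>x. \<bar>pd b \<phi> x\<bar> \<le> M" "0 \<le> M"
    using test_function_bounded[OF \<phi> b] by blast
  let ?d = "\<lambda>x. pd b \<phi> x"
  have [measurable]: "u \<in> borel_measurable borel" "g \<in> borel_measurable borel"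
    using u g by (auto dest: borel_measurable_integrable)
  have [measurable]: "\<phi> \<in> borel_measurable borel" "?d \<in> borel_measurable borel"
    using smooth_fun_continuous[OF sm] smooth_fun_continuous_deriv[OF sm b]
    by (auto intro!: borel_measurable_continuous_onI)
  have i1: "integrable (lborel \<Otimes>\<^sub>M lborel) (\<lambda>(r::real, x). indicator {0..1} r * g (x + (r * h) *\<^sub>R b) * \<phi> x)"
  proof (rule Bochner_Integration.integrable_bound)
    show "integrable (lborel \<Otimes>\<^sub>M lborel) (\<lambda>z. M * seg b h g z)"
      by (rule integrable_mult_right) (rule integrable_pair_shift[OF g])
    show "AE z in lborel \<Otimes>\<^sub>M lborel. norm (case z of (r::real, x) \<Rightarrow> indicator {0..1} r * g (x + (r * h) *\<^sub>R b) * \<phi> x)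
      \<le> norm (M * seg b h g z)"
    proof (rule AE_I2)
      fix z :: "real \<times> 'a"
      obtain r x where z: "z = (r, x)" by (cases z)
      show "norm (case z of (r::real, x) \<Rightarrow> indicator {0..1} r * g (x + (r * h) *\<^sub>R b) * \<phi> x)
        \<le> norm (M * seg b h g z)"
        using mult_right_mono[OF M(1)[of x], of "\<bar>indicator {0..1} r * g (x + (r * h) *\<^sub>R b)\<bar>"] M(3)
        by (simp add: z abs_mult mult.commute mult.left_commute)
    qed
  qed measurable
  have i2: "integrable (lborel \<Otimes>\<^sub>M lborel) (\<lambda>(r::real, x). indicator {0..1} r * u x * (h * ?d (x - (r * h) *\<^sub>R b)))"
  proof (rule Bochner_Integration.integrable_bound)
    show "integrable (lborel \<Otimes>\<^sub>M lborel) (\<lambda>z. (h * M) * seg b 0 u z)"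
      by (rule integrable_mult_right) (rule integrable_pair_shift[OF u])
    show "AE z in lborel \<Otimes>\<^sub>M lborel. norm (case z of (r::real, x) \<Rightarrow> indicator {0..1} r * u x * (h * ?d (x - (r * h) *\<^sub>R b)))
      \<le> norm ((h * M) * seg b 0 u z)"
    proof (rule AE_I2)
      fix z :: "real \<times> 'a"
      obtain r x where z: "z = (r, x)" by (cases z)
      show "norm (case z of (r::real, x) \<Rightarrow> indicator {0..1} r * u x * (h * ?d (x - (r * h) *\<^sub>R b)))
      \<le> norm ((h * M) * seg b 0 u z)"
        using mult_right_mono[OF M(2)[of "x - (r * h) *\<^sub>R b"], of "\<bar>indicator {0..1} r * u x * h\<bar>"] M(3)
        by (simp add: z abs_mult mult_ac)
    qed
  qed measurable
  have in_r: "(LINT x|lborel. indicator {0..1} r * g (x + (r * h) *\<^sub>R b) * \<phi> x) * h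
    = - (LINT x|lborel. indicator {0..1} r * u x * (h * ?d (x - (r * h) *\<^sub>R b)))" for r :: real
  proof (cases "r \<in> {0..1}")
    case True
    let ?c = "(r * h) *\<^sub>R b"
    have "(LINT x|lborel. g (x + ?c) * \<phi> x) = (LINT x|lborel. g (?c + x) * \<phi> (?c + x - ?c))"
      by (simp add: add.commute)
    also have "\<dots> = (LINT x|lborel. g x * \<phi> (x - ?c))"
      by (rule lborel_shift(2)[of "\<lambda>x. g x * \<phi> (x - ?c)"]) measurable
    also have "\<dots> = - (LINT x|lborel. u x * pd b (\<lambda>y. \<phi> (y - ?c)) x)"
    proof -
      have "(LINT x|lborel. u x * pd b (\<lambda>y. \<phi> (y - ?c)) x) = - (LINT x|lborel. g x * \<phi> (x - ?c))"
      proof (rule weak[OF test_function_shift[OF \<phi>]])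
        fix x assume "x \<notin> S"
        then have "x - ?c \<notin> C" using CS[of "x - ?c" r] True by auto
        then show "\<phi> (x - ?c) = 0" by (rule \<phi>C)
      qed
      then show ?thesis by simp
    qed
    also have "\<dots> = - (LINT x|lborel. u x * ?d (x - ?c))" by (simp add: frechet_shift[OF sm])
    finally have "(LINT x|lborel. g (x + ?c) * \<phi> x) * h = - (h * (LINT x|lborel. u x * ?d (x - ?c)))"
      by simp
    then show ?thesis using True by (simp flip: integral_mult_right_zero add: mult.left_commute)
  qed simp
  have "h * (LINT x|lborel. line_avg b h g x * \<phi> x)
    = h * (LINT x|lborel. (LINT r|lborel. indicator {0..1} r * g (x + (r * h) *\<^sub>R b) * \<phi> x))"
    by (simp add: line_avg_def)
  also have "(LINT x|lborel. (LINT r|lborel. indicator {0..1} r * g (x + (r * h) *\<^sub>R b) * \<phi> x))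
    = (LINT r|lborel. (LINT x|lborel. indicator {0..1} r * g (x + (r * h) *\<^sub>R b) * \<phi> x))"
    using lborel_pair.integral_snd[OF i1] lborel_pair.integral_fst[OF i1] by simp
  also have "h * \<dots> = (LINT r|lborel. (LINT x|lborel. indicator {0..1} r * g (x + (r * h) *\<^sub>R b) * \<phi> x) * h)"
    by simp
  also have "\<dots> = - (LINT r|lborel. (LINT x|lborel. indicator {0..1} r * u x * (h * ?d (x - (r * h) *\<^sub>R b))))"
    by (simp only: in_r Bochner_Integration.integral_minus)
  also have "(LINT r|lborel. (LINT x|lborel. indicator {0..1} r * u x * (h * ?d (x - (r * h) *\<^sub>R b))))
    = (LINT x|lborel. (LINT r|lborel. indicator {0..1} r * u x * (h * ?d (x - (r * h) *\<^sub>R b))))"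
    using lborel_pair.integral_snd[OF i2] lborel_pair.integral_fst[OF i2] by simp
  also have "\<dots> = (LINT x|lborel. u x * (LINT r|lborel. indicator {0..1} r * (h * ?d (x - (r * h) *\<^sub>R b))))"
    by (simp flip: integral_mult_right_zero add: mult_ac)
  also have "\<dots> = (LINT x|lborel. u x * (\<phi> x - \<phi> (x - h *\<^sub>R b)))"
    unfolding integral_along[OF sm b] ..
  finally show ?thesis .
qed

lemma integrable_mult_bounded:
  fixes u \<phi> :: "'a \<Rightarrow> real"
  assumes "integrable M u" "\<phi> \<in> borel_measurable M" "\<And>x. \<bar>\<phi> x\<bar> \<le> B"
  shows "integrable M (\<lambda>x. u x * \<phi> x)"
proof (rule Bochner_Integration.integrable_bound)
  show "integrable M (\<lambda>x. B * u x)" using assms(1) by simp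
  show "(\<lambda>x. u x * \<phi> x) \<in> borel_measurable M" using assms by (intro borel_measurable_times) auto
  show "AE x in M. norm (u x * \<phi> x) \<le> norm (B * u x)"
  proof (rule AE_I2)
    fix x
    have "\<bar>u x\<bar> * \<bar>\<phi> x\<bar> \<le> \<bar>u x\<bar> * \<bar>B\<bar>" using assms(3)[of x] by (intro mult_left_mono) auto
    then show "norm (u x * \<phi> x) \<le> norm (B * u x)" by (simp add: abs_mult mult.commute)
  qed
qed

text \<open>The fundamental theorem of calculus in direction b for weak derivatives. Both sides have
  the same integral against every test function vanishing off the box: on the left translation
  invariance moves the shift to the test function, on the right \<open>line_avg_test\<close>
  applies.\<close>

proposition steklov_cbox:
  fixes u g :: "'a::euclidean_space \<Rightarrow> real"
  assumes u: "integrable lborel u" and g: "integrable lborel g" and b: "b \<in> Basis"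
    and CS: "\<And>x r. x \<in> cbox p q \<Longrightarrow> 0 \<le> r \<Longrightarrow> r \<le> 1 \<Longrightarrow> x + (r * h) *\<^sub>R b \<in> S"
    and weak: "\<And>\<phi>. \<phi> \<in> test_functions UNIV \<Longrightarrow> (\<And>x. x \<notin> S \<Longrightarrow> \<phi> x = 0) \<Longrightarrow>
      (LINT x|lborel. u x * pd b \<phi> x) = - (LINT x|lborel. g x * \<phi> x)"
  shows "AE x in lebesgue. x \<in> cbox p q \<longrightarrow> u (x + h *\<^sub>R b) - u x = h * line_avg b h g x"
proof -
  let ?f = "\<lambda>x. u (x + h *\<^sub>R b) - u x - h * line_avg b h g x"
  have [measurable]: "u \<in> borel_measurable borel" "g \<in> borel_measurable borel"
    using u g by (auto dest: borel_measurable_integrable)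
  have ia: "integrable lborel (line_avg b h g)" by (rule integrable_line_avg[OF g])
  then have [measurable]: "line_avg b h g \<in> borel_measurable borel" by (auto dest: borel_measurable_integrable)
  have sh: "integrable lborel (\<lambda>x. u (x + h *\<^sub>R b))"
    using lborel_shift(1)[of u "h *\<^sub>R b"] u by (simp add: add.commute)
  have fi: "integrable lborel ?f" using sh u ia by auto
  have "AE x in lebesgue. x \<in> cbox p q \<longrightarrow> ?f x = 0"
  proof (rule fundamental_lemma_cbox[where D = UNIV])
    have "integrable lebesgue ?f" using fi by (subst integrable_completion) auto
    then show "set_integrable lebesgue (cbox p q) ?f"
      unfolding set_integrable_def by (intro integrable_mult_indicator) auto
    fix \<phi> :: "'a \<Rightarrow> real" assume \<phi>: "\<phi> \<in> test_functions UNIV" and \<phi>C: "\<And>x. x \<notin> cbox p q \<Longrightarrow> \<phi> x = 0"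
    have sm: "smooth_fun \<phi>" using \<phi> by (auto simp: test_functions_def)
    have [measurable]: "\<phi> \<in> borel_measurable borel"
      using smooth_fun_continuous[OF sm] by (auto intro!: borel_measurable_continuous_onI)
    obtain M where M: "\<And>x. \<bar>\<phi> x\<bar> \<le> M" using test_function_bounded[OF \<phi> b] by blast
    have I: "integrable lborel (\<lambda>x. u (x + h *\<^sub>R b) * \<phi> x)" "integrable lborel (\<lambda>x. u x * \<phi> x)"
      "integrable lborel (\<lambda>x. line_avg b h g x * \<phi> x)" "integrable lborel (\<lambda>x. u x * \<phi> (x - h *\<^sub>R b))"
    proof -
      have ib: "integrable lborel (\<lambda>x. f x * k x)"
        if "integrable lborel f" "k \<in> borel_measurable lborel" "\<And>x. \<bar>k x\<bar> \<le> M" for f k :: "'a \<Rightarrow> real"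
        by (rule integrable_mult_bounded[OF that])
      have mm: "\<phi> \<in> borel_measurable lborel" "(\<lambda>x. \<phi> (x - h *\<^sub>R b)) \<in> borel_measurable lborel"
        by measurable
      show "integrable lborel (\<lambda>x. u (x + h *\<^sub>R b) * \<phi> x)" by (rule ib[OF sh mm(1) M])
      show "integrable lborel (\<lambda>x. u x * \<phi> x)" by (rule ib[OF u mm(1) M])
      show "integrable lborel (\<lambda>x. line_avg b h g x * \<phi> x)" by (rule ib[OF ia mm(1) M])
      show "integrable lborel (\<lambda>x. u x * \<phi> (x - h *\<^sub>R b))" by (rule ib[OF u mm(2)]) (rule M)
    qed
    have s: "(LINT x|lborel. u (x + h *\<^sub>R b) * \<phi> x) = (LINT x|lborel. u x * \<phi> (x - h *\<^sub>R b))"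
      using lborel_shift(2)[of "\<lambda>x. u x * \<phi> (x - h *\<^sub>R b)" "h *\<^sub>R b"] by (simp add: add.commute)
    have "(LINT x|lebesgue. ?f x * \<phi> x) = (LINT x|lborel. ?f x * \<phi> x)"
      by (rule integral_completion) measurable
    also have "\<dots> = (LINT x|lborel. u (x + h *\<^sub>R b) * \<phi> x - u x * \<phi> x - h * (line_avg b h g x * \<phi> x))"
      by (simp add: algebra_simps)
    also have "\<dots> = (LINT x|lborel. u (x + h *\<^sub>R b) * \<phi> x) - (LINT x|lborel. u x * \<phi> x)
        - h * (LINT x|lborel. line_avg b h g x * \<phi> x)"
      using I by simp
    also have "h * (LINT x|lborel. line_avg b h g x * \<phi> x)
        = - (LINT x|lborel. u x * (\<phi> x - \<phi> (x - h *\<^sub>R b)))"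
      by (rule line_avg_test[OF u g b CS weak \<phi> \<phi>C])
    also have "(LINT x|lborel. u x * (\<phi> x - \<phi> (x - h *\<^sub>R b)))
        = (LINT x|lborel. u x * \<phi> x) - (LINT x|lborel. u x * \<phi> (x - h *\<^sub>R b))"
      using I by (simp add: right_diff_distrib)
    finally show "(LINT x|lebesgue. ?f x * \<phi> x) = 0" using s by simp
  qed simp
  then show ?thesis by eventually_elim auto
qed

text \<open>By Fubini the distance is at most the mean over r in [0, 1] of the L1 distances between
  g and its translates by r h n b. Each of them tends to 0 by continuity of translation, and twice
  the L1 norm of g dominates.\<close>

lemma line_avg_tendsto_L1:
  fixes g :: "'a::euclidean_space \<Rightarrow> real"
  assumes g: "integrable lborel g" and h: "h \<longlonglongrightarrow> 0"
  shows "(\<lambda>n. LINT x|lborel. \<bar>line_avg b (h n) g x - g x\<bar>) \<longlonglongrightarrow> 0"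
proof -
  have [measurable]: "g \<in> borel_measurable borel" using g by (auto dest: borel_measurable_integrable)
  let ?k = "\<lambda>n (r::real, x). indicator {0..1} r * \<bar>g (x + (r * h n) *\<^sub>R b) - g x\<bar>"
  let ?N = "LINT x|lborel. \<bar>g x\<bar>"
  have sh: "integrable lborel (\<lambda>x. g (x + c))" for c
    using lborel_shift(1)[of g c] g by (simp add: add.commute)
  have shn: "(LINT x|lborel. \<bar>g (x + c)\<bar>) = ?N" for c
    using lborel_shift(2)[of "\<lambda>x. \<bar>g x\<bar>" c] by (simp add: add.commute)
  have ki: "integrable (lborel \<Otimes>\<^sub>M lborel) (?k n)" for n
  proof (rule Bochner_Integration.integrable_bound)
    show "integrable (lborel \<Otimes>\<^sub>M lborel) (\<lambda>z. \<bar>seg b (h n) g z\<bar>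
      + \<bar>seg b 0 g z\<bar>)"
      by (intro Bochner_Integration.integrable_add integrable_abs integrable_pair_shift[OF g])
    show "?k n \<in> borel_measurable (lborel \<Otimes>\<^sub>M lborel)" by measurable
    show "AE z in lborel \<Otimes>\<^sub>M lborel. norm (?k n z)
      \<le> norm (\<bar>seg b (h n) g z\<bar>
        + \<bar>seg b 0 g z\<bar>)"
    proof (rule AE_I2)
      fix z :: "real \<times> 'a"
      obtain r x where z: "z = (r, x)" by (cases z)
      show "norm (?k n z) \<le> norm (\<bar>seg b (h n) g z\<bar>
        + \<bar>seg b 0 g z\<bar>)"
        using abs_triangle_ineq4[of "g (x + (r * h n) *\<^sub>R b)" "g x"] by (auto simp: z indicator_def)
    qed
  qed
  have ai: "integrable lborel (\<lambda>x. line_avg b (h n) g x - g x)" for n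
    using integrable_line_avg[OF g] g by auto
  have le: "(LINT x|lborel. \<bar>line_avg b (h n) g x - g x\<bar>)
      \<le> (LINT r|lborel. indicator {0..1} r * (LINT x|lborel. \<bar>g (x + (r * h n) *\<^sub>R b) - g x\<bar>))" for n
  proof -
    have "(LINT x|lborel. \<bar>line_avg b (h n) g x - g x\<bar>) \<le> (LINT x|lborel. (LINT r|lborel. ?k n (r, x)))"
    proof (rule integral_mono_AE)
      show "integrable lborel (\<lambda>x. LINT r|lborel. ?k n (r, x))"
        using lborel_pair.integrable_snd[of "\<lambda>r x. ?k n (r, x)"] ki[of n] by simp
      show "integrable lborel (\<lambda>x. \<bar>line_avg b (h n) g x - g x\<bar>)" using ai by auto
      have "AE x in lborel. integrable lborel (\<lambda>r. indicator {0..1} r * g (x + (r * h n) *\<^sub>R b))"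
        using lborel_pair.AE_integrable_snd[OF integrable_pair_shift[OF g, of "h n" b]] .
      then show "AE x in lborel. \<bar>line_avg b (h n) g x - g x\<bar> \<le> (LINT r|lborel. ?k n (r, x))"
      proof eventually_elim
        case (elim x)
        have c: "integrable lborel (\<lambda>r. indicator {0..1::real} r * g x)" by simp
        have "(LINT r|lborel. indicator {0..1::real} r * g x) = g x" by simp
        then have "line_avg b (h n) g x - g x
            = (LINT r|lborel. indicator {0..1} r * g (x + (r * h n) *\<^sub>R b) - indicator {0..1} r * g x)"
          unfolding line_avg_def by (subst Bochner_Integration.integral_diff[OF elim c]) simp
        also have "\<bar>\<dots>\<bar> \<le> (LINT r|lborel. \<bar>indicator {0..1} r * g (x + (r * h n) *\<^sub>R b) - indicator {0..1} r * g x\<bar>)"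
          by (rule integral_abs_bound)
        also have "\<dots> = (LINT r|lborel. ?k n (r, x))"
          by (rule Bochner_Integration.integral_cong) (auto simp: indicator_def)
        finally show ?case .
      qed
    qed
    also have "\<dots> = (LINT r|lborel. (LINT x|lborel. ?k n (r, x)))"
      using lborel_pair.integral_snd[of "\<lambda>r x. ?k n (r, x)"] lborel_pair.integral_fst[of "\<lambda>r x. ?k n (r, x)"] ki[of n]
      by simp
    finally show ?thesis by simp
  qed
  have "(\<lambda>n. LINT r|lborel. indicator {0..1} r * (LINT x|lborel. \<bar>g (x + (r * h n) *\<^sub>R b) - g x\<bar>)) \<longlonglongrightarrow> (LINT r::real|lborel. 0)"
  proof (rule integral_dominated_convergence[where w = "\<lambda>r. indicator {0..1} r * (2 * ?N)"])
    show "AE r in lborel. (\<lambda>n. indicator {0..1} r * (LINT x|lborel. \<bar>g (x + (r * h n) *\<^sub>R b) - g x\<bar>)) \<longlonglongrightarrow> 0"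
    proof (rule AE_I2)
      fix r :: real
      have "(\<lambda>n. (r * h n) *\<^sub>R b) \<longlonglongrightarrow> (r * 0) *\<^sub>R b" by (intro tendsto_intros h)
      then have "(\<lambda>n. L1_dist (\<lambda>x. g ((r * h n) *\<^sub>R b + x)) g) \<longlonglongrightarrow> 0"
        by (intro L1_continuous_translation[OF g]) simp
      then have "(\<lambda>n. indicator {0..1} r * (LINT x|lborel. \<bar>g (x + (r * h n) *\<^sub>R b) - g x\<bar>)) \<longlonglongrightarrow> indicator {0..1} r * 0"
        by (intro tendsto_mult tendsto_const) (simp add: L1_dist_def add.commute)
      then show "(\<lambda>n. indicator {0..1} r * (LINT x|lborel. \<bar>g (x + (r * h n) *\<^sub>R b) - g x\<bar>)) \<longlonglongrightarrow> 0" by simp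
    qed
    show "AE r in lborel. norm (indicator {0..1} r * (LINT x|lborel. \<bar>g (x + (r * h n) *\<^sub>R b) - g x\<bar>)) \<le> indicator {0..1} r * (2 * ?N)" for n
    proof (rule AE_I2)
      fix r :: real
      have "(LINT x|lborel. \<bar>g (x + (r * h n) *\<^sub>R b) - g x\<bar>) \<le> (LINT x|lborel. \<bar>g (x + (r * h n) *\<^sub>R b)\<bar> + \<bar>g x\<bar>)"
        using sh g by (intro integral_mono) auto
      also have "\<dots> = 2 * ?N" using sh g by (simp add: shn)
      finally have "(LINT x|lborel. \<bar>g (x + (r * h n) *\<^sub>R b) - g x\<bar>) \<le> 2 * ?N" .
      moreover have "0 \<le> (LINT x|lborel. \<bar>g (x + (r * h n) *\<^sub>R b) - g x\<bar>)" by (rule integral_nonneg_AE) simp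
      ultimately show "norm (indicator {0..1} r * (LINT x|lborel. \<bar>g (x + (r * h n) *\<^sub>R b) - g x\<bar>)) \<le> indicator {0..1} r * (2 * ?N)"
        by (auto simp: indicator_def)
    qed
    show "(\<lambda>r. indicator {0..1} r * (LINT x|lborel. \<bar>g (x + (r * h n) *\<^sub>R b) - g x\<bar>)) \<in> borel_measurable lborel" for n
      using lborel_pair.integrable_fst[of "\<lambda>r x. ?k n (r, x)"] ki[of n] by (simp add: borel_measurable_integrable)
  qed auto
  then have 0: "(\<lambda>n. LINT r|lborel. indicator {0..1} r * (LINT x|lborel. \<bar>g (x + (r * h n) *\<^sub>R b) - g x\<bar>)) \<longlonglongrightarrow> 0"
    by simp
  show ?thesis
    by (rule tendsto_sandwich[OF _ _ tendsto_const 0]) (auto intro!: always_eventually le integral_nonneg_AE)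
qed

subsection \<open>The chain rule\<close>

lemma loc_integrable_bound:
  assumes D: "open D" and u: "loc_integrable D u" and v: "v \<in> borel_measurable (lebesgue_on D)"
    and le: "\<And>x. \<bar>v x\<bar> \<le> c + L * \<bar>u x\<bar>"
  shows "loc_integrable D v"
  unfolding loc_integrable_def
proof (intro allI impI)
  fix K assume K: "compact K \<and> K \<subseteq> D"
  have Ks: "K \<in> sets lebesgue" using K lmeasurable_compact by blast
  have i: "integrable lebesgue (\<lambda>x. indicator K x *\<^sub>R u x)"
    using u K by (auto simp: loc_integrable_def set_integrable_def)
  have i1: "integrable lebesgue (indicator K :: _ \<Rightarrow> real)"
    using lmeasurable_compact[of K] K by (intro integrable_real_indicator) (auto simp: fmeasurable_def)
  have "(\<lambda>x. indicator K x * (indicator D x * v x)) \<in> borel_measurable lebesgue"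
    using v D by (intro borel_measurable_times[OF borel_measurable_indicator[OF Ks]])
      (simp add: borel_measurable_lebesgue_on_iff open_sets_lebesgue)
  moreover have "(\<lambda>x. indicator K x * (indicator D x * v x)) = (\<lambda>x. indicator K x *\<^sub>R v x)"
    using K by (auto simp: indicator_def fun_eq_iff)
  ultimately have m: "(\<lambda>x. indicator K x *\<^sub>R v x) \<in> borel_measurable lebesgue" by simp
  show "set_integrable lebesgue K v"
    unfolding set_integrable_def
  proof (rule Bochner_Integration.integrable_bound)
    show "integrable lebesgue (\<lambda>x. c * indicator K x + L * \<bar>indicator K x *\<^sub>R u x\<bar>)"
      using i i1 by auto
    show "AE x in lebesgue. norm (indicator K x *\<^sub>R v x) \<le> norm (c * indicator K x + L * \<bar>indicator K x *\<^sub>R u x\<bar>)"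
      using le by (intro AE_I2) (auto simp: indicator_def intro: order_trans[OF _ abs_ge_self])
  qed (rule m)
qed

lemma set_integrable_borel_rep:
  fixes u :: "'a::euclidean_space \<Rightarrow> real"
  assumes "set_integrable lebesgue S u"
  obtains u1 where "integrable lborel u1" "AE x in lebesgue. x \<in> S \<longrightarrow> u1 x = u x"
proof -
  have i: "integrable lebesgue (\<lambda>x. indicator S x * u x)" using assms by (simp add: set_integrable_def)
  obtain u1 where u1: "u1 \<in> borel_measurable lborel" "AE x in lborel. indicator S x * u x = u1 x"
    using completion_ex_borel_measurable_real[OF borel_measurable_integrable[OF i]] by auto
  have ae: "AE x in lebesgue. indicator S x * u x = u1 x" using u1(2) by (rule AE_completion)
  have "integrable lebesgue u1"
    using integrable_cong_AE[THEN iffD1, OF _ _ ae i] u1(1) borel_measurable_integrable[OF i]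
    by (simp add: measurable_completion)
  then have "integrable lborel u1" using u1(1) by (simp add: integrable_completion)
  moreover have "AE x in lebesgue. x \<in> S \<longrightarrow> u1 x = u x"
    using ae by eventually_elim (auto simp: indicator_def)
  ultimately show thesis by (rule that)
qed

lemma integral_lborel_rep:
  fixes u u1 \<psi> :: "'a::euclidean_space \<Rightarrow> real"
  assumes ae: "AE x in lebesgue. x \<in> S \<longrightarrow> u1 x = u x" and z: "\<And>x. x \<notin> S \<Longrightarrow> \<psi> x = 0"
    and u1: "u1 \<in> borel_measurable borel" and \<psi>: "\<psi> \<in> borel_measurable borel"
  shows "(LINT x|lebesgue. u x * \<psi> x) = (LINT x|lborel. u1 x * \<psi> x)"
proof -
  have m: "(\<lambda>x. u1 x * \<psi> x) \<in> borel_measurable lborel" using u1 \<psi> by simp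
  have m': "(\<lambda>x. u1 x * \<psi> x) \<in> borel_measurable lebesgue" using m by (rule measurable_completion)
  have e: "AE x in lebesgue. u1 x * \<psi> x = u x * \<psi> x"
    using ae
  proof eventually_elim
    case (elim x)
    then show ?case using z[of x] by (cases "x \<in> S") auto
  qed
  have "(LINT x|lebesgue. u x * \<psi> x) = (LINT x|lebesgue. u1 x * \<psi> x)"
    by (rule integral_cong_AE[OF m' borel_measurable_AE[OF m' e] e, symmetric])
  also have "\<dots> = (LINT x|lborel. u1 x * \<psi> x)" by (rule integral_completion[OF m])
  finally show ?thesis .
qed

lemma Lipschitz_of_deriv:
  fixes G :: "real \<Rightarrow> real"
  assumes "\<And>y. (G has_real_derivative G' y) (at y)" "\<And>y. \<bar>G' y\<bar> \<le> L"
  shows "\<bar>G x - G y\<bar> \<le> L * \<bar>x - y\<bar>"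
  using field_differentiable_bound[of UNIV G G' L x y] assms by simp

lemma quotient_tendsto:
  fixes G :: "real \<Rightarrow> real"
  assumes G: "\<And>y. (G has_real_derivative G' y) (at y)" and h: "h \<longlonglongrightarrow> 0" "\<And>n. h n > 0"
  shows "(\<lambda>n. (G (u + h n * g) - G u) / h n) \<longlonglongrightarrow> G' u * g"
proof -
  have "((\<lambda>s. G (u + s * g)) has_real_derivative G' u * g) (at 0)"
  proof -
    have "((\<lambda>s. u + s * g) has_real_derivative g) (at 0)" by (auto intro!: derivative_eq_intros)
    then show ?thesis using DERIV_chain2[of G "G' u" "\<lambda>s. u + s * g" 0 g] G[of u] by simp
  qed
  then have "((\<lambda>s. (G (u + s * g) - G u) / s) \<longlongrightarrow> G' u * g) (at 0)"
    by (simp add: DERIV_def)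
  then show ?thesis
    by (rule filterlim_compose) (use h in \<open>auto simp: filterlim_at less_imp_neq[symmetric] intro!: always_eventually\<close>)
qed

text \<open>The Steklov formula replaces u (x + h b) by u + h A, where A is the average of g. The
  resulting quotient R differs from the quotient Q formed with g by at most L |A - g|, which
  vanishes in L1, while Q tends to H = G'(u) g by dominated convergence. The averages are known to
  converge only in L1, hence the detour through Q.\<close>

lemma chain_rule_limit_right:
  fixes u g \<phi> :: "'a::euclidean_space \<Rightarrow> real" and G G' :: "real \<Rightarrow> real"
  assumes u: "integrable lborel u" and g: "integrable lborel g"
    and G: "\<And>y. (G has_real_derivative G' y) (at y)" "continuous_on UNIV G'" "\<And>y. \<bar>G' y\<bar> \<le> L"
    and h: "h \<longlonglongrightarrow> 0" "\<And>n. h n > 0"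
    and \<phi>: "\<phi> \<in> borel_measurable borel" "\<And>x. \<bar>\<phi> x\<bar> \<le> M" "\<And>x. x \<notin> S \<Longrightarrow> \<phi> x = 0"
    and s: "\<And>n. AE x in lborel. x \<in> S \<longrightarrow> u (x + h n *\<^sub>R b) - u x = h n * line_avg b (h n) g x"
  shows "(\<lambda>n. LINT x|lborel. \<phi> x * ((G (u (x + h n *\<^sub>R b)) - G (u x)) / h n)) \<longlonglongrightarrow>
     (LINT x|lborel. \<phi> x * (G' (u x) * g x))"
proof -
  have L: "0 \<le> L" using G(3)[of 0] by linarith
  have M: "0 \<le> M" using \<phi>(2)[of 0] by linarith
  have lip: "\<bar>G x - G y\<bar> \<le> L * \<bar>x - y\<bar>" for x y by (rule Lipschitz_of_deriv[OF G(1,3)])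
  have Gc: "continuous_on UNIV G" using DERIV_continuous_on[OF G(1)] by auto
  have mm [measurable]: "u \<in> borel_measurable borel" "g \<in> borel_measurable borel" "\<phi> \<in> borel_measurable borel"
    "G \<in> borel_measurable borel" "G' \<in> borel_measurable borel" "line_avg b (h n) g \<in> borel_measurable borel" for n
    using u g \<phi>(1) borel_measurable_continuous_onI[OF Gc] borel_measurable_continuous_onI[OF G(2)]
      integrable_line_avg[OF g, of b "h n"] by (auto dest: borel_measurable_integrable)
  define A where "A n = line_avg b (h n) g" for n
  define R where "R n x = (G (u x + h n * A n x) - G (u x)) / h n" for n x
  define Q where "Q n x = (G (u x + h n * g x) - G (u x)) / h n" for n x
  define H where "H x = G' (u x) * g x" for x
  have mA [measurable]: "A n \<in> borel_measurable borel" for n unfolding A_def by (rule mm)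
  have mR [measurable]: "R n \<in> borel_measurable borel" "Q n \<in> borel_measurable borel" "H \<in> borel_measurable borel" for n
    unfolding R_def Q_def H_def by measurable
  have Hb: "\<bar>H x\<bar> \<le> L * \<bar>g x\<bar>" for x
    unfolding H_def using G(3)[of "u x"] by (auto simp: abs_mult intro: mult_right_mono)
  have qb: "\<bar>(G (a + h n * c) - G (a + h n * d)) / h n\<bar> \<le> L * \<bar>c - d\<bar>" for n a c d
  proof -
    have "\<bar>G (a + h n * c) - G (a + h n * d)\<bar> \<le> L * (h n * \<bar>c - d\<bar>)"
      using lip[of "a + h n * c" "a + h n * d"] h(2)[of n] by (simp flip: right_diff_distrib add: abs_mult)
    then show ?thesis using h(2)[of n] by (simp add: abs_divide pos_divide_le_eq mult_ac)
  qed
  have Rb: "\<bar>R n x\<bar> \<le> L * \<bar>A n x\<bar>" and Qb: "\<bar>Q n x\<bar> \<le> L * \<bar>g x\<bar>"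
    and RQ: "\<bar>R n x - Q n x\<bar> \<le> L * \<bar>A n x - g x\<bar>" for n x
    using qb[of "u x" n "A n x" 0] qb[of "u x" n "g x" 0] qb[of "u x" n "A n x" "g x"]
    by (simp_all add: R_def Q_def diff_divide_distrib)
  have iA: "integrable lborel (A n)" for n unfolding A_def by (rule integrable_line_avg[OF g])
  have ib: "integrable lborel f" if "f \<in> borel_measurable borel" "integrable lborel k" "\<And>x. \<bar>f x\<bar> \<le> L * \<bar>k x\<bar>" for f k :: "'a \<Rightarrow> real"
  proof (rule Bochner_Integration.integrable_bound)
    show "integrable lborel (\<lambda>x. L * k x)" using that(2) by simp
    show "AE x in lborel. norm (f x) \<le> norm (L * k x)"
      using that(3) L by (intro AE_I2) (simp add: abs_mult)
  qed (use that(1) in simp)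
  have iR: "integrable lborel (R n)" for n by (rule ib[OF mR(1) iA Rb])
  have iQ: "integrable lborel (Q n)" for n by (rule ib[OF mR(2) g Qb])
  have iH: "integrable lborel H" by (rule ib[OF mR(3) g Hb])
  have m\<phi>: "integrable lborel (\<lambda>x. \<phi> x * f x)" if "integrable lborel f" for f
  proof -
    have "integrable lborel (\<lambda>x. f x * \<phi> x)"
      by (rule integrable_mult_bounded[OF that _ \<phi>(2)]) (use \<phi>(1) in simp)
    then show ?thesis by (simp add: mult.commute)
  qed
  have "(\<lambda>n. LINT x|lborel. \<bar>Q n x - H x\<bar>) \<longlonglongrightarrow> (LINT x::'a|lborel. 0)"
  proof (rule integral_dominated_convergence[where w = "\<lambda>x. 2 * (L * \<bar>g x\<bar>)"])
    show "AE x in lborel. (\<lambda>n. \<bar>Q n x - H x\<bar>) \<longlonglongrightarrow> 0"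
      unfolding Q_def H_def
      by (intro AE_I2 tendsto_rabs_zero) (simp add: LIM_zero_iff quotient_tendsto[OF G(1) h])
    show "AE x in lborel. norm \<bar>Q n x - H x\<bar> \<le> 2 * (L * \<bar>g x\<bar>)" for n
    proof (rule AE_I2)
      fix x
      show "norm \<bar>Q n x - H x\<bar> \<le> 2 * (L * \<bar>g x\<bar>)" using Qb[of n x] Hb[of x] unfolding real_norm_def by linarith
    qed
    show "integrable lborel (\<lambda>x. 2 * (L * \<bar>g x\<bar>))" using g by simp
  qed measurable
  then have q0: "(\<lambda>n. LINT x|lborel. \<bar>Q n x - H x\<bar>) \<longlonglongrightarrow> 0" by simp
  have a0: "(\<lambda>n. LINT x|lborel. \<bar>A n x - g x\<bar>) \<longlonglongrightarrow> 0"
    unfolding A_def by (rule line_avg_tendsto_L1[OF g h(1)])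
  have "(\<lambda>n. M * (L * (LINT x|lborel. \<bar>A n x - g x\<bar>) + (LINT x|lborel. \<bar>Q n x - H x\<bar>))) \<longlonglongrightarrow> M * (L * 0 + 0)"
    by (intro tendsto_intros q0 a0)
  then have 0: "(\<lambda>n. M * (L * (LINT x|lborel. \<bar>A n x - g x\<bar>) + (LINT x|lborel. \<bar>Q n x - H x\<bar>))) \<longlonglongrightarrow> 0"
    by simp
  have ptw: "\<bar>\<phi> x * R n x - \<phi> x * H x\<bar> \<le> M * (L * \<bar>A n x - g x\<bar> + \<bar>Q n x - H x\<bar>)" for n x
  proof -
    have "\<bar>R n x - H x\<bar> \<le> L * \<bar>A n x - g x\<bar> + \<bar>Q n x - H x\<bar>" using RQ[of n x] by linarith
    then have "\<bar>\<phi> x\<bar> * \<bar>R n x - H x\<bar> \<le> M * (L * \<bar>A n x - g x\<bar> + \<bar>Q n x - H x\<bar>)"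
      using \<phi>(2)[of x] M by (intro mult_mono) auto
    then show ?thesis by (simp flip: abs_mult right_diff_distrib)
  qed
  have le: "\<bar>(LINT x|lborel. \<phi> x * R n x) - (LINT x|lborel. \<phi> x * H x)\<bar>
    \<le> M * (L * (LINT x|lborel. \<bar>A n x - g x\<bar>) + (LINT x|lborel. \<bar>Q n x - H x\<bar>))" for n
  proof -
    have I1: "integrable lborel (\<lambda>x. \<phi> x * R n x)" and I2: "integrable lborel (\<lambda>x. \<phi> x * H x)"
      using m\<phi>[OF iR] m\<phi>[OF iH] by auto
    have I3: "integrable lborel (\<lambda>x. L * \<bar>A n x - g x\<bar>)" and I4: "integrable lborel (\<lambda>x. \<bar>Q n x - H x\<bar>)"
      using iA[of n] g iQ[of n] iH by auto
    have "(LINT x|lborel. \<phi> x * R n x) - (LINT x|lborel. \<phi> x * H x)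
      = (LINT x|lborel. \<phi> x * R n x - \<phi> x * H x)"
      using I1 I2 by simp
    also have "\<bar>\<dots>\<bar> \<le> (LINT x|lborel. \<bar>\<phi> x * R n x - \<phi> x * H x\<bar>)"
      by (rule integral_abs_bound)
    also have "\<dots> \<le> (LINT x|lborel. M * (L * \<bar>A n x - g x\<bar> + \<bar>Q n x - H x\<bar>))"
      by (rule integral_mono[OF _ _ ptw]) (use I1 I2 I3 I4 in auto)
    also have "\<dots> = M * (L * (LINT x|lborel. \<bar>A n x - g x\<bar>) + (LINT x|lborel. \<bar>Q n x - H x\<bar>))"
      using I3 I4 by simp
    finally show ?thesis .
  qed
  have "(\<lambda>n. (LINT x|lborel. \<phi> x * R n x) - (LINT x|lborel. \<phi> x * H x)) \<longlonglongrightarrow> 0"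
    by (rule Lim_null_comparison[OF _ 0]) (use le in auto)
  then have "(\<lambda>n. LINT x|lborel. \<phi> x * R n x) \<longlonglongrightarrow> (LINT x|lborel. \<phi> x * H x)"
    by (simp add: LIM_zero_iff)
  moreover have "(LINT x|lborel. \<phi> x * ((G (u (x + h n *\<^sub>R b)) - G (u x)) / h n)) = (LINT x|lborel. \<phi> x * R n x)" for n
  proof (rule integral_cong_AE)
    show "AE x in lborel. \<phi> x * ((G (u (x + h n *\<^sub>R b)) - G (u x)) / h n) = \<phi> x * R n x"
      using s[of n]
    proof eventually_elim
      case (elim x)
      show ?case
      proof (cases "x \<in> S")
        case True
        with elim have "u (x + h n *\<^sub>R b) = u x + h n * A n x" by (simp add: A_def)
        then show ?thesis by (simp add: R_def)
      qed (simp add: \<phi>(3))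
    qed
  qed measurable
  ultimately show ?thesis by (simp add: H_def)
qed

lemma difference_quotient_test_tendsto:
  fixes w \<phi> :: "'a::euclidean_space \<Rightarrow> real"
  assumes w: "integrable lborel w" and \<phi>: "\<phi> \<in> test_functions D" and b: "b \<in> Basis"
    and h: "h \<longlonglongrightarrow> 0" "\<And>n. h n > 0"
  shows "(\<lambda>n. LINT x|lborel. w x * ((\<phi> x - \<phi> (x - h n *\<^sub>R b)) / h n)) \<longlonglongrightarrow>
    (LINT x|lborel. w x * pd b \<phi> x)"
proof -
  have sm: "smooth_fun \<phi>" using \<phi> by (auto simp: test_functions_def)
  obtain M where M: "\<And>x. \<bar>\<phi> x\<bar> \<le> M" "\<And>x. \<bar>pd b \<phi> x\<bar> \<le> M" "0 \<le> M"
    using test_function_bounded[OF \<phi> b] by blast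
  let ?d = "\<lambda>x. pd b \<phi> x"
  have [measurable]: "w \<in> borel_measurable borel" using w by (auto dest: borel_measurable_integrable)
  have [measurable]: "\<phi> \<in> borel_measurable borel" "?d \<in> borel_measurable borel"
    using smooth_fun_continuous[OF sm] smooth_fun_continuous_deriv[OF sm b]
    by (auto intro!: borel_measurable_continuous_onI)
  show ?thesis
  proof (rule integral_dominated_convergence[where w = "\<lambda>x. \<bar>w x\<bar> * M"])
    show "AE x in lborel. (\<lambda>n. w x * ((\<phi> x - \<phi> (x - h n *\<^sub>R b)) / h n)) \<longlonglongrightarrow> w x * ?d x"
    proof (rule AE_I2, rule tendsto_mult[OF tendsto_const])
      fix x
      have lin: "linear (frechet_derivative \<phi> (at x))"
        using smooth_fun_frechet(1)[OF sm] by (rule has_derivative_linear)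
      have "((\<lambda>s. x - s *\<^sub>R b) has_derivative (\<lambda>s. - (s *\<^sub>R b))) (at 0)"
        by (auto intro!: derivative_eq_intros)
      from has_derivative_compose[OF this, of \<phi> "frechet_derivative \<phi> (at x)"] smooth_fun_frechet(1)[OF sm, of x]
      have "((\<lambda>s. \<phi> (x - s *\<^sub>R b)) has_derivative (\<lambda>s. pd (- (s *\<^sub>R b)) \<phi> x)) (at 0)"
        by simp
      also have "(\<lambda>s. pd (- (s *\<^sub>R b)) \<phi> x) = (\<lambda>s. s * (- ?d x))"
        by (simp add: linear_neg[OF lin] linear_cmul[OF lin])
      finally have "((\<lambda>s. \<phi> (x - s *\<^sub>R b)) has_real_derivative (- ?d x)) (at 0)"
        by (simp only: has_field_derivative_def mult_commute_abs)
      then have "((\<lambda>s. (\<phi> (x - s *\<^sub>R b) - \<phi> x) / s) \<longlongrightarrow> - ?d x) (at 0)"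
        by (simp add: DERIV_def)
      then have "(\<lambda>n. (\<phi> (x - h n *\<^sub>R b) - \<phi> x) / h n) \<longlonglongrightarrow> - ?d x"
        by (rule filterlim_compose) (use h in \<open>auto simp: filterlim_at less_imp_neq[symmetric] intro!: always_eventually\<close>)
      from tendsto_minus[OF this]
      show "(\<lambda>n. (\<phi> x - \<phi> (x - h n *\<^sub>R b)) / h n) \<longlonglongrightarrow> ?d x"
        by (simp add: minus_divide_left)
    qed
    show "AE x in lborel. norm (w x * ((\<phi> x - \<phi> (x - h n *\<^sub>R b)) / h n)) \<le> \<bar>w x\<bar> * M" for n
    proof (rule AE_I2)
      fix x
      \<comment> \<open>The mean value bound, read off from the integral of the derivative along the
        segment, provides the majorant.\<close>
      have "\<bar>\<phi> x - \<phi> (x - h n *\<^sub>R b)\<bar> \<le> (LINT r|lborel. \<bar>indicator {0..1} r * (h n * ?d (x - (r * h n) *\<^sub>R b))\<bar>)"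
        unfolding integral_along[OF sm b, symmetric] by (rule integral_abs_bound)
      also have "\<dots> \<le> (LINT r|lborel. indicator {0..1::real} r * (h n * M))"
      proof (rule integral_mono_AE')
        show "integrable lborel (\<lambda>r. indicator {0..1::real} r * (h n * M))" by simp
        show "AE r in lborel. \<bar>indicator {0..1} r * (h n * ?d (x - (r * h n) *\<^sub>R b))\<bar> \<le> indicator {0..1::real} r * (h n * M)"
          using M(2) h(2)[of n] by (intro AE_I2) (auto simp: indicator_def abs_mult)
      qed (use M(3) h(2)[of n] in auto)
      also have "\<dots> = h n * M" by simp
      finally have "\<bar>(\<phi> x - \<phi> (x - h n *\<^sub>R b)) / h n\<bar> \<le> M"
        using h(2)[of n] by (simp add: abs_divide pos_divide_le_eq mult.commute)
      then show "norm (w x * ((\<phi> x - \<phi> (x - h n *\<^sub>R b)) / h n)) \<le> \<bar>w x\<bar> * M"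
        unfolding real_norm_def abs_mult by (rule mult_left_mono) simp
    qed
    show "integrable lborel (\<lambda>x. \<bar>w x\<bar> * M)" using w by simp
  qed measurable
qed

text \<open>Test functions vanishing off the compact set S see u and g only there. So integrable
  Borel representatives on S can replace them, and the Steklov formula for functions integrable on
  the whole space applies.\<close>

lemma has_weak_partial_steklov:
  assumes w: "has_weak_partial D b u g" and b: "b \<in> Basis"
    and S: "compact S" "S \<subseteq> D" and O: "open O'"
    and OS: "\<And>x r. x \<in> O' \<Longrightarrow> 0 \<le> r \<Longrightarrow> r \<le> 1 \<Longrightarrow> x + (r * h) *\<^sub>R b \<in> S"
    and u1: "integrable lborel u1" "AE x in lebesgue. x \<in> S \<longrightarrow> u1 x = u x"
    and g1: "integrable lborel g1" "AE x in lebesgue. x \<in> S \<longrightarrow> g1 x = g x"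
  shows "AE x in lborel. x \<in> O' \<longrightarrow> u1 (x + h *\<^sub>R b) - u1 x = h * line_avg b h g1 x"
proof -
  have [measurable]: "u1 \<in> borel_measurable borel" "g1 \<in> borel_measurable borel"
    using u1 g1 by (auto dest: borel_measurable_integrable)
  have "AE x in lebesgue. x \<in> O' \<longrightarrow> u1 (x + h *\<^sub>R b) - u1 x = h * line_avg b h g1 x"
  proof (rule AE_open_cboxI[OF O])
    fix p q assume pq: "cbox p q \<subseteq> O'"
    show "AE x in lebesgue. x \<in> cbox p q \<longrightarrow> u1 (x + h *\<^sub>R b) - u1 x = h * line_avg b h g1 x"
    proof (rule steklov_cbox[OF u1(1) g1(1) b])
      show "x + (r * h) *\<^sub>R b \<in> S" if "x \<in> cbox p q" "0 \<le> r" "r \<le> 1" for x r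
        using OS that pq by blast
      fix \<phi> :: "'a \<Rightarrow> real" assume \<phi>: "\<phi> \<in> test_functions UNIV" and z: "\<And>x. x \<notin> S \<Longrightarrow> \<phi> x = 0"
      have sm: "smooth_fun \<phi>" using \<phi> by (auto simp: test_functions_def)
      have \<phi>D: "\<phi> \<in> test_functions D" by (rule test_functionsI[OF sm S z])
      have z': "\<And>x. x \<notin> S \<Longrightarrow> pd b \<phi> x = 0"
        using frechet_zero_off_closed[OF compact_imp_closed[OF S(1)] z] .
      have m: "\<phi> \<in> borel_measurable borel" "(\<lambda>x. pd b \<phi> x) \<in> borel_measurable borel"
        using smooth_fun_continuous[OF sm] smooth_fun_continuous_deriv[OF sm b]
        by (auto intro!: borel_measurable_continuous_onI)
      show "(LINT x|lborel. u1 x * pd b \<phi> x) = - (LINT x|lborel. g1 x * \<phi> x)"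
        using has_weak_partialD(3)[OF w \<phi>D b] integral_lborel_rep[OF u1(2) z' _ m(2)]
          integral_lborel_rep[OF g1(2) z _ m(1)] by simp
    qed
  qed
  then show ?thesis by (simp add: AE_completion_iff)
qed

text \<open>Difference quotients take the place of mollification: discrete integration by parts
  moves the quotient in direction b from \<phi> to G(u). One side then converges because \<phi> is
  smooth, the other one by \<open>chain_rule_limit_right\<close>.\<close>

theorem has_weak_partial_chain:
  fixes u g :: "'a::euclidean_space \<Rightarrow> real" and G G' :: "real \<Rightarrow> real"
  assumes D: "open D" and w: "has_weak_partial D b u g" and b: "b \<in> Basis"
    and G: "\<And>y. (G has_real_derivative G' y) (at y)" "continuous_on UNIV G'" "\<And>y. \<bar>G' y\<bar> \<le> L"
  shows "has_weak_partial D b (\<lambda>x. G (u x)) (\<lambda>x. G' (u x) * g x)"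
proof -
  have lu: "loc_integrable D u" and lg: "loc_integrable D g" using w by (auto simp: has_weak_partial_def)
  have L: "0 \<le> L" using G(3)[of 0] by linarith
  have lip: "\<bar>G x - G y\<bar> \<le> L * \<bar>x - y\<bar>" for x y by (rule Lipschitz_of_deriv[OF G(1,3)])
  have Gc: "continuous_on UNIV G" using DERIV_continuous_on[OF G(1)] by auto
  have Gm: "G \<in> borel_measurable borel" "G' \<in> borel_measurable borel"
    using borel_measurable_continuous_onI[OF Gc] borel_measurable_continuous_onI[OF G(2)] by auto
  have mu: "u \<in> borel_measurable (lebesgue_on D)" and mg: "g \<in> borel_measurable (lebesgue_on D)"
    by (rule loc_integrable_measurable[OF D lu], rule loc_integrable_measurable[OF D lg])
  have l1: "loc_integrable D (\<lambda>x. G (u x))"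
  proof (rule loc_integrable_bound[OF D lu])
    show "(\<lambda>x. G (u x)) \<in> borel_measurable (lebesgue_on D)" using measurable_compose[OF mu Gm(1)] .
    show "\<bar>G (u x)\<bar> \<le> \<bar>G 0\<bar> + L * \<bar>u x\<bar>" for x using lip[of "u x" 0] by simp
  qed
  have l2: "loc_integrable D (\<lambda>x. G' (u x) * g x)"
  proof (rule loc_integrable_bound[OF D lg])
    show "(\<lambda>x. G' (u x) * g x) \<in> borel_measurable (lebesgue_on D)"
      by (rule borel_measurable_times[OF measurable_compose[OF mu Gm(2)] mg])
    show "\<bar>G' (u x) * g x\<bar> \<le> 0 + L * \<bar>g x\<bar>" for x
      using G(3)[of "u x"] by (auto simp: abs_mult intro: mult_right_mono)
  qed
  show ?thesis
  proof (rule has_weak_partialI[OF l1 l2 b])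
    fix \<phi> assume \<phi>: "\<phi> \<in> test_functions D"
    obtain K where K: "compact K" "K \<subseteq> D" "\<And>x. x \<notin> K \<Longrightarrow> \<phi> x = 0"
      "\<And>x b. x \<notin> K \<Longrightarrow> pd b \<phi> x = 0" "smooth_fun \<phi>"
      using test_functionsE[OF \<phi>] by blast
    obtain M where M: "\<And>x. \<bar>\<phi> x\<bar> \<le> M" "\<And>x. \<bar>pd b \<phi> x\<bar> \<le> M" "0 \<le> M"
      using test_function_bounded[OF \<phi> b] by blast
    \<comment> \<open>Room for the shifts: S will be the closed \<delta>-neighbourhood of the
      support K and O' the open \<delta>/2-neighbourhood, so that steps h n <= \<delta>/2 carry O'
      into S.\<close>
    obtain \<delta> where \<delta>: "\<delta> > 0" "(\<Union>x\<in>K. cball x \<delta>) \<subseteq> D"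
      using compact_subset_open_imp_cball_epsilon_subset[OF K(1) D K(2)] by blast
    define S where "S = {x + y |x y. x \<in> K \<and> y \<in> cball 0 \<delta>}"
    have S: "compact S" unfolding S_def by (rule compact_sums[OF K(1) compact_cball])
    have SD: "S \<subseteq> D"
    proof
      fix z assume "z \<in> S"
      then obtain x y where xy: "z = x + y" "x \<in> K" "y \<in> cball 0 \<delta>" by (auto simp: S_def)
      then have "z \<in> cball x \<delta>" by (simp add: dist_norm)
      then show "z \<in> D" using \<delta>(2) xy(2) by blast
    qed
    have KS: "K \<subseteq> S"
    proof
      fix x assume "x \<in> K"
      then have "x = x + 0 \<and> x \<in> K \<and> (0::'a) \<in> cball 0 \<delta>" using \<delta>(1) by simp
      then show "x \<in> S" unfolding S_def by blast
    qed
    define O' where "O' = (\<Union>x\<in>K. \<Union>y\<in>ball 0 (\<delta> / 2). {x + y})"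
    have O: "open O'" unfolding O'_def by (rule open_sums) simp
    have KO: "K \<subseteq> O'"
    proof
      fix x assume "x \<in> K"
      moreover have "(0::'a) \<in> ball 0 (\<delta> / 2)" using \<delta>(1) by simp
      moreover have "x \<in> {x + 0}" by simp
      ultimately show "x \<in> O'" unfolding O'_def by blast
    qed
    define h where "h n = \<delta> / 2 * inverse (real (Suc n))" for n
    have h0: "h n > 0" for n using \<delta>(1) by (simp add: h_def)
    have hl: "h \<longlonglongrightarrow> 0"
      unfolding h_def using tendsto_mult[OF tendsto_const LIMSEQ_inverse_real_of_nat, of "\<delta> / 2"] by simp
    have hb: "h n \<le> \<delta> / 2" for n
      using \<delta>(1) by (simp add: h_def divide_simps)
    have OS: "x + (r * h n) *\<^sub>R b \<in> S" if o: "x \<in> O'" "0 \<le> r" "r \<le> 1" for x r n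
    proof -
      obtain k y where ky': "k \<in> K" "y \<in> ball 0 (\<delta> / 2)" "x = k + y" using o(1) unfolding O'_def by blast
      then have ky: "k \<in> K" "norm y < \<delta> / 2" "x = k + y" by auto
      have "norm ((r * h n) *\<^sub>R b) = r * h n" using b o h0[of n] by (simp add: norm_Basis)
      also have "\<dots> \<le> \<delta> / 2" using o hb[of n] h0[of n] mult_mono[of r 1 "h n" "\<delta> / 2"] by simp
      finally have "norm (y + (r * h n) *\<^sub>R b) \<le> \<delta>" using norm_triangle_ineq[of y "(r * h n) *\<^sub>R b"] ky(2) by linarith
      then show ?thesis unfolding S_def using ky by (intro CollectI exI[of _ k] exI[of _ "y + (r * h n) *\<^sub>R b"]) simp
    qed
    obtain u1 where u1: "integrable lborel u1" "AE x in lebesgue. x \<in> S \<longrightarrow> u1 x = u x"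
      using set_integrable_borel_rep[of S u] lu S SD by (auto simp: loc_integrable_def)
    obtain g1 where g1: "integrable lborel g1" "AE x in lebesgue. x \<in> S \<longrightarrow> g1 x = g x"
      using set_integrable_borel_rep[of S g] lg S SD by (auto simp: loc_integrable_def)
    have [measurable]: "u1 \<in> borel_measurable borel" "g1 \<in> borel_measurable borel" "S \<in> sets borel"
      using u1 g1 S by (auto dest: borel_measurable_integrable simp: borel_compact)
    note [measurable] = Gm
    have m\<phi> [measurable]: "\<phi> \<in> borel_measurable borel" "(\<lambda>x. pd b \<phi> x) \<in> borel_measurable borel"
      using smooth_fun_continuous[OF K(5)] smooth_fun_continuous_deriv[OF K(5) b]
      by (auto intro!: borel_measurable_continuous_onI)
    have st: "AE x in lborel. x \<in> K \<longrightarrow> u1 (x + h n *\<^sub>R b) - u1 x = h n * line_avg b (h n) g1 x" for n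
    proof -
      have "AE x in lborel. x \<in> O' \<longrightarrow> u1 (x + h n *\<^sub>R b) - u1 x = h n * line_avg b (h n) g1 x"
        by (rule has_weak_partial_steklov[OF w b S SD O _ u1 g1]) (rule OS)
      then show ?thesis by eventually_elim (use KO in auto)
    qed
    \<comment> \<open>G need not vanish at 0, so G (u1) is cut off by the bounded set S to become
      integrable on the whole space.\<close>
    define v where "v x = indicator S x * G (u1 x)" for x
    have [measurable]: "v \<in> borel_measurable borel" unfolding v_def by measurable
    have iv: "integrable lborel v"
    proof (rule Bochner_Integration.integrable_bound)
      have "emeasure lborel S < \<infinity>" using S by (rule emeasure_compact_finite)
      then have "integrable lborel (indicator S :: 'a \<Rightarrow> real)" by (intro integrable_real_indicator) auto
      then show "integrable lborel (\<lambda>x. \<bar>G 0\<bar> * indicator S x + L * \<bar>u1 x\<bar>)" using u1(1) by auto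
      show "AE x in lborel. norm (v x) \<le> norm (\<bar>G 0\<bar> * indicator S x + L * \<bar>u1 x\<bar>)"
      proof (rule AE_I2)
        fix x
        have "\<bar>G (u1 x)\<bar> \<le> \<bar>G 0\<bar> + L * \<bar>u1 x\<bar>" using lip[of "u1 x" 0] by simp
        then show "norm (v x) \<le> norm (\<bar>G 0\<bar> * indicator S x + L * \<bar>u1 x\<bar>)"
          using L by (auto simp: v_def indicator_def)
      qed
    qed measurable
    have 1: "(\<lambda>n. LINT x|lborel. v x * ((\<phi> x - \<phi> (x - h n *\<^sub>R b)) / h n)) \<longlonglongrightarrow>
      (LINT x|lborel. v x * pd b \<phi> x)"
      by (rule difference_quotient_test_tendsto[OF iv \<phi> b hl h0])
    have 2: "(\<lambda>n. LINT x|lborel. \<phi> x * ((G (u1 (x + h n *\<^sub>R b)) - G (u1 x)) / h n)) \<longlonglongrightarrow>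
      (LINT x|lborel. \<phi> x * (G' (u1 x) * g1 x))"
      by (rule chain_rule_limit_right[OF u1(1) g1(1) G hl h0 m\<phi>(1) M(1) K(3) st])
    \<comment> \<open>Discrete integration by parts: translation invariance moves the shift from
      \<phi> to v. On K, off which \<phi> vanishes, both x and x + h n b lie in S, where v is G
      (u1).\<close>
    have "(LINT x|lborel. v x * ((\<phi> x - \<phi> (x - h n *\<^sub>R b)) / h n))
      = - (LINT x|lborel. \<phi> x * ((G (u1 (x + h n *\<^sub>R b)) - G (u1 x)) / h n))" for n
    proof -
      have i1: "integrable lborel (\<lambda>x. v x * \<phi> x)" "integrable lborel (\<lambda>x. v x * \<phi> (x - h n *\<^sub>R b))"
        by (rule integrable_mult_bounded[OF iv _ M(1)], measurable)+
      have i2: "integrable lborel (\<lambda>x. v (x + h n *\<^sub>R b) * \<phi> x)"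
        and e2: "(LINT x|lborel. v (x + h n *\<^sub>R b) * \<phi> x) = (LINT x|lborel. v x * \<phi> (x - h n *\<^sub>R b))"
        using lborel_shift[of "\<lambda>x. v x * \<phi> (x - h n *\<^sub>R b)" "h n *\<^sub>R b"] i1(2) by (simp_all add: add.commute)
      have p: "\<phi> x * ((G (u1 (x + h n *\<^sub>R b)) - G (u1 x)) / h n)
          = (v (x + h n *\<^sub>R b) * \<phi> x - v x * \<phi> x) * (1 / h n)" for x
      proof (cases "x \<in> K")
        case True
        then have "x + h n *\<^sub>R b \<in> S" "x \<in> S" using OS[of x 1 n] KO KS by auto
        then show ?thesis using h0[of n] by (simp add: v_def diff_divide_distrib right_diff_distrib mult.commute)
      qed (simp add: K(3))
      have "(LINT x|lborel. v x * ((\<phi> x - \<phi> (x - h n *\<^sub>R b)) / h n))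
          = (LINT x|lborel. (v x * \<phi> x - v x * \<phi> (x - h n *\<^sub>R b)) * (1 / h n))"
        by (simp add: right_diff_distrib)
      also have "\<dots> = ((LINT x|lborel. v x * \<phi> x) - (LINT x|lborel. v x * \<phi> (x - h n *\<^sub>R b))) * (1 / h n)"
        using i1 by (subst integral_mult_left_zero) simp
      also have "\<dots> = - (((LINT x|lborel. v (x + h n *\<^sub>R b) * \<phi> x) - (LINT x|lborel. v x * \<phi> x)) * (1 / h n))"
        unfolding e2 by (simp add: algebra_simps)
      also have "((LINT x|lborel. v (x + h n *\<^sub>R b) * \<phi> x) - (LINT x|lborel. v x * \<phi> x)) * (1 / h n)
        = (LINT x|lborel. \<phi> x * ((G (u1 (x + h n *\<^sub>R b)) - G (u1 x)) / h n))"
        unfolding p using i1(1) i2 by (subst integral_mult_left_zero) simp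
      finally show ?thesis .
    qed
    with 1 have "(\<lambda>n. - (LINT x|lborel. \<phi> x * ((G (u1 (x + h n *\<^sub>R b)) - G (u1 x)) / h n))) \<longlonglongrightarrow>
      (LINT x|lborel. v x * pd b \<phi> x)" by simp
    with tendsto_minus[OF 2] have e: "(LINT x|lborel. v x * pd b \<phi> x)
        = - (LINT x|lborel. \<phi> x * (G' (u1 x) * g1 x))"
      by (rule LIMSEQ_unique[rotated])
    have "(LINT x|lebesgue. G (u x) * pd b \<phi> x) = (LINT x|lborel. v x * pd b \<phi> x)"
    proof (rule integral_lborel_rep[where S = S])
      show "AE x in lebesgue. x \<in> S \<longrightarrow> v x = G (u x)"
        using u1(2) by eventually_elim (auto simp: v_def)
    qed (use K(4) KS m\<phi> \<open>v \<in> borel_measurable borel\<close> in auto)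
    moreover have "(LINT x|lebesgue. G' (u x) * g x * \<phi> x) = (LINT x|lborel. G' (u1 x) * g1 x * \<phi> x)"
    proof (rule integral_lborel_rep[where S = S])
      show "AE x in lebesgue. x \<in> S \<longrightarrow> G' (u1 x) * g1 x = G' (u x) * g x"
        using u1(2) g1(2) by eventually_elim auto
      show "(\<lambda>x. G' (u1 x) * g1 x) \<in> borel_measurable borel" by measurable
    qed (use K(3) KS m\<phi> in auto)
    ultimately show "(LINT x|lebesgue. G (u x) * pd b \<phi> x) = - (LINT x|lebesgue. G' (u x) * g x * \<phi> x)"
      using e by (simp add: mult.commute)
  qed
qed

subsection \<open>Functions that do not depend on time\<close>

lemma borel_measurable_fst_snd [measurable]:
  "(fst :: 'a::euclidean_space \<times> 'b::euclidean_space \<Rightarrow> 'a) \<in> borel_measurable borel"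
  "(snd :: 'a::euclidean_space \<times> 'b::euclidean_space \<Rightarrow> 'b) \<in> borel_measurable borel"
  by (intro borel_measurable_continuous_onI continuous_intros)+

lemma loc_integrable_borel_rep:
  assumes D: "open D" and u: "loc_integrable D u"
  obtains u' where "u' \<in> borel_measurable borel" "AE x in lebesgue. x \<in> D \<longrightarrow> u x = u' x"
proof -
  have "(\<lambda>x. indicator D x * u x) \<in> borel_measurable lebesgue"
    using loc_integrable_measurable[OF D u] D by (simp add: borel_measurable_lebesgue_on_iff open_sets_lebesgue)
  then obtain u' where u': "u' \<in> borel_measurable lborel" "AE x in lborel. indicator D x * u x = u' x"
    using completion_ex_borel_measurable_real by blast
  have "AE x in lebesgue. x \<in> D \<longrightarrow> u x = u' x"
    using AE_completion[OF u'(2)] by eventually_elim auto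
  with u'(1) show thesis by (intro that[of u']) auto
qed

lemma lebesgue_measurable_vimage:
  fixes T :: "'a::euclidean_space \<Rightarrow> 'b::euclidean_space"
  assumes T: "T \<in> borel_measurable borel"
    and N: "\<And>N. N \<in> null_sets lborel \<Longrightarrow> T -` N \<in> null_sets lborel"
  shows "T \<in> lebesgue \<rightarrow>\<^sub>M lebesgue"
proof (rule completion.measurable_completion2)
  show m: "T \<in> lebesgue \<rightarrow>\<^sub>M lborel" using T by (intro measurable_completion) simp
  show "null_sets lborel \<subseteq> null_sets (distr lebesgue lborel T)"
  proof
    fix M assume M: "M \<in> null_sets (lborel :: 'b measure)"
    have "emeasure lebesgue (T -` M) = 0" using null_setsD1[OF null_sets_completionI[OF N[OF M]]] .
    then show "M \<in> null_sets (distr lebesgue lborel T)"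
      using M m by (intro null_setsI) (auto simp: emeasure_distr)
  qed
qed

lemma AE_lebesgue_vimage:
  fixes T :: "'a::euclidean_space \<Rightarrow> 'b::euclidean_space"
  assumes N: "\<And>N. N \<in> null_sets lborel \<Longrightarrow> T -` N \<in> null_sets lborel"
    and P: "AE x in lebesgue. P x"
  shows "AE x in lebesgue. P (T x)"
proof -
  have "AE x in lborel. P x" using P by (simp add: AE_completion_iff)
  then obtain M where M: "M \<in> null_sets lborel" "\<And>x. x \<notin> M \<Longrightarrow> P x"
    unfolding eventually_ae_filter by auto
  have "AE x in lborel. x \<notin> T -` M" by (rule AE_not_in[OF N[OF M(1)]])
  then have "AE x in lborel. P (T x)" by eventually_elim (use M(2) in auto)
  then show "AE x in lebesgue. P (T x)" by (rule AE_completion)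
qed

lemma null_sets_fst_vimage:
  assumes N: "N \<in> null_sets (lborel :: 'a::euclidean_space measure)"
  shows "fst -` N \<in> null_sets (lborel :: ('a \<times> 'b::euclidean_space) measure)"
proof -
  have "N \<times> (UNIV :: 'b set) \<in> null_sets (lborel \<Otimes>\<^sub>M lborel)"
  proof (rule null_setsI)
    have "emeasure (lborel \<Otimes>\<^sub>M lborel) (N \<times> (UNIV :: 'b set)) = emeasure lborel N * emeasure (lborel :: 'b measure) UNIV"
      by (rule lborel.emeasure_pair_measure_Times) (use N in auto)
    also have "\<dots> = 0" using N by (simp add: null_setsD1)
    finally show "emeasure (lborel \<Otimes>\<^sub>M lborel) (N \<times> (UNIV :: 'b set)) = 0" .
    show "N \<times> (UNIV :: 'b set) \<in> sets (lborel \<Otimes>\<^sub>M lborel)" using N by (intro pair_measureI) auto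
  qed
  moreover have "fst -` N = N \<times> (UNIV :: 'b set)" by auto
  ultimately show ?thesis by (simp add: lborel_prod)
qed

lemma AE_lebesgue_fst:
  assumes "AE x in lebesgue. P x"
  shows "AE z in (lebesgue :: ('a::euclidean_space \<times> 'b::euclidean_space) measure). P (fst z)"
  by (rule AE_lebesgue_vimage[OF null_sets_fst_vimage assms])

lemma lebesgue_fst_measurable:
  "(fst :: 'a::euclidean_space \<times> 'b::euclidean_space \<Rightarrow> 'a) \<in> lebesgue \<rightarrow>\<^sub>M lebesgue"
  by (rule lebesgue_measurable_vimage[OF borel_measurable_fst_snd(1) null_sets_fst_vimage])

lemma integrable_pair_product:
  fixes f :: "'a::euclidean_space \<Rightarrow> real" and k :: "'b::euclidean_space \<Rightarrow> real"
  assumes f: "integrable lborel f" and k: "integrable lborel k"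
  shows "integrable (lborel :: ('a \<times> 'b) measure) (\<lambda>z. f (fst z) * k (snd z))"
    "(LINT z|(lborel :: ('a \<times> 'b) measure). f (fst z) * k (snd z)) = (LINT x|lborel. f x) * (LINT t|lborel. k t)"
proof -
  have [measurable]: "f \<in> borel_measurable borel" "k \<in> borel_measurable borel"
    using f k by (auto dest: borel_measurable_integrable)
  have *: "integrable (lborel \<Otimes>\<^sub>M lborel) (\<lambda>(x, t). f x * k t)"
  proof (rule lborel_pair.Fubini_integrable)
    show "integrable lborel (\<lambda>x. LINT t|lborel. norm (case (x, t) of (x, t) \<Rightarrow> f x * k t))"
      using f by (simp add: abs_mult)
  qed (use k in auto)
  show "integrable (lborel :: ('a \<times> 'b) measure) (\<lambda>z. f (fst z) * k (snd z))"
    using * by (simp add: lborel_prod split_beta')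
  show "(LINT z|(lborel :: ('a \<times> 'b) measure). f (fst z) * k (snd z)) = (LINT x|lborel. f x) * (LINT t|lborel. k t)"
    using lborel_pair.integral_fst[OF *] by (simp add: lborel_prod split_beta')
qed

lemma loc_integrable_fst:
  fixes u :: "'a::euclidean_space \<Rightarrow> real" and J :: "'b::euclidean_space set"
  assumes D: "open D" and J: "open J" and u: "loc_integrable D u"
  shows "loc_integrable (D \<times> J) (\<lambda>z. u (fst z))"
  unfolding loc_integrable_def
proof (intro allI impI)
  fix K assume K: "compact K \<and> K \<subseteq> D \<times> J"
  let ?K1 = "fst ` K" and ?K2 = "snd ` K"
  have c: "compact ?K1" "compact ?K2" using K by (auto intro!: compact_continuous_image continuous_intros)
  have sub: "?K1 \<subseteq> D" using K by auto
  obtain u1 where u1: "integrable lborel u1" "AE x in lebesgue. x \<in> ?K1 \<longrightarrow> u1 x = u x"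
    using set_integrable_borel_rep[of ?K1 u] u c(1) sub by (auto simp: loc_integrable_def)
  have "integrable lborel (indicator ?K2 :: 'b \<Rightarrow> real)"
    using emeasure_compact_finite[OF c(2)] c(2) by (intro integrable_real_indicator) (auto simp: borel_compact)
  from integrable_pair_product(1)[OF u1(1) this]
  have i: "integrable lebesgue (\<lambda>z. u1 (fst z) * indicator ?K2 (snd z) :: real)"
    by (subst integrable_completion) (auto dest: borel_measurable_integrable)
  have Ks: "K \<in> sets lebesgue" using K lmeasurable_compact by blast
  have i2: "integrable lebesgue (\<lambda>z. indicator K z *\<^sub>R (u1 (fst z) * indicator ?K2 (snd z) :: real))"
    by (rule integrable_mult_indicator[OF Ks i])
  have e: "AE z in lebesgue. indicator K z *\<^sub>R (u1 (fst z) * indicator ?K2 (snd z) :: real) = indicator K z *\<^sub>R u (fst z)"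
    using AE_lebesgue_fst[OF u1(2)]
    by eventually_elim (auto simp: indicator_def image_iff)
  have m: "(\<lambda>z. indicator K z *\<^sub>R u (fst z)) \<in> borel_measurable lebesgue"
    by (rule borel_measurable_AE[OF borel_measurable_integrable[OF i2] e])
  show "set_integrable lebesgue K (\<lambda>z. u (fst z))"
    unfolding set_integrable_def
    using integrable_cong_AE[THEN iffD1, OF borel_measurable_integrable[OF i2] m e i2] .
qed

lemma smooth_fun_slice:
  fixes \<phi> :: "'a::euclidean_space \<times> 'b::euclidean_space \<Rightarrow> real"
  assumes "smooth_fun \<phi>"
  shows "smooth_fun (\<lambda>x. \<phi> (x, t))" "pd b (\<lambda>x. \<phi> (x, t)) x = pd (b, 0) \<phi> (x, t)"
proof -
  have d: "((\<lambda>x. (x, t)) has_derivative (\<lambda>h. (h, 0))) (at x)" for x :: 'a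
    by (intro has_derivative_Pair) (auto intro!: derivative_eq_intros)
  show "smooth_fun (\<lambda>x. \<phi> (x, t))"
    by (rule smooth_fun_compose[OF d _ assms]) (auto intro: smooth_fun_intros)
  have "((\<lambda>x. \<phi> (x, t)) has_derivative (\<lambda>h. pd (h, 0) \<phi> (x, t))) (at x)"
    by (rule has_derivative_compose[OF d smooth_fun_frechet(1)[OF assms]])
  from frechet_derivative_at[OF this]
  show "pd b (\<lambda>x. \<phi> (x, t)) x = pd (b, 0) \<phi> (x, t)"
    by metis
qed

lemma integral_time_derivative_test:
  fixes \<phi> :: "'a::euclidean_space \<times> real \<Rightarrow> real"
  assumes \<phi>: "\<phi> \<in> test_functions D"
  shows "(LINT t|lborel. pd (0, 1) \<phi> (x, t)) = 0"
proof -
  obtain K where K: "compact K" "K \<subseteq> D" "\<And>x. x \<notin> K \<Longrightarrow> \<phi> x = 0"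
    "\<And>x b. x \<notin> K \<Longrightarrow> pd b \<phi> x = 0" "smooth_fun \<phi>"
    using test_functionsE[OF \<phi>] by blast
  have "bounded (snd ` K)" using K(1) by (intro compact_imp_bounded compact_continuous_image continuous_intros)
  then obtain R where R: "\<And>z. z \<in> K \<Longrightarrow> \<bar>snd z\<bar> \<le> R" by (auto simp: bounded_iff)
  define a where "a = \<bar>R\<bar> + 1"
  have out: "(x, t) \<notin> K" if "t \<notin> {-a<..<a}" for t using R[of "(x, t)"] that by (auto simp: a_def)
  let ?f = "\<lambda>t. pd (0, 1) \<phi> (x, t)"
  have "(LINT t|lborel. indicator {-a..a} t *\<^sub>R ?f t) = \<phi> (x, a) - \<phi> (x, -a)"
  proof (rule integral_FTC_Icc)
    show "-a \<le> a" by (simp add: a_def)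
    show "((\<lambda>t. \<phi> (x, t)) has_vector_derivative ?f t) (at t within {-a..a})" for t
    proof -
      have lin: "linear (frechet_derivative \<phi> (at (x, t)))"
        using smooth_fun_frechet(1)[OF K(5)] by (rule has_derivative_linear)
      have "((\<lambda>t. (x, t)) has_derivative (\<lambda>h. (0, h))) (at t)"
        by (intro has_derivative_Pair) (auto intro!: derivative_eq_intros)
      from has_derivative_compose[OF this smooth_fun_frechet(1)[OF K(5)]]
      have "((\<lambda>t. \<phi> (x, t)) has_derivative (\<lambda>h. pd (0, h) \<phi> (x, t))) (at t)" .
      also have "(\<lambda>h. pd (0, h) \<phi> (x, t)) = (\<lambda>h. h *\<^sub>R ?f t)"
      proof
        fix h :: real
        show "pd (0, h) \<phi> (x, t) = h *\<^sub>R ?f t"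
          using linear_cmul[OF lin, of h "(0, 1)"] by simp
      qed
      finally show ?thesis unfolding has_vector_derivative_def by (rule has_derivative_at_withinI)
    qed
    have "(0 :: 'a, 1 :: real) \<in> Basis" by (simp add: Basis_prod_def)
    then show "continuous_on {-a..a} ?f"
      by (intro continuous_on_compose2[OF smooth_fun_continuous_deriv[OF K(5), of _ UNIV]])
        (auto intro!: continuous_intros)
  qed
  moreover have e: "indicator {-a..a} t *\<^sub>R ?f t = ?f t" for t
    using K(4)[of "(x, t)" "(0, 1)"] out[of t] by (cases "t \<in> {-a<..<a}") auto
  ultimately have "(LINT t|lborel. ?f t) = \<phi> (x, a) - \<phi> (x, -a)" by (simp only: e)
  then show ?thesis using K(3)[of "(x, a)"] K(3)[of "(x, -a)"] out[of a] out[of "-a"] by simp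
qed

lemma loc_integrable_zero: "loc_integrable D (\<lambda>x. 0)"
  by (simp add: loc_integrable_def)

text \<open>Fubini: for every t the slice of a test function is a test function on D. Borel
  representatives are taken first because a slice of a Lebesgue measurable function need not be
  measurable.\<close>

lemma has_weak_partial_fst_space:
  fixes u g :: "'a::euclidean_space \<Rightarrow> real" and J :: "real set"
  assumes D: "open D" and J: "open J" and b: "b \<in> Basis" and w: "has_weak_partial D b u g"
  shows "has_weak_partial (D \<times> J) (b, 0) (\<lambda>z. u (fst z)) (\<lambda>z. g (fst z))"
proof -
  have DJ: "open (D \<times> J)" using D J by (rule open_Times)
  have b0: "(b, 0 :: real) \<in> Basis" using b by (simp add: Basis_prod_def)
  have lu: "loc_integrable D u" and lg: "loc_integrable D g" using w by (auto simp: has_weak_partial_def)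
  obtain u' where u': "u' \<in> borel_measurable borel" "AE x in lebesgue. x \<in> D \<longrightarrow> u x = u' x"
    using loc_integrable_borel_rep[OF D lu] .
  obtain g' where g': "g' \<in> borel_measurable borel" "AE x in lebesgue. x \<in> D \<longrightarrow> g x = g' x"
    using loc_integrable_borel_rep[OF D lg] .
  have w': "has_weak_partial D b u' g'" by (rule has_weak_partial_AE[OF w D b u'(2) g'(2)])
  have lu': "loc_integrable D u'" and lg': "loc_integrable D g'" using w' by (auto simp: has_weak_partial_def)
  note lu2 = loc_integrable_fst[OF D J lu'] and lg2 = loc_integrable_fst[OF D J lg']
  have "has_weak_partial (D \<times> J) (b, 0) (\<lambda>z. u' (fst z)) (\<lambda>z. g' (fst z))"
  proof (rule has_weak_partialI[OF lu2 lg2 b0])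
    fix \<phi> :: "'a \<times> real \<Rightarrow> real" assume \<phi>: "\<phi> \<in> test_functions (D \<times> J)"
    obtain K where K: "compact K" "K \<subseteq> D \<times> J" "\<And>x. x \<notin> K \<Longrightarrow> \<phi> x = 0"
      "\<And>x b. x \<notin> K \<Longrightarrow> pd b \<phi> x = 0" "smooth_fun \<phi>"
      using test_functionsE[OF \<phi>] by blast
    let ?d = "\<lambda>z. pd (b, 0) \<phi> z"
    have K4: "?d x = 0" if "x \<notin> K" for x using that by (rule K(4))
    note m [measurable] = u'(1) g'(1) borel_measurable_continuous_onI[OF smooth_fun_continuous[OF K(5)]]
      borel_measurable_continuous_onI[OF smooth_fun_continuous_deriv[OF K(5) b0]]
    have mu [measurable]: "(\<lambda>z. u' (fst z)) \<in> borel_measurable (borel :: ('a \<times> real) measure)"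
      by (rule measurable_compose[OF borel_measurable_fst_snd(1) u'(1)])
    have I1: "integrable lborel (\<lambda>z. u' (fst z) * ?d z)"
    proof -
      have "integrable lebesgue (\<lambda>z. u' (fst z) * ?d z)"
        by (rule loc_integrable_mult_test(1)[OF lu2 K(1,2) smooth_fun_continuous_deriv[OF K(5) b0] K4])
      then show ?thesis by (subst (asm) integrable_completion) auto
    qed
    have mg [measurable]: "(\<lambda>z. g' (fst z)) \<in> borel_measurable (borel :: ('a \<times> real) measure)"
      by (rule measurable_compose[OF borel_measurable_fst_snd(1) g'(1)])
    have I2: "integrable lborel (\<lambda>z. g' (fst z) * \<phi> z)"
    proof -
      have "integrable lebesgue (\<lambda>z. g' (fst z) * \<phi> z)"
        by (rule loc_integrable_mult_test(1)[OF lg2 K(1,2) smooth_fun_continuous[OF K(5)] K(3)])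
      then show ?thesis by (subst (asm) integrable_completion) auto
    qed
    have J1: "integrable (lborel \<Otimes>\<^sub>M lborel) (\<lambda>(x, t). u' x * ?d (x, t))"
      and J2: "integrable (lborel \<Otimes>\<^sub>M lborel) (\<lambda>(x, t). g' x * \<phi> (x, t))"
      using I1 I2 by (simp_all add: lborel_prod split_beta')
    have sl: "(LINT x|lborel. u' x * ?d (x, t)) = - (LINT x|lborel. g' x * \<phi> (x, t))" for t
    proof -
      have t: "(\<lambda>x. \<phi> (x, t)) \<in> test_functions D"
      proof (rule test_functionsI[OF smooth_fun_slice(1)[OF K(5)]])
        show "compact (fst ` K)" using K(1) by (intro compact_continuous_image continuous_intros)
        show "fst ` K \<subseteq> D" using K(2) by auto
        show "\<phi> (x, t) = 0" if "x \<notin> fst ` K" for x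
          by (rule K(3)) (use that in force)
      qed
      have "(\<lambda>x. u' x * ?d (x, t)) \<in> borel_measurable lborel" "(\<lambda>x. g' x * \<phi> (x, t)) \<in> borel_measurable lborel"
        by measurable
      then show ?thesis
        using has_weak_partialD(3)[OF w' t b] by (simp add: smooth_fun_slice(2)[OF K(5)] integral_completion)
    qed
    have "(LINT z|lebesgue. u' (fst z) * ?d z) = (LINT z|lborel. u' (fst z) * ?d z)"
      by (rule integral_completion) measurable
    also have "\<dots> = (LINT t|lborel. (LINT x|lborel. u' x * ?d (x, t)))"
      using lborel_pair.integral_snd[OF J1] by (simp add: lborel_prod split_beta')
    also have "\<dots> = - (LINT t|lborel. (LINT x|lborel. g' x * \<phi> (x, t)))" by (simp add: sl)
    also have "(LINT t|lborel. (LINT x|lborel. g' x * \<phi> (x, t))) = (LINT z|lborel. g' (fst z) * \<phi> z)"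
      using lborel_pair.integral_snd[OF J2] by (simp add: lborel_prod split_beta')
    also have "(LINT z|lborel. g' (fst z) * \<phi> z) = (LINT z|lebesgue. g' (fst z) * \<phi> z)"
      by (rule integral_completion[symmetric]) measurable
    finally show "(LINT z|lebesgue. u' (fst z) * ?d z) = - (LINT z|lebesgue. g' (fst z) * \<phi> z)" .
  qed
  then show ?thesis
  proof (rule has_weak_partial_AE[OF _ DJ b0])
    show "AE z in lebesgue. z \<in> D \<times> J \<longrightarrow> u' (fst z) = u (fst z)"
      using AE_lebesgue_fst[OF u'(2)] by eventually_elim auto
    show "AE z in lebesgue. z \<in> D \<times> J \<longrightarrow> g' (fst z) = g (fst z)"
      using AE_lebesgue_fst[OF g'(2)] by eventually_elim auto
  qed
qed

text \<open>Integrating in t first, the time derivative of a compactly supported function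
  contributes 0 on every vertical line.\<close>

lemma has_weak_partial_fst_time:
  fixes u :: "'a::euclidean_space \<Rightarrow> real" and J :: "real set"
  assumes D: "open D" and J: "open J" and lu: "loc_integrable D u"
  shows "has_weak_partial (D \<times> J) (0, 1) (\<lambda>z. u (fst z)) (\<lambda>z. 0)"
proof -
  have DJ: "open (D \<times> J)" using D J by (rule open_Times)
  have b0: "(0 :: 'a, 1 :: real) \<in> Basis" by (simp add: Basis_prod_def)
  obtain u' where u': "u' \<in> borel_measurable borel" "AE x in lebesgue. x \<in> D \<longrightarrow> u x = u' x"
    using loc_integrable_borel_rep[OF D lu] .
  note lu2 = loc_integrable_fst[OF D J loc_integrable_AE[OF lu D u'(2)]]
  have "has_weak_partial (D \<times> J) (0, 1) (\<lambda>z. u' (fst z)) (\<lambda>z. 0)"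
  proof (rule has_weak_partialI[OF lu2 loc_integrable_zero b0])
    fix \<phi> :: "'a \<times> real \<Rightarrow> real" assume \<phi>: "\<phi> \<in> test_functions (D \<times> J)"
    obtain K where K: "compact K" "K \<subseteq> D \<times> J" "\<And>x. x \<notin> K \<Longrightarrow> \<phi> x = 0"
      "\<And>x b. x \<notin> K \<Longrightarrow> pd b \<phi> x = 0" "smooth_fun \<phi>"
      using test_functionsE[OF \<phi>] by blast
    let ?d = "\<lambda>z. pd (0, 1) \<phi> z"
    have K4: "?d x = 0" if "x \<notin> K" for x using that by (rule K(4))
    note m [measurable] = u'(1) borel_measurable_continuous_onI[OF smooth_fun_continuous_deriv[OF K(5) b0]]
    have mu [measurable]: "(\<lambda>z. u' (fst z)) \<in> borel_measurable (borel :: ('a \<times> real) measure)"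
      by (rule measurable_compose[OF borel_measurable_fst_snd(1) u'(1)])
    have I1: "integrable lborel (\<lambda>z. u' (fst z) * ?d z)"
    proof -
      have "integrable lebesgue (\<lambda>z. u' (fst z) * ?d z)"
        by (rule loc_integrable_mult_test(1)[OF lu2 K(1,2) smooth_fun_continuous_deriv[OF K(5) b0] K4])
      then show ?thesis by (subst (asm) integrable_completion) auto
    qed
    have J1: "integrable (lborel \<Otimes>\<^sub>M lborel) (\<lambda>(x, t). u' x * ?d (x, t))"
      using I1 by (simp add: lborel_prod split_beta')
    have "(LINT z|lebesgue. u' (fst z) * ?d z) = (LINT z|lborel. u' (fst z) * ?d z)"
      by (rule integral_completion) measurable
    also have "\<dots> = (LINT x|lborel. (LINT t|lborel. u' x * ?d (x, t)))"
      using lborel_pair.integral_fst[OF J1] by (simp add: lborel_prod split_beta')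
    also have "\<dots> = 0" by (simp add: integral_time_derivative_test[OF \<phi>])
    finally show "(LINT z|lebesgue. u' (fst z) * ?d z) = - (LINT z|lebesgue. 0 * \<phi> z)" by simp
  qed
  then show ?thesis
  proof (rule has_weak_partial_AE[OF _ DJ b0])
    show "AE z in lebesgue. z \<in> D \<times> J \<longrightarrow> u' (fst z) = u (fst z)"
      using AE_lebesgue_fst[OF u'(2)] by eventually_elim auto
  qed simp
qed

subsection \<open>Gluing weak derivatives along an exhaustion\<close>

lemma compact_subset_incseq_open:
  fixes E :: "nat \<Rightarrow> 'a::topological_space set"
  assumes "compact K" "\<And>n. open (E n)" "incseq E" "K \<subseteq> (\<Union>n. E n)"
  obtains n where "K \<subseteq> E n"
proof -
  obtain N where N: "finite N" "K \<subseteq> (\<Union>n\<in>N. E n)"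
    using compactE_image[OF assms(1), of UNIV E] assms(2,4) by (metis UNIV_I subset_UNIV)
  have "(\<Union>n\<in>N. E n) \<subseteq> E (Max (insert 0 N))"
  proof (rule UN_least)
    fix n assume "n \<in> N"
    then have "n \<le> Max (insert 0 N)" using N(1) by simp
    then show "E n \<subseteq> E (Max (insert 0 N))" using assms(3) by (simp add: incseqD)
  qed
  with N(2) show thesis using that by blast
qed

lemma has_weak_partial_exhaust:
  fixes E :: "nat \<Rightarrow> 'a::euclidean_space set"
  assumes E: "\<And>n. open (E n)" "incseq E" "(\<Union>n. E n) = D" and b: "b \<in> Basis"
    and w: "\<And>n. has_weak_partial (E n) b u g"
  shows "has_weak_partial D b u g"
proof -
  have ex: "\<exists>n. K \<subseteq> E n" if "compact K" "K \<subseteq> D" for K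
    using compact_subset_incseq_open[OF that(1) E(1,2)] that(2) E(3) by metis
  show ?thesis
  proof (rule has_weak_partialI[OF _ _ b])
    have l: "loc_integrable D v" if l: "\<And>n. loc_integrable (E n) v" for v
      unfolding loc_integrable_def
    proof (intro allI impI)
      fix K assume K: "compact K \<and> K \<subseteq> D"
      then obtain n where "K \<subseteq> E n" using ex by blast
      then show "set_integrable lebesgue K v" using l[of n] K by (simp add: loc_integrable_def)
    qed
    show "loc_integrable D u" by (rule l) (use w in \<open>simp add: has_weak_partial_def\<close>)
    show "loc_integrable D g" by (rule l) (use w in \<open>simp add: has_weak_partial_def\<close>)
    fix \<phi> assume \<phi>: "\<phi> \<in> test_functions D"
    obtain K where K: "compact K" "K \<subseteq> D" "\<And>x. x \<notin> K \<Longrightarrow> \<phi> x = 0" "smooth_fun \<phi>"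
      by (rule test_functionsE[OF \<phi>]) (rule that)
    obtain n where "K \<subseteq> E n" using ex[OF K(1,2)] by blast
    then have "\<phi> \<in> test_functions (E n)" by (intro test_functionsI[OF K(4,1) _ K(3)])
    from has_weak_partialD(3)[OF w this b]
    show "(LINT x|lebesgue. u x * pd b \<phi> x) = - (LINT x|lebesgue. g x * \<phi> x)" .
  qed
qed

text \<open>At each point the glued derivative uses the first set of the exhaustion containing it.
  By uniqueness of weak derivatives on each E n the choice is immaterial almost everywhere, and
  every test function lives in a single E n.\<close>

lemma has_weak_partial_glue:
  fixes E :: "nat \<Rightarrow> 'a::euclidean_space set"
  assumes E: "\<And>n. open (E n)" "incseq E" "(\<Union>n. E n) = D" and b: "b \<in> Basis"
    and w: "\<And>n. has_weak_partial (E n) b u (g n)"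
  obtains h where "has_weak_partial D b u h" "\<And>n. AE x in lebesgue. x \<in> E n \<longrightarrow> h x = g n x"
proof -
  define h where "h x = g (LEAST n. x \<in> E n) x" for x
  have u: "AE x in lebesgue. m \<le> n \<longrightarrow> x \<in> E m \<longrightarrow> g m x = g n x" for m n
  proof (cases "m \<le> n")
    case True
    have "has_weak_partial (E m) b u (g n)"
      by (rule has_weak_partial_subset[OF w incseqD[OF E(2) True] b])
    from has_weak_partial_unique[OF w this E(1) b] True show ?thesis by simp
  qed simp
  then have "AE x in lebesgue. \<forall>m n. m \<le> n \<longrightarrow> x \<in> E m \<longrightarrow> g m x = g n x"
    by (simp add: AE_all_countable)
  then have ae: "AE x in lebesgue. x \<in> E n \<longrightarrow> h x = g n x" for n
  proof eventually_elim
    case (elim x)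
    show ?case
    proof
      assume x: "x \<in> E n"
      have "(LEAST n. x \<in> E n) \<le> n" "x \<in> E (LEAST n. x \<in> E n)"
        using x by (auto intro: Least_le LeastI)
      with elim show "h x = g n x" unfolding h_def by blast
    qed
  qed
  have "has_weak_partial (E n) b u h" for n
  proof (rule has_weak_partial_AE[OF w E(1) b, of n])
    show "AE x in lebesgue. x \<in> E n \<longrightarrow> g n x = h x" using ae[of n] by eventually_elim auto
  qed simp
  then have "has_weak_partial D b u h" by (rule has_weak_partial_exhaust[OF E b])
  then show thesis by (rule that[OF _ ae])
qed

subsection \<open>Smooth changes of the time variable\<close>

text \<open>The competitors are v (x, \<phi> t), so \<psi> sends the old time to the new one.
  \<psi>' is smooth because test functions get composed with \<psi> and multiplied by \<psi>'. The
  bound c controls the new time derivative and C the Jacobian, which keeps both in L2, and \<psi> 0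
  = 0 preserves the initial trace.\<close>

locale time_change =
  fixes \<psi> \<phi> \<psi>' :: "real \<Rightarrow> real" and c C :: real
  assumes der: "(\<psi> has_real_derivative \<psi>' s) (at s)"
    and smooth: "smooth_fun \<psi>'"
    and c: "0 < c" "c \<le> \<psi>' s" and C: "\<psi>' s \<le> C"
    and inv: "\<phi> (\<psi> s) = s" "\<psi> (\<phi> t) = t"
    and zero: "\<psi> 0 = 0"
begin

lemma strict: "strict_mono \<psi>"
proof (rule strict_monoI)
  fix s t :: real assume "s < t"
  then show "\<psi> s < \<psi> t"
    by (rule DERIV_pos_imp_increasing) (use der c in \<open>auto intro: less_le_trans\<close>)
qed

lemma less_iff: "\<psi> s < \<psi> t \<longleftrightarrow> s < t"
  using strict by (rule strict_mono_less)

lemma phi_less_iff: "\<phi> s < \<phi> t \<longleftrightarrow> s < t"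
  using less_iff[of "\<phi> s" "\<phi> t"] by (simp add: inv)

lemma phi_zero: "\<phi> 0 = 0"
  using inv(1)[of 0] zero by simp

lemma smooth_psi: "smooth_fun \<psi>"
proof -
  have "C_k (Suc m) \<psi>" for m
    using smooth by (intro C_k_real_SucI[OF der]) (simp add: smooth_fun_def)
  then have "C_k m \<psi>" for m using C_k_pred by blast
  then show ?thesis by (simp add: smooth_fun_def)
qed

lemma phi_continuous: "continuous_on UNIV \<phi>"
proof -
  have "isCont \<phi> (\<psi> s)" for s
    by (rule isCont_inverse_function[of 1]) (auto simp: inv intro: DERIV_isCont[OF der])
  then have "isCont \<phi> t" for t using inv(2)[of t] by metis
  then show ?thesis by (simp add: continuous_at_imp_continuous_on)
qed

definition fwd :: "'a \<times> real \<Rightarrow> 'a \<times> real" where "fwd z = (fst z, \<psi> (snd z))"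
definition bwd :: "'a \<times> real \<Rightarrow> 'a \<times> real" where "bwd z = (fst z, \<phi> (snd z))"

lemma fwd_bwd [simp]: "fwd (bwd z) = z" "bwd (fwd z) = z"
  by (auto simp: fwd_def bwd_def inv)

lemma psi_continuous: "continuous_on UNIV \<psi>" "continuous_on UNIV \<psi>'"
  by (auto intro: smooth_fun_continuous smooth smooth_psi)

lemma fwd_continuous: "continuous_on UNIV (fwd :: 'a::euclidean_space \<times> real \<Rightarrow> _)"
  and bwd_continuous: "continuous_on UNIV (bwd :: 'a::euclidean_space \<times> real \<Rightarrow> _)"
  unfolding fwd_def bwd_def
  by (intro continuous_intros continuous_on_compose2[OF psi_continuous(1)] continuous_on_compose2[OF phi_continuous]; simp)+

lemma borel_meas [measurable]:
  "\<psi> \<in> borel_measurable borel" "\<psi>' \<in> borel_measurable borel" "\<phi> \<in> borel_measurable borel"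
  "(fwd :: 'a::euclidean_space \<times> real \<Rightarrow> _) \<in> borel_measurable borel"
  "(bwd :: 'a::euclidean_space \<times> real \<Rightarrow> _) \<in> borel_measurable borel"
  by (intro borel_measurable_continuous_onI psi_continuous phi_continuous fwd_continuous bwd_continuous)+

lemma psi'_snd_meas [measurable]:
  "(\<lambda>z :: 'a::euclidean_space \<times> real. \<psi>' (snd z)) \<in> borel_measurable borel"
  by (rule measurable_compose[OF borel_measurable_fst_snd(2) borel_meas(2)])

text \<open>The substitution rule, verified on boxes: Tonelli separates space from time, and in time
  it is the fundamental theorem of calculus for \<psi> between \<phi> l2 and \<phi> u2.\<close>

lemma lborel_eq: "(lborel :: ('a::euclidean_space \<times> real) measure)
    = distr (density lborel (\<lambda>z. ennreal (\<psi>' (snd z)))) borel fwd"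
proof (rule lborel_eqI)
  fix l u :: "'a \<times> real" assume le: "\<And>b. b \<in> Basis \<Longrightarrow> l \<bullet> b \<le> u \<bullet> b"
  obtain l1 l2 where l: "l = (l1, l2)" by (rule prod.exhaust)
  obtain u1 u2 where u: "u = (u1, u2)" by (rule prod.exhaust)
  note lu = l u
  have l2u2: "l2 \<le> u2" using le[of "(0, 1)"] by (simp add: lu Basis_prod_def)
  have phile: "\<phi> l2 \<le> \<phi> u2" using l2u2 phi_less_iff[of u2 l2] by linarith
  have box: "box l u = box l1 u1 \<times> {l2<..<u2}"
    by (auto simp: lu mem_box Basis_prod_def)
  have vim: "fwd -` box l u = box l1 u1 \<times> {\<phi> l2<..<\<phi> u2}"
  proof -
    have "l2 < \<psi> s \<longleftrightarrow> \<phi> l2 < s" "\<psi> s < u2 \<longleftrightarrow> s < \<phi> u2" for s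
      using phi_less_iff[of l2 "\<psi> s"] phi_less_iff[of "\<psi> s" u2] by (simp_all add: inv)
    then show ?thesis by (auto simp: box fwd_def)
  qed
  have mI: "(\<lambda>z. ennreal (\<psi>' (snd z)) * indicator (box l1 u1 \<times> {\<phi> l2<..<\<phi> u2}) z) \<in> borel_measurable borel"
    using measurable_compose[OF psi'_snd_meas measurable_ennreal]
    by (intro borel_measurable_times_ennreal borel_measurable_indicator borel_Times) auto
  have "emeasure (distr (density lborel (\<lambda>z. ennreal (\<psi>' (snd z)))) borel fwd) (box l u)
    = emeasure (density lborel (\<lambda>z. ennreal (\<psi>' (snd z)))) (fwd -` box l u)"
    by (subst emeasure_distr) auto
  also have "\<dots> = (\<integral>\<^sup>+z. ennreal (\<psi>' (snd z)) * indicator (box l1 u1 \<times> {\<phi> l2<..<\<phi> u2}) z \<partial>lborel)"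
    unfolding vim by (rule emeasure_density) (auto intro!: borel_Times measurable_compose[OF psi'_snd_meas])
  also have "\<dots> = (\<integral>\<^sup>+x. \<integral>\<^sup>+s. ennreal (\<psi>' s) * indicator (box l1 u1 \<times> {\<phi> l2<..<\<phi> u2}) (x, s) \<partial>lborel \<partial>lborel)"
    using lborel.nn_integral_fst[of "\<lambda>z. ennreal (\<psi>' (snd z)) * indicator (box l1 u1 \<times> {\<phi> l2<..<\<phi> u2}) z" "lborel :: 'a measure"]
    by (simp add: lborel_prod mI)
  also have "\<dots> = (\<integral>\<^sup>+x. indicator (box l1 u1) x * (\<integral>\<^sup>+s. ennreal (\<psi>' s) * indicator {\<phi> l2<..<\<phi> u2} s \<partial>lborel) \<partial>lborel)"
    by (intro nn_integral_cong) (auto simp: indicator_def)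
  also have "(\<integral>\<^sup>+s. ennreal (\<psi>' s) * indicator {\<phi> l2<..<\<phi> u2} s \<partial>lborel)
      = (\<integral>\<^sup>+s. ennreal (\<psi>' s) * indicator {\<phi> l2..\<phi> u2} s \<partial>lborel)"
  proof (rule nn_integral_cong_AE)
    have "AE s in lborel. s \<noteq> \<phi> l2" "AE s in lborel. s \<noteq> \<phi> u2" by (rule AE_lborel_singleton)+
    then show "AE s in lborel. ennreal (\<psi>' s) * indicator {\<phi> l2<..<\<phi> u2} s = ennreal (\<psi>' s) * indicator {\<phi> l2..\<phi> u2} s"
      by eventually_elim (auto simp: indicator_def)
  qed
  also have "\<dots> = ennreal (\<psi> (\<phi> u2) - \<psi> (\<phi> l2))"
    by (rule nn_integral_FTC_Icc) (use phile c in \<open>auto intro: DERIV_subset der less_imp_le less_le_trans\<close>)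
  also have "\<dots> = emeasure lborel {l2<..<u2}" using l2u2 by (simp add: inv)
  also have "(\<integral>\<^sup>+x. indicator (box l1 u1) x * emeasure lborel {l2<..<u2} \<partial>lborel)
      = emeasure lborel (box l1 u1) * emeasure lborel {l2<..<u2}"
    by (subst nn_integral_multc) auto
  also have "\<dots> = emeasure (lborel \<Otimes>\<^sub>M lborel) (box l1 u1 \<times> {l2<..<u2})"
    by (rule lborel.emeasure_pair_measure_Times[symmetric]) auto
  also have "\<dots> = emeasure lborel (box l u)" by (simp add: lborel_prod box)
  also have "\<dots> = (\<Prod>b\<in>Basis. (u - l) \<bullet> b)" by (rule emeasure_lborel_box[OF le])
  finally show "emeasure (distr (density lborel (\<lambda>z. ennreal (\<psi>' (snd z)))) borel fwd) (box l u) = ennreal (\<Prod>b\<in>Basis. (u - l) \<bullet> b)" .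
qed simp

lemma nn_integral_borel:
  fixes f :: "'a::euclidean_space \<times> real \<Rightarrow> ennreal"
  assumes [measurable]: "f \<in> borel_measurable borel"
  shows "(\<integral>\<^sup>+z. f z \<partial>lborel) = (\<integral>\<^sup>+z. ennreal (\<psi>' (snd z)) * f (fwd z) \<partial>lborel)"
proof -
  have "(\<integral>\<^sup>+z. f z \<partial>lborel) = (\<integral>\<^sup>+z. f z \<partial>distr (density lborel (\<lambda>z. ennreal (\<psi>' (snd z)))) borel fwd)"
    using lborel_eq[where 'a = 'a] by simp
  also have "\<dots> = (\<integral>\<^sup>+z. f (fwd z) \<partial>density lborel (\<lambda>z. ennreal (\<psi>' (snd z))))"
    by (rule nn_integral_distr) measurable
  also have "\<dots> = (\<integral>\<^sup>+z. ennreal (\<psi>' (snd z)) * f (fwd z) \<partial>lborel)"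
    using measurable_compose[OF psi'_snd_meas measurable_ennreal] measurable_compose[OF borel_meas(4) assms]
    by (intro nn_integral_density) auto
  finally show ?thesis .
qed

text \<open>The density \<psi>' is positive, so null sets are preserved in both directions. This
  carries the substitution rule from Borel functions to Lebesgue measurable ones.\<close>

lemma null_vimage:
  fixes N :: "('a::euclidean_space \<times> real) set"
  assumes N: "N \<in> null_sets lborel"
  shows "fwd -` N \<in> null_sets lborel" "bwd -` N \<in> null_sets lborel"
proof -
  have [measurable]: "N \<in> sets borel" using N by auto
  have fs: "fwd -` N \<in> sets borel" "bwd -` N \<in> sets borel"
    using measurable_sets[OF borel_meas(4), of N] measurable_sets[OF borel_meas(5), of N] by auto
  have "(\<integral>\<^sup>+z. ennreal (\<psi>' (snd z)) * indicator N (fwd z) \<partial>lborel) = (\<integral>\<^sup>+z. indicator N z \<partial>lborel)"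
    by (rule nn_integral_borel[symmetric]) measurable
  also have "\<dots> = 0" using N by (simp add: null_setsD1)
  finally have "AE z in lborel. ennreal (\<psi>' (snd z)) * indicator N (fwd z) = 0"
  proof (subst (asm) nn_integral_0_iff_AE)
    show "(\<lambda>z. ennreal (\<psi>' (snd z)) * indicator N (fwd z)) \<in> borel_measurable lborel"
      using measurable_compose[OF psi'_snd_meas measurable_ennreal]
        measurable_compose[OF borel_meas(4), of "indicator N" borel] by auto
  qed
  moreover have "\<not> \<psi>' s \<le> 0" for s using c(1) c(2)[of s] by linarith
  ultimately have "AE z in lborel. z \<notin> fwd -` N"
    by (auto elim!: eventually_mono simp: indicator_def ennreal_eq_0_iff split: if_splits)
  then show "fwd -` N \<in> null_sets lborel"
    using fs(1) by (subst (asm) AE_iff_null_sets[symmetric]) auto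
  have "emeasure lborel (bwd -` N) = (\<integral>\<^sup>+z. indicator N (bwd z) \<partial>lborel)"
    using fs(2) by (simp flip: nn_integral_indicator add: indicator_vimage o_def)
  also have "\<dots> = (\<integral>\<^sup>+z. ennreal (\<psi>' (snd z)) * indicator N (bwd (fwd z)) \<partial>lborel)"
    by (rule nn_integral_borel) measurable
  also have "\<dots> = (\<integral>\<^sup>+(z :: 'a \<times> real). 0 \<partial>lborel)"
    by (rule nn_integral_cong_AE) (use AE_not_in[OF N] in \<open>auto elim: eventually_mono\<close>)
  finally show "bwd -` N \<in> null_sets lborel" using fs(2) by (intro null_setsI) auto
qed

lemma lebesgue_measurable:
  "(fwd :: 'a::euclidean_space \<times> real \<Rightarrow> _) \<in> lebesgue \<rightarrow>\<^sub>M lebesgue"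
  "(bwd :: 'a::euclidean_space \<times> real \<Rightarrow> _) \<in> lebesgue \<rightarrow>\<^sub>M lebesgue"
  using lebesgue_measurable_vimage[OF borel_meas(4)] lebesgue_measurable_vimage[OF borel_meas(5)] null_vimage
  by blast+

lemma AE_fwd: "AE z in (lebesgue :: ('a::euclidean_space \<times> real) measure). P z \<Longrightarrow> AE z in lebesgue. P (fwd z)"
  by (rule AE_lebesgue_vimage[OF null_vimage(1)])

lemma nn_integral_lebesgue:
  fixes f :: "'a::euclidean_space \<times> real \<Rightarrow> ennreal"
  assumes f: "f \<in> borel_measurable lebesgue"
  shows "(\<integral>\<^sup>+z. f z \<partial>lebesgue) = (\<integral>\<^sup>+z. ennreal (\<psi>' (snd z)) * f (fwd z) \<partial>lebesgue)"
proof -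
  obtain f' where f': "f' \<in> borel_measurable lborel" "AE z in lborel. f z = f' z"
    using completion_ex_borel_measurable[OF f] by blast
  have ae: "AE z in lebesgue. f z = f' z" by (rule AE_completion[OF f'(2)])
  have "(\<integral>\<^sup>+z. f z \<partial>lebesgue) = (\<integral>\<^sup>+z. f' z \<partial>lborel)"
    using nn_integral_cong_AE[OF ae] by (simp add: nn_integral_completion)
  also have "\<dots> = (\<integral>\<^sup>+z. ennreal (\<psi>' (snd z)) * f' (fwd z) \<partial>lborel)"
    using f'(1) by (intro nn_integral_borel) simp
  also have "\<dots> = (\<integral>\<^sup>+z. ennreal (\<psi>' (snd z)) * f' (fwd z) \<partial>lebesgue)"
    by (simp add: nn_integral_completion)
  also have "\<dots> = (\<integral>\<^sup>+z. ennreal (\<psi>' (snd z)) * f (fwd z) \<partial>lebesgue)"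
    by (rule nn_integral_cong_AE) (use AE_fwd[OF ae] in \<open>eventually_elim, simp\<close>)
  finally show ?thesis .
qed

lemma lebesgue_eq: "(lebesgue :: ('a::euclidean_space \<times> real) measure)
    = distr (density lebesgue (\<lambda>z. ennreal (\<psi>' (snd z)))) lebesgue fwd"
proof (rule measure_eqI)
  fix A assume A: "A \<in> sets (lebesgue :: ('a \<times> real) measure)"
  have m: "(\<lambda>z :: 'a \<times> real. ennreal (\<psi>' (snd z))) \<in> borel_measurable lebesgue"
    using measurable_compose[OF psi'_snd_meas measurable_ennreal] by (intro measurable_completion) simp
  have v: "fwd -` A \<in> sets lebesgue" using measurable_sets[OF lebesgue_measurable(1) A] by simp
  have fm: "fwd \<in> density lebesgue (\<lambda>z :: 'a \<times> real. ennreal (\<psi>' (snd z))) \<rightarrow>\<^sub>M lebesgue"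
    using lebesgue_measurable(1) by simp
  have "emeasure lebesgue A = (\<integral>\<^sup>+z. ennreal (\<psi>' (snd z)) * indicator A (fwd z) \<partial>lebesgue)"
    using nn_integral_lebesgue[of "indicator A"] A by simp
  also have "\<dots> = (\<integral>\<^sup>+z. ennreal (\<psi>' (snd z)) * indicator (fwd -` A) z \<partial>lebesgue)"
    by (simp add: indicator_vimage o_def)
  also have "\<dots> = emeasure (density lebesgue (\<lambda>z. ennreal (\<psi>' (snd z)))) (fwd -` A)"
    by (rule emeasure_density[OF m v, symmetric])
  also have "\<dots> = emeasure (distr (density lebesgue (\<lambda>z. ennreal (\<psi>' (snd z)))) lebesgue fwd) A"
    by (subst emeasure_distr[OF fm A]) simp
  finally show "emeasure lebesgue A = emeasure (distr (density lebesgue (\<lambda>z. ennreal (\<psi>' (snd z)))) lebesgue fwd) A" .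
qed simp

lemma integral_lebesgue:
  fixes f :: "'a::euclidean_space \<times> real \<Rightarrow> real"
  assumes f: "f \<in> borel_measurable lebesgue"
  shows "(LINT z|lebesgue. f z) = (LINT z|lebesgue. \<psi>' (snd z) * f (fwd z))"
    "integrable lebesgue f \<longleftrightarrow> integrable lebesgue (\<lambda>z. \<psi>' (snd z) * f (fwd z))"
proof -
  let ?d = "density lebesgue (\<lambda>z :: 'a \<times> real. ennreal (\<psi>' (snd z)))"
  have m: "(\<lambda>z :: 'a \<times> real. \<psi>' (snd z)) \<in> borel_measurable lebesgue"
    using psi'_snd_meas by (intro measurable_completion) simp
  have fm: "fwd \<in> ?d \<rightarrow>\<^sub>M lebesgue" using lebesgue_measurable(1) by simp
  have ff: "(\<lambda>z. f (fwd z)) \<in> borel_measurable lebesgue"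
    using measurable_compose[OF lebesgue_measurable(1) f] .
  have pos: "AE z in lebesgue. 0 \<le> \<psi>' (snd (z :: 'a \<times> real))" using c by (auto intro: order_trans[OF less_imp_le])
  have "(LINT z|lebesgue. f z) = (LINT z|distr ?d lebesgue fwd. f z)"
    using lebesgue_eq[where 'a = 'a] by simp
  also have "\<dots> = (LINT z|?d. f (fwd z))" by (rule integral_distr[OF fm f])
  also have "\<dots> = (LINT z|lebesgue. \<psi>' (snd z) * f (fwd z))"
    by (subst integral_density[OF ff m pos]) simp
  finally show "(LINT z|lebesgue. f z) = (LINT z|lebesgue. \<psi>' (snd z) * f (fwd z))" .
  have "integrable lebesgue f \<longleftrightarrow> integrable (distr ?d lebesgue fwd) f"
    using lebesgue_eq[where 'a = 'a] by simp
  also have "\<dots> \<longleftrightarrow> integrable ?d (\<lambda>z. f (fwd z))" by (rule integrable_distr_eq[OF fm f])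
  also have "\<dots> \<longleftrightarrow> integrable lebesgue (\<lambda>z. \<psi>' (snd z) * f (fwd z))"
    by (subst integrable_density[OF ff m pos]) simp
  finally show "integrable lebesgue f \<longleftrightarrow> integrable lebesgue (\<lambda>z. \<psi>' (snd z) * f (fwd z))" .
qed

end

section \<open>Weak derivatives under a change of time\<close>

context time_change
begin

lemma fwd_has_derivative:
  "((fwd :: 'a::euclidean_space \<times> real \<Rightarrow> _) has_derivative (\<lambda>h. (fst h, \<psi>' (snd z) * snd h))) (at z)"
  unfolding fwd_def
proof (rule has_derivative_Pair)
  show "(fst has_derivative fst) (at z)" by (intro bounded_linear_imp_has_derivative bounded_linear_fst)
  have "(\<psi> has_derivative (\<lambda>h. \<psi>' (snd z) * h)) (at (snd z))"
    using der[of "snd z"] by (simp add: has_field_derivative_def)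
  from has_derivative_compose[OF has_derivative_snd[OF has_derivative_ident] this]
  show "((\<lambda>z. \<psi> (snd z)) has_derivative (\<lambda>h. \<psi>' (snd z) * snd h)) (at z)" .
qed

lemma smooth_snd: "smooth_fun k \<Longrightarrow> smooth_fun (\<lambda>z :: 'a::euclidean_space \<times> real. k (snd z))"
  by (rule smooth_fun_compose[where p' = "\<lambda>_. snd"])
    (auto intro!: derivative_eq_intros smooth_fun_intros)

lemma smooth_fwd:
  assumes "smooth_fun (\<eta> :: 'a::euclidean_space \<times> real \<Rightarrow> real)"
  shows "smooth_fun (\<lambda>z. \<eta> (fwd z))"
proof (rule smooth_fun_compose[OF fwd_has_derivative _ assms])
  fix b c :: "'a \<times> real"
  have "smooth_fun (\<lambda>z :: 'a \<times> real. fst b \<bullet> fst c + (\<psi>' (snd z)) * (snd b * snd c))"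
    by (intro smooth_fun_intros smooth_snd smooth)
  then show "smooth_fun (\<lambda>z :: 'a \<times> real. (fst b, \<psi>' (snd z) * snd b) \<bullet> c)"
    by (simp add: inner_prod_def mult.assoc)
qed

lemma frechet_fwd:
  assumes "smooth_fun (\<eta> :: 'a::euclidean_space \<times> real \<Rightarrow> real)"
  shows "pd (0, 1) (\<lambda>z. \<eta> (fwd z)) z = \<psi>' (snd z) * pd (0, 1) \<eta> (fwd z)"
    "pd (b, 0) (\<lambda>z. \<eta> (fwd z) * \<psi>' (snd z)) z = pd (b, 0) \<eta> (fwd z) * \<psi>' (snd z)"
proof -
  have d: "((\<lambda>z. \<eta> (fwd z)) has_derivative (\<lambda>h. pd (fst h, \<psi>' (snd z) * snd h) \<eta> (fwd z))) (at z)"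
    by (rule has_derivative_compose[OF fwd_has_derivative smooth_fun_frechet(1)[OF assms]])
  have lin: "linear (frechet_derivative \<eta> (at (fwd z)))"
    using smooth_fun_frechet(1)[OF assms] by (rule has_derivative_linear)
  have "pd (0, 1) (\<lambda>z. \<eta> (fwd z)) z = pd (0, \<psi>' (snd z)) \<eta> (fwd z)"
    using fun_cong[OF frechet_derivative_at[OF d], of "(0, 1)"] by simp
  also have "\<dots> = \<psi>' (snd z) * pd (0, 1) \<eta> (fwd z)"
    using linear_cmul[OF lin, of "\<psi>' (snd z)" "(0, 1)"] by simp
  finally show "pd (0, 1) (\<lambda>z. \<eta> (fwd z)) z = \<psi>' (snd z) * pd (0, 1) \<eta> (fwd z)" .
  have d2: "((\<lambda>z :: 'a \<times> real. \<psi>' (snd z)) has_derivative (\<lambda>h. pd (snd h) \<psi>' (snd z))) (at z)"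
    by (rule has_derivative_compose[OF has_derivative_snd[OF has_derivative_ident] smooth_fun_frechet(1)[OF smooth]])
  have lin2: "linear (frechet_derivative \<psi>' (at (snd z)))"
    using smooth_fun_frechet(1)[OF smooth] by (rule has_derivative_linear)
  show "pd (b, 0) (\<lambda>z. \<eta> (fwd z) * \<psi>' (snd z)) z = pd (b, 0) \<eta> (fwd z) * \<psi>' (snd z)"
    using fun_cong[OF frechet_derivative_at[OF has_derivative_mult[OF d d2]], of "(b, 0)"] linear_0[OF lin2] by simp
qed

lemma open_bwd_vimage:
  fixes E :: "('a::euclidean_space \<times> real) set"
  shows "open E \<Longrightarrow> open (bwd -` E)"
  by (rule open_vimage[OF _ bwd_continuous])

lemma compact_bwd: "compact K \<Longrightarrow> compact (bwd ` (K :: ('a::euclidean_space \<times> real) set))"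
  by (rule compact_continuous_image[OF continuous_on_subset[OF bwd_continuous]]) auto

lemma mem_bwd_image: "z \<in> bwd ` K \<longleftrightarrow> fwd z \<in> K"
  by (metis fwd_bwd image_iff)

lemma test_fwd:
  fixes \<eta> k :: "'a::euclidean_space \<times> real \<Rightarrow> real"
  assumes \<eta>: "\<eta> \<in> test_functions (bwd -` E)" and k: "smooth_fun k"
  shows "(\<lambda>z. \<eta> (fwd z) * k z) \<in> test_functions E"
proof -
  obtain K where K: "compact K" "K \<subseteq> bwd -` E" "\<And>x. x \<notin> K \<Longrightarrow> \<eta> x = 0" "smooth_fun \<eta>"
    by (rule test_functionsE[OF \<eta>]) (rule that)
  show ?thesis
  proof (rule test_functionsI)
    show "smooth_fun (\<lambda>z. \<eta> (fwd z) * k z)" by (intro smooth_fun_intros smooth_fwd K k)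
    show "compact (bwd ` K)" by (rule compact_bwd[OF K(1)])
    show "bwd ` K \<subseteq> E" using K(2) by auto
    show "\<eta> (fwd x) * k x = 0" if "x \<notin> bwd ` K" for x
      using K(3) that by (simp add: mem_bwd_image)
  qed
qed

lemma loc_integrable_bwd:
  fixes u :: "'a::euclidean_space \<times> real \<Rightarrow> real"
  assumes E: "open E" and u: "loc_integrable E u"
  shows "loc_integrable (bwd -` E) (\<lambda>z. u (bwd z))"
  unfolding loc_integrable_def
proof (intro allI impI)
  fix K assume K: "compact K \<and> K \<subseteq> bwd -` E"
  have cK: "compact (bwd ` K)" using K compact_bwd by blast
  have sub: "bwd ` K \<subseteq> E" using K by auto
  let ?F = "\<lambda>z. indicator K z * u (bwd z)"
  have m: "?F \<in> borel_measurable lebesgue"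
  proof -
    have "(\<lambda>x. indicator E x * u x) \<in> borel_measurable lebesgue"
      using loc_integrable_measurable[OF E u] E by (simp add: borel_measurable_lebesgue_on_iff open_sets_lebesgue)
    from measurable_compose[OF lebesgue_measurable(2) this]
    have 1: "(\<lambda>z. indicator E (bwd z) * u (bwd z)) \<in> borel_measurable lebesgue" .
    have "K \<in> sets lebesgue" using K lmeasurable_compact by blast
    from borel_measurable_times[OF borel_measurable_indicator[OF this] 1]
    have "(\<lambda>z. indicator K z * (indicator E (bwd z) * u (bwd z))) \<in> borel_measurable lebesgue" .
    moreover have "(\<lambda>z. indicator K z * (indicator E (bwd z) * u (bwd z))) = ?F"
      using K by (auto simp: indicator_def fun_eq_iff)
    ultimately show ?thesis by simp
  qed
  have i: "integrable lebesgue (\<lambda>z. indicator (bwd ` K) z * u z)"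
    using u cK sub by (auto simp: loc_integrable_def set_integrable_def)
  have "integrable lebesgue (\<lambda>z. (indicator (bwd ` K) z * u z) * \<psi>' (snd z))"
  proof (rule integrable_mult_bounded[OF i])
    show "(\<lambda>z :: 'a \<times> real. \<psi>' (snd z)) \<in> borel_measurable lebesgue"
      using psi'_snd_meas by (intro measurable_completion) simp
    show "\<bar>\<psi>' (snd z)\<bar> \<le> C" for z :: "'a \<times> real"
      using c(1) c(2)[of "snd z"] C[of "snd z"] by linarith
  qed
  moreover have "(\<lambda>z. (indicator (bwd ` K) z * u z) * \<psi>' (snd z)) = (\<lambda>z. \<psi>' (snd z) * ?F (fwd z))"
    by (auto simp: fun_eq_iff indicator_def mem_bwd_image)
  ultimately have "integrable lebesgue ?F" using integral_lebesgue(2)[OF m] by simp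
  then show "set_integrable lebesgue K (\<lambda>z. u (bwd z))" by (simp add: set_integrable_def)
qed

text \<open>After substitution the Jacobian \<psi>' becomes a factor of the test function; it
  depends on time only and therefore commutes with derivatives in space.\<close>

lemma has_weak_partial_bwd_space:
  fixes u g :: "'a::euclidean_space \<times> real \<Rightarrow> real"
  assumes E: "open E" and w: "has_weak_partial E (b, 0) u g" and b: "b \<in> Basis"
  shows "has_weak_partial (bwd -` E) (b, 0) (\<lambda>z. u (bwd z)) (\<lambda>z. g (bwd z))"
proof -
  have b0: "(b, 0 :: real) \<in> Basis" using b by (simp add: Basis_prod_def)
  have l: "loc_integrable (bwd -` E) (\<lambda>z. u (bwd z))" "loc_integrable (bwd -` E) (\<lambda>z. g (bwd z))"
    using w by (auto simp: has_weak_partial_def intro: loc_integrable_bwd[OF E])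
  show ?thesis
  proof (rule has_weak_partialI[OF l b0])
    fix \<eta> :: "'a \<times> real \<Rightarrow> real" assume \<eta>: "\<eta> \<in> test_functions (bwd -` E)"
    obtain K where K: "compact K" "K \<subseteq> bwd -` E" "\<And>x. x \<notin> K \<Longrightarrow> \<eta> x = 0"
      "\<And>x b. x \<notin> K \<Longrightarrow> pd b \<eta> x = 0" "smooth_fun \<eta>"
      using test_functionsE[OF \<eta>] by blast
    have K4: "pd (b, 0) \<eta> x = 0" if "x \<notin> K" for x using that by (rule K(4))
    have m1: "(\<lambda>z. u (bwd z) * pd (b, 0) \<eta> z) \<in> borel_measurable lebesgue"
      by (rule borel_measurable_integrable, rule loc_integrable_mult_test(1)[OF l(1) K(1,2) smooth_fun_continuous_deriv[OF K(5) b0] K4])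
    have m2: "(\<lambda>z. g (bwd z) * \<eta> z) \<in> borel_measurable lebesgue"
      by (rule borel_measurable_integrable, rule loc_integrable_mult_test(1)[OF l(2) K(1,2) smooth_fun_continuous[OF K(5)] K(3)])
    have "(LINT z|lebesgue. u (bwd z) * pd (b, 0) \<eta> z)
      = (LINT z|lebesgue. u z * pd (b, 0) (\<lambda>z. \<eta> (fwd z) * \<psi>' (snd z)) z)"
      unfolding integral_lebesgue(1)[OF m1] frechet_fwd(2)[OF K(5)] by (simp add: mult_ac)
    also have "\<dots> = - (LINT z|lebesgue. g z * (\<eta> (fwd z) * \<psi>' (snd z)))"
      by (rule has_weak_partialD(3)[OF w test_fwd[OF \<eta> smooth_snd[OF smooth]] b0])
    also have "(LINT z|lebesgue. g z * (\<eta> (fwd z) * \<psi>' (snd z))) = (LINT z|lebesgue. g (bwd z) * \<eta> z)"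
      unfolding integral_lebesgue(1)[OF m2] by (simp add: mult_ac)
    finally show "(LINT z|lebesgue. u (bwd z) * pd (b, 0) \<eta> z) = - (LINT z|lebesgue. g (bwd z) * \<eta> z)" .
  qed
qed

lemma loc_integrable_time_factor:
  fixes g :: "'a::euclidean_space \<times> real \<Rightarrow> real"
  assumes E: "open E" and g: "loc_integrable E g"
  shows "loc_integrable E (\<lambda>z. g z / \<psi>' (\<phi> (snd z)))"
proof (rule loc_integrable_bound[OF E g])
  have "(\<lambda>z :: 'a \<times> real. \<psi>' (\<phi> (snd z))) \<in> borel_measurable (lebesgue_on E)"
    using measurable_compose[OF borel_measurable_fst_snd(2) measurable_compose[OF borel_meas(3) borel_meas(2)]]
    by (intro measurable_restrict_space1 measurable_completion) simp
  then show "(\<lambda>z. g z / \<psi>' (\<phi> (snd z))) \<in> borel_measurable (lebesgue_on E)"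
    by (rule borel_measurable_divide[OF loc_integrable_measurable[OF E g]])
  show "\<bar>g z / \<psi>' (\<phi> (snd z))\<bar> \<le> 0 + (1 / c) * \<bar>g z\<bar>" for z
  proof -
    have "\<bar>\<psi>' (\<phi> (snd z))\<bar> \<ge> c" "c > 0" using c(1) c(2)[of "\<phi> (snd z)"] by linarith+
    then have "\<bar>g z\<bar> / \<bar>\<psi>' (\<phi> (snd z))\<bar> \<le> \<bar>g z\<bar> / c" by (intro divide_left_mono) auto
    then show ?thesis by (simp add: abs_divide)
  qed
qed

text \<open>Here the Jacobian on the left is exactly the inner derivative of \<eta> composed with
  \<open>fwd\<close>, so the new test function carries no extra factor; on the right it cancels the
  division by \<psi>'.\<close>

lemma has_weak_partial_bwd_time:
  fixes u g :: "'a::euclidean_space \<times> real \<Rightarrow> real"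
  assumes E: "open E" and w: "has_weak_partial E (0, 1) u g"
  shows "has_weak_partial (bwd -` E) (0, 1) (\<lambda>z. u (bwd z)) (\<lambda>z. g (bwd z) / \<psi>' (\<phi> (snd z)))"
proof -
  have b0: "(0 :: 'a, 1 :: real) \<in> Basis" by (simp add: Basis_prod_def)
  have l: "loc_integrable (bwd -` E) (\<lambda>z. u (bwd z))" "loc_integrable (bwd -` E) (\<lambda>z. g (bwd z))"
    using w by (auto simp: has_weak_partial_def intro: loc_integrable_bwd[OF E])
  note l2 = loc_integrable_time_factor[OF open_bwd_vimage[OF E] l(2)]
  show ?thesis
  proof (rule has_weak_partialI[OF l(1) l2 b0])
    fix \<eta> :: "'a \<times> real \<Rightarrow> real" assume \<eta>: "\<eta> \<in> test_functions (bwd -` E)"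
    obtain K where K: "compact K" "K \<subseteq> bwd -` E" "\<And>x. x \<notin> K \<Longrightarrow> \<eta> x = 0"
      "\<And>x b. x \<notin> K \<Longrightarrow> pd b \<eta> x = 0" "smooth_fun \<eta>"
      using test_functionsE[OF \<eta>] by blast
    have K4: "pd (0, 1) \<eta> x = 0" if "x \<notin> K" for x using that by (rule K(4))
    have m1: "(\<lambda>z. u (bwd z) * pd (0, 1) \<eta> z) \<in> borel_measurable lebesgue"
      by (rule borel_measurable_integrable, rule loc_integrable_mult_test(1)[OF l(1) K(1,2) smooth_fun_continuous_deriv[OF K(5) b0] K4])
    have m2: "(\<lambda>z. g (bwd z) / \<psi>' (\<phi> (snd z)) * \<eta> z) \<in> borel_measurable lebesgue"
      by (rule borel_measurable_integrable, rule loc_integrable_mult_test(1)[OF l2 K(1,2) smooth_fun_continuous[OF K(5)] K(3)])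
    have "(LINT z|lebesgue. u (bwd z) * pd (0, 1) \<eta> z)
      = (LINT z|lebesgue. u z * pd (0, 1) (\<lambda>z. \<eta> (fwd z)) z)"
      unfolding integral_lebesgue(1)[OF m1] frechet_fwd(1)[OF K(5)] by (simp add: mult_ac)
    also have "\<dots> = - (LINT z|lebesgue. g z * \<eta> (fwd z))"
      using has_weak_partialD(3)[OF w test_fwd[OF \<eta> smooth_fun_intros(1)[of 1]] b0] by simp
    also have "(LINT z|lebesgue. g z * \<eta> (fwd z)) = (LINT z|lebesgue. g (bwd z) / \<psi>' (\<phi> (snd z)) * \<eta> z)"
    proof -
      have "\<psi>' s \<noteq> 0" for s using c(1) c(2)[of s] by linarith
      then have "\<psi>' (snd z) * (g (bwd (fwd z)) / \<psi>' (\<phi> (snd (fwd z))) * \<eta> (fwd z)) = g z * \<eta> (fwd z)" for z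
        by (simp add: fwd_def bwd_def inv)
      then show ?thesis unfolding integral_lebesgue(1)[OF m2] by simp
    qed
    finally show "(LINT z|lebesgue. u (bwd z) * pd (0, 1) \<eta> z)
      = - (LINT z|lebesgue. g (bwd z) / \<psi>' (\<phi> (snd z)) * \<eta> z)" .
  qed
qed

end

subsection \<open>Calculus in $L^2$ and $H^1$\<close>

text \<open>The squared L2 norm with values in \<open>ennreal\<close>, so that estimates and limits
  need no integrability side conditions.\<close>

definition sq_int :: "'a measure \<Rightarrow> ('a \<Rightarrow> real) \<Rightarrow> ennreal" where
  "sq_int M f = (\<integral>\<^sup>+ x. ennreal ((f x)\<^sup>2) \<partial>M)"

lemma L2_iff: "f \<in> L2 M \<longleftrightarrow> f \<in> borel_measurable M \<and> sq_int M f < \<infinity>"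
proof -
  have "integrable M (\<lambda>x. (f x)\<^sup>2) \<longleftrightarrow> sq_int M f < \<infinity>" if [measurable]: "f \<in> borel_measurable M"
    unfolding integrable_iff_bounded sq_int_def by simp
  then show ?thesis by (auto simp: L2_def)
qed

lemma sq_int_integral: "f \<in> L2 M \<Longrightarrow> sq_int M f = ennreal (LINT x|M. (f x)\<^sup>2)"
  unfolding sq_int_def by (rule nn_integral_eq_integral) (auto simp: L2_def)

lemma sq_int_cong_AE: "(AE x in M. f x = g x) \<Longrightarrow> sq_int M f = sq_int M g"
  unfolding sq_int_def by (rule nn_integral_cong_AE) (auto elim: eventually_mono)

lemma sq_int_mono:
  assumes "AE x in M. \<bar>f x\<bar> \<le> L * \<bar>g x\<bar>" "g \<in> borel_measurable M"
  shows "sq_int M f \<le> ennreal (L\<^sup>2) * sq_int M g"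
proof -
  have "sq_int M f \<le> (\<integral>\<^sup>+x. ennreal (L\<^sup>2) * ennreal ((g x)\<^sup>2) \<partial>M)"
    unfolding sq_int_def
  proof (rule nn_integral_mono_AE)
    show "AE x in M. ennreal ((f x)\<^sup>2) \<le> ennreal (L\<^sup>2) * ennreal ((g x)\<^sup>2)"
      using assms(1)
    proof eventually_elim
      case (elim x)
      then have "(\<bar>f x\<bar>)\<^sup>2 \<le> (L * \<bar>g x\<bar>)\<^sup>2" by (intro power_mono) auto
      then show ?case by (simp flip: ennreal_mult add: power_mult_distrib)
    qed
  qed
  also have "\<dots> = ennreal (L\<^sup>2) * sq_int M g"
    unfolding sq_int_def using assms(2) by (intro nn_integral_cmult) simp
  finally show ?thesis .
qed

lemma sq_int_lin:
  assumes [measurable]: "f \<in> borel_measurable M" "g \<in> borel_measurable M"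
  shows "sq_int M (\<lambda>x. c * f x + d * g x) \<le> ennreal (2 * c\<^sup>2) * sq_int M f + ennreal (2 * d\<^sup>2) * sq_int M g"
proof -
  have "sq_int M (\<lambda>x. c * f x + d * g x)
    \<le> (\<integral>\<^sup>+x. ennreal (2 * c\<^sup>2) * ennreal ((f x)\<^sup>2) + ennreal (2 * d\<^sup>2) * ennreal ((g x)\<^sup>2) \<partial>M)"
    unfolding sq_int_def
  proof (rule nn_integral_mono)
    fix x
    have "(c * f x + d * g x)\<^sup>2 \<le> 2 * c\<^sup>2 * (f x)\<^sup>2 + 2 * d\<^sup>2 * (g x)\<^sup>2"
      using zero_le_power2[of "c * f x - d * g x"] by (simp add: power2_eq_square algebra_simps)
    then show "ennreal ((c * f x + d * g x)\<^sup>2) \<le> ennreal (2 * c\<^sup>2) * ennreal ((f x)\<^sup>2) + ennreal (2 * d\<^sup>2) * ennreal ((g x)\<^sup>2)"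
      by (simp flip: ennreal_mult ennreal_plus)
  qed
  also have "\<dots> = ennreal (2 * c\<^sup>2) * sq_int M f + ennreal (2 * d\<^sup>2) * sq_int M g"
    unfolding sq_int_def by (simp add: nn_integral_add nn_integral_cmult)
  finally show ?thesis .
qed

lemma L2_lin: "f \<in> L2 M \<Longrightarrow> g \<in> L2 M \<Longrightarrow> (\<lambda>x. c * f x + d * g x) \<in> L2 M"
  using sq_int_lin[of f M g c d]
  by (auto simp: L2_iff ennreal_mult_less_top intro: le_less_trans)

lemma L2_diff: "f \<in> L2 M \<Longrightarrow> g \<in> L2 M \<Longrightarrow> (\<lambda>x. f x - g x) \<in> L2 M"
  using L2_lin[of f M g 1 "-1"] by simp

lemma L2_bound:
  assumes "g \<in> L2 M" "f \<in> borel_measurable M" "AE x in M. \<bar>f x\<bar> \<le> L * \<bar>g x\<bar>"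
  shows "f \<in> L2 M"
  using assms sq_int_mono[OF assms(3)] by (auto simp: L2_iff ennreal_mult_less_top intro: le_less_trans)

lemma sq_int_lin_tendsto:
  assumes "\<And>m. f m \<in> borel_measurable M" "\<And>m. g m \<in> borel_measurable M"
    and "(\<lambda>m. sq_int M (f m)) \<longlonglongrightarrow> 0" "(\<lambda>m. sq_int M (g m)) \<longlonglongrightarrow> 0"
  shows "(\<lambda>m. sq_int M (\<lambda>x. c * f m x + d * g m x)) \<longlonglongrightarrow> 0"
proof -
  have "(\<lambda>m. ennreal (2 * c\<^sup>2) * sq_int M (f m) + ennreal (2 * d\<^sup>2) * sq_int M (g m)) \<longlonglongrightarrow>
      ennreal (2 * c\<^sup>2) * 0 + ennreal (2 * d\<^sup>2) * 0"
    by (intro tendsto_add ennreal_tendsto_cmult assms) auto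
  then have 0: "(\<lambda>m. ennreal (2 * c\<^sup>2) * sq_int M (f m) + ennreal (2 * d\<^sup>2) * sq_int M (g m)) \<longlonglongrightarrow> 0" by simp
  show ?thesis
    by (rule tendsto_sandwich[OF _ _ tendsto_const 0]) (auto intro!: always_eventually sq_int_lin assms)
qed

lemma L2_lebesgue_AE:
  assumes f: "f \<in> L2 (lebesgue_on D)" and D: "D \<in> sets lebesgue"
    and ae: "AE x in lebesgue. x \<in> D \<longrightarrow> f x = g x"
  shows "g \<in> L2 (lebesgue_on D)"
proof -
  have e: "AE x in lebesgue. indicator D x * f x = indicator D x * g x"
    using ae by eventually_elim (auto simp: indicator_def)
  have "(\<lambda>x. indicator D x * f x) \<in> borel_measurable lebesgue"
    using f D by (simp add: L2_iff borel_measurable_lebesgue_on_iff)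
  from borel_measurable_AE[OF this e] have "g \<in> borel_measurable (lebesgue_on D)"
    using D by (simp add: borel_measurable_lebesgue_on_iff)
  moreover have "AE x in lebesgue_on D. f x = g x" using ae D by (simp add: AE_lebesgue_on_iff)
  note sq_int_cong_AE[OF this]
  ultimately show ?thesis using f by (simp add: L2_iff)
qed

lemma H1_weak_partial:
  assumes "u \<in> H1 D" "b \<in> Basis" "open D"
  shows "has_weak_partial D b u (weak_partial D b u)" "weak_partial D b u \<in> L2 (lebesgue_on D)"
proof -
  obtain g where g: "g \<in> L2 (lebesgue_on D)" "has_weak_partial D b u g"
    using assms by (auto simp: H1_def)
  show "has_weak_partial D b u (weak_partial D b u)"
    using g(2) by (rule has_weak_partial_weak_partial)
  have "AE x in lebesgue. x \<in> D \<longrightarrow> g x = weak_partial D b u x"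
    using weak_partial_AE_eq[OF g(2) assms(3,2)] by eventually_elim auto
  then show "weak_partial D b u \<in> L2 (lebesgue_on D)"
    by (rule L2_lebesgue_AE[OF g(1) open_sets_lebesgue[OF assms(3)]])
qed

lemma H1_imp_L2: "u \<in> H1 D \<Longrightarrow> u \<in> L2 (lebesgue_on D)"
  by (simp add: H1_def)

lemma H1I:
  "u \<in> L2 (lebesgue_on D) \<Longrightarrow> (\<And>b. b \<in> Basis \<Longrightarrow> has_weak_partial D b u (g b)) \<Longrightarrow>
    (\<And>b. b \<in> Basis \<Longrightarrow> g b \<in> L2 (lebesgue_on D)) \<Longrightarrow> u \<in> H1 D"
  by (auto simp: H1_def)

lemma H1_lin:
  assumes "u \<in> H1 D" "v \<in> H1 D" "open D"
  shows "(\<lambda>x. c * u x + d * v x) \<in> H1 D"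
proof (rule H1I)
  show "(\<lambda>x. c * u x + d * v x) \<in> L2 (lebesgue_on D)" using assms by (intro L2_lin H1_imp_L2)
  fix b :: 'a assume b: "b \<in> Basis"
  show "has_weak_partial D b (\<lambda>x. c * u x + d * v x) (\<lambda>x. c * weak_partial D b u x + d * weak_partial D b v x)"
    by (rule has_weak_partial_lin[OF H1_weak_partial(1)[OF assms(1) b assms(3)] H1_weak_partial(1)[OF assms(2) b assms(3)] b])
  show "(\<lambda>x. c * weak_partial D b u x + d * weak_partial D b v x) \<in> L2 (lebesgue_on D)"
    using assms b by (intro L2_lin H1_weak_partial)
qed

lemma weak_partial_lin:
  assumes "u \<in> H1 D" "v \<in> H1 D" "open D" "b \<in> Basis"
  shows "AE x in lebesgue_on D. weak_partial D b (\<lambda>x. c * u x + d * v x) x = c * weak_partial D b u x + d * weak_partial D b v x"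
  using weak_partial_AE_eq[OF has_weak_partial_lin[OF H1_weak_partial(1)[OF assms(1,4,3)] H1_weak_partial(1)[OF assms(2,4,3)] assms(4)] assms(3,4)]
  by (simp add: AE_lebesgue_on_iff open_sets_lebesgue assms(3))

text \<open>G 0 = 0 gives |G u| <= L |u|, so square integrability is inherited whatever the measure
  of D.\<close>

lemma H1_chain:
  assumes u: "u \<in> H1 D" and D: "open D"
    and G: "\<And>y. (G has_real_derivative G' y) (at y)" "continuous_on UNIV G'" "\<And>y. \<bar>G' y\<bar> \<le> L" "G 0 = 0"
  shows "(\<lambda>x. G (u x)) \<in> H1 D"
    "b \<in> Basis \<Longrightarrow> AE x in lebesgue_on D. weak_partial D b (\<lambda>x. G (u x)) x = G' (u x) * weak_partial D b u x"
proof -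
  have Gm: "G \<in> borel_measurable borel" "G' \<in> borel_measurable borel"
    using DERIV_continuous_on[OF G(1)] G(2) by (auto intro!: borel_measurable_continuous_onI)
  have um: "u \<in> borel_measurable (lebesgue_on D)" using H1_imp_L2[OF u] by (simp add: L2_iff)
  have ch: "has_weak_partial D b (\<lambda>x. G (u x)) (\<lambda>x. G' (u x) * weak_partial D b u x)" if "b \<in> Basis" for b
    by (rule has_weak_partial_chain[OF D H1_weak_partial(1)[OF u that D] that G(1,2,3)])
  show "(\<lambda>x. G (u x)) \<in> H1 D"
  proof (rule H1I[OF _ ch])
    have "\<bar>G (u x)\<bar> \<le> L * \<bar>u x\<bar>" for x using Lipschitz_of_deriv[OF G(1,3), of "u x" 0] G(4) by simp
    then show "(\<lambda>x. G (u x)) \<in> L2 (lebesgue_on D)"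
      by (intro L2_bound[OF H1_imp_L2[OF u] measurable_compose[OF um Gm(1)]]) auto
    fix b :: 'a assume b: "b \<in> Basis"
    have wm: "weak_partial D b u \<in> borel_measurable (lebesgue_on D)"
      using H1_weak_partial(2)[OF u b D] by (simp add: L2_iff)
    show "(\<lambda>x. G' (u x) * weak_partial D b u x) \<in> L2 (lebesgue_on D)"
    proof (rule L2_bound[OF H1_weak_partial(2)[OF u b D]])
      show "(\<lambda>x. G' (u x) * weak_partial D b u x) \<in> borel_measurable (lebesgue_on D)"
        by (rule borel_measurable_times[OF measurable_compose[OF um Gm(2)] wm])
      show "AE x in lebesgue_on D. \<bar>G' (u x) * weak_partial D b u x\<bar> \<le> L * \<bar>weak_partial D b u x\<bar>"
        using G(3) by (intro AE_I2) (auto simp: abs_mult intro: mult_right_mono)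
    qed
  qed
  show "AE x in lebesgue_on D. weak_partial D b (\<lambda>x. G (u x)) x = G' (u x) * weak_partial D b u x" if "b \<in> Basis"
    using weak_partial_AE_eq[OF ch[OF that] D that] by (simp add: AE_lebesgue_on_iff open_sets_lebesgue D)
qed

text \<open>Convergence in \<open>H1_norm\<close>, split into components, with a difference of weak
  derivatives in place of the weak derivative of a difference.\<close>

definition H1_conv :: "'a::euclidean_space set \<Rightarrow> (nat \<Rightarrow> 'a \<Rightarrow> real) \<Rightarrow> ('a \<Rightarrow> real) \<Rightarrow> bool" where
  "H1_conv D \<phi> u \<longleftrightarrow> (\<forall>m. \<phi> m \<in> H1 D) \<and> u \<in> H1 D \<and>
     (\<lambda>m. sq_int (lebesgue_on D) (\<lambda>x. \<phi> m x - u x)) \<longlonglongrightarrow> 0 \<and>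
     (\<forall>b\<in>Basis. (\<lambda>m. sq_int (lebesgue_on D) (\<lambda>x. weak_partial D b (\<phi> m) x - weak_partial D b u x)) \<longlonglongrightarrow> 0)"

lemma tendsto_ennreal_0_iff:
  assumes "\<And>m :: nat. 0 \<le> f m"
  shows "(\<lambda>m. ennreal (f m)) \<longlonglongrightarrow> 0 \<longleftrightarrow> f \<longlonglongrightarrow> 0"
proof -
  have "(\<lambda>m. ennreal (f m)) \<longlonglongrightarrow> ennreal 0 \<longleftrightarrow> f \<longlonglongrightarrow> 0"
    by (rule tendsto_ennreal_iff) (use assms in auto)
  then show ?thesis by simp
qed

lemma H1_conv_iff:
  fixes u :: "'a::euclidean_space \<Rightarrow> real"
  assumes D: "open D" and \<phi>: "\<And>m. \<phi> m \<in> H1 D" and u: "u \<in> H1 D"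
  shows "H1_conv D \<phi> u \<longleftrightarrow> (\<lambda>m. H1_norm D (\<lambda>x. \<phi> m x - u x)) \<longlonglongrightarrow> 0"
proof -
  have dH: "(\<lambda>x. \<phi> m x - u x) \<in> H1 D" for m using H1_lin[OF \<phi>[of m] u D, of 1 "-1"] by simp
  define a where "a m = (LINT x|lebesgue_on D. (\<phi> m x - u x)\<^sup>2)" for m
  define e where "e b m = (LINT x|lebesgue_on D. (weak_partial D b (\<lambda>x. \<phi> m x - u x) x)\<^sup>2)" for b m
  have a: "sq_int (lebesgue_on D) (\<lambda>x. \<phi> m x - u x) = ennreal (a m)" for m
    unfolding a_def by (rule sq_int_integral[OF H1_imp_L2[OF dH]])
  have e: "sq_int (lebesgue_on D) (\<lambda>x. weak_partial D b (\<phi> m) x - weak_partial D b u x) = ennreal (e b m)"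
    if "b \<in> Basis" for b m
  proof -
    have "sq_int (lebesgue_on D) (\<lambda>x. weak_partial D b (\<phi> m) x - weak_partial D b u x)
      = sq_int (lebesgue_on D) (weak_partial D b (\<lambda>x. \<phi> m x - u x))"
      using weak_partial_lin[OF \<phi>[of m] u D that, of 1 "-1"]
      by (intro sq_int_cong_AE) (auto elim: eventually_mono)
    also have "\<dots> = ennreal (e b m)"
      unfolding e_def by (rule sq_int_integral[OF H1_weak_partial(2)[OF dH that D]])
    finally show ?thesis .
  qed
  have a0: "0 \<le> a m" and e0: "0 \<le> e b m" for m b by (auto simp: a_def e_def)
  have N: "H1_norm D (\<lambda>x. \<phi> m x - u x) = sqrt (a m + (\<Sum>b\<in>Basis. e b m))" for m
    by (simp add: H1_norm_def a_def e_def)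
  have "(\<lambda>m. sqrt (a m + (\<Sum>b\<in>Basis. e b m))) \<longlonglongrightarrow> 0 \<longleftrightarrow> a \<longlonglongrightarrow> 0 \<and> (\<forall>b\<in>Basis. e b \<longlonglongrightarrow> 0)"
  proof
    assume "(\<lambda>m. sqrt (a m + (\<Sum>b\<in>Basis. e b m))) \<longlonglongrightarrow> 0"
    then have "(\<lambda>m. (sqrt (a m + (\<Sum>b\<in>Basis. e b m)))\<^sup>2) \<longlonglongrightarrow> 0\<^sup>2" by (rule tendsto_power)
    then have s: "(\<lambda>m. a m + (\<Sum>b\<in>Basis. e b m)) \<longlonglongrightarrow> 0"
      by (simp add: a0 e0 sum_nonneg)
    have "a \<longlonglongrightarrow> 0"
      by (rule tendsto_sandwich[OF _ _ tendsto_const s]) (auto intro!: always_eventually a0 e0 sum_nonneg)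
    moreover have "e b \<longlonglongrightarrow> 0" if "b \<in> Basis" for b
    proof (rule tendsto_sandwich[OF _ _ tendsto_const s])
      have "e b m \<le> (\<Sum>b\<in>Basis. e b m)" for m by (rule member_le_sum[OF that]) (auto intro: e0)
      then show "\<forall>\<^sub>F m in sequentially. e b m \<le> a m + (\<Sum>b\<in>Basis. e b m)"
        using a0 by (intro always_eventually allI) (simp add: add_increasing)
    qed (auto intro!: always_eventually e0)
    ultimately show "a \<longlonglongrightarrow> 0 \<and> (\<forall>b\<in>Basis. e b \<longlonglongrightarrow> 0)" by blast
  next
    assume *: "a \<longlonglongrightarrow> 0 \<and> (\<forall>b\<in>Basis. e b \<longlonglongrightarrow> 0)"
    have "(\<lambda>m. \<Sum>b\<in>Basis. e b m) \<longlonglongrightarrow> (\<Sum>b\<in>(Basis :: 'a set). 0)"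
      using * by (intro tendsto_sum) auto
    then have "(\<lambda>m. sqrt (a m + (\<Sum>b\<in>Basis. e b m))) \<longlonglongrightarrow> sqrt (0 + (\<Sum>b\<in>(Basis :: 'a set). 0))"
      using * by (intro tendsto_intros) auto
    then show "(\<lambda>m. sqrt (a m + (\<Sum>b\<in>Basis. e b m))) \<longlonglongrightarrow> 0" by simp
  qed
  moreover have "(\<lambda>m. ennreal (a m)) \<longlonglongrightarrow> 0 \<longleftrightarrow> a \<longlonglongrightarrow> 0" by (rule tendsto_ennreal_0_iff) (rule a0)
  moreover have "(\<lambda>m. ennreal (e b m)) \<longlonglongrightarrow> 0 \<longleftrightarrow> e b \<longlonglongrightarrow> 0" for b by (rule tendsto_ennreal_0_iff) (rule e0)
  ultimately show ?thesis
    unfolding H1_conv_def using \<phi> u by (simp add: a e N)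
qed

lemma H1_conv_subseq: "H1_conv D \<phi> u \<Longrightarrow> strict_mono r \<Longrightarrow> H1_conv D (\<lambda>m. \<phi> (r m)) u"
  unfolding H1_conv_def
  using LIMSEQ_subseq_LIMSEQ[of "\<lambda>m. sq_int (lebesgue_on D) (\<lambda>x. \<phi> m x - u x)" 0 r]
    LIMSEQ_subseq_LIMSEQ[of "\<lambda>m. sq_int (lebesgue_on D) (\<lambda>x. weak_partial D b (\<phi> m) x - weak_partial D b u x)" 0 r for b]
  by (auto simp: o_def)

lemma H1_conv_lin:
  assumes 1: "H1_conv D \<phi> u" and 2: "H1_conv D \<theta> v" and D: "open D"
  shows "H1_conv D (\<lambda>m x. c * \<phi> m x + d * \<theta> m x) (\<lambda>x. c * u x + d * v x)"
proof -
  let ?M = "lebesgue_on D"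
  have H: "\<phi> m \<in> H1 D" "\<theta> m \<in> H1 D" "u \<in> H1 D" "v \<in> H1 D" for m
    using 1 2 by (auto simp: H1_conv_def)
  have m: "(\<lambda>x. f x - g x) \<in> borel_measurable ?M" if "f \<in> H1 D" "g \<in> H1 D" for f g
    using H1_imp_L2[OF that(1)] H1_imp_L2[OF that(2)] by (auto simp: L2_iff)
  have mw: "(\<lambda>x. weak_partial D b f x - weak_partial D b g x) \<in> borel_measurable ?M"
    if "f \<in> H1 D" "g \<in> H1 D" "b \<in> Basis" for f g b
    using H1_weak_partial(2)[OF that(1,3) D] H1_weak_partial(2)[OF that(2,3) D] by (auto simp: L2_iff)
  show ?thesis
    unfolding H1_conv_def
  proof (intro conjI allI ballI)
    show "(\<lambda>x. c * \<phi> m x + d * \<theta> m x) \<in> H1 D" "(\<lambda>x. c * u x + d * v x) \<in> H1 D" for m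
      using H1_lin[OF H(1,2) D] H1_lin[OF H(3,4) D] by auto
    have "(\<lambda>m. sq_int ?M (\<lambda>x. c * (\<phi> m x - u x) + d * (\<theta> m x - v x))) \<longlonglongrightarrow> 0"
      using 1 2 by (intro sq_int_lin_tendsto m H) (auto simp: H1_conv_def)
    then show "(\<lambda>m. sq_int ?M (\<lambda>x. c * \<phi> m x + d * \<theta> m x - (c * u x + d * v x))) \<longlonglongrightarrow> 0"
      by (simp add: algebra_simps)
    fix b :: 'a assume b: "b \<in> Basis"
    have "(\<lambda>m. sq_int ?M (\<lambda>x. c * (weak_partial D b (\<phi> m) x - weak_partial D b u x) + d * (weak_partial D b (\<theta> m) x - weak_partial D b v x))) \<longlonglongrightarrow> 0"
      using 1 2 b by (intro sq_int_lin_tendsto mw H) (auto simp: H1_conv_def)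
    moreover have "sq_int ?M (\<lambda>x. weak_partial D b (\<lambda>x. c * \<phi> m x + d * \<theta> m x) x - weak_partial D b (\<lambda>x. c * u x + d * v x) x)
      = sq_int ?M (\<lambda>x. c * (weak_partial D b (\<phi> m) x - weak_partial D b u x) + d * (weak_partial D b (\<theta> m) x - weak_partial D b v x))" for m
    proof (rule sq_int_cong_AE)
      show "AE x in ?M. weak_partial D b (\<lambda>x. c * \<phi> m x + d * \<theta> m x) x - weak_partial D b (\<lambda>x. c * u x + d * v x) x
        = c * (weak_partial D b (\<phi> m) x - weak_partial D b u x) + d * (weak_partial D b (\<theta> m) x - weak_partial D b v x)"
        using weak_partial_lin[OF H(1)[of m] H(2)[of m] D b, of c d] weak_partial_lin[OF H(3,4) D b, of c d]
        by eventually_elim (simp add: algebra_simps)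
    qed
    ultimately show "(\<lambda>m. sq_int ?M (\<lambda>x. weak_partial D b (\<lambda>x. c * \<phi> m x + d * \<theta> m x) x - weak_partial D b (\<lambda>x. c * u x + d * v x) x)) \<longlonglongrightarrow> 0"
      by simp
  qed
qed

text \<open>Only a subsequence is obtained: the factor G' composed with the approximations converges
  to G'(u) only where the functions themselves converge pointwise, and L2 convergence gives this
  almost everywhere along a subsequence.\<close>

lemma H1_conv_chain:
  assumes conv: "H1_conv D \<phi> u" and D: "open D"
    and G: "\<And>y. (G has_real_derivative G' y) (at y)" "continuous_on UNIV G'" "\<And>y. \<bar>G' y\<bar> \<le> L" "G 0 = 0"
  obtains r where "strict_mono r" "H1_conv D (\<lambda>m x. G (\<phi> (r m) x)) (\<lambda>x. G (u x))"
proof -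
  let ?M = "lebesgue_on D"
  have H: "\<phi> m \<in> H1 D" "u \<in> H1 D" for m using conv by (auto simp: H1_conv_def)
  have Gm: "G \<in> borel_measurable borel" "G' \<in> borel_measurable borel"
    using DERIV_continuous_on[OF G(1)] G(2) by (auto intro!: borel_measurable_continuous_onI)
  have m: "\<phi> m \<in> borel_measurable ?M" "u \<in> borel_measurable ?M" for m
    using H1_imp_L2[OF H(1)] H1_imp_L2[OF H(2)] by (auto simp: L2_iff)
  have mw: "weak_partial D b (\<phi> m) \<in> borel_measurable ?M" "weak_partial D b u \<in> borel_measurable ?M" if "b \<in> Basis" for m b
    using H1_weak_partial(2)[OF H(1) that D] H1_weak_partial(2)[OF H(2) that D] by (auto simp: L2_iff)
  have mG: "(\<lambda>x. G (\<phi> m x)) \<in> borel_measurable ?M" "(\<lambda>x. G' (\<phi> m x)) \<in> borel_measurable ?M"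
    "(\<lambda>x. G (u x)) \<in> borel_measurable ?M" "(\<lambda>x. G' (u x)) \<in> borel_measurable ?M" for m
    using measurable_compose[OF m(1) Gm(1)] measurable_compose[OF m(1) Gm(2)]
      measurable_compose[OF m(2) Gm(1)] measurable_compose[OF m(2) Gm(2)] by auto
  have dL: "(\<lambda>x. \<phi> m x - u x) \<in> L2 ?M" for m by (intro L2_diff H1_imp_L2 H)
  have i: "integrable ?M (\<lambda>x. (\<phi> m x - u x)\<^sup>2)" for m using dL[of m] by (simp add: L2_def)
  have "(\<lambda>m. ennreal (LINT x|?M. (\<phi> m x - u x)\<^sup>2)) \<longlonglongrightarrow> ennreal 0"
    using conv by (simp add: H1_conv_def flip: sq_int_integral[OF dL])
  then have "(\<lambda>m. LINT x|?M. norm ((\<phi> m x - u x)\<^sup>2)) \<longlonglongrightarrow> 0"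
    by (subst (asm) tendsto_ennreal_iff) (auto intro!: always_eventually)
  from tendsto_L1_AE_subseq[OF i this] obtain r where r: "strict_mono r"
    "AE x in ?M. (\<lambda>m. (\<phi> (r m) x - u x)\<^sup>2) \<longlonglongrightarrow> 0" by blast
  have ae: "AE x in ?M. (\<lambda>m. \<phi> (r m) x) \<longlonglongrightarrow> u x"
    using r(2)
  proof eventually_elim
    case (elim x)
    have "(\<lambda>m. sqrt ((\<phi> (r m) x - u x)\<^sup>2)) \<longlonglongrightarrow> sqrt 0" using elim by (rule tendsto_real_sqrt)
    then have "(\<lambda>m. \<bar>\<phi> (r m) x - u x\<bar>) \<longlonglongrightarrow> 0" by simp
    then show ?case by (simp add: tendsto_rabs_zero_iff LIM_zero_iff)
  qed
  have convr: "H1_conv D (\<lambda>m. \<phi> (r m)) u" by (rule H1_conv_subseq[OF conv r(1)])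
  show thesis
  proof (rule that[OF r(1)], unfold H1_conv_def, intro conjI allI ballI)
    show "(\<lambda>x. G (\<phi> (r m) x)) \<in> H1 D" "(\<lambda>x. G (u x)) \<in> H1 D" for m
      by (rule H1_chain(1)[OF H(1) D G] H1_chain(1)[OF H(2) D G])+
    show "(\<lambda>m. sq_int ?M (\<lambda>x. G (\<phi> (r m) x) - G (u x))) \<longlonglongrightarrow> 0"
    proof (rule tendsto_sandwich[OF _ _ tendsto_const])
      show "\<forall>\<^sub>F m in sequentially. sq_int ?M (\<lambda>x. G (\<phi> (r m) x) - G (u x))
          \<le> ennreal (L\<^sup>2) * sq_int ?M (\<lambda>x. \<phi> (r m) x - u x)"
        using m by (intro always_eventually allI sq_int_mono AE_I2 Lipschitz_of_deriv[OF G(1,3)]) auto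
      have "(\<lambda>m. ennreal (L\<^sup>2) * sq_int ?M (\<lambda>x. \<phi> (r m) x - u x)) \<longlonglongrightarrow> ennreal (L\<^sup>2) * 0"
        using convr by (intro ennreal_tendsto_cmult) (auto simp: H1_conv_def)
      then show "(\<lambda>m. ennreal (L\<^sup>2) * sq_int ?M (\<lambda>x. \<phi> (r m) x - u x)) \<longlonglongrightarrow> 0" by simp
    qed simp
    fix b :: 'a assume b: "b \<in> Basis"
    let ?w = "weak_partial D b"
    have t1: "(\<lambda>m. sq_int ?M (\<lambda>x. G' (\<phi> (r m) x) * (?w (\<phi> (r m)) x - ?w u x))) \<longlonglongrightarrow> 0"
    proof (rule tendsto_sandwich[OF _ _ tendsto_const])
      show "\<forall>\<^sub>F m in sequentially. sq_int ?M (\<lambda>x. G' (\<phi> (r m) x) * (?w (\<phi> (r m)) x - ?w u x))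
          \<le> ennreal (L\<^sup>2) * sq_int ?M (\<lambda>x. ?w (\<phi> (r m)) x - ?w u x)"
        using mw[OF b] G(3) by (intro always_eventually allI sq_int_mono AE_I2) (auto simp: abs_mult intro: mult_right_mono)
      have "(\<lambda>m. ennreal (L\<^sup>2) * sq_int ?M (\<lambda>x. ?w (\<phi> (r m)) x - ?w u x)) \<longlonglongrightarrow> ennreal (L\<^sup>2) * 0"
        using convr b by (intro ennreal_tendsto_cmult) (auto simp: H1_conv_def)
      then show "(\<lambda>m. ennreal (L\<^sup>2) * sq_int ?M (\<lambda>x. ?w (\<phi> (r m)) x - ?w u x)) \<longlonglongrightarrow> 0" by simp
    qed simp
    \<comment> \<open>The error in the derivative is split into G'(\<phi>) times the difference of
      derivatives, controlled by L, and this term, in which only G' varies. Pointwise convergence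
      along r and the majorant 2 L |\<partial>u| take care of it.\<close>
    let ?q = "\<lambda>m x. (G' (\<phi> (r m) x) - G' (u x)) * ?w u x"
    have mq: "?q m \<in> borel_measurable ?M" for m using mG mw[OF b] by (intro borel_measurable_times borel_measurable_diff)
    have qb: "\<bar>?q m x\<bar> \<le> (2 * L) * \<bar>?w u x\<bar>" for m x
    proof -
      have "\<bar>G' (\<phi> (r m) x) - G' (u x)\<bar> \<le> 2 * L" using G(3)[of "\<phi> (r m) x"] G(3)[of "u x"] by linarith
      then show ?thesis unfolding abs_mult by (rule mult_right_mono) simp
    qed
    have wL: "?w u \<in> L2 ?M" by (rule H1_weak_partial(2)[OF H(2) b D])
    have qL: "?q m \<in> L2 ?M" for m using qb[of m] by (intro L2_bound[OF wL mq]) auto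
    have "(\<lambda>m. LINT x|?M. (?q m x)\<^sup>2) \<longlonglongrightarrow> (LINT x|?M. (0 :: real))"
    proof (rule integral_dominated_convergence[where w = "\<lambda>x. (2 * L)\<^sup>2 * (?w u x)\<^sup>2"])
      show "AE x in ?M. (\<lambda>m. (?q m x)\<^sup>2) \<longlonglongrightarrow> 0"
        using ae
      proof eventually_elim
        case (elim x)
        have "isCont G' (u x)" using G(2) by (simp add: continuous_on_eq_continuous_at)
        then have "(\<lambda>m. G' (\<phi> (r m) x)) \<longlonglongrightarrow> G' (u x)" using elim by (rule isCont_tendsto_compose)
        then have "(\<lambda>m. ((G' (\<phi> (r m) x) - G' (u x)) * ?w u x)\<^sup>2) \<longlonglongrightarrow> ((G' (u x) - G' (u x)) * ?w u x)\<^sup>2"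
          by (intro tendsto_intros)
        then show ?case by simp
      qed
      show "AE x in ?M. norm ((?q m x)\<^sup>2) \<le> (2 * L)\<^sup>2 * (?w u x)\<^sup>2" for m
      proof (rule AE_I2)
        fix x
        have "\<bar>?q m x\<bar>\<^sup>2 \<le> ((2 * L) * \<bar>?w u x\<bar>)\<^sup>2" using qb[of m x] by (intro power_mono) auto
        then show "norm ((?q m x)\<^sup>2) \<le> (2 * L)\<^sup>2 * (?w u x)\<^sup>2" by (simp add: power_mult_distrib)
      qed
      show "integrable ?M (\<lambda>x. (2 * L)\<^sup>2 * (?w u x)\<^sup>2)" using wL by (simp add: L2_def)
      show "(\<lambda>x. (?q m x)\<^sup>2) \<in> borel_measurable ?M" for m using mq by (rule borel_measurable_power)
    qed simp
    then have t2: "(\<lambda>m. sq_int ?M (?q m)) \<longlonglongrightarrow> 0"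
      unfolding sq_int_integral[OF qL] by (subst tendsto_ennreal_0_iff) auto
    have "(\<lambda>m. sq_int ?M (\<lambda>x. 1 * (G' (\<phi> (r m) x) * (?w (\<phi> (r m)) x - ?w u x)) + 1 * ?q m x)) \<longlonglongrightarrow> 0"
      using mG mw[OF b] by (intro sq_int_lin_tendsto t1 t2 mq borel_measurable_times borel_measurable_diff)
    moreover have "sq_int ?M (\<lambda>x. ?w (\<lambda>x. G (\<phi> (r m) x)) x - ?w (\<lambda>x. G (u x)) x)
      = sq_int ?M (\<lambda>x. 1 * (G' (\<phi> (r m) x) * (?w (\<phi> (r m)) x - ?w u x)) + 1 * ?q m x)" for m
    proof (rule sq_int_cong_AE)
      show "AE x in ?M. ?w (\<lambda>x. G (\<phi> (r m) x)) x - ?w (\<lambda>x. G (u x)) x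
        = 1 * (G' (\<phi> (r m) x) * (?w (\<phi> (r m)) x - ?w u x)) + 1 * ?q m x"
        using H1_chain(2)[OF H(1) D G b, of "r m"] H1_chain(2)[OF H(2) D G b]
        by eventually_elim (simp add: algebra_simps)
    qed
    ultimately show "(\<lambda>m. sq_int ?M (\<lambda>x. ?w (\<lambda>x. G (\<phi> (r m) x)) x - ?w (\<lambda>x. G (u x)) x)) \<longlonglongrightarrow> 0" by simp
  qed
qed

subsection \<open>Calculus of traces\<close>

lemma has_trace_iff:
  assumes D: "open D"
  shows "has_trace D M j u g \<longleftrightarrow> g \<in> L2 M \<and>
    (\<exists>\<phi>. (\<forall>m. continuous_on (closure D) (\<phi> m)) \<and> H1_conv D \<phi> u \<and> (\<lambda>m. sq_int M (\<lambda>y. \<phi> m (j y) - g y)) \<longlonglongrightarrow> 0)"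
proof
  assume t: "has_trace D M j u g"
  then obtain \<phi> where \<phi>: "u \<in> H1 D" "g \<in> L2 M" "\<And>m. \<phi> m \<in> H1 D" "\<And>m. continuous_on (closure D) (\<phi> m)"
    "(\<lambda>m. H1_norm D (\<lambda>x. \<phi> m x - u x)) \<longlonglongrightarrow> 0" "(\<lambda>m. \<integral>\<^sup>+ y. ennreal ((\<phi> m (j y) - g y)\<^sup>2) \<partial>M) \<longlonglongrightarrow> 0"
    unfolding has_trace_def by blast
  show "g \<in> L2 M \<and> (\<exists>\<phi>. (\<forall>m. continuous_on (closure D) (\<phi> m)) \<and> H1_conv D \<phi> u \<and> (\<lambda>m. sq_int M (\<lambda>y. \<phi> m (j y) - g y)) \<longlonglongrightarrow> 0)"
  proof (intro conjI exI[of _ \<phi>] allI)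
    show "H1_conv D \<phi> u" using H1_conv_iff[OF D \<phi>(3,1)] \<phi>(5) by simp
    show "(\<lambda>m. sq_int M (\<lambda>y. \<phi> m (j y) - g y)) \<longlonglongrightarrow> 0" using \<phi>(6) by (simp add: sq_int_def)
  qed (rule \<phi>)+
next
  assume "g \<in> L2 M \<and> (\<exists>\<phi>. (\<forall>m. continuous_on (closure D) (\<phi> m)) \<and> H1_conv D \<phi> u \<and> (\<lambda>m. sq_int M (\<lambda>y. \<phi> m (j y) - g y)) \<longlonglongrightarrow> 0)"
  then obtain \<phi> where \<phi>: "g \<in> L2 M" "\<And>m. continuous_on (closure D) (\<phi> m)" "H1_conv D \<phi> u"
    "(\<lambda>m. sq_int M (\<lambda>y. \<phi> m (j y) - g y)) \<longlonglongrightarrow> 0" by blast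
  have H: "\<phi> m \<in> H1 D" "u \<in> H1 D" for m using \<phi>(3) by (auto simp: H1_conv_def)
  show "has_trace D M j u g"
    unfolding has_trace_def
  proof (intro conjI exI[of _ \<phi>] allI H \<phi>(1,2))
    show "(\<lambda>m. H1_norm D (\<lambda>x. \<phi> m x - u x)) \<longlonglongrightarrow> 0" using H1_conv_iff[OF D H] \<phi>(3) by simp
    show "(\<lambda>m. \<integral>\<^sup>+ y. ennreal ((\<phi> m (j y) - g y)\<^sup>2) \<partial>M) \<longlonglongrightarrow> 0" using \<phi>(4) by (simp add: sq_int_def)
  qed
qed

text \<open>M and j are arbitrary, so measurability of restricted continuous functions enters as a
  hypothesis. It is supplied by \<open>continuous_measurable_surface\<close> for the lateral
  boundary and by \<open>continuous_initial_measurable\<close> for the bottom of a cylinder.\<close>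

lemma has_trace_lin:
  fixes D :: "'a::euclidean_space set"
  assumes D: "open D" and m: "\<And>f :: 'a \<Rightarrow> real. continuous_on (closure D) f \<Longrightarrow> (\<lambda>y. f (j y)) \<in> borel_measurable M"
    and 1: "has_trace D M j u g" and 2: "has_trace D M j v k"
  shows "has_trace D M j (\<lambda>x. c * u x + d * v x) (\<lambda>y. c * g y + d * k y)"
proof -
  obtain \<phi> where \<phi>: "g \<in> L2 M" "\<And>m. continuous_on (closure D) (\<phi> m)" "H1_conv D \<phi> u"
    "(\<lambda>m. sq_int M (\<lambda>y. \<phi> m (j y) - g y)) \<longlonglongrightarrow> 0" using 1 unfolding has_trace_iff[OF D] by blast
  obtain \<theta> where \<theta>: "k \<in> L2 M" "\<And>m. continuous_on (closure D) (\<theta> m)" "H1_conv D \<theta> v"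
    "(\<lambda>m. sq_int M (\<lambda>y. \<theta> m (j y) - k y)) \<longlonglongrightarrow> 0" using 2 unfolding has_trace_iff[OF D] by blast
  have gm: "g \<in> borel_measurable M" "k \<in> borel_measurable M" using \<phi>(1) \<theta>(1) by (auto simp: L2_iff)
  show ?thesis
    unfolding has_trace_iff[OF D]
  proof (intro conjI exI[of _ "\<lambda>m x. c * \<phi> m x + d * \<theta> m x"] allI)
    show "(\<lambda>y. c * g y + d * k y) \<in> L2 M" by (rule L2_lin[OF \<phi>(1) \<theta>(1)])
    show "continuous_on (closure D) (\<lambda>x. c * \<phi> m x + d * \<theta> m x)" for m by (intro continuous_intros \<phi> \<theta>)
    show "H1_conv D (\<lambda>m x. c * \<phi> m x + d * \<theta> m x) (\<lambda>x. c * u x + d * v x)"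
      by (rule H1_conv_lin[OF \<phi>(3) \<theta>(3) D])
    have "(\<lambda>m. sq_int M (\<lambda>y. c * (\<phi> m (j y) - g y) + d * (\<theta> m (j y) - k y))) \<longlonglongrightarrow> 0"
      by (intro sq_int_lin_tendsto \<phi>(4) \<theta>(4) borel_measurable_diff gm m[OF \<phi>(2)] m[OF \<theta>(2)])
    then show "(\<lambda>m. sq_int M (\<lambda>y. c * \<phi> m (j y) + d * \<theta> m (j y) - (c * g y + d * k y))) \<longlonglongrightarrow> 0"
      by (simp add: algebra_simps)
  qed
qed

text \<open>Composing the approximating functions with G keeps them continuous up to the boundary.
  Passing to the subsequence of \<open>H1_conv_chain\<close> does not disturb the convergence of the
  boundary values, which G transports by its Lipschitz bound.\<close>

lemma has_trace_chain:
  fixes D :: "'a::euclidean_space set"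
  assumes D: "open D" and m: "\<And>f :: 'a \<Rightarrow> real. continuous_on (closure D) f \<Longrightarrow> (\<lambda>y. f (j y)) \<in> borel_measurable M"
    and t: "has_trace D M j u g"
    and G: "\<And>y. (G has_real_derivative G' y) (at y)" "continuous_on UNIV G'" "\<And>y. \<bar>G' y\<bar> \<le> L" "G 0 = 0"
  shows "has_trace D M j (\<lambda>x. G (u x)) (\<lambda>y. G (g y))"
proof -
  obtain \<phi> where \<phi>: "g \<in> L2 M" "\<And>m. continuous_on (closure D) (\<phi> m)" "H1_conv D \<phi> u"
    "(\<lambda>m. sq_int M (\<lambda>y. \<phi> m (j y) - g y)) \<longlonglongrightarrow> 0" using t unfolding has_trace_iff[OF D] by blast
  obtain r where r: "strict_mono r" "H1_conv D (\<lambda>m x. G (\<phi> (r m) x)) (\<lambda>x. G (u x))"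
    using H1_conv_chain[OF \<phi>(3) D G] .
  have Gc: "continuous_on UNIV G" using DERIV_continuous_on[OF G(1)] by auto
  have gm: "g \<in> borel_measurable M" using \<phi>(1) by (auto simp: L2_iff)
  have lip: "\<bar>G x - G y\<bar> \<le> L * \<bar>x - y\<bar>" for x y by (rule Lipschitz_of_deriv[OF G(1,3)])
  show ?thesis
    unfolding has_trace_iff[OF D]
  proof (intro conjI exI[of _ "\<lambda>m x. G (\<phi> (r m) x)"] allI r(2))
    have "\<bar>G (g x)\<bar> \<le> L * \<bar>g x\<bar>" for x using lip[of "g x" 0] G(4) by simp
    then show "(\<lambda>y. G (g y)) \<in> L2 M"
      by (intro L2_bound[OF \<phi>(1) measurable_compose[OF gm borel_measurable_continuous_onI[OF Gc]]]) auto
    show "continuous_on (closure D) (\<lambda>x. G (\<phi> (r m) x))" for m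
      by (rule continuous_on_compose2[OF Gc \<phi>(2)]) auto
    show "(\<lambda>m. sq_int M (\<lambda>y. G (\<phi> (r m) (j y)) - G (g y))) \<longlonglongrightarrow> 0"
    proof (rule tendsto_sandwich[OF _ _ tendsto_const])
      show "\<forall>\<^sub>F m in sequentially. sq_int M (\<lambda>y. G (\<phi> (r m) (j y)) - G (g y))
          \<le> ennreal (L\<^sup>2) * sq_int M (\<lambda>y. \<phi> (r m) (j y) - g y)"
        by (intro always_eventually allI sq_int_mono AE_I2 lip borel_measurable_diff m[OF \<phi>(2)] gm)
      have "(\<lambda>m. ennreal (L\<^sup>2) * sq_int M (\<lambda>y. \<phi> (r m) (j y) - g y)) \<longlonglongrightarrow> ennreal (L\<^sup>2) * 0"
        using LIMSEQ_subseq_LIMSEQ[OF \<phi>(4) r(1)] by (intro ennreal_tendsto_cmult) (auto simp: o_def)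
      then show "(\<lambda>m. ennreal (L\<^sup>2) * sq_int M (\<lambda>y. \<phi> (r m) (j y) - g y)) \<longlonglongrightarrow> 0" by simp
    qed simp
  qed
qed

lemma H1_AE:
  assumes u: "u \<in> H1 D" and D: "open D" and ae: "AE x in lebesgue. x \<in> D \<longrightarrow> u x = u' x"
  shows "u' \<in> H1 D"
proof (rule H1I[where g = "\<lambda>b. weak_partial D b u"])
  show "u' \<in> L2 (lebesgue_on D)" by (rule L2_lebesgue_AE[OF H1_imp_L2[OF u] open_sets_lebesgue[OF D] ae])
  show "has_weak_partial D b u' (weak_partial D b u)" if "b \<in> Basis" for b
    by (rule has_weak_partial_AE[OF H1_weak_partial(1)[OF u that D] D that ae]) simp
qed (rule H1_weak_partial(2)[OF u _ D])

lemma has_trace_AE: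
  assumes t: "has_trace D M j u g" and D: "open D"
    and u: "AE x in lebesgue. x \<in> D \<longrightarrow> u x = u' x"
    and g: "AE y in M. g y = g' y" "g' \<in> borel_measurable M"
  shows "has_trace D M j u' g'"
proof -
  obtain \<phi> where \<phi>: "g \<in> L2 M" "\<And>m. continuous_on (closure D) (\<phi> m)" "H1_conv D \<phi> u"
    "(\<lambda>m. sq_int M (\<lambda>y. \<phi> m (j y) - g y)) \<longlonglongrightarrow> 0" using t unfolding has_trace_iff[OF D] by blast
  have H: "u \<in> H1 D" using \<phi>(3) by (auto simp: H1_conv_def)
  have H': "u' \<in> H1 D" by (rule H1_AE[OF H D u])
  have u': "AE x in lebesgue_on D. u x = u' x" using u D by (simp add: AE_lebesgue_on_iff open_sets_lebesgue)
  have w: "AE x in lebesgue_on D. weak_partial D b u x = weak_partial D b u' x" if b: "b \<in> Basis" for b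
  proof -
    have "has_weak_partial D b u' (weak_partial D b u)"
      by (rule has_weak_partial_AE[OF H1_weak_partial(1)[OF H b D] D b u]) simp
    from has_weak_partial_unique[OF this H1_weak_partial(1)[OF H' b D] D b]
    show ?thesis using D by (simp add: AE_lebesgue_on_iff open_sets_lebesgue)
  qed
  show ?thesis
    unfolding has_trace_iff[OF D]
  proof (intro conjI exI[of _ \<phi>] allI \<phi>(2))
    show "g' \<in> L2 M" using g \<phi>(1) sq_int_cong_AE[OF g(1)] by (simp add: L2_iff)
    have "sq_int M (\<lambda>y. \<phi> m (j y) - g y) = sq_int M (\<lambda>y. \<phi> m (j y) - g' y)" for m
      by (rule sq_int_cong_AE) (use g(1) in eventually_elim, simp)
    then show "(\<lambda>m. sq_int M (\<lambda>y. \<phi> m (j y) - g' y)) \<longlonglongrightarrow> 0" using \<phi>(4) by simp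
    have "sq_int (lebesgue_on D) (\<lambda>x. \<phi> m x - u x) = sq_int (lebesgue_on D) (\<lambda>x. \<phi> m x - u' x)" for m
      by (rule sq_int_cong_AE) (use u' in eventually_elim, simp)
    moreover have "sq_int (lebesgue_on D) (\<lambda>x. weak_partial D b (\<phi> m) x - weak_partial D b u x)
      = sq_int (lebesgue_on D) (\<lambda>x. weak_partial D b (\<phi> m) x - weak_partial D b u' x)" if "b \<in> Basis" for m b
      by (rule sq_int_cong_AE) (use w[OF that] in eventually_elim, simp)
    ultimately show "H1_conv D \<phi> u'" using \<phi>(3) H' by (simp add: H1_conv_def)
  qed
qed

subsection \<open>Borel sets are measurable for the surface measure\<close>

text \<open>Caratheodory's criterion for metric outer measures. The points of A at distance at least
  q n from C are separated from those in C, so the metric property handles these two parts. It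
  remains to see that the rest of A - C is small. It is cut into rings R; rings whose indices differ
  by two are separated, so the sums over even and over odd rings are bounded by H A. Hence the
  series over all rings converges and its tails vanish.\<close>

lemma caratheodory_criterion:
  fixes H :: "'a::metric_space set \<Rightarrow> ennreal"
  assumes mono: "\<And>A B. A \<subseteq> B \<Longrightarrow> H A \<le> H B"
    and csub: "\<And>A :: nat \<Rightarrow> 'a set. H (\<Union>i. A i) \<le> (\<Sum>i. H (A i))"
    and empty: "H {} = 0"
    and metric: "\<And>A B r. 0 < r \<Longrightarrow> (\<And>x y. x \<in> A \<Longrightarrow> y \<in> B \<Longrightarrow> r \<le> dist x y) \<Longrightarrow> H A + H B \<le> H (A \<union> B)"
    and C: "closed C"
  shows "C \<in> lambda_system UNIV UNIV H"
proof -
  have sub2: "H (A \<union> B) \<le> H A + H B" for A B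
  proof -
    have "A \<union> B = (\<Union>i. binaryset A B i)" by (simp add: UN_binaryset_eq)
    then have "H (A \<union> B) \<le> (\<Sum>i. H (binaryset A B i))" using csub[of "binaryset A B"] by simp
    also have "\<dots> = H A + H B" by (rule suminf_binaryset_eq) (rule empty)
    finally show ?thesis .
  qed
  have main: "H (A \<inter> C) + H (A - C) \<le> H A" for A
  proof (cases "H A = \<infinity> \<or> C = {}")
    case True
    then show ?thesis by (auto simp: empty)
  next
    case False
    then have fin: "H A < \<infinity>" and ne: "C \<noteq> {}" by (auto simp: top.not_eq_extremum)
    define q where "q n = inverse (real (Suc n))" for n
    have q: "q n > 0" "q (Suc n) < q n" for n by (auto simp: q_def)
    define K where "K n = {x \<in> A. q n \<le> infdist x C}" for n
    define R where "R n = K (Suc n) - K n" for n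
    have Kmono: "K n \<subseteq> K (Suc n)" for n using q(2)[of n] by (auto simp: K_def)
    have KA: "K n \<subseteq> A" for n by (auto simp: K_def)
    have K1: "H (A \<inter> C) + H (K n) \<le> H A" for n
    proof -
      have "H (A \<inter> C) + H (K n) \<le> H ((A \<inter> C) \<union> K n)"
      proof (rule metric[OF q(1)[of n]])
        fix x y assume "x \<in> A \<inter> C" "y \<in> K n"
        then show "q n \<le> dist x y"
          using infdist_le[of x C y] by (auto simp: K_def dist_commute)
      qed
      also have "\<dots> \<le> H A" by (rule mono) (auto simp: K_def)
      finally show ?thesis .
    qed
    have Kinc: "K a \<subseteq> K b" if "a \<le> b" for a b
      using Kmono that by (rule lift_Suc_mono_le)
    \<comment> \<open>The distance to C is 1-Lipschitz, so points of K p and points of A outside K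
      (Suc p) are at least q p - q (Suc p) apart.\<close>
    have step: "H U + H V \<le> H (U \<union> V)" if U: "U \<subseteq> K p" and V: "V \<subseteq> A - K (Suc p)" for U V p
    proof (rule metric)
      show "0 < q p - q (Suc p)" using q(2)[of p] by linarith
      fix x y assume x: "x \<in> U" and y: "y \<in> V"
      have "x \<in> K p" "y \<in> A" "y \<notin> K (Suc p)" using U V x y by blast+
      then have "q p \<le> infdist x C" "infdist y C < q (Suc p)" by (auto simp: K_def)
      moreover have "infdist x C \<le> infdist y C + dist x y" by (rule infdist_triangle)
      ultimately show "q p - q (Suc p) \<le> dist x y" by linarith
    qed
    \<comment> \<open>Between two rings of equal parity lies a whole ring, which provides the gap
      required by \<open>step\<close>.\<close>
    have sums: "(\<Sum>k<n. H (R (2 * k + j))) \<le> H (\<Union>k<n. R (2 * k + j))" for n j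
    proof (induction n)
      case 0
      show ?case by simp
    next
      case (Suc n)
      let ?U = "\<Union>k<n. R (2 * k + j)"
      have "(\<Sum>k<Suc n. H (R (2 * k + j))) \<le> H ?U + H (R (2 * n + j))"
        using Suc.IH by (simp add: add_right_mono)
      also have "\<dots> \<le> H (?U \<union> R (2 * n + j))"
      proof (cases "n = 0")
        case True
        then show ?thesis by (simp add: empty)
      next
        case False
        then obtain n' where n': "n = Suc n'" using not0_implies_Suc by blast
        show ?thesis
        proof (rule step[of _ "Suc (2 * n' + j)"])
          show "?U \<subseteq> K (Suc (2 * n' + j))"
          proof (rule UN_least)
            fix k assume "k \<in> {..<n}"
            then have "Suc (2 * k + j) \<le> Suc (2 * n' + j)" using n' by simp
            from Kinc[OF this] show "R (2 * k + j) \<subseteq> K (Suc (2 * n' + j))" unfolding R_def by blast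
          qed
          have "2 * n + j = Suc (Suc (2 * n' + j))" using n' by simp
          then show "R (2 * n + j) \<subseteq> A - K (Suc (Suc (2 * n' + j)))"
            unfolding R_def using KA by auto
        qed
      qed
      also have "?U \<union> R (2 * n + j) = (\<Union>k<Suc n. R (2 * k + j))"
        by (auto simp: less_Suc_eq)
      finally show ?case .
    qed
    have RA: "R k \<subseteq> A" for k using KA by (auto simp: R_def)
    have sumsA: "(\<Sum>k. H (R (2 * k + j))) \<le> H A" for j
    proof (rule suminf_le_const)
      show "(\<Sum>k<n. H (R (2 * k + j))) \<le> H A" for n
        using sums[of j n] mono[of "\<Union>k<n. R (2 * k + j)" A] RA by (meson UN_least order_trans)
    qed simp
    have "(\<Sum>k<n. H (R k)) \<le> H A + H A" for n
    proof -
      have "(\<Sum>k<n. H (R k)) \<le> (\<Sum>k<2 * n. H (R k))" by (rule sum_mono2) auto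
      also have "\<dots> = (\<Sum>k<n. H (R (2 * k + 0))) + (\<Sum>k<n. H (R (2 * k + 1)))"
        by (induction n) (auto simp: ac_simps)
      also have "\<dots> \<le> H A + H A"
        using sum_le_suminf[of "\<lambda>k. H (R (2 * k + 0))" "{..<n}"] sum_le_suminf[of "\<lambda>k. H (R (2 * k + 1))" "{..<n}"]
          sumsA[of 0] sumsA[of 1]
        by (intro add_mono) (auto intro: order_trans)
      finally show ?thesis .
    qed
    then have "(\<Sum>k. H (R k)) \<le> H A + H A" by (intro suminf_le_const) auto
    also have "\<dots> < \<infinity>" using fin by (simp add: ennreal_add_eq_top top.not_eq_extremum)
    finally have S: "(\<Sum>k. H (R k)) < \<infinity>" .
    \<comment> \<open>Since C is closed, every point of A - C has positive distance from C and lies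
      in K n or in a later ring.\<close>
    have tail: "H (A - C) \<le> H (K n) + (\<Sum>k. H (R (k + n)))" for n
    proof -
      have "A - C \<subseteq> K n \<union> (\<Union>k. R (k + n))"
      proof
        fix x assume x: "x \<in> A - C"
        then have "infdist x C > 0"
          using in_closed_iff_infdist_zero[OF C ne] infdist_nonneg[of x C] by (metis DiffD2 less_eq_real_def)
        then obtain m where m: "q m < infdist x C"
          using reals_Archimedean[of "infdist x C"] by (auto simp: q_def)
        then have "x \<in> K m" using x by (simp add: K_def)
        then have ex: "\<exists>m. x \<in> K m" by blast
        define l where "l = (LEAST m. x \<in> K m)"
        have l: "x \<in> K l" unfolding l_def using ex by (rule LeastI_ex)
        show "x \<in> K n \<union> (\<Union>k. R (k + n))"
        proof (cases "l \<le> n")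
          case True
          have "incseq K" using Kmono by (rule incseq_SucI)
          then show ?thesis using l True by (auto dest: incseqD)
        next
          case False
          then obtain p where p: "l = Suc p" "n \<le> p" by (cases l) auto
          have "x \<notin> K p" using not_less_Least[of p "\<lambda>m. x \<in> K m"] p by (simp flip: l_def)
          then have "x \<in> R ((p - n) + n)" using l p by (simp add: R_def)
          then show ?thesis by blast
        qed
      qed
      then have "H (A - C) \<le> H (K n \<union> (\<Union>k. R (k + n)))" by (rule mono)
      also have "\<dots> \<le> H (K n) + H (\<Union>k. R (k + n))" by (rule sub2)
      also have "\<dots> \<le> H (K n) + (\<Sum>k. H (R (k + n)))" by (intro add_left_mono csub)
      finally show ?thesis .
    qed
    have "H (A \<inter> C) + H (A - C) \<le> H A + (\<Sum>k. H (R (k + n)))" for n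
    proof -
      have "H (A \<inter> C) + H (A - C) \<le> (H (A \<inter> C) + H (K n)) + (\<Sum>k. H (R (k + n)))"
        using tail[of n] by (simp add: add.assoc add_left_mono)
      also have "\<dots> \<le> H A + (\<Sum>k. H (R (k + n)))" by (intro add_right_mono K1)
      finally show ?thesis .
    qed
    moreover have "(\<lambda>n. H A + (\<Sum>k. H (R (k + n)))) \<longlonglongrightarrow> H A + 0"
    proof (intro tendsto_add tendsto_const)
      define f where "f k = enn2real (H (R k))" for k
      have Hf: "H (R k) = ennreal (f k)" for k
        using mono[OF RA[of k]] fin by (simp add: f_def order.strict_trans1)
      have sf: "summable f"
      proof (rule summable_suminf_not_top)
        show "0 \<le> f k" for k by (simp add: f_def)
        show "(\<Sum>k. ennreal (f k)) \<noteq> top" using S unfolding Hf by auto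
      qed
      have "(\<lambda>n. \<Sum>k. f (k + n)) \<longlonglongrightarrow> 0" by (rule suminf_exist_split2[OF sf])
      then have "(\<lambda>n. ennreal (\<Sum>k. f (k + n))) \<longlonglongrightarrow> ennreal 0" by (rule tendsto_ennrealI)
      moreover have "(\<Sum>k. H (R (k + n))) = ennreal (\<Sum>k. f (k + n))" for n
        unfolding Hf by (rule suminf_ennreal2[OF _ summable_ignore_initial_segment[OF sf]]) (simp add: f_def)
      ultimately show "(\<lambda>n. \<Sum>k. H (R (k + n))) \<longlonglongrightarrow> 0" by simp
    qed
    ultimately show ?thesis
      using LIMSEQ_le_const[of "\<lambda>n. H A + (\<Sum>k. H (R (k + n)))" "H A + 0" "H (A \<inter> C) + H (A - C)"] by simp
  qed
  have "H (C \<inter> A) + H ((UNIV - C) \<inter> A) = H A" for A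
  proof (rule antisym)
    show "H (C \<inter> A) + H ((UNIV - C) \<inter> A) \<le> H A"
      using main[of A] by (simp add: Int_commute Diff_eq)
    have "A = (C \<inter> A) \<union> ((UNIV - C) \<inter> A)" by auto
    then show "H A \<le> H (C \<inter> A) + H ((UNIV - C) \<inter> A)" using sub2 by metis
  qed
  then show ?thesis by (simp add: lambda_system_def)
qed

section \<open>The Hausdorff outer measure is a metric outer measure\<close>

definition hausdorff_weight :: "nat \<Rightarrow> 'a::metric_space set \<Rightarrow> ennreal" where
  "hausdorff_weight d E = (if E = {} then 0 else ennreal (unit_ball_vol (real d) * (diameter E / 2) ^ d))"

definition fine_covers :: "real \<Rightarrow> 'a::metric_space set \<Rightarrow> (nat \<Rightarrow> 'a set) set" where
  "fine_covers \<delta> S = {E. S \<subseteq> (\<Union>m. E m) \<and> (\<forall>m. bounded (E m) \<and> diameter (E m) \<le> \<delta>)}"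

definition hausdorff_pre :: "nat \<Rightarrow> real \<Rightarrow> 'a::metric_space set \<Rightarrow> ennreal" where
  "hausdorff_pre d \<delta> S = (INF E\<in>fine_covers \<delta> S. \<Sum>m. hausdorff_weight d (E m))"

lemma hausdorff_outer_eq: "hausdorff_outer d S = (SUP \<delta>\<in>{0<..}. hausdorff_pre d \<delta> S)"
  unfolding hausdorff_outer_def hausdorff_pre_def hausdorff_weight_def fine_covers_def ..

lemma hausdorff_pre_mono: "A \<subseteq> B \<Longrightarrow> \<delta> \<le> \<delta>' \<Longrightarrow> hausdorff_pre d \<delta>' A \<le> hausdorff_pre d \<delta> B"
  unfolding hausdorff_pre_def by (rule INF_superset_mono) (auto simp: fine_covers_def intro: order_trans)

lemma hausdorff_pre_le_outer: "0 < \<delta> \<Longrightarrow> hausdorff_pre d \<delta> S \<le> hausdorff_outer d S"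
  unfolding hausdorff_outer_eq by (rule SUP_upper) simp

lemma hausdorff_outer_mono: "A \<subseteq> B \<Longrightarrow> hausdorff_outer d A \<le> hausdorff_outer d B"
  unfolding hausdorff_outer_eq by (rule SUP_mono) (use hausdorff_pre_mono in blast)

lemma hausdorff_outer_empty: "hausdorff_outer d ({} :: 'a::metric_space set) = 0"
proof -
  have "hausdorff_pre d \<delta> ({} :: 'a set) = 0" if "0 < \<delta>" for \<delta>
  proof -
    have "(\<lambda>_. {}) \<in> fine_covers \<delta> ({} :: 'a set)" using that by (simp add: fine_covers_def)
    then have "hausdorff_pre d \<delta> ({} :: 'a set) \<le> (\<Sum>m. hausdorff_weight d ({} :: 'a set))"
      unfolding hausdorff_pre_def by (rule INF_lower)
    then show ?thesis by (simp add: hausdorff_weight_def)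
  qed
  then show ?thesis unfolding hausdorff_outer_eq by (intro antisym SUP_least) auto
qed

lemma hausdorff_pre_csub:
  fixes A :: "nat \<Rightarrow> 'a::metric_space set"
  assumes \<delta>: "0 < \<delta>"
  shows "hausdorff_pre d \<delta> (\<Union>i. A i) \<le> (\<Sum>i. hausdorff_pre d \<delta> (A i))"
proof (cases "(\<Sum>i. hausdorff_pre d \<delta> (A i)) = \<infinity>")
  case False
  then have fin: "hausdorff_pre d \<delta> (A i) < \<infinity>" for i
    using ennreal_suminf_lessD[of "\<lambda>i. hausdorff_pre d \<delta> (A i)" \<infinity> i] by (simp add: top.not_eq_extremum)
  show ?thesis
  proof (rule ennreal_le_epsilon)
    fix e :: real assume e: "0 < e"
    \<comment> \<open>Covers that are optimal up to errors e / 2^(i + 1), which add up to e.\<close>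
    have "\<exists>E\<in>fine_covers \<delta> (A i). (\<Sum>m. hausdorff_weight d (E m)) < hausdorff_pre d \<delta> (A i) + ennreal (e * (1 / 2) ^ Suc i)" for i
    proof -
      have "hausdorff_pre d \<delta> (A i) < hausdorff_pre d \<delta> (A i) + ennreal (e * (1 / 2) ^ Suc i)"
      proof -
        obtain p where "hausdorff_pre d \<delta> (A i) = ennreal p" "0 \<le> p"
          using fin[of i] by (cases "hausdorff_pre d \<delta> (A i)") auto
        then show ?thesis using e by (simp add: ennreal_less_iff flip: ennreal_plus)
      qed
      then show ?thesis unfolding hausdorff_pre_def by (subst (asm) (1) INF_less_iff)
    qed
    then have "\<forall>i. \<exists>E. E \<in> fine_covers \<delta> (A i) \<and>
        (\<Sum>m. hausdorff_weight d (E m)) < hausdorff_pre d \<delta> (A i) + ennreal (e * (1 / 2) ^ Suc i)" by blast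
    from choice[OF this] obtain E where E': "\<forall>i. E i \<in> fine_covers \<delta> (A i) \<and>
        (\<Sum>m. hausdorff_weight d (E i m)) < hausdorff_pre d \<delta> (A i) + ennreal (e * (1 / 2) ^ Suc i)" ..
    then have E: "E i \<in> fine_covers \<delta> (A i)"
      "(\<Sum>m. hausdorff_weight d (E i m)) < hausdorff_pre d \<delta> (A i) + ennreal (e * (1 / 2) ^ Suc i)" for i
      by simp_all
    define E' where "E' k = (case prod_decode k of (i, m) \<Rightarrow> E i m)" for k
    have "E' \<in> fine_covers \<delta> (\<Union>i. A i)"
    proof -
      have "(\<Union>i. A i) \<subseteq> (\<Union>k. E' k)"
      proof
        fix x assume "x \<in> (\<Union>i. A i)"
        then obtain i where "x \<in> A i" by blast
        then obtain m where "x \<in> E i m" using E(1)[of i] by (auto simp: fine_covers_def)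
        then have "x \<in> E' (prod_encode (i, m))" by (simp add: E'_def)
        then show "x \<in> (\<Union>k. E' k)" by blast
      qed
      moreover have "bounded (E' k) \<and> diameter (E' k) \<le> \<delta>" for k
        using E(1) by (auto simp: E'_def fine_covers_def split: prod.split)
      ultimately show ?thesis by (simp add: fine_covers_def)
    qed
    then have "hausdorff_pre d \<delta> (\<Union>i. A i) \<le> (\<Sum>k. hausdorff_weight d (E' k))"
      unfolding hausdorff_pre_def by (rule INF_lower)
    also have "\<dots> = (\<Sum>i. \<Sum>m. hausdorff_weight d (E i m))"
      using suminf_ennreal_2dimen[of "\<lambda>i. \<Sum>m. hausdorff_weight d (E i m)" "\<lambda>(i, m). hausdorff_weight d (E i m)"]
      by (simp add: E'_def o_def split_beta')
    also have "\<dots> \<le> (\<Sum>i. hausdorff_pre d \<delta> (A i) + ennreal (e * (1 / 2) ^ Suc i))"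
      by (intro suminf_le less_imp_le E) auto
    also have "\<dots> = (\<Sum>i. hausdorff_pre d \<delta> (A i)) + (\<Sum>i. ennreal (e * (1 / 2) ^ Suc i))"
      by (rule suminf_add[symmetric]) auto
    also have "(\<Sum>i. ennreal (e * (1 / 2) ^ Suc i)) = ennreal e"
    proof -
      have "(\<lambda>i. e * (1 / 2) ^ Suc i) sums (e * 1)"
        by (intro sums_mult power_half_series)
      then show ?thesis using e by (intro suminf_ennreal_eq) auto
    qed
    finally show "hausdorff_pre d \<delta> (\<Union>i. A i) \<le> (\<Sum>i. hausdorff_pre d \<delta> (A i)) + ennreal e" .
  qed
qed simp

lemma hausdorff_outer_csub:
  fixes A :: "nat \<Rightarrow> 'a::metric_space set"
  shows "hausdorff_outer d (\<Union>i. A i) \<le> (\<Sum>i. hausdorff_outer d (A i))"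
  unfolding hausdorff_outer_eq[of d "\<Union>i. A i"]
proof (rule SUP_least)
  fix \<delta> :: real assume "\<delta> \<in> {0<..}"
  then have \<delta>: "0 < \<delta>" by simp
  have "hausdorff_pre d \<delta> (\<Union>i. A i) \<le> (\<Sum>i. hausdorff_pre d \<delta> (A i))" by (rule hausdorff_pre_csub[OF \<delta>])
  also have "\<dots> \<le> (\<Sum>i. hausdorff_outer d (A i))" by (intro suminf_le hausdorff_pre_le_outer \<delta>) auto
  finally show "hausdorff_pre d \<delta> (\<Union>i. A i) \<le> (\<Sum>i. hausdorff_outer d (A i))" .
qed

text \<open>A set of diameter at most \<delta> < r cannot meet both A and B, so every fine cover of
  the union splits into covers of A and of B that share no nonempty set. Discarded sets become {},
  whose weight is 0 even for d = 0.\<close>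

lemma hausdorff_pre_metric:
  fixes A B :: "'a::metric_space set"
  assumes sep: "\<And>x y. x \<in> A \<Longrightarrow> y \<in> B \<Longrightarrow> r \<le> dist x y" and \<delta>: "\<delta> < r" "0 < \<delta>"
  shows "hausdorff_pre d \<delta> A + hausdorff_pre d \<delta> B \<le> hausdorff_pre d \<delta> (A \<union> B)"
  unfolding hausdorff_pre_def[of d \<delta> "A \<union> B"]
proof (rule INF_greatest)
  fix E assume E: "E \<in> fine_covers \<delta> (A \<union> B)"
  let ?w = "hausdorff_weight d"
  define EA where "EA m = (if E m \<inter> A = {} then {} else E m)" for m
  define EB where "EB m = (if E m \<inter> B = {} then {} else E m)" for m
  have "EA \<in> fine_covers \<delta> A"
  proof -
    have "A \<subseteq> (\<Union>m. EA m)"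
    proof
      fix x assume x: "x \<in> A"
      then obtain m where "x \<in> E m" using E by (auto simp: fine_covers_def)
      with x have "x \<in> EA m" by (auto simp: EA_def)
      then show "x \<in> (\<Union>m. EA m)" by blast
    qed
    then show ?thesis using E \<delta> by (auto simp: fine_covers_def EA_def)
  qed
  then have "hausdorff_pre d \<delta> A \<le> (\<Sum>m. ?w (EA m))" unfolding hausdorff_pre_def by (rule INF_lower)
  moreover have "EB \<in> fine_covers \<delta> B"
  proof -
    have "B \<subseteq> (\<Union>m. EB m)"
    proof
      fix x assume x: "x \<in> B"
      then obtain m where "x \<in> E m" using E by (auto simp: fine_covers_def)
      with x have "x \<in> EB m" by (auto simp: EB_def)
      then show "x \<in> (\<Union>m. EB m)" by blast
    qed
    then show ?thesis using E \<delta> by (auto simp: fine_covers_def EB_def)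
  qed
  then have "hausdorff_pre d \<delta> B \<le> (\<Sum>m. ?w (EB m))" unfolding hausdorff_pre_def by (rule INF_lower)
  ultimately have "hausdorff_pre d \<delta> A + hausdorff_pre d \<delta> B \<le> (\<Sum>m. ?w (EA m)) + (\<Sum>m. ?w (EB m))"
    by (rule add_mono)
  also have "\<dots> = (\<Sum>m. ?w (EA m) + ?w (EB m))" by (rule suminf_add) auto
  also have "\<dots> \<le> (\<Sum>m. ?w (E m))"
  proof (intro suminf_le)
    fix m
    have "EA m = {} \<or> EB m = {}"
    proof (rule ccontr)
      assume "\<not> (EA m = {} \<or> EB m = {})"
      then obtain x y where xy: "x \<in> E m" "x \<in> A" "y \<in> E m" "y \<in> B"
        by (auto simp: EA_def EB_def split: if_splits)
      have "dist x y \<le> diameter (E m)" using E xy by (intro diameter_bounded_bound) (auto simp: fine_covers_def)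
      also have "\<dots> \<le> \<delta>" using E by (auto simp: fine_covers_def)
      finally show False using sep[OF xy(2,4)] \<delta> by linarith
    qed
    moreover have "?w (EA m) \<le> ?w (E m)" "?w (EB m) \<le> ?w (E m)"
      by (auto simp: EA_def EB_def hausdorff_weight_def)
    moreover have "?w ({} :: 'a set) = 0" by (simp add: hausdorff_weight_def)
    ultimately show "?w (EA m) + ?w (EB m) \<le> ?w (E m)" by (elim disjE) simp_all
  qed auto
  finally show "hausdorff_pre d \<delta> A + hausdorff_pre d \<delta> B \<le> (\<Sum>m. ?w (E m))" .
qed

lemma hausdorff_outer_metric:
  fixes A B :: "'a::metric_space set"
  assumes r: "0 < r" and sep: "\<And>x y. x \<in> A \<Longrightarrow> y \<in> B \<Longrightarrow> r \<le> dist x y"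
  shows "hausdorff_outer d A + hausdorff_outer d B \<le> hausdorff_outer d (A \<union> B)"
proof -
  have le: "hausdorff_pre d \<delta>1 A + hausdorff_pre d \<delta>2 B \<le> hausdorff_outer d (A \<union> B)"
    if "0 < \<delta>1" "0 < \<delta>2" for \<delta>1 \<delta>2
  proof -
    define \<delta> where "\<delta> = min (r / 2) (min \<delta>1 \<delta>2)"
    have \<delta>: "0 < \<delta>" "\<delta> < r" "\<delta> \<le> \<delta>1" "\<delta> \<le> \<delta>2" using that r by (auto simp: \<delta>_def)
    have "hausdorff_pre d \<delta>1 A + hausdorff_pre d \<delta>2 B \<le> hausdorff_pre d \<delta> A + hausdorff_pre d \<delta> B"
      using \<delta> by (intro add_mono hausdorff_pre_mono) auto
    also have "\<dots> \<le> hausdorff_pre d \<delta> (A \<union> B)" by (rule hausdorff_pre_metric[OF sep \<delta>(2,1)])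
    also have "\<dots> \<le> hausdorff_outer d (A \<union> B)" by (rule hausdorff_pre_le_outer[OF \<delta>(1)])
    finally show ?thesis .
  qed
  have ne: "{0::real<..} \<noteq> {}" by (auto intro: exI[of _ 1])
  have "hausdorff_pre d \<delta>1 A + hausdorff_outer d B \<le> hausdorff_outer d (A \<union> B)" if "0 < \<delta>1" for \<delta>1
  proof -
    have "hausdorff_outer d B + hausdorff_pre d \<delta>1 A = (SUP \<delta>2\<in>{0<..}. hausdorff_pre d \<delta>2 B + hausdorff_pre d \<delta>1 A)"
      unfolding hausdorff_outer_eq by (rule ennreal_SUP_add_left[symmetric, OF ne])
    also have "\<dots> \<le> hausdorff_outer d (A \<union> B)"
      using le[OF that] by (intro SUP_least) (simp add: add.commute)
    finally show ?thesis by (simp add: add.commute)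
  qed
  then have "(SUP \<delta>1\<in>{0<..}. hausdorff_pre d \<delta>1 A + hausdorff_outer d B) \<le> hausdorff_outer d (A \<union> B)"
    by (intro SUP_least) simp
  then show ?thesis unfolding hausdorff_outer_eq[of d A] using ennreal_SUP_add_left[OF ne] by metis
qed

lemma borel_sets_hausdorff:
  assumes "B \<in> sets (borel :: 'a::metric_space measure)"
  shows "B \<in> sets (hausdorff_measure d :: 'a measure)"
proof -
  let ?L = "lambda_system UNIV UNIV (hausdorff_outer d) :: 'a set set"
  have "C \<in> ?L" if "closed C" for C
    by (rule caratheodory_criterion[OF hausdorff_outer_mono hausdorff_outer_csub hausdorff_outer_empty
          hausdorff_outer_metric that])
  then have "Collect closed \<subseteq> ?L" by blast
  then have "sigma_sets UNIV (Collect closed) \<subseteq> sigma_sets UNIV ?L" by (rule sigma_sets_subseteq)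
  moreover have "B \<in> sigma_sets UNIV (Collect closed)"
    using assms by (simp add: borel_eq_closed sets_measure_of)
  moreover have "sets (hausdorff_measure d :: 'a measure) = sigma_sets UNIV ?L"
    unfolding hausdorff_measure_def by (rule sets_measure_of) simp
  ultimately show ?thesis by blast
qed

lemma continuous_measurable_surface:
  fixes f :: "'a::euclidean_space \<Rightarrow> real"
  assumes f: "continuous_on (closure D) f"
  shows "f \<in> borel_measurable (surface_measure D)"
proof -
  have "continuous_on (frontier D) f"
    by (rule continuous_on_subset[OF f]) (auto simp: frontier_def)
  then have m: "f \<in> borel_measurable (restrict_space borel (frontier D))"
    by (rule borel_measurable_continuous_on_restrict)
  have sp: "space (surface_measure D) = frontier D"
    by (simp add: surface_measure_def space_restrict_space hausdorff_measure_def)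
  show ?thesis
  proof (rule measurableI)
    fix B :: "real set" assume "B \<in> sets borel"
    from measurable_sets[OF m this]
    have "f -` B \<inter> frontier D \<in> sets (restrict_space borel (frontier D))"
      by (simp add: space_restrict_space)
    then obtain A where A: "A \<in> sets borel" "f -` B \<inter> frontier D = frontier D \<inter> A"
      unfolding sets_restrict_space by blast
    have "frontier D \<inter> A \<in> sets (surface_measure D)"
      unfolding surface_measure_def sets_restrict_space using borel_sets_hausdorff[OF A(1)] by blast
    then show "f -` B \<inter> space (surface_measure D) \<in> sets (surface_measure D)"
      unfolding sp using A(2) by simp
  qed simp
qed

subsection \<open>Functions on a space-time cylinder\<close>

abbreviation cyl :: "'a set \<Rightarrow> real \<Rightarrow> ('a \<times> real) set" where
  "cyl D T \<equiv> D \<times> {0<..<T}"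

lemma open_cyl: "open D \<Longrightarrow> open (cyl D T)"
  by (intro open_Times) auto

lemma nn_integral_pair_product:
  fixes h :: "'a::euclidean_space \<Rightarrow> ennreal" and k :: "'b::euclidean_space \<Rightarrow> ennreal"
  assumes h: "h \<in> borel_measurable lebesgue" and k: "k \<in> borel_measurable borel"
  shows "(\<integral>\<^sup>+z. h (fst z) * k (snd z) \<partial>lebesgue) = (\<integral>\<^sup>+x. h x \<partial>lebesgue) * (\<integral>\<^sup>+t. k t \<partial>lborel)"
proof -
  obtain h' where h': "h' \<in> borel_measurable lborel" "AE x in lborel. h x = h' x"
    using completion_ex_borel_measurable[OF h] by blast
  have h'b: "h' \<in> borel_measurable borel" using h'(1) by simp
  have m: "(\<lambda>z. h' (fst z) * k (snd z)) \<in> borel_measurable (lborel \<Otimes>\<^sub>M lborel)"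
    using h'b k by measurable
  have ae: "AE x in lebesgue. h x = h' x" by (rule AE_completion[OF h'(2)])
  have "(\<integral>\<^sup>+z. h (fst z) * k (snd z) \<partial>lebesgue) = (\<integral>\<^sup>+z. h' (fst z) * k (snd z) \<partial>lebesgue)"
    by (rule nn_integral_cong_AE) (use AE_lebesgue_fst[OF ae] in \<open>auto elim!: eventually_mono\<close>)
  also have "\<dots> = (\<integral>\<^sup>+z. h' (fst z) * k (snd z) \<partial>lborel)" by (rule nn_integral_completion)
  also have "\<dots> = (\<integral>\<^sup>+z. h' (fst z) * k (snd z) \<partial>(lborel \<Otimes>\<^sub>M lborel))" by (simp add: lborel_prod)
  also have "\<dots> = (\<integral>\<^sup>+x. \<integral>\<^sup>+t. h' x * k t \<partial>lborel \<partial>lborel)"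
    using lborel.nn_integral_fst[OF m] by simp
  also have "\<dots> = (\<integral>\<^sup>+x. h' x * (\<integral>\<^sup>+t. k t \<partial>lborel) \<partial>lborel)"
    using k by (intro nn_integral_cong nn_integral_cmult) simp
  also have "\<dots> = (\<integral>\<^sup>+x. h' x \<partial>lborel) * (\<integral>\<^sup>+t. k t \<partial>lborel)"
    by (rule nn_integral_multc[OF h'(1)])
  also have "(\<integral>\<^sup>+x. h' x \<partial>lborel) = (\<integral>\<^sup>+x. h x \<partial>lebesgue)"
    using nn_integral_cong_AE[OF ae] by (simp add: nn_integral_completion)
  finally show ?thesis .
qed

lemma sq_int_lebesgue_on:
  "S \<in> sets lebesgue \<Longrightarrow> sq_int (lebesgue_on S) f = (\<integral>\<^sup>+x. ennreal ((f x)\<^sup>2) * indicator S x \<partial>lebesgue)"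
  unfolding sq_int_def by (rule nn_integral_restrict_space) simp

lemma measurable_sq_indicator:
  fixes f :: "'a::euclidean_space \<Rightarrow> real"
  assumes f: "f \<in> borel_measurable (lebesgue_on S)" and S: "S \<in> sets lebesgue"
  shows "(\<lambda>x. ennreal ((f x)\<^sup>2) * indicator S x) \<in> borel_measurable lebesgue"
  using f S by (subst borel_measurable_restrict_space_iff_ennreal[symmetric]) auto

lemma sq_int_fst:
  fixes f :: "'a::euclidean_space \<Rightarrow> real"
  assumes f: "f \<in> borel_measurable (lebesgue_on D)" and D: "open D" and T: "0 < T"
  shows "sq_int (lebesgue_on (cyl D T)) (\<lambda>z. f (fst z)) = sq_int (lebesgue_on D) f * ennreal T"
proof -
  have Ds: "D \<in> sets lebesgue" "cyl D T \<in> sets lebesgue"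
    using D open_cyl[OF D] by (auto intro: open_sets_lebesgue)
  have "sq_int (lebesgue_on (cyl D T)) (\<lambda>z. f (fst z))
      = (\<integral>\<^sup>+z. (ennreal ((f (fst z))\<^sup>2) * indicator D (fst z)) * indicator {0<..<T} (snd z) \<partial>lebesgue)"
    unfolding sq_int_lebesgue_on[OF Ds(2)] by (rule nn_integral_cong) (auto simp: indicator_def)
  also have "\<dots> = sq_int (lebesgue_on D) f * (\<integral>\<^sup>+t. indicator {0<..<T} t \<partial>lborel)"
    unfolding sq_int_lebesgue_on[OF Ds(1)] by (rule nn_integral_pair_product[OF measurable_sq_indicator[OF f Ds(1)]]) simp
  also have "(\<integral>\<^sup>+t. indicator {0<..<T} t \<partial>lborel) = ennreal T" using T by simp
  finally show ?thesis .
qed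

lemma measurable_fst_lebesgue_on:
  fixes f :: "'a::euclidean_space \<Rightarrow> real"
  assumes f: "f \<in> borel_measurable (lebesgue_on D)" and D: "open D" and J: "open (J :: real set)"
  shows "(\<lambda>z. f (fst z)) \<in> borel_measurable (lebesgue_on (D \<times> J))"
proof -
  have "(\<lambda>x. indicator D x * f x) \<in> borel_measurable lebesgue"
    using f D by (simp add: borel_measurable_lebesgue_on_iff open_sets_lebesgue)
  from measurable_compose[OF lebesgue_fst_measurable this]
  have "(\<lambda>z :: 'a \<times> real. indicator D (fst z) * f (fst z)) \<in> borel_measurable (lebesgue_on (D \<times> J))"
    by (rule measurable_restrict_space1)
  then show ?thesis
    by (subst measurable_cong[of _ _ "\<lambda>z. indicator D (fst z) * f (fst z)"]) (auto simp: space_restrict_space)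
qed

lemma Basis_prod_real: "(Basis :: ('a::euclidean_space \<times> real) set) = (\<lambda>b. (b, 0)) ` Basis \<union> {(0, 1)}"
  by (auto simp: Basis_prod_def)

lemma H1_fst:
  fixes u :: "'a::euclidean_space \<Rightarrow> real"
  assumes u: "u \<in> H1 D" and D: "open D" and T: "0 < T"
  shows "(\<lambda>z. u (fst z)) \<in> H1 (cyl D T)"
    "b \<in> Basis \<Longrightarrow> AE z in lebesgue_on (cyl D T). weak_partial (cyl D T) (b, 0) (\<lambda>z. u (fst z)) z = weak_partial D b u (fst z)"
    "AE z in lebesgue_on (cyl D T). weak_partial (cyl D T) (0, 1) (\<lambda>z. u (fst z)) z = 0"
proof -
  have oc: "open (cyl D T)" by (rule open_cyl[OF D])
  have L: "(\<lambda>z. f (fst z)) \<in> L2 (lebesgue_on (cyl D T))" if "f \<in> L2 (lebesgue_on D)" for f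
    using that sq_int_fst[OF _ D T, of f] measurable_fst_lebesgue_on[OF _ D, of f "{0<..<T}"]
    by (auto simp: L2_iff ennreal_mult_less_top)
  have wb: "has_weak_partial (cyl D T) (b, 0) (\<lambda>z. u (fst z)) (\<lambda>z. weak_partial D b u (fst z))" if "b \<in> Basis" for b
    by (rule has_weak_partial_fst_space[OF D _ that H1_weak_partial(1)[OF u that D]]) simp
  have wt: "has_weak_partial (cyl D T) (0, 1) (\<lambda>z. u (fst z)) (\<lambda>z. 0)"
    by (rule has_weak_partial_fst_time[OF D _ L2_loc_integrable[OF H1_imp_L2[OF u] open_sets_lebesgue[OF D]]]) simp
  have Ls: "cyl D T \<in> sets lebesgue" by (rule open_sets_lebesgue[OF oc])
  have t1: "(0 :: 'a, 1 :: real) \<in> Basis" by (simp add: Basis_prod_def)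
  show "AE z in lebesgue_on (cyl D T). weak_partial (cyl D T) (b, 0) (\<lambda>z. u (fst z)) z = weak_partial D b u (fst z)" if b: "b \<in> Basis"
  proof -
    have "(b, 0 :: real) \<in> Basis" using b by (simp add: Basis_prod_def)
    from weak_partial_AE_eq[OF wb[OF b] oc this] show ?thesis unfolding AE_lebesgue_on_iff[OF Ls] .
  qed
  show "AE z in lebesgue_on (cyl D T). weak_partial (cyl D T) (0, 1) (\<lambda>z. u (fst z)) z = 0"
    using weak_partial_AE_eq[OF wt oc t1] unfolding AE_lebesgue_on_iff[OF Ls] .
  have z: "(\<lambda>z. 0) \<in> L2 (lebesgue_on (cyl D T))" by (simp add: L2_def)
  show "(\<lambda>z. u (fst z)) \<in> H1 (cyl D T)"
    unfolding H1_def
  proof (intro CollectI conjI ballI)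
    show "(\<lambda>z. u (fst z)) \<in> L2 (lebesgue_on (cyl D T))" by (rule L[OF H1_imp_L2[OF u]])
    fix e :: "'a \<times> real" assume "e \<in> Basis"
    then consider b where "b \<in> Basis" "e = (b, 0)" | "e = (0, 1)" by (auto simp: Basis_prod_real)
    then show "\<exists>g\<in>L2 (lebesgue_on (cyl D T)). has_weak_partial (cyl D T) e (\<lambda>z. u (fst z)) g"
    proof cases
      case 1
      then show ?thesis using wb[OF 1(1)] L[OF H1_weak_partial(2)[OF u 1(1) D]] by blast
    next
      case 2
      then show ?thesis using wt z by blast
    qed
  qed
qed

lemma H1_conv_fst:
  fixes u :: "'a::euclidean_space \<Rightarrow> real"
  assumes c: "H1_conv D \<phi> u" and D: "open D" and T: "0 < T"
  shows "H1_conv (cyl D T) (\<lambda>m z. \<phi> m (fst z)) (\<lambda>z. u (fst z))"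
proof -
  let ?M = "lebesgue_on D" and ?C = "lebesgue_on (cyl D T)"
  have H: "\<phi> m \<in> H1 D" "u \<in> H1 D" for m using c by (auto simp: H1_conv_def)
  have m: "(\<lambda>x. \<phi> m x - u x) \<in> borel_measurable ?M" for m
    using L2_diff[OF H1_imp_L2[OF H(1)] H1_imp_L2[OF H(2)], of m] by (simp add: L2_iff)
  have mb: "(\<lambda>x. weak_partial D b (\<phi> m) x - weak_partial D b u x) \<in> borel_measurable ?M" if "b \<in> Basis" for m b
    using L2_diff[OF H1_weak_partial(2)[OF H(1) that D] H1_weak_partial(2)[OF H(2) that D], of m] by (simp add: L2_iff)
  have lim: "(\<lambda>m. f m * ennreal T) \<longlonglongrightarrow> 0" if "f \<longlonglongrightarrow> 0" for f :: "nat \<Rightarrow> ennreal"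
    using ennreal_tendsto_cmult[OF _ that, of "ennreal T"] by (simp add: mult.commute)
  show ?thesis
    unfolding H1_conv_def
  proof (intro conjI allI ballI)
    show "(\<lambda>z. \<phi> m (fst z)) \<in> H1 (cyl D T)" "(\<lambda>z. u (fst z)) \<in> H1 (cyl D T)" for m
      by (rule H1_fst(1)[OF H(1) D T] H1_fst(1)[OF H(2) D T])+
    have "sq_int ?C (\<lambda>z. \<phi> m (fst z) - u (fst z)) = sq_int ?M (\<lambda>x. \<phi> m x - u x) * ennreal T" for m
      by (rule sq_int_fst[OF m D T])
    then show "(\<lambda>m. sq_int ?C (\<lambda>z. \<phi> m (fst z) - u (fst z))) \<longlonglongrightarrow> 0"
      using lim c by (simp add: H1_conv_def)
    fix e :: "'a \<times> real" assume "e \<in> Basis"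
    then consider b where "b \<in> Basis" "e = (b, 0)" | "e = (0, 1)" by (auto simp: Basis_prod_real)
    then show "(\<lambda>m. sq_int ?C (\<lambda>z. weak_partial (cyl D T) e (\<lambda>z. \<phi> m (fst z)) z - weak_partial (cyl D T) e (\<lambda>z. u (fst z)) z)) \<longlonglongrightarrow> 0"
    proof cases
      case 1
      have "sq_int ?C (\<lambda>z. weak_partial (cyl D T) e (\<lambda>z. \<phi> m (fst z)) z - weak_partial (cyl D T) e (\<lambda>z. u (fst z)) z)
        = sq_int ?C (\<lambda>z. weak_partial D b (\<phi> m) (fst z) - weak_partial D b u (fst z))" for m
        by (rule sq_int_cong_AE)
          (use H1_fst(2)[OF H(1) D T 1(1), of m] H1_fst(2)[OF H(2) D T 1(1)] in \<open>eventually_elim, simp add: 1(2)\<close>)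
      also have "sq_int ?C (\<lambda>z. weak_partial D b (\<phi> m) (fst z) - weak_partial D b u (fst z))
        = sq_int ?M (\<lambda>x. weak_partial D b (\<phi> m) x - weak_partial D b u x) * ennreal T" for m
        by (rule sq_int_fst[OF mb[OF 1(1)] D T])
      finally show ?thesis using lim c 1(1) by (simp add: H1_conv_def)
    next
      case 2
      have "sq_int ?C (\<lambda>z. weak_partial (cyl D T) e (\<lambda>z. \<phi> m (fst z)) z - weak_partial (cyl D T) e (\<lambda>z. u (fst z)) z)
        = sq_int ?C (\<lambda>z. 0)" for m
        by (rule sq_int_cong_AE)
          (use H1_fst(3)[OF H(1) D T, of m] H1_fst(3)[OF H(2) D T] in \<open>eventually_elim, simp add: 2\<close>)
      then show ?thesis by (simp add: sq_int_def)
    qed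
  qed
qed

text \<open>The lateral trace is used only for its approximating sequence: functions continuous on
  \<open>closure D\<close>, extended constantly in time, are continuous on the closed cylinder, and
  their values at t = 0 converge to u in L2.\<close>

lemma has_initial_trace_fst:
  fixes u :: "'a::euclidean_space \<Rightarrow> real"
  assumes D: "open D" and T: "0 < T" and t: "has_boundary_trace D u g"
  shows "has_initial_trace D T (\<lambda>z. u (fst z)) u"
proof -
  obtain \<phi> where \<phi>: "\<And>m. continuous_on (closure D) (\<phi> m)" "H1_conv D \<phi> u"
    using t unfolding has_boundary_trace_def has_trace_iff[OF D] by blast
  have u: "u \<in> L2 (lebesgue_on D)" using \<phi>(2) by (simp add: H1_conv_def H1_imp_L2)
  show ?thesis
    unfolding has_initial_trace_def has_trace_iff[OF open_cyl[OF D]]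
  proof (intro conjI exI[of _ "\<lambda>m z. \<phi> m (fst z)"] allI)
    show "u \<in> L2 (lebesgue_on D)" by (rule u)
    show "continuous_on (closure (cyl D T)) (\<lambda>z. \<phi> m (fst z))" for m
      by (rule continuous_on_compose2[OF \<phi>(1) continuous_on_fst[OF continuous_on_id]]) (auto simp: closure_Times)
    show "H1_conv (cyl D T) (\<lambda>m z. \<phi> m (fst z)) (\<lambda>z. u (fst z))" by (rule H1_conv_fst[OF \<phi>(2) D T])
    show "(\<lambda>m. sq_int (lebesgue_on D) (\<lambda>y. \<phi> m (fst (y, 0 :: real)) - u y)) \<longlonglongrightarrow> 0"
      using \<phi>(2) by (simp add: H1_conv_def)
  qed
qed

lemma continuous_initial_measurable:
  fixes f :: "'a::euclidean_space \<times> real \<Rightarrow> real"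
  assumes f: "continuous_on (closure (cyl D T)) f" and D: "open D" and T: "0 < T"
  shows "(\<lambda>x. f (x, 0)) \<in> borel_measurable (lebesgue_on D)"
proof (rule continuous_imp_measurable_on_sets_lebesgue)
  have "(0 :: real) \<in> closure {0<..<T}" using T by simp
  then have "\<And>x. x \<in> D \<Longrightarrow> (x, 0) \<in> closure (cyl D T)"
    using closure_subset[of D] by (auto simp: closure_Times)
  then show "continuous_on D (\<lambda>x. f (x, 0))"
    by (intro continuous_on_compose2[OF f]) (auto intro!: continuous_intros)
  show "D \<in> sets lebesgue" using D by (rule open_sets_lebesgue)
qed

subsection \<open>Time changes of Sobolev functions\<close>

context time_change
begin

lemma bwd_vimage_cyl: "bwd -` cyl D T = cyl D (\<psi> T)"
proof -
  have "0 < \<phi> t \<longleftrightarrow> 0 < t" "\<phi> t < T \<longleftrightarrow> t < \<psi> T" for t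
    using phi_less_iff[of 0 t] phi_less_iff[of t "\<psi> T"] by (simp_all add: phi_zero inv)
  then show ?thesis by (auto simp: bwd_def)
qed

lemma sq_int_bwd:
  fixes f :: "'a::euclidean_space \<times> real \<Rightarrow> real"
  assumes f: "f \<in> borel_measurable (lebesgue_on E)" and E: "open E"
  shows "sq_int (lebesgue_on (bwd -` E)) (\<lambda>z. f (bwd z)) \<le> ennreal C * sq_int (lebesgue_on E) f"
    "(\<lambda>z. f (bwd z)) \<in> borel_measurable (lebesgue_on (bwd -` E))"
proof -
  have s: "E \<in> sets lebesgue" "bwd -` E \<in> sets lebesgue"
    using E open_bwd_vimage[OF E] by (auto intro: open_sets_lebesgue)
  have m: "(\<lambda>z. ennreal ((f z)\<^sup>2) * indicator E z) \<in> borel_measurable lebesgue"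
    by (rule measurable_sq_indicator[OF f s(1)])
  have m2: "(\<lambda>z. ennreal ((f (bwd z))\<^sup>2) * indicator E (bwd z)) \<in> borel_measurable lebesgue"
    by (rule measurable_compose[OF lebesgue_measurable(2) m])
  have "sq_int (lebesgue_on (bwd -` E)) (\<lambda>z. f (bwd z))
    = (\<integral>\<^sup>+z. ennreal ((f (bwd z))\<^sup>2) * indicator E (bwd z) \<partial>lebesgue)"
    unfolding sq_int_lebesgue_on[OF s(2)] by (simp add: indicator_vimage o_def)
  also have "\<dots> = (\<integral>\<^sup>+z. ennreal (\<psi>' (snd z)) * (ennreal ((f z)\<^sup>2) * indicator E z) \<partial>lebesgue)"
    unfolding nn_integral_lebesgue[OF m2] by simp
  also have "\<dots> \<le> (\<integral>\<^sup>+z. ennreal C * (ennreal ((f z)\<^sup>2) * indicator E z) \<partial>lebesgue)"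
    by (intro nn_integral_mono mult_right_mono ennreal_leI C) simp
  also have "\<dots> = ennreal C * sq_int (lebesgue_on E) f"
    unfolding sq_int_lebesgue_on[OF s(1)] by (rule nn_integral_cmult[OF m])
  finally show "sq_int (lebesgue_on (bwd -` E)) (\<lambda>z. f (bwd z)) \<le> ennreal C * sq_int (lebesgue_on E) f" .
  have "(\<lambda>z. indicator E z * f z) \<in> borel_measurable lebesgue"
    using f s(1) by (simp add: borel_measurable_lebesgue_on_iff)
  from measurable_compose[OF lebesgue_measurable(2) this]
  show "(\<lambda>z. f (bwd z)) \<in> borel_measurable (lebesgue_on (bwd -` E))"
    unfolding borel_measurable_lebesgue_on_iff[OF s(2)] by (simp add: indicator_vimage o_def)
qed

lemma L2_bwd:
  fixes f :: "'a::euclidean_space \<times> real \<Rightarrow> real"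
  assumes "f \<in> L2 (lebesgue_on E)" "open E"
  shows "(\<lambda>z. f (bwd z)) \<in> L2 (lebesgue_on (bwd -` E))"
  using sq_int_bwd[of f E] assms by (auto simp: L2_iff ennreal_mult_less_top intro: le_less_trans)

lemma time_factor_le: "\<bar>a / \<psi>' (\<phi> s)\<bar> \<le> (1 / c) * \<bar>a\<bar>"
proof -
  have "\<bar>\<psi>' (\<phi> s)\<bar> \<ge> c" "c > 0" using c(1) c(2)[of "\<phi> s"] by linarith+
  then have "\<bar>a\<bar> / \<bar>\<psi>' (\<phi> s)\<bar> \<le> \<bar>a\<bar> / c" by (intro divide_left_mono) auto
  then show ?thesis by (simp add: abs_divide)
qed

lemma time_factor_measurable:
  "(\<lambda>z :: 'a::euclidean_space \<times> real. \<psi>' (\<phi> (snd z))) \<in> borel_measurable (lebesgue_on E)"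
  using measurable_compose[OF borel_measurable_fst_snd(2) measurable_compose[OF borel_meas(3) borel_meas(2)]]
  by (intro measurable_restrict_space1 measurable_completion) simp

lemma H1_bwd:
  fixes u :: "'a::euclidean_space \<times> real \<Rightarrow> real"
  assumes u: "u \<in> H1 E" and E: "open E"
  shows "(\<lambda>z. u (bwd z)) \<in> H1 (bwd -` E)"
    "b \<in> Basis \<Longrightarrow> AE z in lebesgue_on (bwd -` E).
       weak_partial (bwd -` E) (b, 0) (\<lambda>z. u (bwd z)) z = weak_partial E (b, 0) u (bwd z)"
    "AE z in lebesgue_on (bwd -` E).
       weak_partial (bwd -` E) (0, 1) (\<lambda>z. u (bwd z)) z = weak_partial E (0, 1) u (bwd z) / \<psi>' (\<phi> (snd z))"
proof -
  have oE: "open (bwd -` E)" by (rule open_bwd_vimage[OF E])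
  have Ls: "bwd -` E \<in> sets lebesgue" by (rule open_sets_lebesgue[OF oE])
  have bB: "(b, 0 :: real) \<in> Basis" if "b \<in> Basis" for b :: 'a using that by (simp add: Basis_prod_def)
  have t1: "(0 :: 'a, 1 :: real) \<in> Basis" by (simp add: Basis_prod_def)
  have wb: "has_weak_partial (bwd -` E) (b, 0) (\<lambda>z. u (bwd z)) (\<lambda>z. weak_partial E (b, 0) u (bwd z))" if "b \<in> Basis" for b
    by (rule has_weak_partial_bwd_space[OF E H1_weak_partial(1)[OF u bB[OF that] E] that])
  have wt: "has_weak_partial (bwd -` E) (0, 1) (\<lambda>z. u (bwd z)) (\<lambda>z. weak_partial E (0, 1) u (bwd z) / \<psi>' (\<phi> (snd z)))"
    by (rule has_weak_partial_bwd_time[OF E H1_weak_partial(1)[OF u t1 E]])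
  show "AE z in lebesgue_on (bwd -` E). weak_partial (bwd -` E) (b, 0) (\<lambda>z. u (bwd z)) z = weak_partial E (b, 0) u (bwd z)"
    if b: "b \<in> Basis"
    using weak_partial_AE_eq[OF wb[OF b] oE bB[OF b]] unfolding AE_lebesgue_on_iff[OF Ls] .
  show "AE z in lebesgue_on (bwd -` E).
       weak_partial (bwd -` E) (0, 1) (\<lambda>z. u (bwd z)) z = weak_partial E (0, 1) u (bwd z) / \<psi>' (\<phi> (snd z))"
    using weak_partial_AE_eq[OF wt oE t1] unfolding AE_lebesgue_on_iff[OF Ls] .
  have Lt: "(\<lambda>z. weak_partial E (0, 1) u (bwd z) / \<psi>' (\<phi> (snd z))) \<in> L2 (lebesgue_on (bwd -` E))"
  proof (rule L2_bound[OF L2_bwd[OF H1_weak_partial(2)[OF u t1 E] E]])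
    show "(\<lambda>z. weak_partial E (0, 1) u (bwd z) / \<psi>' (\<phi> (snd z))) \<in> borel_measurable (lebesgue_on (bwd -` E))"
      using L2_bwd[OF H1_weak_partial(2)[OF u t1 E] E] time_factor_measurable[of "bwd -` E"]
      by (intro borel_measurable_divide) (auto simp: L2_iff)
    show "AE z in lebesgue_on (bwd -` E). \<bar>weak_partial E (0, 1) u (bwd z) / \<psi>' (\<phi> (snd z))\<bar> \<le> (1 / c) * \<bar>weak_partial E (0, 1) u (bwd z)\<bar>"
      by (intro AE_I2 time_factor_le)
  qed
  show "(\<lambda>z. u (bwd z)) \<in> H1 (bwd -` E)"
    unfolding H1_def
  proof (intro CollectI conjI ballI)
    show "(\<lambda>z. u (bwd z)) \<in> L2 (lebesgue_on (bwd -` E))" by (rule L2_bwd[OF H1_imp_L2[OF u] E])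
    fix e :: "'a \<times> real" assume "e \<in> Basis"
    then consider b where "b \<in> Basis" "e = (b, 0)" | "e = (0, 1)" by (auto simp: Basis_prod_real)
    then show "\<exists>g\<in>L2 (lebesgue_on (bwd -` E)). has_weak_partial (bwd -` E) e (\<lambda>z. u (bwd z)) g"
    proof cases
      case 1
      then show ?thesis using wb[OF 1(1)] L2_bwd[OF H1_weak_partial(2)[OF u bB[OF 1(1)] E] E] by blast
    next
      case 2
      then show ?thesis using wt Lt by blast
    qed
  qed
qed

lemma H1_conv_bwd:
  fixes u :: "'a::euclidean_space \<times> real \<Rightarrow> real"
  assumes cv: "H1_conv E f u" and E: "open E"
  shows "H1_conv (bwd -` E) (\<lambda>m z. f m (bwd z)) (\<lambda>z. u (bwd z))"
proof -
  let ?M = "lebesgue_on E" and ?C = "lebesgue_on (bwd -` E)"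
  have H: "f m \<in> H1 E" "u \<in> H1 E" for m using cv by (auto simp: H1_conv_def)
  have bB: "(b, 0 :: real) \<in> Basis" if "b \<in> Basis" for b :: 'a using that by (simp add: Basis_prod_def)
  have t1: "(0 :: 'a, 1 :: real) \<in> Basis" by (simp add: Basis_prod_def)
  have m: "(\<lambda>x. f m x - u x) \<in> borel_measurable ?M" for m
    using L2_diff[OF H1_imp_L2[OF H(1)] H1_imp_L2[OF H(2)], of m] by (simp add: L2_iff)
  have mb: "(\<lambda>x. weak_partial E b (f m) x - weak_partial E b u x) \<in> borel_measurable ?M" if "b \<in> Basis" for m b
    using L2_diff[OF H1_weak_partial(2)[OF H(1) that E] H1_weak_partial(2)[OF H(2) that E], of m] by (simp add: L2_iff)
  have lim: "(\<lambda>m. sq_int ?C (\<lambda>z. k m (bwd z))) \<longlonglongrightarrow> 0"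
    if "\<And>m. k m \<in> borel_measurable ?M" "(\<lambda>m. sq_int ?M (k m)) \<longlonglongrightarrow> 0" for k
  proof (rule tendsto_sandwich[OF _ _ tendsto_const])
    show "\<forall>\<^sub>F m in sequentially. sq_int ?C (\<lambda>z. k m (bwd z)) \<le> ennreal C * sq_int ?M (k m)"
      by (intro always_eventually allI sq_int_bwd(1) that(1) E)
    show "(\<lambda>m. ennreal C * sq_int ?M (k m)) \<longlonglongrightarrow> 0"
      using ennreal_tendsto_cmult[OF _ that(2), of "ennreal C"] by simp
  qed simp
  show ?thesis
    unfolding H1_conv_def
  proof (intro conjI allI ballI)
    show "(\<lambda>z. f m (bwd z)) \<in> H1 (bwd -` E)" "(\<lambda>z. u (bwd z)) \<in> H1 (bwd -` E)" for m
      by (rule H1_bwd(1)[OF H(1) E] H1_bwd(1)[OF H(2) E])+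
    show "(\<lambda>m. sq_int ?C (\<lambda>z. f m (bwd z) - u (bwd z))) \<longlonglongrightarrow> 0"
      using lim[OF m] cv by (simp add: H1_conv_def)
    fix e :: "'a \<times> real" assume "e \<in> Basis"
    then consider b where "b \<in> Basis" "e = (b, 0)" | "e = (0, 1)" by (auto simp: Basis_prod_real)
    then show "(\<lambda>m. sq_int ?C (\<lambda>z. weak_partial (bwd -` E) e (\<lambda>z. f m (bwd z)) z - weak_partial (bwd -` E) e (\<lambda>z. u (bwd z)) z)) \<longlonglongrightarrow> 0"
    proof cases
      case 1
      have "sq_int ?C (\<lambda>z. weak_partial (bwd -` E) e (\<lambda>z. f m (bwd z)) z - weak_partial (bwd -` E) e (\<lambda>z. u (bwd z)) z)
        = sq_int ?C (\<lambda>z. weak_partial E e (f m) (bwd z) - weak_partial E e u (bwd z))" for m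
        by (rule sq_int_cong_AE)
          (use H1_bwd(2)[OF H(1) E 1(1), of m] H1_bwd(2)[OF H(2) E 1(1)] in \<open>eventually_elim, simp add: 1(2)\<close>)
      then show ?thesis using lim[OF mb[of e]] cv bB[OF 1(1)] by (simp add: H1_conv_def 1(2))
    next
      case 2
      let ?k = "\<lambda>m z. weak_partial E e (f m) z - weak_partial E e u z"
      have eB: "e \<in> Basis" using 2 t1 by simp
      have "sq_int ?C (\<lambda>z. weak_partial (bwd -` E) e (\<lambda>z. f m (bwd z)) z - weak_partial (bwd -` E) e (\<lambda>z. u (bwd z)) z)
        = sq_int ?C (\<lambda>z. ?k m (bwd z) / \<psi>' (\<phi> (snd z)))" for m
        by (rule sq_int_cong_AE)
          (use H1_bwd(3)[OF H(1) E, of m] H1_bwd(3)[OF H(2) E] in \<open>eventually_elim, simp add: 2 diff_divide_distrib\<close>)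
      moreover have "(\<lambda>m. sq_int ?C (\<lambda>z. ?k m (bwd z) / \<psi>' (\<phi> (snd z)))) \<longlonglongrightarrow> 0"
      proof (rule tendsto_sandwich[OF _ _ tendsto_const])
        show "\<forall>\<^sub>F m in sequentially. sq_int ?C (\<lambda>z. ?k m (bwd z) / \<psi>' (\<phi> (snd z))) \<le> ennreal ((1 / c)\<^sup>2) * sq_int ?C (\<lambda>z. ?k m (bwd z))"
          by (intro always_eventually allI sq_int_mono AE_I2 time_factor_le sq_int_bwd(2)[OF mb[OF eB] E])
        have "(\<lambda>m. sq_int ?C (\<lambda>z. ?k m (bwd z))) \<longlonglongrightarrow> 0"
          using lim[OF mb[OF eB]] cv eB by (simp add: H1_conv_def)
        then show "(\<lambda>m. ennreal ((1 / c)\<^sup>2) * sq_int ?C (\<lambda>z. ?k m (bwd z))) \<longlonglongrightarrow> 0"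
          using ennreal_tendsto_cmult[of "ennreal ((1 / c)\<^sup>2)"] by fastforce
      qed simp
      ultimately show ?thesis by simp
    qed
  qed
qed

text \<open>\<open>bwd\<close> fixes the bottom t = 0 and maps the closed cylinder of height \<psi>
  T into the one of height T, so the approximating sequence can be composed with it and keeps its
  initial values.\<close>

lemma has_initial_trace_bwd:
  fixes u :: "'a::euclidean_space \<times> real \<Rightarrow> real"
  assumes D: "open D" and t: "has_initial_trace D T u g"
  shows "has_initial_trace D (\<psi> T) (\<lambda>z. u (bwd z)) g"
proof -
  obtain f where f: "g \<in> L2 (lebesgue_on D)" "\<And>m. continuous_on (closure (cyl D T)) (f m)" "H1_conv (cyl D T) f u"
    "(\<lambda>m. sq_int (lebesgue_on D) (\<lambda>y. f m (y, 0) - g y)) \<longlonglongrightarrow> 0"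
    using t unfolding has_initial_trace_def has_trace_iff[OF open_cyl[OF D]] by blast
  show ?thesis
    unfolding has_initial_trace_def has_trace_iff[OF open_cyl[OF D]]
  proof (intro conjI exI[of _ "\<lambda>m z. f m (bwd z)"] allI f(1))
    have "bwd ` closure (cyl D (\<psi> T)) \<subseteq> closure (cyl D T)"
    proof (rule image_closure_subset)
      show "continuous_on (closure (cyl D (\<psi> T))) bwd" by (rule continuous_on_subset[OF bwd_continuous]) simp
      show "closed (closure (cyl D T))" by simp
      have "bwd ` cyl D (\<psi> T) \<subseteq> cyl D T"
        by (simp add: image_subset_iff_subset_vimage bwd_vimage_cyl)
      then show "bwd ` cyl D (\<psi> T) \<subseteq> closure (cyl D T)"
        using closure_subset by (rule subset_trans)
    qed
    then show "continuous_on (closure (cyl D (\<psi> T))) (\<lambda>z. f m (bwd z))" for m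
      by (intro continuous_on_compose2[OF f(2) continuous_on_subset[OF bwd_continuous]]) auto
    show "H1_conv (cyl D (\<psi> T)) (\<lambda>m z. f m (bwd z)) (\<lambda>z. u (bwd z))"
      using H1_conv_bwd[OF f(3) open_cyl[OF D]] by (simp add: bwd_vimage_cyl)
    show "(\<lambda>m. sq_int (lebesgue_on D) (\<lambda>y. f m (bwd (y, 0)) - g y)) \<longlonglongrightarrow> 0"
      using f(4) by (simp add: bwd_def phi_zero)
  qed
qed

text \<open>The new exceptional times form the \<psi>-image of the old ones, and a differentiable
  \<psi> maps null sets to null sets.\<close>

lemma AE_phi:
  assumes "AE t in lebesgue. P t"
  shows "AE t in lebesgue. P (\<phi> t)"
proof -
  obtain N where N: "N \<in> null_sets lebesgue" "\<And>t. t \<notin> N \<Longrightarrow> P t"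
    using assms unfolding eventually_ae_filter by auto
  have "negligible (\<psi> ` N)"
  proof (rule negligible_differentiable_image_negligible)
    show "negligible N" using N(1) by (simp add: negligible_iff_null_sets)
    show "\<psi> differentiable_on N"
      using der unfolding differentiable_on_def real_differentiable_def
      by (meson has_field_derivative_at_within)
  qed simp
  then have "AE t in lebesgue. t \<notin> \<psi> ` N" by (intro AE_not_in) (simp add: negligible_iff_null_sets)
  then show ?thesis
  proof eventually_elim
    case (elim t)
    have "\<phi> t \<notin> N"
    proof
      assume "\<phi> t \<in> N"
      then have "\<psi> (\<phi> t) \<in> \<psi> ` N" by (rule imageI)
      with elim show False by (simp add: inv)
    qed
    then show ?case by (rule N(2))
  qed
qed

end

subsection \<open>Functions with vanishing initial trace and time derivative\<close>

text \<open>The substitution r -> t + h r turns h times the average into an integral over the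
  segment from t to t + h. In \<open>ennreal\<close> this needs no integrability: a Bochner integral
  that does not exist is 0.\<close>

lemma line_avg_bound:
  fixes g g1 :: "'a::euclidean_space \<times> real \<Rightarrow> real"
  assumes h: "0 < h" and g: "g \<in> borel_measurable borel"
    and le: "\<And>r. 0 \<le> r \<Longrightarrow> r \<le> 1 \<Longrightarrow> \<bar>g1 (x, t + r * h)\<bar> \<le> indicator J (t + r * h) * \<bar>g (x, t + r * h)\<bar>"
    and J: "J \<in> sets borel"
  shows "ennreal \<bar>h * line_avg (0, 1) h g1 (x, t)\<bar> \<le> (\<integral>\<^sup>+r. indicator J r * ennreal \<bar>g (x, r)\<bar> \<partial>lborel)"
proof -
  let ?k = "\<lambda>r. indicator {0..1} r * g1 ((x, t) + (r * h) *\<^sub>R (0, 1))"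
  have gm: "(\<lambda>r. g (x, r)) \<in> borel_measurable borel"
    by (rule measurable_compose[OF _ g]) (auto intro!: borel_measurable_continuous_onI continuous_intros)
  have "ennreal \<bar>LINT r|lborel. ?k r\<bar> \<le> (\<integral>\<^sup>+r. ennreal \<bar>?k r\<bar> \<partial>lborel)"
  proof (cases "integrable lborel ?k")
    case True
    then show ?thesis using integral_norm_bound_ennreal[OF True] by simp
  next
    case False
    then show ?thesis by (simp add: not_integrable_integral_eq)
  qed
  also have "\<dots> \<le> (\<integral>\<^sup>+r. indicator J (t + h * r) * ennreal \<bar>g (x, t + h * r)\<bar> \<partial>lborel)"
  proof (rule nn_integral_mono)
    fix r :: real
    show "ennreal \<bar>?k r\<bar> \<le> indicator J (t + h * r) * ennreal \<bar>g (x, t + h * r)\<bar>"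
    proof (cases "r \<in> {0..1}")
      case True
      then have "\<bar>?k r\<bar> \<le> indicator J (t + h * r) * \<bar>g (x, t + h * r)\<bar>"
        using le[of r] by (simp add: mult.commute)
      then have "ennreal \<bar>?k r\<bar> \<le> ennreal (indicator J (t + h * r) * \<bar>g (x, t + h * r)\<bar>)" by (rule ennreal_leI)
      also have "\<dots> = indicator J (t + h * r) * ennreal \<bar>g (x, t + h * r)\<bar>"
        by (auto simp: indicator_def)
      finally show ?thesis .
    qed simp
  qed
  finally have "ennreal h * ennreal \<bar>LINT r|lborel. ?k r\<bar>
      \<le> ennreal h * (\<integral>\<^sup>+r. indicator J (t + h * r) * ennreal \<bar>g (x, t + h * r)\<bar> \<partial>lborel)"
    by (rule mult_left_mono) simp
  also have "\<dots> = (\<integral>\<^sup>+r. indicator J r * ennreal \<bar>g (x, r)\<bar> \<partial>lborel)"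
    using nn_integral_real_affine[of "\<lambda>r. indicator J r * ennreal \<bar>g (x, r)\<bar>" h t] h gm J by simp
  finally show ?thesis
    using h by (simp add: line_avg_def abs_mult ennreal_mult)
qed

text \<open>The bound for the time increment depends neither on h nor on the starting time, so that
  the latter may tend to 0 afterwards. The height T - h keeps the time segments inside of the
  cylinder.\<close>

lemma steklov_time:
  fixes f g :: "'a::euclidean_space \<times> real \<Rightarrow> real"
  assumes D: "open D" and f: "f \<in> borel_measurable borel" and g: "g \<in> borel_measurable borel"
    and w: "has_weak_partial (cyl D T) (0, 1) f g" and h: "0 < h" "h < T"
  shows "AE z in lborel. z \<in> cyl D (T - h) \<longrightarrow>
    ennreal \<bar>f (fst z, snd z + h) - f z\<bar> \<le> (\<integral>\<^sup>+r. indicator {0<..<T} r * ennreal \<bar>g (fst z, r)\<bar> \<partial>lborel)"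
proof -
  have t1: "(0 :: 'a, 1 :: real) \<in> Basis" by (simp add: Basis_prod_def)
  have l: "loc_integrable (cyl D T) f" "loc_integrable (cyl D T) g" using w by (auto simp: has_weak_partial_def)
  let ?P = "\<lambda>z. ennreal \<bar>f (fst z, snd z + h) - f z\<bar> \<le> (\<integral>\<^sup>+r. indicator {0<..<T} r * ennreal \<bar>g (fst z, r)\<bar> \<partial>lborel)"
  have "AE z in lebesgue. z \<in> cyl D (T - h) \<longrightarrow> ?P z"
  proof (rule AE_open_cboxI[OF open_cyl[OF D]])
    fix p q :: "'a \<times> real" assume pq: "cbox p q \<subseteq> cyl D (T - h)"
    define S where "S = {z + y |z y. z \<in> cbox p q \<and> y \<in> cbox (0, 0) (0, h)}"
    have S: "compact S" unfolding S_def by (rule compact_sums) (auto intro: compact_cbox)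
    have Sb: "S \<in> sets borel" using S by (rule borel_compact)
    have SI: "(x, t + s) \<in> S" if "(x, t) \<in> cbox p q" "0 \<le> s" "s \<le> h" for x t s
    proof -
      have "(x, t + s) = (x, t) + (0, s)" by simp
      moreover have "(0, s) \<in> cbox (0 :: 'a, 0 :: real) (0, h)" using that by (simp add: cbox_Pair_eq)
      ultimately show ?thesis unfolding S_def using that(1) by blast
    qed
    have SD: "S \<subseteq> cyl D T"
    proof
      fix v assume "v \<in> S"
      then obtain z y where zy: "v = z + y" "z \<in> cbox p q" "y \<in> cbox (0 :: 'a, 0 :: real) (0, h)" unfolding S_def by blast
      then have "z \<in> cyl D (T - h)" using pq by blast
      moreover have "fst y = 0" "0 \<le> snd y" "snd y \<le> h" using zy(3) by (auto simp: cbox_Pair_eq)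
      ultimately show "v \<in> cyl D T" using zy(1) by (auto simp: mem_Times_iff)
    qed
    let ?f = "\<lambda>z. indicator S z * f z" and ?g = "\<lambda>z. indicator S z * g z"
    have i: "integrable lborel (\<lambda>z. indicator S z * k z)" if "loc_integrable (cyl D T) k" "k \<in> borel_measurable borel" for k
    proof -
      have "integrable lebesgue (\<lambda>z. indicator S z * k z)"
        using that(1) S SD by (simp add: loc_integrable_def set_integrable_def)
      moreover have "(\<lambda>z. indicator S z * k z) \<in> borel_measurable lborel" using that(2) Sb by simp
      ultimately show ?thesis by (simp add: integrable_completion)
    qed
    have "AE z in lborel. z \<in> box p q \<longrightarrow> ?f (z + h *\<^sub>R (0, 1)) - ?f z = h * line_avg (0, 1) h ?g z"
    proof (rule has_weak_partial_steklov[OF w t1 S SD open_box _ i[OF l(1) f] _ i[OF l(2) g]])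
      fix z r assume z: "z \<in> box p q" and r: "0 \<le> r" "r \<le> (1 :: real)"
      have "r * h \<le> 1 * h" using r h by (intro mult_right_mono) auto
      moreover have "(fst z, snd z) \<in> cbox p q" using z box_subset_cbox by auto
      ultimately have "(fst z, snd z + r * h) \<in> S" using r h by (intro SI) auto
      moreover have "z + (r * h) *\<^sub>R (0, 1) = (fst z, snd z + r * h)" by (simp add: prod_eq_iff)
      ultimately show "z + (r * h) *\<^sub>R (0, 1) \<in> S" by simp
    qed auto
    then have "AE z in lebesgue. z \<in> box p q \<longrightarrow> ?f (z + h *\<^sub>R (0, 1)) - ?f z = h * line_avg (0, 1) h ?g z"
      by (rule AE_completion)
    moreover have "AE z in lebesgue. z \<notin> cbox p q - box p q"
      by (rule AE_not_in) (simp flip: negligible_iff_null_sets add: negligible_frontier_interval)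
    ultimately show "AE z in lebesgue. z \<in> cbox p q \<longrightarrow> ?P z"
    proof eventually_elim
      case (elim z)
      show ?case
      proof
        assume zc: "z \<in> cbox p q"
        obtain x t where z: "z = (x, t)" by (rule prod.exhaust)
        have xt: "(x, t) \<in> cbox p q" using zc z by simp
        have "(x, t) \<in> S" "(x, t + h) \<in> S" using SI[OF xt, of 0] SI[OF xt, of h] h by auto
        moreover have "z + h *\<^sub>R (0, 1) = (x, t + h)" by (simp add: z)
        moreover have "?f (z + h *\<^sub>R (0, 1)) - ?f z = h * line_avg (0, 1) h ?g z" using elim zc by blast
        ultimately have e: "f (x, t + h) - f (x, t) = h * line_avg (0, 1) h ?g (x, t)" by (simp add: z)
        have tT: "0 < t" "t < T - h" using pq xt by auto
        have "ennreal \<bar>h * line_avg (0, 1) h ?g (x, t)\<bar> \<le> (\<integral>\<^sup>+r. indicator {0<..<T} r * ennreal \<bar>g (x, r)\<bar> \<partial>lborel)"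
        proof (rule line_avg_bound[OF h(1) g])
          fix r :: real assume r: "0 \<le> r" "r \<le> 1"
          have "0 \<le> r * h" "r * h \<le> h" using r h mult_right_mono[of r 1 h] by auto
          then have "t + r * h \<in> {0<..<T}" using tT by auto
          then show "\<bar>indicator S (x, t + r * h) * g (x, t + r * h)\<bar> \<le> indicator {0<..<T} (t + r * h) * \<bar>g (x, t + r * h)\<bar>"
            by (auto simp: indicator_def)
        qed simp
        with e show "?P z" by (simp add: z)
      qed
    qed
  qed
  then show ?thesis by (simp add: AE_completion_iff)
qed

text \<open>By continuity a violation at 0 would persist on an interval of positive measure.\<close>

lemma AE_le_at_zero:
  fixes k :: "real \<Rightarrow> real"
  assumes k: "continuous_on {0..d} k" and d: "0 < d"
    and ae: "AE t in lborel. 0 < t \<longrightarrow> t < d \<longrightarrow> ennreal (k t) \<le> B"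
  shows "ennreal (k 0) \<le> B"
proof (rule ccontr)
  assume "\<not> ennreal (k 0) \<le> B"
  then have lt: "B < ennreal (k 0)" by simp
  then obtain b where b: "B = ennreal b" "0 \<le> b" by (cases B) auto
  have kb: "b < k 0" using lt b by (simp add: ennreal_less_iff)
  have "\<exists>e>0. \<forall>t\<in>{0..d}. dist t 0 < e \<longrightarrow> dist (k t) (k 0) < k 0 - b"
    using k d kb unfolding continuous_on_iff by (metis atLeastAtMost_iff diff_gt_0_iff_gt less_eq_real_def order_refl)
  then obtain e where e: "e > 0" "\<And>t. t \<in> {0..d} \<Longrightarrow> \<bar>t\<bar> < e \<Longrightarrow> \<bar>k t - k 0\<bar> < k 0 - b"
    by (auto simp: dist_real_def)
  define m where "m = min d e"
  have m: "0 < m" "m \<le> d" "m \<le> e" using d e by (auto simp: m_def)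
  have "AE t in lborel. t \<notin> {0<..<m}"
    using ae
  proof eventually_elim
    case (elim t)
    show ?case
    proof
      assume t: "t \<in> {0<..<m}"
      then have "ennreal (k t) \<le> ennreal b" using elim m b by auto
      then have "k t \<le> b" using b(2) ennreal_le_iff[of b "k t"] b(1) by auto
      moreover have "\<bar>k t - k 0\<bar> < k 0 - b" using t m by (intro e(2)) auto
      ultimately show False by linarith
    qed
  qed
  then have "{0<..<m} \<in> null_sets lborel" by (subst (asm) AE_iff_null_sets[symmetric]) auto
  then have "emeasure lborel {0<..<m} = 0" by (rule null_setsD1)
  with m show False by simp
qed

text \<open>For fixed h and almost every x, |f (x, h) - f (x, 0)| is at most the integral of |g (x,
  .)| over (0, T): \<open>steklov_time\<close> gives this for increments starting at almost every t
  > 0, and continuity of f extends it to t = 0. Integrating over h in (0, T) produces the factor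
  T.\<close>

lemma initial_trace_L1_estimate:
  fixes f g :: "'a::euclidean_space \<times> real \<Rightarrow> real"
  assumes D: "open D" and T: "0 < T" and f: "continuous_on (closure (cyl D T)) f"
    and w: "has_weak_partial (cyl D T) (0, 1) f g"
  shows "(\<integral>\<^sup>+z. indicator (cyl D T) z * ennreal \<bar>f z - f (fst z, 0)\<bar> \<partial>lebesgue)
    \<le> ennreal T * (\<integral>\<^sup>+z. indicator (cyl D T) z * ennreal \<bar>g z\<bar> \<partial>lebesgue)"
proof -
  have t1: "(0 :: 'a, 1 :: real) \<in> Basis" by (simp add: Basis_prod_def)
  have oc: "open (cyl D T)" by (rule open_cyl[OF D])
  \<comment> \<open>Extended by 0 off the closed cylinder, f becomes Borel measurable on the whole
    space, as needed for slicing.\<close>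
  define f' where "f' z = indicator (closure (cyl D T)) z *\<^sub>R f z" for z
  have f'b: "f' \<in> borel_measurable borel"
    unfolding f'_def by (rule borel_measurable_continuous_on_indicator[OF _ f]) simp
  have cl: "(x, t) \<in> closure (cyl D T)" if "x \<in> D" "0 \<le> t" "t \<le> T" for x t
    using that T closure_subset[of D] by (auto simp: closure_Times)
  have f'eq: "f' (x, t) = f (x, t)" if "x \<in> D" "0 \<le> t" "t \<le> T" for x t
    using cl[OF that] by (simp add: f'_def)
  have lg: "loc_integrable (cyl D T) g" using w by (simp add: has_weak_partial_def)
  obtain g' where g': "g' \<in> borel_measurable borel" "AE z in lebesgue. z \<in> cyl D T \<longrightarrow> g z = g' z"
    using loc_integrable_borel_rep[OF oc lg] .
  have w': "has_weak_partial (cyl D T) (0, 1) f' g'"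
  proof (rule has_weak_partial_AE[OF w oc t1 _ g'(2)])
    show "AE z in lebesgue. z \<in> cyl D T \<longrightarrow> f z = f' z"
      using f'eq by (intro AE_I2) auto
  qed
  define B where "B x = (\<integral>\<^sup>+r. indicator {0<..<T} r * ennreal \<bar>g' (x, r)\<bar> \<partial>lborel)" for x
  have key: "AE x in lborel. x \<in> D \<longrightarrow> ennreal \<bar>f' (x, h) - f' (x, 0)\<bar> \<le> B x" if h: "0 < h" "h < T" for h
  proof -
    have "AE z in lborel \<Otimes>\<^sub>M lborel. z \<in> cyl D (T - h) \<longrightarrow> ennreal \<bar>f' (fst z, snd z + h) - f' z\<bar> \<le> B (fst z)"
      using steklov_time[OF D f'b g'(1) w' h] unfolding lborel_prod B_def .
    from lborel_pair.AE_pair[OF this] show ?thesis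
    proof eventually_elim
      case (elim x)
      show ?case
      proof
        assume x: "x \<in> D"
        have cf: "continuous_on {0..T} (\<lambda>t. f (x, t))"
          by (rule continuous_on_compose2[OF f]) (use cl x in \<open>auto intro!: continuous_intros\<close>)
        have "ennreal \<bar>f (x, 0 + h) - f (x, 0)\<bar> \<le> B x"
        proof (rule AE_le_at_zero[where d = "T - h"])
          show "continuous_on {0..T - h} (\<lambda>t. \<bar>f (x, t + h) - f (x, t)\<bar>)"
            using h by (intro continuous_intros continuous_on_compose2[OF cf]) auto
          show "AE t in lborel. 0 < t \<longrightarrow> t < T - h \<longrightarrow> ennreal \<bar>f (x, t + h) - f (x, t)\<bar> \<le> B x"
            using elim by eventually_elim (use x h f'eq in auto)
        qed (use h in simp)
        then show "ennreal \<bar>f' (x, h) - f' (x, 0)\<bar> \<le> B x" using f'eq x h by simp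
      qed
    qed
  qed
  let ?H = "\<lambda>z. indicator (cyl D T) z * ennreal \<bar>f' z - f' (fst z, 0)\<bar>"
  have Dm: "D \<in> sets borel" "cyl D T \<in> sets borel" using D oc by auto
  have f'0: "(\<lambda>z :: 'a \<times> real. f' (fst z, 0)) \<in> borel_measurable borel"
    by (rule measurable_compose[OF _ f'b]) (auto intro!: borel_measurable_continuous_onI continuous_intros)
  have Hm: "?H \<in> borel_measurable (lborel \<Otimes>\<^sub>M lborel)"
    using f'b f'0 Dm by (simp add: lborel_prod)
  have "(\<integral>\<^sup>+z. indicator (cyl D T) z * ennreal \<bar>f z - f (fst z, 0)\<bar> \<partial>lebesgue) = (\<integral>\<^sup>+z. ?H z \<partial>lebesgue)"
    by (rule nn_integral_cong) (use f'eq T in \<open>auto simp: indicator_def\<close>)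
  also have "\<dots> = (\<integral>\<^sup>+z. ?H z \<partial>(lborel \<Otimes>\<^sub>M lborel))" by (simp add: nn_integral_completion lborel_prod)
  also have "\<dots> = (\<integral>\<^sup>+h. \<integral>\<^sup>+x. ?H (x, h) \<partial>lborel \<partial>lborel)"
    using lborel_pair.nn_integral_snd[OF Hm] by simp
  also have "\<dots> \<le> (\<integral>\<^sup>+h. indicator {0<..<T} h * (\<integral>\<^sup>+x. indicator D x * B x \<partial>lborel) \<partial>lborel)"
  proof (rule nn_integral_mono)
    fix h :: real
    show "(\<integral>\<^sup>+x. ?H (x, h) \<partial>lborel) \<le> indicator {0<..<T} h * (\<integral>\<^sup>+x. indicator D x * B x \<partial>lborel)"
    proof (cases "0 < h \<and> h < T")
      case True
      have "(\<integral>\<^sup>+x. ?H (x, h) \<partial>lborel) \<le> (\<integral>\<^sup>+x. indicator D x * B x \<partial>lborel)"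
        by (rule nn_integral_mono_AE)
          (use key[of h] True in \<open>auto elim!: eventually_mono simp: indicator_def\<close>)
      then show ?thesis using True by simp
    qed (auto simp: indicator_def)
  qed
  also have "\<dots> = (\<integral>\<^sup>+h. indicator {0<..<T} h \<partial>lborel) * (\<integral>\<^sup>+x. indicator D x * B x \<partial>lborel)"
    by (rule nn_integral_multc) simp
  also have "(\<integral>\<^sup>+h. indicator {0<..<T} h \<partial>lborel) = ennreal T" using T by simp
  also have "(\<integral>\<^sup>+x. indicator D x * B x \<partial>lborel)
    = (\<integral>\<^sup>+x. \<integral>\<^sup>+r. indicator D x * (indicator {0<..<T} r * ennreal \<bar>g' (x, r)\<bar>) \<partial>lborel \<partial>lborel)"
  proof (rule nn_integral_cong)
    fix x :: 'a
    have "(\<lambda>r. g' (x, r)) \<in> borel_measurable borel"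
      by (rule measurable_compose[OF _ g'(1)]) (auto intro!: borel_measurable_continuous_onI continuous_intros)
    then show "indicator D x * B x = (\<integral>\<^sup>+r. indicator D x * (indicator {0<..<T} r * ennreal \<bar>g' (x, r)\<bar>) \<partial>lborel)"
      unfolding B_def by (intro nn_integral_cmult[symmetric]) simp
  qed
  also have "\<dots> = (\<integral>\<^sup>+z. indicator (cyl D T) z * ennreal \<bar>g' z\<bar> \<partial>lborel)"
  proof -
    have m: "(\<lambda>z. indicator (cyl D T) z * ennreal \<bar>g' z\<bar>) \<in> borel_measurable (lborel \<Otimes>\<^sub>M lborel)"
      using g'(1) Dm by (simp add: lborel_prod)
    have "indicator (cyl D T) (x, r) * ennreal \<bar>g' (x, r)\<bar> = indicator D x * (indicator {0<..<T} r * ennreal \<bar>g' (x, r)\<bar>)" for x r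
      by (auto simp: indicator_def)
    then show ?thesis using lborel.nn_integral_fst[OF m] by (simp add: lborel_prod)
  qed
  also have "\<dots> = (\<integral>\<^sup>+z. indicator (cyl D T) z * ennreal \<bar>g' z\<bar> \<partial>lebesgue)"
    by (rule nn_integral_completion[symmetric])
  also have "\<dots> = (\<integral>\<^sup>+z. indicator (cyl D T) z * ennreal \<bar>g z\<bar> \<partial>lebesgue)"
    by (rule nn_integral_cong_AE) (use g'(2) in \<open>auto elim!: eventually_mono simp: indicator_def\<close>)
  finally show ?thesis .
qed

text \<open>Young's inequality |w| <= \<delta> + w^2 / \<delta>. On a set of finite measure it turns
  convergence in L2 into convergence in L1, once \<delta> tends to 0 after the limit.\<close>

lemma L1_le_sq_int:
  assumes w: "w \<in> borel_measurable (lebesgue_on S)" and S: "S \<in> sets lebesgue" and \<delta>: "0 < \<delta>"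
  shows "(\<integral>\<^sup>+z. indicator S z * ennreal \<bar>w z\<bar> \<partial>lebesgue)
    \<le> ennreal \<delta> * emeasure lebesgue S + ennreal (1 / \<delta>) * sq_int (lebesgue_on S) w"
proof -
  have "(\<integral>\<^sup>+z. indicator S z * ennreal \<bar>w z\<bar> \<partial>lebesgue)
    \<le> (\<integral>\<^sup>+z. ennreal \<delta> * indicator S z + ennreal (1 / \<delta>) * (ennreal ((w z)\<^sup>2) * indicator S z) \<partial>lebesgue)"
  proof (rule nn_integral_mono)
    fix z
    have p: "0 \<le> \<delta> * \<bar>w z\<bar>" using \<delta> by simp
    have "2 * (\<delta> * \<bar>w z\<bar>) \<le> \<delta>\<^sup>2 + (w z)\<^sup>2"
      using zero_le_power2[of "\<delta> - \<bar>w z\<bar>"] by (simp add: power2_diff)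
    with p have "\<delta> * \<bar>w z\<bar> \<le> \<delta>\<^sup>2 + (w z)\<^sup>2" by linarith
    then have "\<bar>w z\<bar> \<le> (\<delta>\<^sup>2 + (w z)\<^sup>2) / \<delta>" using \<delta> by (simp add: pos_le_divide_eq mult.commute)
    also have "\<dots> = \<delta> + (1 / \<delta>) * (w z)\<^sup>2" using \<delta> by (simp add: add_divide_distrib power2_eq_square)
    finally have "ennreal \<bar>w z\<bar> \<le> ennreal (\<delta> + (1 / \<delta>) * (w z)\<^sup>2)" by (rule ennreal_leI)
    also have "\<dots> = ennreal \<delta> + ennreal (1 / \<delta>) * ennreal ((w z)\<^sup>2)"
      using \<delta> by (simp add: ennreal_plus ennreal_mult[symmetric])
    finally show "indicator S z * ennreal \<bar>w z\<bar> \<le> ennreal \<delta> * indicator S z + ennreal (1 / \<delta>) * (ennreal ((w z)\<^sup>2) * indicator S z)"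
      by (auto simp: indicator_def)
  qed
  also have "\<dots> = ennreal \<delta> * emeasure lebesgue S + ennreal (1 / \<delta>) * sq_int (lebesgue_on S) w"
    unfolding sq_int_lebesgue_on[OF S] using measurable_sq_indicator[OF w S] S
    by (subst nn_integral_add) (auto simp: nn_integral_cmult)
  finally show ?thesis .
qed

text \<open>Traces are reached only through the continuous approximations f m, so |u| is bounded by
  |f m - u|, |f m - f m (., 0)| and |f m (., 0)|. All three vanish in L1, the second by
  \<open>initial_trace_L1_estimate\<close>, because the time derivatives of f m converge in L2 to
  that of u, which is 0.\<close>

proposition zero_initial_trace:
  fixes u :: "'a::euclidean_space \<times> real \<Rightarrow> real"
  assumes D: "open D" "bounded D" and T: "0 < T" and tr: "has_initial_trace D T u (\<lambda>x. 0)"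
    and z: "AE z in lebesgue_on (cyl D T). weak_partial (cyl D T) (0, 1) u z = 0"
  shows "AE z in lebesgue_on (cyl D T). u z = 0"
proof -
  let ?C = "cyl D T" and ?w = "weak_partial (cyl D T) (0, 1)"
  have t1: "(0 :: 'a, 1 :: real) \<in> Basis" by (simp add: Basis_prod_def)
  have oc: "open ?C" by (rule open_cyl[OF D(1)])
  have Cs: "?C \<in> sets lebesgue" "D \<in> sets lebesgue" using oc D by (auto intro: open_sets_lebesgue)
  have Cb: "bounded ?C" using D(2) by (intro bounded_Times) auto
  have fin: "emeasure lebesgue ?C < \<infinity>"
    using bounded_set_imp_lmeasurable[OF Cb Cs(1)] unfolding fmeasurable_def by blast
  obtain f where f: "\<And>m. continuous_on (closure ?C) (f m)" "H1_conv ?C f u"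
    "(\<lambda>m. sq_int (lebesgue_on D) (\<lambda>y. f m (y, 0) - 0)) \<longlonglongrightarrow> 0"
    using tr unfolding has_initial_trace_def has_trace_iff[OF oc] by blast
  have H: "f m \<in> H1 ?C" "u \<in> H1 ?C" for m using f(2) by (auto simp: H1_conv_def)
  have fm: "f m \<in> borel_measurable (lebesgue_on ?C)" "u \<in> borel_measurable (lebesgue_on ?C)" for m
    using H1_imp_L2[OF H(1)] H1_imp_L2[OF H(2)] by (auto simp: L2_iff)
  have wm: "?w (f m) \<in> borel_measurable (lebesgue_on ?C)" for m
    using H1_weak_partial(2)[OF H(1) t1 oc] by (simp add: L2_iff)
  have f0: "(\<lambda>x. f m (x, 0)) \<in> borel_measurable (lebesgue_on D)" for m
    by (rule continuous_initial_measurable[OF f(1) D(1) T])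
  have f0c: "(\<lambda>z. f m (fst z, 0)) \<in> borel_measurable (lebesgue_on ?C)" for m
    using measurable_fst_lebesgue_on[OF f0 D(1), of "{0<..<T}"] by simp
  define N where "N w = (\<integral>\<^sup>+z. indicator ?C z * ennreal \<bar>w z\<bar> \<partial>lebesgue)" for w
  \<comment> \<open>The coefficients of \<delta> collected from three applications of
    \<open>L1_le_sq_int\<close>, the middle one multiplied by T.\<close>
  define K where "K = emeasure lebesgue ?C + ennreal T * emeasure lebesgue ?C + emeasure lebesgue ?C"
  have Kfin: "K < \<infinity>" using fin by (simp add: K_def ennreal_mult_less_top)
  have s1: "(\<lambda>m. sq_int (lebesgue_on ?C) (\<lambda>z. f m z - u z)) \<longlonglongrightarrow> 0"
    using f(2) by (simp add: H1_conv_def)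
  have s2: "(\<lambda>m. sq_int (lebesgue_on ?C) (?w (f m))) \<longlonglongrightarrow> 0"
  proof -
    have "(\<lambda>m. sq_int (lebesgue_on ?C) (\<lambda>z. ?w (f m) z - ?w u z)) \<longlonglongrightarrow> 0"
      using f(2) t1 by (simp add: H1_conv_def)
    moreover have "sq_int (lebesgue_on ?C) (\<lambda>z. ?w (f m) z - ?w u z) = sq_int (lebesgue_on ?C) (?w (f m))" for m
      by (rule sq_int_cong_AE) (use z in \<open>auto elim: eventually_mono\<close>)
    ultimately show ?thesis by simp
  qed
  have s3: "(\<lambda>m. sq_int (lebesgue_on ?C) (\<lambda>z. f m (fst z, 0))) \<longlonglongrightarrow> 0"
    unfolding sq_int_fst[OF f0 D(1) T]
    using ennreal_tendsto_cmult[OF _ f(3), of "ennreal T"] by (simp add: mult.commute)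
  have main: "N u \<le> ennreal \<delta> * K" if \<delta>: "0 < \<delta>" for \<delta>
  proof -
    let ?i = "ennreal (1 / \<delta>)"
    have le: "N u \<le> ennreal \<delta> * K + (?i * sq_int (lebesgue_on ?C) (\<lambda>z. f m z - u z)
        + ennreal T * (?i * sq_int (lebesgue_on ?C) (?w (f m))) + ?i * sq_int (lebesgue_on ?C) (\<lambda>z. f m (fst z, 0)))" for m
    proof -
      have am: "(\<lambda>z. indicator ?C z * ennreal \<bar>w z\<bar>) \<in> borel_measurable lebesgue"
        if "w \<in> borel_measurable (lebesgue_on ?C)" for w
      proof -
        have "(\<lambda>z. ennreal \<bar>w z\<bar>) \<in> borel_measurable (lebesgue_on ?C)" using that by simp
        then show ?thesis using Cs(1) by (subst (asm) borel_measurable_restrict_space_iff_ennreal) (auto simp: mult.commute)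
      qed
      have "N u \<le> (\<integral>\<^sup>+z. indicator ?C z * ennreal \<bar>f m z - u z\<bar>
          + (indicator ?C z * ennreal \<bar>f m z - f m (fst z, 0)\<bar> + indicator ?C z * ennreal \<bar>f m (fst z, 0)\<bar>) \<partial>lebesgue)"
        unfolding N_def
      proof (rule nn_integral_mono)
        fix z
        have "\<bar>u z\<bar> \<le> \<bar>f m z - u z\<bar> + (\<bar>f m z - f m (fst z, 0)\<bar> + \<bar>f m (fst z, 0)\<bar>)" by linarith
        then have "ennreal \<bar>u z\<bar> \<le> ennreal (\<bar>f m z - u z\<bar> + (\<bar>f m z - f m (fst z, 0)\<bar> + \<bar>f m (fst z, 0)\<bar>))" by (rule ennreal_leI)
        then show "indicator ?C z * ennreal \<bar>u z\<bar> \<le> indicator ?C z * ennreal \<bar>f m z - u z\<bar>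
          + (indicator ?C z * ennreal \<bar>f m z - f m (fst z, 0)\<bar> + indicator ?C z * ennreal \<bar>f m (fst z, 0)\<bar>)"
          by (auto simp: indicator_def ennreal_plus)
      qed
      also have "\<dots> = N (\<lambda>z. f m z - u z) + (N (\<lambda>z. f m z - f m (fst z, 0)) + N (\<lambda>z. f m (fst z, 0)))"
      proof -
        note ms = am[OF borel_measurable_diff[OF fm(1)[of m] fm(2)]] am[OF borel_measurable_diff[OF fm(1)[of m] f0c[of m]]] am[OF f0c[of m]]
        show ?thesis unfolding N_def
          by (subst nn_integral_add[OF ms(1) borel_measurable_add[OF ms(2,3)]], subst nn_integral_add[OF ms(2,3)]) simp
      qed
      also have "\<dots> \<le> (ennreal \<delta> * emeasure lebesgue ?C + ?i * sq_int (lebesgue_on ?C) (\<lambda>z. f m z - u z))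
        + (ennreal T * (ennreal \<delta> * emeasure lebesgue ?C + ?i * sq_int (lebesgue_on ?C) (?w (f m)))
          + (ennreal \<delta> * emeasure lebesgue ?C + ?i * sq_int (lebesgue_on ?C) (\<lambda>z. f m (fst z, 0))))"
      proof (intro add_mono)
        show "N (\<lambda>z. f m z - u z) \<le> ennreal \<delta> * emeasure lebesgue ?C + ?i * sq_int (lebesgue_on ?C) (\<lambda>z. f m z - u z)"
          unfolding N_def by (rule L1_le_sq_int[OF borel_measurable_diff[OF fm] Cs(1) \<delta>])
        show "N (\<lambda>z. f m (fst z, 0)) \<le> ennreal \<delta> * emeasure lebesgue ?C + ?i * sq_int (lebesgue_on ?C) (\<lambda>z. f m (fst z, 0))"
          unfolding N_def by (rule L1_le_sq_int[OF f0c Cs(1) \<delta>])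
        have "N (\<lambda>z. f m z - f m (fst z, 0)) \<le> ennreal T * N (?w (f m))"
          unfolding N_def by (rule initial_trace_L1_estimate[OF D(1) T f(1) H1_weak_partial(1)[OF H(1) t1 oc]])
        also have "\<dots> \<le> ennreal T * (ennreal \<delta> * emeasure lebesgue ?C + ?i * sq_int (lebesgue_on ?C) (?w (f m)))"
          unfolding N_def by (intro mult_left_mono L1_le_sq_int[OF wm Cs(1) \<delta>]) simp
        finally show "N (\<lambda>z. f m z - f m (fst z, 0)) \<le> \<dots>" .
      qed
      also have "\<dots> = ennreal \<delta> * K + (?i * sq_int (lebesgue_on ?C) (\<lambda>z. f m z - u z)
        + ennreal T * (?i * sq_int (lebesgue_on ?C) (?w (f m))) + ?i * sq_int (lebesgue_on ?C) (\<lambda>z. f m (fst z, 0)))"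
        by (simp add: K_def algebra_simps)
      finally show ?thesis .
    qed
    have "(\<lambda>m. ennreal \<delta> * K + (?i * sq_int (lebesgue_on ?C) (\<lambda>z. f m z - u z)
        + ennreal T * (?i * sq_int (lebesgue_on ?C) (?w (f m))) + ?i * sq_int (lebesgue_on ?C) (\<lambda>z. f m (fst z, 0))))
      \<longlonglongrightarrow> ennreal \<delta> * K + (?i * 0 + ennreal T * (?i * 0) + ?i * 0)"
      by (intro tendsto_add tendsto_const ennreal_tendsto_cmult s1 s2 s3) auto
    then have "(\<lambda>m. ennreal \<delta> * K + (?i * sq_int (lebesgue_on ?C) (\<lambda>z. f m z - u z)
        + ennreal T * (?i * sq_int (lebesgue_on ?C) (?w (f m))) + ?i * sq_int (lebesgue_on ?C) (\<lambda>z. f m (fst z, 0))))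
      \<longlonglongrightarrow> ennreal \<delta> * K" by simp
    then show ?thesis by (rule LIMSEQ_le_const) (use le in auto)
  qed
  have "N u \<le> 0 + ennreal e" if e: "0 < e" for e
  proof -
    \<comment> \<open>With \<delta> = e / (k + 1) the bound is at most e; the summand 1 avoids a
      division by 0.\<close>
    obtain k where k: "K = ennreal k" "0 \<le> k" using Kfin by (cases K) auto
    have "N u \<le> ennreal (e / (k + 1)) * K" using e k by (intro main) simp
    also have "\<dots> = ennreal (e / (k + 1) * k)" using e k by (simp add: ennreal_mult[symmetric])
    also have "\<dots> \<le> ennreal e" using e k by (intro ennreal_leI) (simp add: field_simps)
    finally show ?thesis by simp
  qed
  then have "N u \<le> 0" by (rule ennreal_le_epsilon)
  then have N0: "(\<integral>\<^sup>+z. indicator ?C z * ennreal \<bar>u z\<bar> \<partial>lebesgue) = 0" by (simp add: N_def)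
  have "(\<lambda>z. ennreal \<bar>u z\<bar>) \<in> borel_measurable (lebesgue_on ?C)" using fm(2) by simp
  then have um: "(\<lambda>z. indicator ?C z * ennreal \<bar>u z\<bar>) \<in> borel_measurable lebesgue"
    using Cs(1) by (subst (asm) borel_measurable_restrict_space_iff_ennreal) (auto simp: mult.commute)
  have "AE z in lebesgue. indicator ?C z * ennreal \<bar>u z\<bar> = 0"
    using N0 by (subst (asm) nn_integral_0_iff_AE[OF um])
  then show ?thesis
    unfolding AE_lebesgue_on_iff[OF Cs(1)] by eventually_elim (auto simp: indicator_def)
qed

subsection \<open>Functions on the infinite cylinder\<close>

abbreviation halfcyl :: "'a set \<Rightarrow> ('a \<times> real) set" where
  "halfcyl D \<equiv> D \<times> {0<..}"

definition H1_cyl :: "'a::euclidean_space set \<Rightarrow> ('a \<times> real \<Rightarrow> real) set" where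
  "H1_cyl D = {u. \<forall>T>0. u \<in> H1 (cyl D T)}"

lemma U_space_iff: "v \<in> U_space D \<longleftrightarrow> (\<forall>i. (\<lambda>z. v z $ i) \<in> H1_cyl D)"
  by (auto simp: U_space_def H1_cyl_def)

lemma open_halfcyl: "open D \<Longrightarrow> open (halfcyl D)"
  by (intro open_Times) auto

lemma cyl_Suc_exhaust:
  "incseq (\<lambda>n. cyl D (real (Suc n)))" "(\<Union>n. cyl D (real (Suc n))) = halfcyl D"
proof -
  show "incseq (\<lambda>n. cyl D (real (Suc n)))" by (auto simp: incseq_def)
  have "\<exists>n. t < real (Suc n)" for t
    using reals_Archimedean2[of t] by (metis less_trans lessI of_nat_less_iff)
  then show "(\<Union>n. cyl D (real (Suc n))) = halfcyl D" by auto
qed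

lemma AE_halfcylI:
  assumes "\<And>T. 0 < T \<Longrightarrow> AE z in lebesgue. z \<in> cyl D T \<longrightarrow> P z"
  shows "AE z in lebesgue. z \<in> halfcyl D \<longrightarrow> P z"
proof -
  have "AE z in lebesgue. \<forall>n. z \<in> cyl D (real (Suc n)) \<longrightarrow> P z"
    unfolding AE_all_countable by (intro allI assms) simp
  then show ?thesis
  proof eventually_elim
    case (elim z)
    show ?case
    proof
      assume "z \<in> halfcyl D"
      then obtain n where "z \<in> cyl D (real (Suc n))" unfolding cyl_Suc_exhaust(2)[symmetric] by blast
      with elim show "P z" by blast
    qed
  qed
qed

text \<open>The functional differentiates on the infinite cylinder, whereas membership in the
  function space gives weak derivatives on finite cylinders only; gluing connects the two.\<close>

lemma H1_cyl_weak_partial: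
  fixes u :: "'a::euclidean_space \<times> real \<Rightarrow> real"
  assumes u: "u \<in> H1_cyl D" and D: "open D" and e: "e \<in> Basis"
  shows "has_weak_partial (halfcyl D) e u (weak_partial (halfcyl D) e u)"
    "0 < T \<Longrightarrow> AE z in lebesgue. z \<in> cyl D T \<longrightarrow> weak_partial (cyl D T) e u z = weak_partial (halfcyl D) e u z"
    "weak_partial (halfcyl D) e u \<in> borel_measurable (lebesgue_on (halfcyl D))"
proof -
  have w: "has_weak_partial (cyl D (real (Suc n))) e u (weak_partial (cyl D (real (Suc n))) e u)" for n
    using u by (intro H1_weak_partial(1)[OF _ e open_cyl[OF D]]) (simp add: H1_cyl_def)
  obtain h where h: "has_weak_partial (halfcyl D) e u h"
    by (rule has_weak_partial_glue[where E = "\<lambda>n. cyl D (real (Suc n))", OF open_cyl[OF D] cyl_Suc_exhaust e w]) (rule that)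
  show 1: "has_weak_partial (halfcyl D) e u (weak_partial (halfcyl D) e u)"
    by (rule has_weak_partial_weak_partial[OF h])
  show "AE z in lebesgue. z \<in> cyl D T \<longrightarrow> weak_partial (cyl D T) e u z = weak_partial (halfcyl D) e u z" if "0 < T"
    by (rule weak_partial_AE_eq[OF has_weak_partial_subset[OF 1 _ e] open_cyl[OF D] e]) auto
  show "weak_partial (halfcyl D) e u \<in> borel_measurable (lebesgue_on (halfcyl D))"
    using 1 by (intro loc_integrable_measurable[OF open_halfcyl[OF D]]) (simp add: has_weak_partial_def)
qed

lemma Basis_time: "(0 :: 'a::euclidean_space, 1 :: real) \<in> Basis"
  by (simp add: Basis_prod_def)

lemma Basis_space: "b \<in> Basis \<Longrightarrow> (b :: 'a::euclidean_space, 0 :: real) \<in> Basis"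
  by (simp add: Basis_prod_def)

lemma H1_cyl_measurable:
  assumes u: "u \<in> H1_cyl D" and D: "open D"
  shows "u \<in> borel_measurable (lebesgue_on (halfcyl D))"
  using H1_cyl_weak_partial(1)[OF u D Basis_time]
  by (intro loc_integrable_measurable[OF open_halfcyl[OF D]]) (simp add: has_weak_partial_def)

lemma H1_cyl_chain:
  assumes u: "u \<in> H1_cyl D" and D: "open D"
    and G: "\<And>y. (G has_real_derivative G' y) (at y)" "continuous_on UNIV G'" "\<And>y. \<bar>G' y\<bar> \<le> L" "G 0 = 0"
  shows "(\<lambda>z. G (u z)) \<in> H1_cyl D"
    "e \<in> Basis \<Longrightarrow> AE z in lebesgue. z \<in> halfcyl D \<longrightarrow>
      weak_partial (halfcyl D) e (\<lambda>z. G (u z)) z = G' (u z) * weak_partial (halfcyl D) e u z"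
proof -
  have "(\<lambda>z. G (u z)) \<in> H1 (cyl D T)" if "0 < T" for T
  proof (rule H1_chain(1)[OF _ open_cyl[OF D] G])
    show "u \<in> H1 (cyl D T)" using u that by (simp add: H1_cyl_def)
  qed
  then show "(\<lambda>z. G (u z)) \<in> H1_cyl D" by (simp add: H1_cyl_def)
  show "AE z in lebesgue. z \<in> halfcyl D \<longrightarrow>
      weak_partial (halfcyl D) e (\<lambda>z. G (u z)) z = G' (u z) * weak_partial (halfcyl D) e u z" if e: "e \<in> Basis"
    by (rule weak_partial_AE_eq[OF has_weak_partial_chain[OF open_halfcyl[OF D] H1_cyl_weak_partial(1)[OF u D e] e G(1-3)]
      open_halfcyl[OF D] e])
qed

lemma H1_cyl_fst:
  fixes u :: "'a::euclidean_space \<Rightarrow> real"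
  assumes u: "u \<in> H1 D" and D: "open D"
  shows "(\<lambda>z. u (fst z)) \<in> H1_cyl D"
    "b \<in> Basis \<Longrightarrow> AE z in lebesgue. z \<in> halfcyl D \<longrightarrow> weak_partial (halfcyl D) (b, 0) (\<lambda>z. u (fst z)) z = weak_partial D b u (fst z)"
    "AE z in lebesgue. z \<in> halfcyl D \<longrightarrow> weak_partial (halfcyl D) (0, 1) (\<lambda>z. u (fst z)) z = 0"
proof -
  show "(\<lambda>z. u (fst z)) \<in> H1_cyl D" using H1_fst(1)[OF u D] by (simp add: H1_cyl_def)
  show "AE z in lebesgue. z \<in> halfcyl D \<longrightarrow> weak_partial (halfcyl D) (b, 0) (\<lambda>z. u (fst z)) z = weak_partial D b u (fst z)"
    if b: "b \<in> Basis"
    by (rule weak_partial_AE_eq[OF has_weak_partial_fst_space[OF D _ b H1_weak_partial(1)[OF u b D]] open_halfcyl[OF D] Basis_space[OF b]]) simp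
  show "AE z in lebesgue. z \<in> halfcyl D \<longrightarrow> weak_partial (halfcyl D) (0, 1) (\<lambda>z. u (fst z)) z = 0"
    by (rule weak_partial_AE_eq[OF has_weak_partial_fst_time[OF D _ L2_loc_integrable[OF H1_imp_L2[OF u] open_sets_lebesgue[OF D]]]
      open_halfcyl[OF D] Basis_time]) simp
qed

lemma has_traceD: "has_trace D M j u g \<Longrightarrow> u \<in> H1 D" "has_trace D M j u g \<Longrightarrow> g \<in> L2 M"
  by (simp_all add: has_trace_def)

text \<open>The time-independent extension lies in the smaller class \<open>U_init_bdry\<close>,
  hence is a competitor in both cases of the theorem.\<close>

lemma U_init_fst:
  fixes v0 g0 :: "'a::euclidean_space \<Rightarrow> real^'k"
  assumes D: "open D" and t: "\<And>i. has_boundary_trace D (\<lambda>x. v0 x $ i) (\<lambda>x. g0 x $ i)"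
  shows "(\<lambda>z. v0 (fst z)) \<in> U_init_bdry D v0 g0"
proof -
  have H: "(\<lambda>x. v0 x $ i) \<in> H1 D" for i
    using t[of i] unfolding has_boundary_trace_def by (rule has_traceD)
  have "(\<lambda>z. v0 (fst z)) \<in> U_space D" unfolding U_space_iff using H1_cyl_fst(1)[OF H D] by simp
  then have "(\<lambda>z. v0 (fst z)) \<in> U_init D v0"
    using has_initial_trace_fst[OF D _ t] by (simp add: U_init_def)
  then show ?thesis using t by (simp add: U_init_bdry_def)
qed

section \<open>Admissible competitors: changes of time and compositions\<close>

context time_change
begin

lemma phi_pos_iff: "0 < \<phi> t \<longleftrightarrow> 0 < t"
  using phi_less_iff[of 0 t] by (simp add: phi_zero)

lemma psi_pos_iff: "0 < \<psi> t \<longleftrightarrow> 0 < t"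
  using less_iff[of 0 t] by (simp add: zero)

lemma bwd_halfcyl_iff: "bwd z \<in> halfcyl D \<longleftrightarrow> z \<in> halfcyl D" "fwd z \<in> halfcyl D \<longleftrightarrow> z \<in> halfcyl D"
  by (cases z; simp add: bwd_def fwd_def phi_pos_iff psi_pos_iff)+

lemma bwd_vimage_halfcyl: "bwd -` halfcyl D = halfcyl D"
  by (rule set_eqI) (simp only: vimage_eq bwd_halfcyl_iff(1))

lemma H1_cyl_bwd:
  fixes u :: "'a::euclidean_space \<times> real \<Rightarrow> real"
  assumes u: "u \<in> H1_cyl D" and D: "open D"
  shows "(\<lambda>z. u (bwd z)) \<in> H1_cyl D"
    "b \<in> Basis \<Longrightarrow> AE z in lebesgue. z \<in> halfcyl D \<longrightarrow>
       weak_partial (halfcyl D) (b, 0) (\<lambda>z. u (bwd z)) z = weak_partial (halfcyl D) (b, 0) u (bwd z)"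
    "AE z in lebesgue. z \<in> halfcyl D \<longrightarrow>
       weak_partial (halfcyl D) (0, 1) (\<lambda>z. u (bwd z)) z = weak_partial (halfcyl D) (0, 1) u (bwd z) / \<psi>' (\<phi> (snd z))"
proof -
  note oH = open_halfcyl[OF D]
  have "(\<lambda>z. u (bwd z)) \<in> H1 (cyl D T)" if T: "0 < T" for T
  proof -
    have "u \<in> H1 (cyl D (\<phi> T))" using u T by (simp add: H1_cyl_def phi_pos_iff)
    from H1_bwd(1)[OF this open_cyl[OF D]] show ?thesis by (simp add: bwd_vimage_cyl inv)
  qed
  then show "(\<lambda>z. u (bwd z)) \<in> H1_cyl D" by (simp add: H1_cyl_def)
  show "AE z in lebesgue. z \<in> halfcyl D \<longrightarrow>
       weak_partial (halfcyl D) (b, 0) (\<lambda>z. u (bwd z)) z = weak_partial (halfcyl D) (b, 0) u (bwd z)" if b: "b \<in> Basis"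
    using has_weak_partial_bwd_space[OF oH H1_cyl_weak_partial(1)[OF u D Basis_space[OF b]] b]
    unfolding bwd_vimage_halfcyl by (rule weak_partial_AE_eq[OF _ oH Basis_space[OF b]])
  show "AE z in lebesgue. z \<in> halfcyl D \<longrightarrow>
       weak_partial (halfcyl D) (0, 1) (\<lambda>z. u (bwd z)) z = weak_partial (halfcyl D) (0, 1) u (bwd z) / \<psi>' (\<phi> (snd z))"
    using has_weak_partial_bwd_time[OF oH H1_cyl_weak_partial(1)[OF u D Basis_time]]
    unfolding bwd_vimage_halfcyl by (rule weak_partial_AE_eq[OF _ oH Basis_time])
qed

lemma U_init_bwd:
  fixes v :: "'a::euclidean_space \<times> real \<Rightarrow> real^'k"
  assumes v: "v \<in> U_init D v0" and D: "open D"
  shows "(\<lambda>z. v (bwd z)) \<in> U_init D v0"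
proof -
  have "(\<lambda>z. v z $ i) \<in> H1_cyl D" for i using v by (simp add: U_init_def U_space_iff)
  from H1_cyl_bwd(1)[OF this D]
  have "(\<lambda>z. v (bwd z)) \<in> U_space D" by (simp add: U_space_iff)
  moreover have "has_initial_trace D T (\<lambda>z. v (bwd z) $ i) (\<lambda>x. v0 x $ i)" if T: "0 < T" for T i
  proof -
    have "has_initial_trace D (\<phi> T) (\<lambda>z. v z $ i) (\<lambda>x. v0 x $ i)"
      using v T unfolding U_init_def by (simp add: phi_pos_iff)
    from has_initial_trace_bwd[OF D this] show ?thesis by (simp add: inv)
  qed
  ultimately show ?thesis by (simp add: U_init_def)
qed

text \<open>The boundary datum does not depend on time, and the slice of the competitor at t is the
  slice of v at \<phi> t. Only the null set of exceptional times moves, which \<open>AE_phi\<close>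
  allows.\<close>

lemma U_init_bdry_bwd:
  fixes v :: "'a::euclidean_space \<times> real \<Rightarrow> real^'k"
  assumes v: "v \<in> U_init_bdry D v0 g0" and D: "open D"
  shows "(\<lambda>z. v (bwd z)) \<in> U_init_bdry D v0 g0"
proof -
  have "AE t in lebesgue. t > 0 \<longrightarrow> (\<forall>i. has_boundary_trace D (\<lambda>x. v (x, t) $ i) (\<lambda>x. g0 x $ i))"
    using v unfolding U_init_bdry_def by blast
  from AE_phi[OF this]
  have "AE t in lebesgue. t > 0 \<longrightarrow> (\<forall>i. has_boundary_trace D (\<lambda>x. v (bwd (x, t)) $ i) (\<lambda>x. g0 x $ i))"
    unfolding bwd_def fst_conv snd_conv phi_pos_iff .
  moreover have "v \<in> U_init D v0" using v unfolding U_init_bdry_def by blast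
  from U_init_bwd[OF this D] have "(\<lambda>z. v (bwd z)) \<in> U_init D v0" .
  ultimately show ?thesis unfolding U_init_bdry_def vec_lambda_beta mem_Collect_eq by blast
qed

end

lemma U_init_chain:
  fixes v :: "'a::euclidean_space \<times> real \<Rightarrow> real^'k"
  assumes v: "v \<in> U_init D v0" and D: "open D"
    and G: "\<And>y. (G has_real_derivative G' y) (at y)" "continuous_on UNIV G'" "\<And>y. \<bar>G' y\<bar> \<le> L" "G 0 = 0"
    and ae: "\<And>i. AE x in lebesgue_on D. G (v0 x $ i) = v0 x $ i"
  shows "(\<lambda>z. \<chi> i. G (v z $ i)) \<in> U_init D v0"
proof -
  have "(\<lambda>z. v z $ i) \<in> H1_cyl D" for i using v by (simp add: U_init_def U_space_iff)
  from H1_cyl_chain(1)[OF this D G]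
  have "(\<lambda>z. \<chi> i. G (v z $ i)) \<in> U_space D" by (simp add: U_space_iff)
  moreover have "has_initial_trace D T (\<lambda>z. G (v z $ i)) (\<lambda>x. v0 x $ i)" if T: "0 < T" for T i
  proof -
    have t: "has_trace (cyl D T) (lebesgue_on D) (\<lambda>x. (x, 0)) (\<lambda>z. v z $ i) (\<lambda>x. v0 x $ i)"
      using v T by (simp add: U_init_def has_initial_trace_def)
    have m: "(\<lambda>x. v0 x $ i) \<in> borel_measurable (lebesgue_on D)"
      using has_traceD(2)[OF t] by (simp add: L2_def)
    have "has_trace (cyl D T) (lebesgue_on D) (\<lambda>x. (x, 0)) (\<lambda>z. G (v z $ i)) (\<lambda>x. G (v0 x $ i))"
      by (rule has_trace_chain[where j = "\<lambda>x. (x, 0)", OF open_cyl[OF D] continuous_initial_measurable[OF _ D T] t G])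
    then show ?thesis
      unfolding has_initial_trace_def by (rule has_trace_AE[OF _ open_cyl[OF D] _ ae m]) simp
  qed
  ultimately show ?thesis by (simp add: U_init_def)
qed

text \<open>\<open>G (v(t)) - G v\<^sub>0 + v\<^sub>0\<close> is \<open>G (v(t))\<close> and has the trace \<open>G g\<^sub>0 - G g\<^sub>0 + g\<^sub>0\<close>.\<close>
lemma U_init_bdry_chain:
  fixes v :: "'a::euclidean_space \<times> real \<Rightarrow> real^'k"
  assumes v: "v \<in> U_init_bdry D v0 g0" and D: "open D"
    and t0: "\<And>i. has_boundary_trace D (\<lambda>x. v0 x $ i) (\<lambda>x. g0 x $ i)"
    and G: "\<And>y. (G has_real_derivative G' y) (at y)" "continuous_on UNIV G'" "\<And>y. \<bar>G' y\<bar> \<le> L" "G 0 = 0"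
    and ae: "\<And>i. AE x in lebesgue_on D. G (v0 x $ i) = v0 x $ i"
  shows "(\<lambda>z. \<chi> i. G (v z $ i)) \<in> U_init_bdry D v0 g0"
proof -
  have tr: "has_boundary_trace D (\<lambda>x. G (u x)) (\<lambda>x. g0 x $ i)"
    if u: "has_boundary_trace D u (\<lambda>x. g0 x $ i)" for u i
  proof -
    note m = continuous_measurable_surface
    have ch: "has_boundary_trace D (\<lambda>x. G (w x)) (\<lambda>x. G (g0 x $ i))" if "has_boundary_trace D w (\<lambda>x. g0 x $ i)" for w
      unfolding has_boundary_trace_def
      by (rule has_trace_chain[where j = "\<lambda>x. x", OF D _ that[unfolded has_boundary_trace_def] G]) (rule m)
    \<comment> \<open>The chain rule yields the trace G g0, but that G fixes the datum is known only
      inside D, as G v0 = v0. Comparing with G v0, which has the same trace, avoids arguing on the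
      boundary.\<close>
    have d: "has_boundary_trace D (\<lambda>x. 1 * G (u x) + (- 1) * G (v0 x $ i)) (\<lambda>x. 1 * G (g0 x $ i) + (- 1) * G (g0 x $ i))"
      unfolding has_boundary_trace_def
      by (rule has_trace_lin[where j = "\<lambda>x. x", OF D _ ch[OF u, unfolded has_boundary_trace_def]
        ch[OF t0[of i], unfolded has_boundary_trace_def]]) (rule m)
    have s: "has_boundary_trace D (\<lambda>x. 1 * (1 * G (u x) + (- 1) * G (v0 x $ i)) + 1 * v0 x $ i)
      (\<lambda>x. 1 * (1 * G (g0 x $ i) + (- 1) * G (g0 x $ i)) + 1 * g0 x $ i)"
      unfolding has_boundary_trace_def
      by (rule has_trace_lin[where j = "\<lambda>x. x", OF D _ d[unfolded has_boundary_trace_def]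
        t0[of i, unfolded has_boundary_trace_def]]) (rule m)
    have gm: "(\<lambda>x. g0 x $ i) \<in> borel_measurable (surface_measure D)"
      using t0[of i] unfolding has_boundary_trace_def by (auto dest: has_traceD(2) simp: L2_def)
    show ?thesis
      unfolding has_boundary_trace_def
    proof (rule has_trace_AE[OF s[unfolded has_boundary_trace_def] D _ _ gm])
      have "AE x in lebesgue. x \<in> D \<longrightarrow> G (v0 x $ i) = v0 x $ i"
        using ae[of i] unfolding AE_lebesgue_on_iff[OF open_sets_lebesgue[OF D]] .
      then show "AE x in lebesgue. x \<in> D \<longrightarrow> 1 * (1 * G (u x) + (- 1) * G (v0 x $ i)) + 1 * v0 x $ i = G (u x)"
        by eventually_elim simp
    qed simp
  qed
  have "AE t in lebesgue. t > 0 \<longrightarrow> (\<forall>i. has_boundary_trace D (\<lambda>x. v (x, t) $ i) (\<lambda>x. g0 x $ i))"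
    using v unfolding U_init_bdry_def by blast
  then have "AE t in lebesgue. t > 0 \<longrightarrow> (\<forall>i. has_boundary_trace D (\<lambda>x. G (v (x, t) $ i)) (\<lambda>x. g0 x $ i))"
  proof eventually_elim
    case (elim t)
    show ?case
    proof (intro impI allI)
      fix i assume "0 < t"
      with elim have "has_boundary_trace D (\<lambda>x. v (x, t) $ i) (\<lambda>x. g0 x $ i)" by blast
      then show "has_boundary_trace D (\<lambda>x. G (v (x, t) $ i)) (\<lambda>x. g0 x $ i)" by (rule tr)
    qed
  qed
  moreover have "v \<in> U_init D v0" using v unfolding U_init_bdry_def by blast
  from U_init_chain[OF this D G ae] have "(\<lambda>z. \<chi> i. G (v z $ i)) \<in> U_init D v0" .
  ultimately show ?thesis unfolding U_init_bdry_def vec_lambda_beta mem_Collect_eq by blast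
qed

subsection \<open>The nonnegative form of the functional\<close>

lemma nn_integral_exp_weight:
  assumes \<epsilon>: "0 < \<epsilon>"
  shows "(\<integral>\<^sup>+t. ennreal (exp (- t / \<epsilon>) / \<epsilon>) * indicator {0<..} t \<partial>lborel) = 1"
proof -
  have "(\<integral>\<^sup>+t. ennreal (exp (- t / \<epsilon>) / \<epsilon>) * indicator {0<..} t \<partial>lborel)
    = (\<integral>\<^sup>+t. ennreal (exp (- t / \<epsilon>) / \<epsilon>) * indicator {0..} t \<partial>lborel)"
  proof (rule nn_integral_cong_AE)
    show "AE t in lborel. ennreal (exp (- t / \<epsilon>) / \<epsilon>) * indicator {0<..} t = ennreal (exp (- t / \<epsilon>) / \<epsilon>) * indicator {0..} t"
      using AE_lborel_singleton[of "0 :: real"] by eventually_elim (simp add: indicator_def)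
  qed
  also have "\<dots> = ennreal (0 - (- exp (- 0 / \<epsilon>)))"
  proof (rule nn_integral_FTC_atLeast)
    show "((\<lambda>t. - exp (- t / \<epsilon>)) has_real_derivative exp (- t / \<epsilon>) / \<epsilon>) (at t)" for t
      using \<epsilon> by (auto intro!: derivative_eq_intros)
    have "filterlim (\<lambda>t. 1 / \<epsilon> * t) at_top at_top"
      by (rule filterlim_tendsto_pos_mult_at_top[OF tendsto_const _ filterlim_ident]) (use \<epsilon> in simp)
    from tendsto_minus[OF filterlim_compose[OF exp_at_bot filterlim_compose[OF filterlim_uminus_at_bot_at_top this]]]
    show "((\<lambda>t. - exp (- t / \<epsilon>)) \<longlongrightarrow> 0) at_top" by simp
  qed (use \<epsilon> in auto)
  finally show ?thesis by simp
qed

abbreviation decay :: "real \<Rightarrow> 'a \<times> real \<Rightarrow> real" where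
  "decay \<epsilon> z \<equiv> exp (- snd z / \<epsilon>) / \<epsilon>"

text \<open>The exponential weight has total mass 1 on (0, \<infinity>) for every \<epsilon>; this
  is why the energy of a time-independent competitor does not depend on \<epsilon>.\<close>

lemma nn_integral_halfcyl_weight:
  fixes h :: "'a::euclidean_space \<Rightarrow> real"
  assumes h: "h \<in> borel_measurable (lebesgue_on D)" and D: "open D" and \<epsilon>: "0 < \<epsilon>"
  shows "(\<integral>\<^sup>+z. ennreal (decay \<epsilon> z * h (fst z)) \<partial>lebesgue_on (halfcyl D))
    = (\<integral>\<^sup>+x. ennreal (h x) \<partial>lebesgue_on D)"
proof -
  have Ls: "halfcyl D \<in> sets lebesgue" "D \<in> sets lebesgue"
    using D open_halfcyl[OF D] by (auto intro: open_sets_lebesgue)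
  have hm: "(\<lambda>x. ennreal (h x) * indicator D x) \<in> borel_measurable lebesgue"
    using measurable_compose[OF h measurable_ennreal] Ls(2)
    by (subst (asm) borel_measurable_restrict_space_iff_ennreal) auto
  have "(\<integral>\<^sup>+z. ennreal (decay \<epsilon> z * h (fst z)) \<partial>lebesgue_on (halfcyl D))
    = (\<integral>\<^sup>+z. ennreal (decay \<epsilon> z * h (fst z)) * indicator (halfcyl D) z \<partial>lebesgue)"
    using Ls(1) by (intro nn_integral_restrict_space) simp
  also have "\<dots> = (\<integral>\<^sup>+z. (ennreal (h (fst z)) * indicator D (fst z)) * (ennreal (decay \<epsilon> z) * indicator {0<..} (snd z)) \<partial>lebesgue)"
  proof (rule nn_integral_cong)
    fix z :: "'a \<times> real"
    have "ennreal (decay \<epsilon> z * h (fst z)) = ennreal (decay \<epsilon> z) * ennreal (h (fst z))"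
      using \<epsilon> by (intro ennreal_mult') simp
    then show "ennreal (decay \<epsilon> z * h (fst z)) * indicator (halfcyl D) z
      = (ennreal (h (fst z)) * indicator D (fst z)) * (ennreal (decay \<epsilon> z) * indicator {0<..} (snd z))"
      by (auto simp: indicator_def mem_Times_iff mult.commute)
  qed
  also have "\<dots> = (\<integral>\<^sup>+x. ennreal (h x) * indicator D x \<partial>lebesgue) * (\<integral>\<^sup>+t. ennreal (exp (- t / \<epsilon>) / \<epsilon>) * indicator {0<..} t \<partial>lborel)"
    by (rule nn_integral_pair_product[OF hm]) simp
  also have "\<dots> = (\<integral>\<^sup>+x. ennreal (h x) * indicator D x \<partial>lebesgue)"
    by (simp only: nn_integral_exp_weight[OF \<epsilon>] mult_1_right)
  also have "\<dots> = (\<integral>\<^sup>+x. ennreal (h x) \<partial>lebesgue_on D)"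
    using Ls(2) by (intro nn_integral_restrict_space[symmetric]) simp
  finally show ?thesis .
qed

lemma borel_measurable_snd_lebesgue_on:
  "k \<in> borel_measurable borel \<Longrightarrow> (\<lambda>z :: 'a::euclidean_space \<times> real. k (snd z) :: real) \<in> borel_measurable (lebesgue_on E)"
  using measurable_compose[OF borel_measurable_fst_snd(2), of k borel]
  by (intro measurable_restrict_space1 measurable_completion) simp

lemma decay_measurable: "(\<lambda>z :: 'a::euclidean_space \<times> real. decay \<epsilon> z) \<in> borel_measurable (lebesgue_on E)"
  by (rule borel_measurable_snd_lebesgue_on[of "\<lambda>t. exp (- t / \<epsilon>) / \<epsilon>"]) simp

lemma dt_sq_nonneg: "0 \<le> dt_sq D v z" and grad_sq_nonneg: "0 \<le> grad_sq D v z"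
  by (simp_all add: dt_sq_def grad_sq_def sum_nonneg)

lemma U_space_measurable:
  fixes v :: "'a::euclidean_space \<times> real \<Rightarrow> real^'k"
  assumes v: "v \<in> U_space D" and D: "open D"
  shows "(\<lambda>z. v z $ i) \<in> borel_measurable (lebesgue_on (halfcyl D))"
    "dt_sq D v \<in> borel_measurable (lebesgue_on (halfcyl D))"
    "grad_sq D v \<in> borel_measurable (lebesgue_on (halfcyl D))"
    "(\<lambda>z. competition A (v z)) \<in> borel_measurable (lebesgue_on (halfcyl D))"
proof -
  have vi: "(\<lambda>z. v z $ i) \<in> H1_cyl D" for i using v by (simp add: U_space_iff)
  show m: "(\<lambda>z. v z $ i) \<in> borel_measurable (lebesgue_on (halfcyl D))" for i
    by (rule H1_cyl_measurable[OF vi D])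
  show "dt_sq D v \<in> borel_measurable (lebesgue_on (halfcyl D))"
    unfolding dt_sq_def
    by (intro borel_measurable_sum borel_measurable_power H1_cyl_weak_partial(3)[OF vi D Basis_time])
  show "grad_sq D v \<in> borel_measurable (lebesgue_on (halfcyl D))"
    unfolding grad_sq_def
    by (intro borel_measurable_sum borel_measurable_power H1_cyl_weak_partial(3)[OF vi D Basis_space])
  show "(\<lambda>z. competition A (v z)) \<in> borel_measurable (lebesgue_on (halfcyl D))"
    unfolding competition_def
    by (intro borel_measurable_sum borel_measurable_times borel_measurable_power borel_measurable_const m)
qed

text \<open>One constant M bounds all F i from above. With M - F i in place of - F i the integrand
  is nonnegative, and all comparisons take place in \<open>ennreal\<close>, where infinite values
  cause no trouble.\<close>

locale lagrangian =
  fixes D :: "'a::euclidean_space set" and A :: "real^'k^'k" and F :: "'k \<Rightarrow> real \<Rightarrow> real" and M :: real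
  assumes D: "open D" "bounded D" and A: "0 \<le> A $ i $ j"
    and F: "continuous_on UNIV (F i)" "F i y \<le> M" and M: "0 \<le> M"
begin

abbreviation Q :: "('a \<times> real) measure" where
  "Q \<equiv> lebesgue_on (halfcyl D)"

definition pot :: "real^'k \<Rightarrow> real" where
  "pot y = (\<Sum>i\<in>UNIV. 2 * (M - F i (y $ i)))"

definition rest :: "real \<Rightarrow> ('a \<times> real \<Rightarrow> real^'k) \<Rightarrow> 'a \<times> real \<Rightarrow> real" where
  "rest \<beta> v z = grad_sq D v z + pot (v z) + \<beta> / 2 * competition A (v z)"

definition J :: "real \<Rightarrow> real \<Rightarrow> ('a \<times> real \<Rightarrow> real^'k) \<Rightarrow> ennreal" where
  "J \<epsilon> \<beta> v = (\<integral>\<^sup>+z. ennreal (decay \<epsilon> z * (\<epsilon> * dt_sq D v z + rest \<beta> v z)) \<partial>Q)"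

lemma pot_nonneg: "0 \<le> pot y"
  unfolding pot_def using F(2) by (intro sum_nonneg) simp

lemma competition_nonneg: "0 \<le> competition A y"
  unfolding competition_def using A by (intro sum_nonneg mult_nonneg_nonneg) auto

lemma rest_nonneg: "0 \<le> \<beta> \<Longrightarrow> 0 \<le> rest \<beta> v z"
  unfolding rest_def by (intro add_nonneg_nonneg mult_nonneg_nonneg grad_sq_nonneg pot_nonneg competition_nonneg) simp

lemma D_finite: "emeasure lebesgue D < \<infinity>"
  using bounded_set_imp_lmeasurable[OF D(2) open_sets_lebesgue[OF D(1)]] unfolding fmeasurable_def by blast

lemma Q_sets: "halfcyl D \<in> sets lebesgue"
  using open_halfcyl[OF D(1)] by (rule open_sets_lebesgue)

lemma AE_Q_iff: "(AE z in Q. P z) \<longleftrightarrow> (AE z in lebesgue. z \<in> halfcyl D \<longrightarrow> P z)"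
  by (rule AE_lebesgue_on_iff[OF Q_sets])

lemma pot_measurable:
  assumes "\<And>i. (\<lambda>z. v z $ i) \<in> borel_measurable N"
  shows "(\<lambda>z. pot (v z)) \<in> borel_measurable N"
  unfolding pot_def
  by (intro borel_measurable_sum borel_measurable_times borel_measurable_diff borel_measurable_const
      measurable_compose[OF assms borel_measurable_continuous_onI[OF F(1)]])

lemma rest_measurable:
  assumes v: "v \<in> U_space D"
  shows "rest \<beta> v \<in> borel_measurable Q"
  unfolding rest_def
  by (intro borel_measurable_add borel_measurable_times borel_measurable_const
      pot_measurable U_space_measurable[OF v D(1)])

text \<open>The added constant has finite integral, since the weight has mass 1 and D finite
  measure. The identity P + I = J + N is first proved in \<open>ennreal\<close>, where no difference
  of infinite values can occur; N and I are finite, so it can then be rearranged in the extended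
  reals even if P and J are infinite.\<close>

lemma energy_eq:
  assumes v: "v \<in> U_space D" and \<epsilon>: "0 < \<epsilon>" and \<beta>: "0 < \<beta>"
  shows "energy D A F \<epsilon> \<beta> v = enn2ereal (J \<epsilon> \<beta> v) - enn2ereal (ennreal (2 * CARD('k) * M) * emeasure lebesgue D)"
proof -
  define f where "f z = decay \<epsilon> z *
        (\<epsilon> * dt_sq D v z + grad_sq D v z - 2 * (\<Sum>i\<in>UNIV. F i (v z $ i)) + \<beta> / 2 * competition A (v z))" for z
  define m where "m z = decay \<epsilon> z * (2 * CARD('k) * M)" for z :: "'a \<times> real"
  define j where "j z = decay \<epsilon> z * (\<epsilon> * dt_sq D v z + rest \<beta> v z)" for z
  have pot: "pot y = 2 * CARD('k) * M - 2 * (\<Sum>i\<in>UNIV. F i (y $ i))" for y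
    by (simp add: pot_def sum_subtractf right_diff_distrib sum_distrib_left)
  have jf: "j z = f z + m z" for z
    unfolding j_def f_def m_def rest_def pot by (simp add: algebra_simps)
  have m0: "0 \<le> m z" for z using \<epsilon> M by (simp add: m_def)
  have j0: "0 \<le> j z" for z
    using \<epsilon> \<beta> by (simp add: j_def dt_sq_nonneg rest_nonneg)
  note wm = decay_measurable[of \<epsilon> "halfcyl D"]
  have jm: "j \<in> borel_measurable Q"
    unfolding j_def
    by (intro borel_measurable_times[OF wm] borel_measurable_add rest_measurable[OF v] borel_measurable_const borel_measurable_times
        U_space_measurable[OF v D(1)])
  have mm: "m \<in> borel_measurable Q" unfolding m_def by (intro borel_measurable_times[OF wm] borel_measurable_const)
  have "f = (\<lambda>z. j z - m z)" using jf by auto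
  then have fm: "f \<in> borel_measurable Q" using borel_measurable_diff[OF jm mm] by simp
  define P N I where "P = (\<integral>\<^sup>+z. ennreal (f z) \<partial>Q)" and "N = (\<integral>\<^sup>+z. ennreal (- f z) \<partial>Q)" and "I = (\<integral>\<^sup>+z. ennreal (m z) \<partial>Q)"
  have Jj: "J \<epsilon> \<beta> v = (\<integral>\<^sup>+z. ennreal (j z) \<partial>Q)" by (simp add: J_def j_def)
  have "P + I = (\<integral>\<^sup>+z. ennreal (f z) + ennreal (m z) \<partial>Q)"
    unfolding P_def I_def using fm mm by (intro nn_integral_add[symmetric]) auto
  also have "\<dots> = (\<integral>\<^sup>+z. ennreal (j z) + ennreal (- f z) \<partial>Q)"
  proof (rule nn_integral_cong)
    fix z
    show "ennreal (f z) + ennreal (m z) = ennreal (j z) + ennreal (- f z)"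
    proof (cases "0 \<le> f z")
      case True
      then show ?thesis using m0[of z] by (simp add: jf ennreal_plus ennreal_neg)
    next
      case False
      then have "ennreal (j z) + ennreal (- f z) = ennreal (j z + - f z)"
        using j0[of z] by (intro ennreal_plus[symmetric]) auto
      then show ?thesis using False by (simp add: jf ennreal_neg)
    qed
  qed
  also have "\<dots> = J \<epsilon> \<beta> v + N"
    unfolding Jj N_def using fm jm by (intro nn_integral_add) auto
  finally have eq: "P + I = J \<epsilon> \<beta> v + N" .
  have NI: "N \<le> I" unfolding N_def I_def
    by (intro nn_integral_mono ennreal_leI) (use jf j0 in \<open>smt (verit)\<close>)
  have "I = (\<integral>\<^sup>+x. ennreal (2 * CARD('k) * M) \<partial>lebesgue_on D)"
    unfolding I_def m_def by (rule nn_integral_halfcyl_weight[OF _ D(1) \<epsilon>]) simp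
  also have "\<dots> = ennreal (2 * CARD('k) * M) * emeasure lebesgue D"
    using open_sets_lebesgue[OF D(1)] by (simp add: emeasure_restrict_space space_restrict_space)
  finally have I: "I = ennreal (2 * CARD('k) * M) * emeasure lebesgue D" .
  from D_finite have fin: "I < \<infinity>" unfolding I by (simp add: ennreal_mult_less_top)
  obtain i where i: "I = ennreal i" "0 \<le> i" using fin by (cases I) auto
  obtain n where n: "N = ennreal n" "0 \<le> n" using fin NI by (cases N) (auto simp: top_unique)
  have "enn2ereal P - enn2ereal N = enn2ereal (J \<epsilon> \<beta> v) - enn2ereal I"
  proof (cases P)
    case (real p)
    then have "J \<epsilon> \<beta> v + ennreal n = ennreal (p + i)" using eq i n by (simp add: ennreal_plus)
    then obtain q where q: "J \<epsilon> \<beta> v = ennreal q" "0 \<le> q" by (cases "J \<epsilon> \<beta> v") auto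
    then have "ennreal (q + n) = ennreal (p + i)" using \<open>J \<epsilon> \<beta> v + ennreal n = ennreal (p + i)\<close> n by simp
    then have "q + n = p + i" using q n i real ennreal_inj[of "q + n" "p + i"] by (simp del: ennreal_plus)
    then show ?thesis using q n i real by simp
  next
    case top
    then have "J \<epsilon> \<beta> v + ennreal n = top" using eq n by simp
    then have "J \<epsilon> \<beta> v = top" by simp
    then show ?thesis using top i n by simp
  qed
  moreover have "energy D A F \<epsilon> \<beta> v = enn2ereal P - enn2ereal N"
    unfolding energy_def ext_integral_def P_def N_def f_def ..
  ultimately show ?thesis by (simp add: I)
qed

lemma arg_min_J_le:
  assumes m: "is_arg_min (energy D A F \<epsilon> \<beta>) (\<lambda>w. w \<in> U0) v" and w: "w \<in> U0" and U: "U0 \<subseteq> U_space D"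
    and \<epsilon>: "0 < \<epsilon>" and \<beta>: "0 < \<beta>"
  shows "J \<epsilon> \<beta> v \<le> J \<epsilon> \<beta> w"
proof -
  let ?I = "ennreal (2 * CARD('k) * M) * emeasure lebesgue D"
  from D_finite have "?I < \<infinity>" by (simp add: ennreal_mult_less_top)
  then obtain i where i: "?I = ennreal i" "0 \<le> i" by (cases ?I) auto
  have "v \<in> U_space D" "w \<in> U_space D" "\<not> energy D A F \<epsilon> \<beta> w < energy D A F \<epsilon> \<beta> v"
    using m w U by (auto simp: is_arg_min_def)
  then have "enn2ereal (J \<epsilon> \<beta> v) - ereal i \<le> enn2ereal (J \<epsilon> \<beta> w) - ereal i"
    using i by (simp add: energy_eq[OF _ \<epsilon> \<beta>] not_less)
  then have "enn2ereal (J \<epsilon> \<beta> v) \<le> enn2ereal (J \<epsilon> \<beta> w)"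
    by (cases "enn2ereal (J \<epsilon> \<beta> v)"; cases "enn2ereal (J \<epsilon> \<beta> w)") auto
  then show ?thesis by (simp add: less_eq_ennreal.rep_eq)
qed

definition initial_energy :: "('a \<Rightarrow> real^'k) \<Rightarrow> ennreal" where
  "initial_energy v0 = (\<integral>\<^sup>+x. ennreal ((\<Sum>i\<in>UNIV. \<Sum>b\<in>Basis. (weak_partial D b (\<lambda>x. v0 x $ i) x)\<^sup>2) + pot (v0 x)) \<partial>lebesgue_on D)"

lemma J_initial:
  assumes H: "\<And>i. (\<lambda>x. v0 x $ i) \<in> H1 D"
    and seg: "\<And>i j. i \<noteq> j \<Longrightarrow> AE x in lebesgue_on D. v0 x $ i * v0 x $ j = 0"
    and A0: "\<And>i. A $ i $ i = 0" and \<epsilon>: "0 < \<epsilon>"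
  shows "J \<epsilon> \<beta> (\<lambda>z. v0 (fst z)) = initial_energy v0"
proof -
  let ?h = "\<lambda>x. (\<Sum>i\<in>UNIV. \<Sum>b\<in>Basis. (weak_partial D b (\<lambda>x. v0 x $ i) x)\<^sup>2) + pot (v0 x)"
  have Ds: "D \<in> sets lebesgue" by (rule open_sets_lebesgue[OF D(1)])
  have hm: "?h \<in> borel_measurable (lebesgue_on D)"
  proof (intro borel_measurable_add borel_measurable_sum borel_measurable_power pot_measurable)
    show "(\<lambda>x. v0 x $ i) \<in> borel_measurable (lebesgue_on D)" for i
      using H1_imp_L2[OF H[of i]] by (simp add: L2_def)
    show "weak_partial D b (\<lambda>x. v0 x $ i) \<in> borel_measurable (lebesgue_on D)" if "b \<in> Basis" for b i
      using H1_weak_partial(2)[OF H[of i] that D(1)] by (simp add: L2_def)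
  qed
  have a1: "AE z in lebesgue. \<forall>i\<in>UNIV. z \<in> halfcyl D \<longrightarrow> weak_partial (halfcyl D) (0, 1) (\<lambda>z. v0 (fst z) $ i) z = 0"
    by (subst AE_finite_all) (auto intro: H1_cyl_fst(3)[OF H D(1)])
  have a2: "AE z in lebesgue. \<forall>i\<in>UNIV. \<forall>b\<in>Basis. z \<in> halfcyl D \<longrightarrow>
      weak_partial (halfcyl D) (b, 0) (\<lambda>z. v0 (fst z) $ i) z = weak_partial D b (\<lambda>x. v0 x $ i) (fst z)"
    by (subst AE_finite_all, simp, intro ballI, subst AE_finite_all, simp) (auto intro: H1_cyl_fst(2)[OF H D(1)])
  have "AE x in lebesgue. \<forall>i\<in>UNIV. \<forall>j\<in>UNIV. x \<in> D \<longrightarrow> A $ i $ j * (v0 x $ i)\<^sup>2 * (v0 x $ j)\<^sup>2 = 0"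
  proof (subst AE_finite_all, simp, intro ballI, subst AE_finite_all, simp, intro ballI)
    fix i j
    show "AE x in lebesgue. x \<in> D \<longrightarrow> A $ i $ j * (v0 x $ i)\<^sup>2 * (v0 x $ j)\<^sup>2 = 0"
    proof (cases "i = j")
      case True
      then show ?thesis by (simp add: A0)
    next
      case False
      from seg[OF this] show ?thesis unfolding AE_lebesgue_on_iff[OF Ds] by eventually_elim auto
    qed
  qed
  from AE_lebesgue_fst[OF this]
  have a3: "AE z in (lebesgue :: ('a \<times> real) measure). \<forall>i\<in>UNIV. \<forall>j\<in>UNIV. fst z \<in> D \<longrightarrow> A $ i $ j * (v0 (fst z) $ i)\<^sup>2 * (v0 (fst z) $ j)\<^sup>2 = 0" .
  have "AE z in Q. \<epsilon> * dt_sq D (\<lambda>z. v0 (fst z)) z + rest \<beta> (\<lambda>z. v0 (fst z)) z = ?h (fst z)"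
    unfolding AE_Q_iff using a1 a2 a3
  proof eventually_elim
    case (elim z)
    show ?case
    proof
      assume z: "z \<in> halfcyl D"
      then have "fst z \<in> D" by auto
      with elim(3) have "competition A (v0 (fst z)) = 0"
        unfolding competition_def by (intro sum.neutral ballI) blast
      with elim(1,2) z show "\<epsilon> * dt_sq D (\<lambda>z. v0 (fst z)) z + rest \<beta> (\<lambda>z. v0 (fst z)) z = ?h (fst z)"
        by (simp add: dt_sq_def rest_def grad_sq_def)
    qed
  qed
  then have "J \<epsilon> \<beta> (\<lambda>z. v0 (fst z)) = (\<integral>\<^sup>+z. ennreal (decay \<epsilon> z * ?h (fst z)) \<partial>Q)"
    unfolding J_def by (intro nn_integral_cong_AE) (auto elim!: eventually_mono)
  also have "\<dots> = initial_energy v0"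
    unfolding initial_energy_def by (rule nn_integral_halfcyl_weight[OF hm D(1) \<epsilon>])
  finally show ?thesis .
qed

text \<open>The F i need not be bounded below, but on [0, 1], where v0 takes its values, continuity
  bounds them; the gradient part is finite since v0 is in H1.\<close>

lemma initial_energy_finite:
  assumes H: "\<And>i. (\<lambda>x. v0 x $ i) \<in> H1 D"
    and bd: "\<And>i. AE x in lebesgue_on D. 0 \<le> v0 x $ i \<and> v0 x $ i \<le> 1"
  shows "initial_energy v0 < \<infinity>"
proof -
  have "\<exists>B. \<forall>y\<in>{0..1}. \<bar>F i y\<bar> \<le> B" for i
  proof -
    have "compact (F i ` {0..1})"
      by (intro compact_continuous_image continuous_on_subset[OF F(1)]) auto
    then have "bounded (F i ` {0..1})" by (rule compact_imp_bounded)
    then show ?thesis by (auto simp: bounded_iff)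
  qed
  then obtain B where B: "\<And>i y. y \<in> {0..1} \<Longrightarrow> \<bar>F i y\<bar> \<le> B i" by metis
  define b where "b = (\<Sum>i\<in>UNIV. 2 * (M + B i))"
  have wm: "weak_partial D c (\<lambda>x. v0 x $ i) \<in> borel_measurable (lebesgue_on D)" if "c \<in> Basis" for c i
    using H1_weak_partial(2)[OF H[of i] that D(1)] by (simp add: L2_def)
  have "AE x in lebesgue_on D. \<forall>i\<in>UNIV. 0 \<le> v0 x $ i \<and> v0 x $ i \<le> 1"
    using bd by (subst AE_finite_all) auto
  then have "AE x in lebesgue_on D. pot (v0 x) \<le> b"
  proof eventually_elim
    case (elim x)
    have "2 * (M - F i (v0 x $ i)) \<le> 2 * (M + B i)" for i
      using B[of "v0 x $ i" i] elim by force
    then show ?case unfolding pot_def b_def by (intro sum_mono) auto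
  qed
  then have "AE x in lebesgue_on D.
      ennreal ((\<Sum>i\<in>UNIV. \<Sum>c\<in>Basis. (weak_partial D c (\<lambda>x. v0 x $ i) x)\<^sup>2) + pot (v0 x))
      \<le> (\<Sum>i\<in>UNIV. \<Sum>c\<in>Basis. ennreal ((weak_partial D c (\<lambda>x. v0 x $ i) x)\<^sup>2)) + ennreal b"
  proof eventually_elim
    case (elim x)
    have "ennreal ((\<Sum>i\<in>UNIV. \<Sum>c\<in>Basis. (weak_partial D c (\<lambda>x. v0 x $ i) x)\<^sup>2) + pot (v0 x))
      = (\<Sum>i\<in>UNIV. \<Sum>c\<in>Basis. ennreal ((weak_partial D c (\<lambda>x. v0 x $ i) x)\<^sup>2)) + ennreal (pot (v0 x))"
      by (subst ennreal_plus) (auto simp: pot_nonneg sum_nonneg sum_ennreal[symmetric] simp del: sum_ennreal)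
    then show ?case using elim by (simp add: add_left_mono ennreal_leI)
  qed
  then have "initial_energy v0 \<le> (\<integral>\<^sup>+x. (\<Sum>i\<in>UNIV. \<Sum>c\<in>Basis. ennreal ((weak_partial D c (\<lambda>x. v0 x $ i) x)\<^sup>2)) + ennreal b \<partial>lebesgue_on D)"
    unfolding initial_energy_def by (rule nn_integral_mono_AE)
  also have "\<dots> = (\<Sum>i\<in>UNIV. \<Sum>c\<in>Basis. sq_int (lebesgue_on D) (weak_partial D c (\<lambda>x. v0 x $ i)))
      + (\<integral>\<^sup>+x. ennreal b \<partial>lebesgue_on D)"
  proof -
    let ?s = "\<lambda>i c x. ennreal ((weak_partial D c (\<lambda>x. v0 x $ i) x)\<^sup>2)"
    have sm: "?s i c \<in> borel_measurable (lebesgue_on D)" if "c \<in> Basis" for i c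
      using borel_measurable_power[OF wm[OF that]] by (rule measurable_compose[OF _ measurable_ennreal])
    have "(\<integral>\<^sup>+x. (\<Sum>i\<in>UNIV. \<Sum>c\<in>Basis. ?s i c x) + ennreal b \<partial>lebesgue_on D)
      = (\<integral>\<^sup>+x. (\<Sum>i\<in>UNIV. \<Sum>c\<in>Basis. ?s i c x) \<partial>lebesgue_on D) + (\<integral>\<^sup>+x. ennreal b \<partial>lebesgue_on D)"
      by (intro nn_integral_add borel_measurable_sum sm) simp_all
    also have "(\<integral>\<^sup>+x. (\<Sum>i\<in>UNIV. \<Sum>c\<in>Basis. ?s i c x) \<partial>lebesgue_on D)
      = (\<Sum>i\<in>UNIV. \<integral>\<^sup>+x. (\<Sum>c\<in>Basis. ?s i c x) \<partial>lebesgue_on D)"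
      by (intro nn_integral_sum borel_measurable_sum sm)
    also have "\<dots> = (\<Sum>i\<in>UNIV. \<Sum>c\<in>Basis. \<integral>\<^sup>+x. ?s i c x \<partial>lebesgue_on D)"
      by (intro sum.cong refl nn_integral_sum sm)
    finally show ?thesis unfolding sq_int_def .
  qed
  also have "\<dots> < \<infinity>"
  proof -
    have "sq_int (lebesgue_on D) (weak_partial D c (\<lambda>x. v0 x $ i)) < \<infinity>" if "c \<in> Basis" for i c
      using H1_weak_partial(2)[OF H[of i] that D(1)] by (simp add: L2_iff)
    moreover have "(\<integral>\<^sup>+x. ennreal b \<partial>lebesgue_on D) < \<infinity>"
      using open_sets_lebesgue[OF D(1)] D_finite by (simp add: emeasure_restrict_space space_restrict_space ennreal_mult_less_top)
    ultimately show ?thesis by (simp add: ennreal_sum_less_top)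
  qed
  finally show ?thesis .
qed

end

subsection \<open>Truncation of minimizers\<close>

text \<open>A smooth substitute for clipping to [0, 1], within reach of the chain rule for C1
  functions. Its fixed points are exactly [0, 1]; other values move towards that interval without
  crossing its ends, so that F i increases by monotonicity. The factor 1/8 together with
  \<open>flat_2_le\<close> keeps the slope between 0 and 1.\<close>

definition trunc :: "real \<Rightarrow> real" where
  "trunc y = y - flat 0 (y - 1) / 8 + flat 0 (- y) / 8"

definition trunc_deriv :: "real \<Rightarrow> real" where
  "trunc_deriv y = 1 - flat 2 (y - 1) / 8 - flat 2 (- y) / 8"

lemma flat_nonneg: "0 \<le> flat n x"
  by (simp add: flat_def)

lemma flat_nonpos_arg: "x \<le> 0 \<Longrightarrow> flat n x = 0"
  by (simp add: flat_def)

text \<open>With s = 1 / (2 x) this is the square of s <= exp s, multiplied by 4 exp(- 2 s).\<close>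

lemma flat_2_le: "flat 2 x \<le> 4"
proof (cases "0 < x")
  case True
  have "1 / (2 * x) \<le> exp (1 / (2 * x))" using exp_ge_add_one_self[of "1 / (2 * x)"] by linarith
  then have "(1 / (2 * x))\<^sup>2 \<le> (exp (1 / (2 * x)))\<^sup>2" using True by (intro power_mono) auto
  also have "\<dots> = exp (1 / x)" using exp_double[of "1 / (2 * x)"] by simp
  finally have "1 / x\<^sup>2 \<le> 4 * exp (1 / x)" by (simp add: power_divide power_mult_distrib)
  then have "1 / x\<^sup>2 * exp (- (1 / x)) \<le> 4 * exp (1 / x) * exp (- (1 / x))" by (rule mult_right_mono) simp
  also have "\<dots> = 4" by (simp add: exp_minus)
  finally show ?thesis using True by (simp add: flat_def)
qed (simp add: flat_def)

lemma flat_0_less: "0 < x \<Longrightarrow> 0 < flat 0 x \<and> flat 0 x < x"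
proof -
  assume x: "0 < x"
  have "1 / x < exp (1 / x)" using exp_ge_add_one_self[of "1 / x"] by linarith
  then have "inverse (exp (1 / x)) < inverse (1 / x)" using x by (intro less_imp_inverse_less) auto
  then show ?thesis using x by (simp add: flat_def exp_minus)
qed

lemma trunc_has_derivative: "(trunc has_real_derivative trunc_deriv y) (at y)"
proof -
  have d: "(flat 0 has_real_derivative flat 2 x) (at x)" for x
    using flat_has_derivative[of 0 x] by (simp add: numeral_2_eq_2)
  have 1: "((\<lambda>y. flat 0 (y - 1)) has_real_derivative flat 2 (y - 1) * 1) (at y)"
    by (rule DERIV_chain2[OF d]) (auto intro!: derivative_eq_intros)
  have 2: "((\<lambda>y. flat 0 (- y)) has_real_derivative flat 2 (- y) * (- 1)) (at y)"
    by (rule DERIV_chain2[OF d]) (auto intro!: derivative_eq_intros)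
  show ?thesis
    unfolding trunc_def[abs_def] trunc_deriv_def by (auto intro!: derivative_eq_intros 1 2)
qed

lemma trunc_deriv_continuous: "continuous_on UNIV trunc_deriv"
proof -
  have c: "continuous_on UNIV (flat 2)" by (rule smooth_fun_continuous[OF smooth_fun_flat])
  have 1: "continuous_on UNIV (\<lambda>y. flat 2 (y - 1))" "continuous_on UNIV (\<lambda>y. flat 2 (- y))"
    by (rule continuous_on_compose2[OF c]; auto intro!: continuous_intros)+
  show ?thesis unfolding trunc_deriv_def[abs_def] by (intro continuous_intros 1) auto
qed

lemma trunc_deriv_bounds: "0 \<le> trunc_deriv y" "trunc_deriv y \<le> 1"
  using flat_nonneg[of 2 "y - 1"] flat_nonneg[of 2 "- y"] flat_2_le[of "y - 1"] flat_2_le[of "- y"]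
  by (simp_all add: trunc_deriv_def)

lemma trunc_deriv_abs: "\<bar>trunc_deriv y\<bar> \<le> 1" "\<bar>1 - trunc_deriv y\<bar> \<le> 1"
  using trunc_deriv_bounds[of y] by linarith+

lemma trunc_id: "0 \<le> y \<Longrightarrow> y \<le> 1 \<Longrightarrow> trunc y = y"
  by (simp add: trunc_def flat_nonpos_arg)

lemma trunc_above: "1 < y \<Longrightarrow> 1 < trunc y \<and> trunc y < y"
  using flat_0_less[of "y - 1"] by (simp add: trunc_def flat_nonpos_arg)

lemma trunc_below: "y < 0 \<Longrightarrow> y < trunc y \<and> trunc y < 0"
  using flat_0_less[of "- y"] by (simp add: trunc_def flat_nonpos_arg)

lemma trunc_fixed: "y - trunc y = 0 \<Longrightarrow> 0 \<le> y \<and> y \<le> 1"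
  using trunc_above[of y] trunc_below[of y] by linarith

lemma trunc_sq_le: "(trunc y)\<^sup>2 \<le> y\<^sup>2"
proof -
  have "\<bar>trunc y\<bar> \<le> \<bar>y\<bar>"
    using trunc_above[of y] trunc_below[of y] trunc_id[of y] by linarith
  then show ?thesis by (simp add: abs_le_square_iff)
qed

lemma le_trunc:
  assumes "mono_on {..<0} f" "antimono_on {1<..} f"
  shows "f y \<le> (f (trunc y) :: real)"
proof -
  consider "y < 0" | "0 \<le> y" "y \<le> 1" | "1 < y" by linarith
  then show ?thesis
  proof cases
    case 1
    then show ?thesis using trunc_below[OF 1] by (intro mono_onD[OF assms(1)]) auto
  next
    case 2
    then show ?thesis by (simp add: trunc_id)
  next
    case 3
    then show ?thesis using trunc_above[OF 3] by (intro monotone_onD[OF assms(2), simplified]) auto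
  qed
qed

lemma (in lagrangian) J_measurable:
  assumes v: "v \<in> U_space D"
  shows "(\<lambda>z. decay \<epsilon> z * (\<epsilon> * dt_sq D v z + rest \<beta> v z)) \<in> borel_measurable Q"
proof -
  note wm = decay_measurable[of \<epsilon> "halfcyl D"]
  show ?thesis
    by (intro borel_measurable_times[OF wm] borel_measurable_add rest_measurable[OF v] borel_measurable_const
        borel_measurable_times U_space_measurable[OF v D(1)])
qed

text \<open>Truncating strictly decreases \<open>(\<partial>\<^sub>t v\<^sub>i)\<^sup>2\<close> wherever \<open>v\<^sub>i\<close> is outside of [0,1] and \<open>\<partial>\<^sub>t v\<^sub>i\<close> does not vanish.\<close>
lemma (in lagrangian) minimizer_trunc_time_derivative:
  assumes v: "v \<in> U_space D" and fin: "J \<epsilon> \<beta> v < \<infinity>" and \<epsilon>: "0 < \<epsilon>" and \<beta>: "0 < \<beta>"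
    and le: "J \<epsilon> \<beta> v \<le> J \<epsilon> \<beta> (\<lambda>z. \<chi> i. trunc (v z $ i))"
    and Ft: "\<And>i y. F i y \<le> F i (trunc y)"
  shows "AE z in Q. weak_partial (halfcyl D) (0, 1) (\<lambda>z. v z $ i - trunc (v z $ i)) z = 0"
proof -
  define w where "w = (\<lambda>z. \<chi> i. trunc (v z $ i))"
  define p where "p e i = weak_partial (halfcyl D) e (\<lambda>z. v z $ i)" for e i
  have vi: "(\<lambda>z. v z $ i) \<in> H1_cyl D" for i using v by (simp add: U_space_iff)
  note T = trunc_has_derivative trunc_deriv_continuous trunc_deriv_abs(1) trunc_id[of 0, simplified]
  have w: "w \<in> U_space D" unfolding w_def U_space_iff using H1_cyl_chain(1)[OF vi D(1) T] by simp
  have wp: "AE z in Q. weak_partial (halfcyl D) e (\<lambda>z. w z $ i) z = trunc_deriv (v z $ i) * p e i z" if "e \<in> Basis" for e i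
    unfolding AE_Q_iff p_def w_def vec_lambda_beta by (rule H1_cyl_chain(2)[OF vi D(1) T that])
  have wt: "AE z in Q. \<forall>i\<in>UNIV. weak_partial (halfcyl D) (0, 1) (\<lambda>z. w z $ i) z = trunc_deriv (v z $ i) * p (0, 1) i z"
    by (subst AE_finite_all) (auto intro: wp[OF Basis_time])
  have ws: "AE z in Q. \<forall>i\<in>UNIV. \<forall>b\<in>Basis. weak_partial (halfcyl D) (b, 0) (\<lambda>z. w z $ i) z = trunc_deriv (v z $ i) * p (b, 0) i z"
    by (subst AE_finite_all, simp, intro ballI, subst AE_finite_all, simp) (auto intro: wp[OF Basis_space])
  define f where "f v z = decay \<epsilon> z * (\<epsilon> * dt_sq D v z + rest \<beta> v z)" for v z
  have sq: "(trunc_deriv y * x)\<^sup>2 \<le> x\<^sup>2" for x y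
  proof -
    have "(trunc_deriv y)\<^sup>2 \<le> 1" using trunc_deriv_bounds[of y] by (simp add: power_le_one)
    from mult_right_mono[OF this, of "x\<^sup>2"] show ?thesis by (simp add: power_mult_distrib)
  qed
  have rl: "AE z in Q. rest \<beta> w z \<le> rest \<beta> v z"
    using ws
  proof eventually_elim
    case (elim z)
    have "grad_sq D w z \<le> grad_sq D v z"
      unfolding grad_sq_def using elim sq by (intro sum_mono) (simp add: p_def)
    moreover have "pot (w z) \<le> pot (v z)"
      unfolding pot_def w_def using Ft by (intro sum_mono) simp
    moreover have "competition A (w z) \<le> competition A (v z)"
      unfolding competition_def w_def using A trunc_sq_le
      by (intro sum_mono mult_mono mult_nonneg_nonneg) auto
    then have "\<beta> / 2 * competition A (w z) \<le> \<beta> / 2 * competition A (v z)"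
      using \<beta> by (intro mult_left_mono) auto
    ultimately show ?case unfolding rest_def by linarith
  qed
  have tl: "AE z in Q. dt_sq D w z \<le> dt_sq D v z"
    using wt
  proof eventually_elim
    case (elim z)
    then show ?case unfolding dt_sq_def using sq by (intro sum_mono) (simp add: p_def)
  qed
  have fl: "AE z in Q. f w z \<le> f v z"
    using rl tl
  proof eventually_elim
    case (elim z)
    have "\<epsilon> * dt_sq D w z \<le> \<epsilon> * dt_sq D v z" using elim(2) \<epsilon> by simp
    then show ?case unfolding f_def using elim(1) \<epsilon> by (intro mult_left_mono add_mono) auto
  qed
  have fm: "f v \<in> borel_measurable Q" "f w \<in> borel_measurable Q"
    unfolding f_def[abs_def] by (rule J_measurable[OF v] J_measurable[OF w])+
  have Jf: "J \<epsilon> \<beta> v = (\<integral>\<^sup>+z. ennreal (f v z) \<partial>Q)" "J \<epsilon> \<beta> w = (\<integral>\<^sup>+z. ennreal (f w z) \<partial>Q)"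
    by (simp_all add: J_def f_def)
  have "J \<epsilon> \<beta> w \<le> J \<epsilon> \<beta> v"
    unfolding Jf by (rule nn_integral_mono_AE) (use fl in \<open>auto elim!: eventually_mono intro: ennreal_leI\<close>)
  then have eq: "J \<epsilon> \<beta> v = J \<epsilon> \<beta> w" using le unfolding w_def[symmetric] by (rule antisym[rotated])
  have "(\<integral>\<^sup>+z. ennreal (f v z) - ennreal (f w z) \<partial>Q) = (\<integral>\<^sup>+z. ennreal (f v z) \<partial>Q) - (\<integral>\<^sup>+z. ennreal (f w z) \<partial>Q)"
  proof (rule nn_integral_diff)
    show "(\<lambda>z. ennreal (f v z)) \<in> borel_measurable Q" "(\<lambda>z. ennreal (f w z)) \<in> borel_measurable Q" using fm by auto
    show "(\<integral>\<^sup>+z. ennreal (f w z) \<partial>Q) \<noteq> \<infinity>" using fin eq by (simp flip: Jf)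
    show "AE z in Q. ennreal (f w z) \<le> ennreal (f v z)" using fl by (auto elim!: eventually_mono intro: ennreal_leI)
  qed
  also have "\<dots> = 0" using fin eq by (simp flip: Jf)
  finally have "(\<integral>\<^sup>+z. ennreal (f v z) - ennreal (f w z) \<partial>Q) = 0" .
  \<comment> \<open>Ordered integrands with the same finite integral agree almost
    everywhere.\<close>
  then have "AE z in Q. ennreal (f v z) - ennreal (f w z) = 0"
    using fm by (subst (asm) nn_integral_0_iff_AE) auto
  then have ge: "AE z in Q. f v z \<le> f w z"
  proof eventually_elim
    case (elim z)
    have "0 \<le> f w z" unfolding f_def using \<epsilon> \<beta> by (simp add: dt_sq_nonneg rest_nonneg)
    with elim show ?case by (simp add: diff_eq_0_iff_ennreal ennreal_le_iff)
  qed
  have G: "((\<lambda>y. y - trunc y) has_real_derivative 1 - trunc_deriv y) (at y)" for y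
    by (auto intro!: derivative_eq_intros trunc_has_derivative)
  have Gc: "continuous_on UNIV (\<lambda>y. 1 - trunc_deriv y)"
    by (intro continuous_intros trunc_deriv_continuous)
  have dt: "AE z in Q. weak_partial (halfcyl D) (0, 1) (\<lambda>z. v z $ i - trunc (v z $ i)) z = (1 - trunc_deriv (v z $ i)) * p (0, 1) i z"
    unfolding AE_Q_iff p_def
    by (rule H1_cyl_chain(2)[where G = "\<lambda>y. y - trunc y", OF vi D(1) G Gc trunc_deriv_abs(2) _ Basis_time]) (simp add: trunc_id)
  show ?thesis
    using dt ge rl tl wt
  proof eventually_elim
    case (elim z)
    have "0 < decay \<epsilon> z" using \<epsilon> by simp
    from elim(2)[unfolded f_def] this have "\<epsilon> * dt_sq D v z + rest \<beta> v z \<le> \<epsilon> * dt_sq D w z + rest \<beta> w z"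
      by (rule mult_left_le_imp_le)
    \<comment> \<open>\<open>rest\<close> has not increased, so the equality must hold for the time
      derivatives alone; since no slope exceeds 1, it then holds for each component.\<close>
    then have "\<epsilon> * dt_sq D v z \<le> \<epsilon> * dt_sq D w z" using elim(3) by linarith
    then have "dt_sq D v z \<le> dt_sq D w z" using \<epsilon> by simp
    then have "dt_sq D w z = dt_sq D v z" using elim(4) by simp
    then have s: "(\<Sum>i\<in>UNIV. (trunc_deriv (v z $ i) * p (0, 1) i z)\<^sup>2) = (\<Sum>i\<in>UNIV. (p (0, 1) i z)\<^sup>2)"
      unfolding dt_sq_def using elim(5) by (simp add: p_def)
    have "(trunc_deriv (v z $ i) * p (0, 1) i z)\<^sup>2 = (p (0, 1) i z)\<^sup>2"
      by (rule sum_mono_inv[OF s sq]) auto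
    then have "p (0, 1) i z = 0 \<or> (trunc_deriv (v z $ i))\<^sup>2 = 1" by (simp add: power_mult_distrib)
    then have "p (0, 1) i z = 0 \<or> trunc_deriv (v z $ i) = 1"
      using trunc_deriv_bounds(1)[of "v z $ i"] by (auto simp: power2_eq_1_iff)
    then show ?case using elim(1) by auto
  qed
qed

text \<open>The difference of v_i and its truncation has zero time derivative, and its initial trace
  is 0 because v0 takes values in [0, 1]. Hence it vanishes on every finite cylinder, and only
  values in [0, 1] are fixed by \<open>trunc\<close>.\<close>

lemma (in lagrangian) minimizer_bounds:
  assumes v: "v \<in> U_init D v0" and fin: "J \<epsilon> \<beta> v < \<infinity>" and \<epsilon>: "0 < \<epsilon>" and \<beta>: "0 < \<beta>"
    and le: "J \<epsilon> \<beta> v \<le> J \<epsilon> \<beta> (\<lambda>z. \<chi> i. trunc (v z $ i))"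
    and Ft: "\<And>i y. F i y \<le> F i (trunc y)"
    and bd: "\<And>i. AE x in lebesgue_on D. 0 \<le> v0 x $ i \<and> v0 x $ i \<le> 1"
  shows "AE z in Q. 0 \<le> v z $ i \<and> v z $ i \<le> 1"
proof -
  have vU: "v \<in> U_space D" using v by (simp add: U_init_def)
  let ?u = "\<lambda>z. v z $ i - trunc (v z $ i)"
  have G: "((\<lambda>y. y - trunc y) has_real_derivative 1 - trunc_deriv y) (at y)" for y
    by (auto intro!: derivative_eq_intros trunc_has_derivative)
  have Gc: "continuous_on UNIV (\<lambda>y. 1 - trunc_deriv y)"
    by (intro continuous_intros trunc_deriv_continuous)
  have G0: "0 - trunc 0 = 0" by (simp add: trunc_id)
  have vi: "(\<lambda>z. v z $ i) \<in> H1_cyl D" using vU by (simp add: U_space_iff)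
  have u: "?u \<in> H1_cyl D" by (rule H1_cyl_chain(1)[OF vi D(1) G Gc trunc_deriv_abs(2) G0])
  have dz: "AE z in lebesgue. z \<in> halfcyl D \<longrightarrow> weak_partial (halfcyl D) (0, 1) ?u z = 0"
    using minimizer_trunc_time_derivative[OF vU fin \<epsilon> \<beta> le Ft, of i] unfolding AE_Q_iff .
  have "AE z in lebesgue. z \<in> cyl D T \<longrightarrow> ?u z = 0" if T: "0 < T" for T
  proof -
    have t: "has_trace (cyl D T) (lebesgue_on D) (\<lambda>x. (x, 0)) (\<lambda>z. v z $ i) (\<lambda>x. v0 x $ i)"
      using v T by (simp add: U_init_def has_initial_trace_def)
    have "has_trace (cyl D T) (lebesgue_on D) (\<lambda>x. (x, 0)) ?u (\<lambda>x. v0 x $ i - trunc (v0 x $ i))"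
      by (rule has_trace_chain[where j = "\<lambda>x. (x, 0)",
          OF open_cyl[OF D(1)] continuous_initial_measurable[OF _ D(1) T] t G Gc trunc_deriv_abs(2) G0])
    then have tr: "has_initial_trace D T ?u (\<lambda>x. 0)"
      unfolding has_initial_trace_def
    proof (rule has_trace_AE[OF _ open_cyl[OF D(1)]])
      show "AE x in lebesgue_on D. v0 x $ i - trunc (v0 x $ i) = 0"
        using bd[of i] by eventually_elim (simp add: trunc_id)
    qed simp_all
    have cs: "cyl D T \<in> sets lebesgue" by (rule open_sets_lebesgue[OF open_cyl[OF D(1)]])
    have "AE z in lebesgue_on (cyl D T). weak_partial (cyl D T) (0, 1) ?u z = 0"
      unfolding AE_lebesgue_on_iff[OF cs] using H1_cyl_weak_partial(2)[OF u D(1) Basis_time T] dz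
      by eventually_elim auto
    from zero_initial_trace[OF D T tr this] show ?thesis unfolding AE_lebesgue_on_iff[OF cs] .
  qed
  then have "AE z in lebesgue. z \<in> halfcyl D \<longrightarrow> ?u z = 0" by (rule AE_halfcylI)
  then show ?thesis
    unfolding AE_Q_iff by eventually_elim (use trunc_fixed in blast)
qed

subsection \<open>Logistic time changes\<close>

text \<open>The decreasing logistic function of s / \<epsilon>, solving \<epsilon> \<sigma>' = -
  \<sigma> (1 - \<sigma>) and equal to 1/2 where exp(s / \<epsilon>) = L. Through this equation all
  weights below become polynomials in \<sigma>.\<close>

definition logistic :: "real \<Rightarrow> real \<Rightarrow> real \<Rightarrow> real" where
  "logistic L \<epsilon> s = L / (exp (s / \<epsilon>) + L)"

text \<open>As \<sigma> starts from L / (L + 1), the profile vanishes at s = 0, so the time change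
  fixes the initial time. It increases towards \<epsilon> L.\<close>

definition stretch :: "real \<Rightarrow> real \<Rightarrow> real \<Rightarrow> real" where
  "stretch L \<epsilon> s = \<epsilon> * (L - (L + 1) * logistic L \<epsilon> s)"

definition stretch_deriv :: "real \<Rightarrow> real \<Rightarrow> real \<Rightarrow> real" where
  "stretch_deriv L \<epsilon> s = (L + 1) * (logistic L \<epsilon> s * (1 - logistic L \<epsilon> s))"

text \<open>The weight of the energy density in the inner variation along \<open>stretch\<close>; the term \<open>L / (1 + L)\<close>
  is paid for by the energy itself and makes the weight nonnegative.\<close>
definition energy_weight :: "real \<Rightarrow> real \<Rightarrow> real \<Rightarrow> real" where
  "energy_weight L \<epsilon> s = stretch L \<epsilon> s / \<epsilon> - stretch_deriv L \<epsilon> s + L / (1 + L)"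

context
  fixes L \<epsilon> :: real
  assumes L: "0 < L" and \<epsilon>: "0 < \<epsilon>"
begin

lemma logistic_bounds: "0 < logistic L \<epsilon> s" "logistic L \<epsilon> s < 1"
  using L by (simp_all add: logistic_def add_pos_pos)

lemma logistic_le: "0 \<le> s \<Longrightarrow> logistic L \<epsilon> s \<le> L / (1 + L)"
  unfolding logistic_def using L \<epsilon> by (intro divide_left_mono) (auto simp: add_pos_pos)

lemma logistic_deriv:
  "(logistic L \<epsilon> has_real_derivative - (1 / \<epsilon>) * (logistic L \<epsilon> s * (1 - logistic L \<epsilon> s))) (at s)"
proof -
  have p: "0 < exp (s / \<epsilon>) + L" using L by (simp add: add_pos_pos)
  have "((\<lambda>s. L / (exp (s / \<epsilon>) + L)) has_real_derivative - (L * (exp (s / \<epsilon>) / \<epsilon>)) / ((exp (s / \<epsilon>) + L) * (exp (s / \<epsilon>) + L))) (at s)"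
    using p \<epsilon> by (auto intro!: derivative_eq_intros)
  moreover have "1 - L / (exp (s / \<epsilon>) + L) = exp (s / \<epsilon>) / (exp (s / \<epsilon>) + L)"
    using p by (simp add: field_simps)
  ultimately show ?thesis by (simp add: logistic_def[abs_def])
qed

lemma smooth_logistic: "smooth_fun (logistic L \<epsilon>)"
proof -
  have "C_k m (logistic L \<epsilon>)" for m
  proof (induction m)
    case 0
    have "continuous_on UNIV (logistic L \<epsilon>)"
      by (rule DERIV_continuous_on, rule has_field_derivative_at_within, rule logistic_deriv)
    then show ?case by simp
  next
    case (Suc m)
    have eq: "(\<lambda>s. - (1 / \<epsilon>) * (logistic L \<epsilon> s * (1 - logistic L \<epsilon> s)))
      = (\<lambda>s. - (1 / \<epsilon>) * (logistic L \<epsilon> s * (1 + (- 1) * logistic L \<epsilon> s)))" by simp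
    show ?case
      by (rule C_k_real_SucI[OF logistic_deriv]) (subst eq, intro C_k_mult C_k_add C_k_const Suc.IH)
  qed
  then show ?thesis by (simp add: smooth_fun_def)
qed

lemma smooth_stretch_deriv: "smooth_fun (stretch_deriv L \<epsilon>)"
  unfolding stretch_deriv_def[abs_def]
  by (intro smooth_fun_intros smooth_fun_diff smooth_logistic)

lemma stretch_has_derivative: "(stretch L \<epsilon> has_real_derivative stretch_deriv L \<epsilon> s) (at s)"
  unfolding stretch_def[abs_def] stretch_deriv_def
  using \<epsilon> by (auto intro!: derivative_eq_intros logistic_deriv simp: field_simps)

lemma stretch_zero: "stretch L \<epsilon> 0 = 0"
  using L by (simp add: stretch_def logistic_def add.commute)

lemma stretch_deriv_bounds: "0 \<le> stretch_deriv L \<epsilon> s" "stretch_deriv L \<epsilon> s \<le> L + 1"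
proof -
  note b = logistic_bounds[of s]
  show "0 \<le> stretch_deriv L \<epsilon> s" unfolding stretch_deriv_def using L b by (intro mult_nonneg_nonneg) auto
  have "logistic L \<epsilon> s * (1 - logistic L \<epsilon> s) \<le> 1 * 1" using b by (intro mult_mono) auto
  from mult_left_mono[OF this, of "L + 1"] show "stretch_deriv L \<epsilon> s \<le> L + 1"
    unfolding stretch_deriv_def using L by simp
qed

lemma stretch_lower: "- \<epsilon> \<le> stretch L \<epsilon> s"
proof -
  have "(L + 1) * logistic L \<epsilon> s \<le> (L + 1) * 1" using L logistic_bounds[of s] by (intro mult_left_mono) auto
  then have "\<epsilon> * (- 1) \<le> \<epsilon> * (L - (L + 1) * logistic L \<epsilon> s)" using \<epsilon> by (intro mult_left_mono) auto
  then show ?thesis by (simp add: stretch_def)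
qed

lemma stretch_upper: "stretch L \<epsilon> s \<le> \<epsilon> * L"
  unfolding stretch_def using \<epsilon> L logistic_bounds[of s] by (intro mult_left_mono) auto

lemma stretch_nonneg: "0 \<le> s \<Longrightarrow> 0 \<le> stretch L \<epsilon> s"
proof -
  assume "0 \<le> s"
  from mult_left_mono[OF logistic_le[OF this], of "L + 1"] have "(L + 1) * logistic L \<epsilon> s \<le> L"
    using L by (simp add: add.commute)
  then show ?thesis using \<epsilon> by (simp add: stretch_def)
qed

text \<open>A quadratic polynomial in \<sigma> with roots c = L / (1 + L), the value of \<sigma> at
  s = 0, and 2 - c. The constant c added in \<open>energy_weight\<close> is the one that places a
  root at the initial value of \<sigma>.\<close>

lemma energy_weight_factor:
  "energy_weight L \<epsilon> s = (L + 1) * (L / (1 + L) - logistic L \<epsilon> s) * (2 - L / (1 + L) - logistic L \<epsilon> s)"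
proof -
  define c where "c = L / (1 + L)"
  define x where "x = logistic L \<epsilon> s"
  have c: "(L + 1) * c = L" using L by (simp add: c_def add.commute)
  have "stretch L \<epsilon> s / \<epsilon> = L - (L + 1) * x" using \<epsilon> by (simp add: stretch_def x_def)
  then have "energy_weight L \<epsilon> s = (L - (L + 1) * x) - (L + 1) * (x * (1 - x)) + c"
    unfolding energy_weight_def stretch_deriv_def by (simp add: x_def c_def)
  also have "\<dots> = (L + 1) * (c - x) * (2 - c - x)"
  proof -
    have "(L + 1) * (c - x) * (2 - c - x) = 2 * ((L + 1) * c) - ((L + 1) * c) * c - 2 * (L + 1) * x + (L + 1) * x * x"
      by (simp add: algebra_simps)
    also have "\<dots> = 2 * L - L * c - 2 * (L + 1) * x + (L + 1) * x * x" by (simp only: c)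
    also have "L * c = L - c" using c by (simp add: algebra_simps)
    finally show ?thesis by (simp add: algebra_simps)
  qed
  finally show ?thesis by (simp add: c_def x_def)
qed

lemma energy_weight_nonneg: "0 \<le> s \<Longrightarrow> 0 \<le> energy_weight L \<epsilon> s"
proof -
  assume s: "0 \<le> s"
  have "L / (1 + L) < 1" using L by simp
  then have "0 \<le> 2 - L / (1 + L) - logistic L \<epsilon> s" using logistic_bounds(2)[of s] by linarith
  then show ?thesis
    unfolding energy_weight_factor using logistic_le[OF s] L
    by (intro mult_nonneg_nonneg) simp_all
qed

text \<open>For exp(s / \<epsilon>) between 2 L and 6 L one has \<sigma> <= 1/3; the first two
  factors give together at least L/3 and the last one at least 2/3. So the weight is at least 2 L /
  9, and 6 L is 27 times that.\<close>

lemma energy_weight_lower: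
  assumes y: "2 * L \<le> exp (s / \<epsilon>)" "exp (s / \<epsilon>) \<le> 6 * L" and L1: "1 \<le> L"
  shows "exp (s / \<epsilon>) \<le> 27 * energy_weight L \<epsilon> s"
proof -
  define x where "x = logistic L \<epsilon> s"
  define y where "y = exp (s / \<epsilon>)"
  have yb: "2 * L \<le> y" "y \<le> 6 * L" "0 < y + L" "2 \<le> y" using assms L by (auto simp: y_def)
  have xe: "x = L / (y + L)" by (simp add: x_def y_def logistic_def)
  have x3: "x \<le> 1 / 3" unfolding xe using yb L by (simp add: divide_le_eq)
  have e: "(L + 1) * (L / (1 + L) - x) = L * ((y - 1) / (y + L))"
  proof -
    have "(L + 1) * (L / (1 + L) - x) = L - (L + 1) * x" using L by (simp add: right_diff_distrib add.commute)
    also have "\<dots> = L * ((y - 1) / (y + L))" unfolding xe using yb(3) by (simp add: field_simps)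
    finally show ?thesis .
  qed
  have "1 / 3 \<le> (y - 1) / (y + L)" using yb by (simp add: field_simps)
  then have a: "L * (1 / 3) \<le> (L + 1) * (L / (1 + L) - x)" unfolding e using L by (intro mult_left_mono) auto
  have "L / (1 + L) < 1" using L by simp
  then have b: "2 / 3 \<le> 2 - L / (1 + L) - x" using x3 by linarith
  have "L * (1 / 3) * (2 / 3) \<le> (L + 1) * (L / (1 + L) - x) * (2 - L / (1 + L) - x)"
    by (rule mult_mono[OF a b]) (use order_trans[OF _ a] L in auto)
  then have "2 * L / 9 \<le> energy_weight L \<epsilon> s" by (simp add: energy_weight_factor x_def)
  then show ?thesis using yb unfolding y_def by linarith
qed

text \<open>In terms of y = exp(s / \<epsilon>) the derivative is (L + 1) L y / (y + L)^2, and y <=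
  L makes the denominator at most 4 L^2.\<close>

lemma stretch_deriv_lower:
  assumes y: "exp (s / \<epsilon>) \<le> L"
  shows "exp (s / \<epsilon>) \<le> 4 * stretch_deriv L \<epsilon> s"
proof -
  define y where "y = exp (s / \<epsilon>)"
  have yb: "0 < y" "y \<le> L" "0 < y + L" using assms L by (auto simp: y_def add_pos_pos)
  have "1 - L / (y + L) = y / (y + L)" using yb by (simp add: field_simps)
  then have e: "stretch_deriv L \<epsilon> s = (L + 1) * L * y / (y + L)\<^sup>2"
    by (simp add: stretch_deriv_def logistic_def y_def power2_eq_square)
  have "(y + L)\<^sup>2 \<le> (L + L)\<^sup>2" using yb by (intro power_mono) auto
  also have "\<dots> \<le> 4 * ((L + 1) * L)" using L by (simp add: power2_eq_square algebra_simps)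
  finally have "y * (y + L)\<^sup>2 \<le> y * (4 * ((L + 1) * L))" using yb by (intro mult_left_mono) auto
  then have "y \<le> 4 * ((L + 1) * L * y / (y + L)\<^sup>2)" using yb(3) by (simp add: field_simps)
  then show ?thesis unfolding e by (simp add: y_def)
qed

lemma stretch_time_change:
  assumes \<delta>: "0 < \<delta>"
  defines "\<psi> \<equiv> \<lambda>s. s + \<delta> * stretch L \<epsilon> s"
  shows "time_change \<psi> (inv \<psi>) (\<lambda>s. 1 + \<delta> * stretch_deriv L \<epsilon> s) 1 (1 + \<delta> * (L + 1))"
proof -
  have d: "(\<psi> has_real_derivative 1 + \<delta> * stretch_deriv L \<epsilon> s) (at s)" for s
    unfolding \<psi>_def by (auto intro!: derivative_eq_intros stretch_has_derivative)
  have pos: "1 \<le> 1 + \<delta> * stretch_deriv L \<epsilon> s" for s using \<delta> stretch_deriv_bounds(1)[of s] by simp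
  have "strict_mono \<psi>"
  proof (rule strict_monoI)
    fix s t :: real assume "s < t"
    then show "\<psi> s < \<psi> t"
      by (rule DERIV_pos_imp_increasing) (use d less_le_trans[OF zero_less_one pos] in blast)
  qed
  then have inj: "inj \<psi>" by (rule strict_mono_imp_inj_on)
  have cont: "continuous_on {a..b} \<psi>" for a b
    by (rule DERIV_continuous_on, rule has_field_derivative_at_within, rule d)
  \<comment> \<open>As the profile takes values between - \<epsilon> and \<epsilon> L, the points t
    - \<delta> \<epsilon> L and t + \<delta> \<epsilon> bracket a solution.\<close>
  have surj: "\<exists>s. \<psi> s = t" for t
  proof -
    have "\<delta> * stretch L \<epsilon> (t - \<delta> * (\<epsilon> * L)) \<le> \<delta> * (\<epsilon> * L)" using \<delta> stretch_upper by (intro mult_left_mono) auto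
    then have "\<psi> (t - \<delta> * (\<epsilon> * L)) \<le> t" by (simp add: \<psi>_def)
    moreover have "\<delta> * (- \<epsilon>) \<le> \<delta> * stretch L \<epsilon> (t + \<delta> * \<epsilon>)" using \<delta> stretch_lower by (intro mult_left_mono) auto
    then have "t \<le> \<psi> (t + \<delta> * \<epsilon>)" by (simp add: \<psi>_def)
    moreover have "t - \<delta> * (\<epsilon> * L) \<le> t + \<delta> * \<epsilon>" using \<delta> \<epsilon> L mult_pos_pos[OF \<delta> mult_pos_pos[OF \<epsilon> L]] mult_pos_pos[OF \<delta> \<epsilon>] by linarith
    ultimately show ?thesis using IVT'[of \<psi>] cont by blast
  qed
  then have "surj \<psi>" by (metis surjI surj_def)
  show ?thesis
  proof
    show "(\<psi> has_real_derivative 1 + \<delta> * stretch_deriv L \<epsilon> s) (at s)" for s by (rule d)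
    show "smooth_fun (\<lambda>s. 1 + \<delta> * stretch_deriv L \<epsilon> s)" by (intro smooth_fun_intros smooth_stretch_deriv)
    show "(0 :: real) < 1" by simp
    show "1 \<le> 1 + \<delta> * stretch_deriv L \<epsilon> s" for s by (rule pos)
    show "1 + \<delta> * stretch_deriv L \<epsilon> s \<le> 1 + \<delta> * (L + 1)" for s
      using stretch_deriv_bounds(2)[of s] \<delta> by (simp add: mult_left_mono)
    show "inv \<psi> (\<psi> s) = s" for s by (rule inv_f_f[OF inj])
    show "\<psi> (inv \<psi> t) = t" for t by (rule surj_f_inv_f[OF \<open>surj \<psi>\<close>])
    show "\<psi> 0 = 0" by (simp add: \<psi>_def stretch_zero)
  qed
qed

end

text \<open>Both rest on (1 - a + a^2) (1 + a) = 1 + a^3 and on exp a >= 1 + a.\<close>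

lemma exp_minus_le:
  fixes a :: real
  assumes "0 \<le> a"
  shows "exp (- a) \<le> 1 - a + a\<^sup>2" "1 / (1 + a) \<le> 1 - a + a\<^sup>2"
proof -
  have "1 \<le> (1 - a + a\<^sup>2) * (1 + a)"
    using assms by (simp add: algebra_simps power2_eq_square)
  then show *: "1 / (1 + a) \<le> 1 - a + a\<^sup>2" using assms by (simp add: divide_le_eq)
  have "inverse (exp a) \<le> inverse (1 + a)" using assms by (intro le_imp_inverse_le) auto
  then show "exp (- a) \<le> 1 - a + a\<^sup>2" using * by (simp add: exp_minus inverse_eq_divide)
qed

text \<open>With a = \<delta> \<eta> / \<epsilon> and b = \<delta> \<eta>' these are the factors
  that the time change puts on the kinetic part and on the rest. The error 4 m^2 is uniform in time
  and of second order in \<delta>.\<close>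

lemma inner_variation_factor:
  fixes a b m :: real
  assumes a: "0 \<le> a" "a \<le> m" and b: "0 \<le> b" "b \<le> m" and m: "m \<le> 1"
  shows "exp (- a) / (1 + b) \<le> 1 - a - b + 4 * m\<^sup>2" "exp (- a) * (1 + b) \<le> 1 - a + b + 4 * m\<^sup>2"
proof -
  have sq: "a * a \<le> m * m" "b * b \<le> m * m" "a * b \<le> m * m" using a b by (auto intro!: mult_mono)
  have nn: "0 \<le> a * a" "0 \<le> b * b" "0 \<le> a * b" "0 \<le> a * (b * b)" "0 \<le> a * a * b" using a b by auto
  have m1: "m * m \<le> 1" using a m by (intro mult_le_one) auto
  have q: "(a * a) * (b * b) \<le> (m * m) * 1"
    using sq(2) m1 by (intro mult_mono[OF sq(1)] order_trans[OF sq(2)]) (auto simp: nn)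
  have "a * a * b \<le> (m * m) * 1"
    using b m by (intro mult_mono[OF sq(1)]) auto
  have "exp (- a) * (1 / (1 + b)) \<le> (1 - a + a\<^sup>2) * (1 - b + b\<^sup>2)"
    using exp_minus_le[OF a(1)] exp_minus_le[OF b(1)] a b
    by (intro mult_mono) (auto intro: order_trans[rotated])
  also have "\<dots> = 1 - a - b + a * b + a * a + b * b - a * (b * b) - a * a * b + (a * a) * (b * b)"
    by (simp add: algebra_simps power2_eq_square)
  also have "\<dots> \<le> 1 - a - b + 4 * m\<^sup>2" using sq nn q by (simp add: power2_eq_square)
  finally show "exp (- a) / (1 + b) \<le> 1 - a - b + 4 * m\<^sup>2" by simp
  have "exp (- a) * (1 + b) \<le> (1 - a + a\<^sup>2) * (1 + b)"
    using exp_minus_le(1)[OF a(1)] b by (intro mult_right_mono) auto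
  also have "\<dots> = 1 - a + b + a * a - a * b + a * a * b" by (simp add: algebra_simps power2_eq_square)
  also have "\<dots> \<le> 1 - a + b + 4 * m\<^sup>2"
    using sq nn \<open>a * a * b \<le> (m * m) * 1\<close> by (simp add: power2_eq_square)
  finally show "exp (- a) * (1 + b) \<le> 1 - a + b + 4 * m\<^sup>2" .
qed

subsection \<open>Inner variations\<close>

context lagrangian
begin

text \<open>Substitution t = \<psi> s: the squared time derivative brings the factor \<psi>' to the
  power -2 and the volume element brings \<psi>', so the kinetic part is divided by \<psi>' and the
  rest is multiplied by it.\<close>

lemma J_bwd:
  assumes tc: "time_change \<psi> \<phi> \<psi>' c C" and v: "v \<in> U_space D" and \<epsilon>: "0 < \<epsilon>"
  shows "J \<epsilon> \<beta> (\<lambda>z. v (time_change.bwd \<phi> z))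
    = (\<integral>\<^sup>+z. ennreal (exp (- \<psi> (snd z) / \<epsilon>) / \<epsilon> * (\<epsilon> * dt_sq D v z / \<psi>' (snd z) + \<psi>' (snd z) * rest \<beta> v z)) \<partial>Q)"
proof -
  interpret time_change \<psi> \<phi> \<psi>' c C by (rule tc)
  let ?H = "halfcyl D"
  define w where "w = (\<lambda>z. v (bwd z))"
  have vi: "(\<lambda>z. v z $ i) \<in> H1_cyl D" for i using v by (simp add: U_space_iff)
  have pos: "0 < \<psi>' s" for s using c(1) c(2)[of s] by linarith
  have a1: "AE z in lebesgue. \<forall>i\<in>UNIV. z \<in> ?H \<longrightarrow>
      weak_partial ?H (0, 1) (\<lambda>z. w z $ i) z = weak_partial ?H (0, 1) (\<lambda>z. v z $ i) (bwd z) / \<psi>' (\<phi> (snd z))"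
    unfolding w_def by (subst AE_finite_all) (auto intro: H1_cyl_bwd(3)[OF vi D(1)])
  have a2: "AE z in lebesgue. \<forall>i\<in>UNIV. \<forall>b\<in>Basis. z \<in> ?H \<longrightarrow>
      weak_partial ?H (b, 0) (\<lambda>z. w z $ i) z = weak_partial ?H (b, 0) (\<lambda>z. v z $ i) (bwd z)"
    unfolding w_def by (subst AE_finite_all, simp, intro ballI, subst AE_finite_all, simp) (auto intro: H1_cyl_bwd(2)[OF vi D(1)])
  have ae: "AE z in lebesgue. z \<in> ?H \<longrightarrow>
      dt_sq D w z = dt_sq D v (bwd z) / (\<psi>' (\<phi> (snd z)))\<^sup>2 \<and> rest \<beta> w z = rest \<beta> v (bwd z)"
    using a1 a2
  proof eventually_elim
    case (elim z)
    show ?case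
    proof (intro impI conjI)
      assume z: "z \<in> ?H"
      show "dt_sq D w z = dt_sq D v (bwd z) / (\<psi>' (\<phi> (snd z)))\<^sup>2"
        using elim(1) z by (simp add: dt_sq_def power_divide sum_divide_distrib)
      have "grad_sq D w z = grad_sq D v (bwd z)" using elim(2) z by (simp add: grad_sq_def)
      then show "rest \<beta> w z = rest \<beta> v (bwd z)" by (simp add: rest_def w_def)
    qed
  qed
  define f where "f z = exp (- \<psi> (snd z) / \<epsilon>) / \<epsilon> * (\<epsilon> * (dt_sq D v z / (\<psi>' (snd z))\<^sup>2) + rest \<beta> v z)" for z
  define g where "g z = ennreal (f z) * indicator ?H z" for z
  have wm: "(\<lambda>z. exp (- \<psi> (snd z) / \<epsilon>) / \<epsilon>) \<in> borel_measurable Q"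
    by (rule borel_measurable_snd_lebesgue_on[of "\<lambda>t. exp (- \<psi> t / \<epsilon>) / \<epsilon>"]) measurable
  have pm: "(\<lambda>z. (\<psi>' (snd z))\<^sup>2) \<in> borel_measurable Q"
    by (rule borel_measurable_snd_lebesgue_on[of "\<lambda>t. (\<psi>' t)\<^sup>2"]) measurable
  have "f \<in> borel_measurable Q"
    unfolding f_def[abs_def]
    by (intro borel_measurable_times[OF wm] borel_measurable_add rest_measurable[OF v] borel_measurable_const
        borel_measurable_times borel_measurable_divide[OF _ pm] U_space_measurable[OF v D(1)])
  from measurable_compose[OF this measurable_ennreal]
  have gm: "g \<in> borel_measurable lebesgue"
    unfolding g_def[abs_def] using Q_sets by (subst (asm) borel_measurable_restrict_space_iff_ennreal) auto
  have gbm: "(\<lambda>z. g (bwd z)) \<in> borel_measurable lebesgue" by (rule measurable_compose[OF lebesgue_measurable(2) gm])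
  have "J \<epsilon> \<beta> w = (\<integral>\<^sup>+z. ennreal (decay \<epsilon> z * (\<epsilon> * dt_sq D w z + rest \<beta> w z)) * indicator ?H z \<partial>lebesgue)"
    unfolding J_def using Q_sets by (intro nn_integral_restrict_space) simp
  also have "\<dots> = (\<integral>\<^sup>+z. g (bwd z) \<partial>lebesgue)"
  proof (rule nn_integral_cong_AE)
    show "AE z in lebesgue. ennreal (decay \<epsilon> z * (\<epsilon> * dt_sq D w z + rest \<beta> w z)) * indicator ?H z = g (bwd z)"
      using ae
    proof eventually_elim
      case (elim z)
      show ?case
      proof (cases "z \<in> ?H")
        case True
        moreover have "bwd z \<in> ?H" using True by (simp only: bwd_halfcyl_iff)
        ultimately show ?thesis using elim by (simp add: g_def f_def) (simp add: bwd_def inv)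
      next
        case False
        moreover have "bwd z \<notin> ?H" using False by (simp only: bwd_halfcyl_iff not_False_eq_True)
        ultimately show ?thesis by (simp add: g_def)
      qed
    qed
  qed
  also have "\<dots> = (\<integral>\<^sup>+z. ennreal (\<psi>' (snd z)) * g z \<partial>lebesgue)"
    unfolding nn_integral_lebesgue[OF gbm] by simp
  also have "\<dots> = (\<integral>\<^sup>+z. ennreal (exp (- \<psi> (snd z) / \<epsilon>) / \<epsilon> * (\<epsilon> * dt_sq D v z / \<psi>' (snd z) + \<psi>' (snd z) * rest \<beta> v z)) * indicator ?H z \<partial>lebesgue)"
  proof (rule nn_integral_cong)
    fix z
    have "ennreal (\<psi>' (snd z)) * g z = ennreal (\<psi>' (snd z) * f z) * indicator ?H z"
      unfolding g_def using pos[of "snd z"] by (simp add: ennreal_mult' mult.assoc)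
    also have "\<psi>' (snd z) * f z = exp (- \<psi> (snd z) / \<epsilon>) / \<epsilon> * (\<epsilon> * dt_sq D v z / \<psi>' (snd z) + \<psi>' (snd z) * rest \<beta> v z)"
    proof -
      have "\<psi>' (snd z) * (\<epsilon> * (dt_sq D v z / (\<psi>' (snd z))\<^sup>2) + rest \<beta> v z)
        = \<epsilon> * dt_sq D v z / \<psi>' (snd z) + \<psi>' (snd z) * rest \<beta> v z"
        using pos[of "snd z"] by (simp add: distrib_left power2_eq_square)
      then show ?thesis unfolding f_def by (simp only: mult.left_commute[of "\<psi>' (snd z)"])
    qed
    finally show "ennreal (\<psi>' (snd z)) * g z
      = ennreal (exp (- \<psi> (snd z) / \<epsilon>) / \<epsilon> * (\<epsilon> * dt_sq D v z / \<psi>' (snd z) + \<psi>' (snd z) * rest \<beta> v z)) * indicator ?H z" .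
  qed
  also have "\<dots> = (\<integral>\<^sup>+z. ennreal (exp (- \<psi> (snd z) / \<epsilon>) / \<epsilon> * (\<epsilon> * dt_sq D v z / \<psi>' (snd z) + \<psi>' (snd z) * rest \<beta> v z)) \<partial>Q)"
    using Q_sets by (intro nn_integral_restrict_space[symmetric]) simp
  finally show ?thesis unfolding w_def .
qed

lemma AE_Q_pos: "AE z in Q. 0 < snd z"
  unfolding AE_Q_iff by auto

text \<open>Instead of differentiating under the integral, minimality is used for each small
  \<delta> > 0 together with the explicit remainder of \<open>inner_variation_factor\<close>.
  Division by \<delta> shows that the integral of X is at most 0, and adding L / (1 + L) times the
  energy gives the bound.\<close>

proposition inner_variation:
  assumes v: "v \<in> U_space D" and fin: "J \<epsilon> \<beta> v < \<infinity>" and \<epsilon>: "0 < \<epsilon>" and \<beta>: "0 < \<beta>" and L: "0 < L"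
    and min: "\<And>\<psi> \<phi> \<psi>' c C. time_change \<psi> \<phi> \<psi>' c C \<Longrightarrow> J \<epsilon> \<beta> v \<le> J \<epsilon> \<beta> (\<lambda>z. v (time_change.bwd \<phi> z))"
  shows "(\<integral>\<^sup>+z. ennreal (decay \<epsilon> z * (energy_weight L \<epsilon> (snd z) * (\<epsilon> * dt_sq D v z + rest \<beta> v z)
      + 2 * stretch_deriv L \<epsilon> (snd z) * (\<epsilon> * dt_sq D v z))) \<partial>Q) \<le> J \<epsilon> \<beta> v"
proof -
  define om where "om z = decay \<epsilon> z" for z :: "'a \<times> real"
  define k where "k z = \<epsilon> * dt_sq D v z" for z
  define r where "r z = rest \<beta> v z" for z
  define h where "h z = stretch L \<epsilon> (snd z) / \<epsilon>" for z :: "'a \<times> real"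
  define e where "e z = stretch_deriv L \<epsilon> (snd z)" for z :: "'a \<times> real"
  define q where "q z = om z * (k z + r z)" for z
  \<comment> \<open>X is minus the derivative at \<delta> = 0 of the integrand transformed by the
    time change.\<close>
  define X where "X z = om z * ((h z + e z) * k z + (h z - e z) * r z)" for z
  have om: "0 < om z" for z using \<epsilon> by (simp add: om_def)
  have k0: "0 \<le> k z" for z using \<epsilon> by (simp add: k_def dt_sq_nonneg)
  have r0: "0 \<le> r z" for z using \<beta> by (simp add: r_def rest_nonneg)
  have q0: "0 \<le> q z" for z unfolding q_def using om[of z] k0[of z] r0[of z] by simp
  have e0: "0 \<le> e z" "e z \<le> L + 1" for z using stretch_deriv_bounds[OF L \<epsilon>] by (simp_all add: e_def)
  have h0: "0 \<le> h z" "h z \<le> L + 1" if "0 < snd z" for z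
  proof -
    show "0 \<le> h z" using stretch_nonneg[OF L \<epsilon>, of "snd z"] that \<epsilon> by (simp add: h_def)
    have "h z \<le> \<epsilon> * L / \<epsilon>" unfolding h_def using stretch_upper[OF L \<epsilon>] \<epsilon> by (intro divide_right_mono) auto
    then show "h z \<le> L + 1" using \<epsilon> by simp
  qed
  have hm: "h \<in> borel_measurable Q"
  proof -
    have "continuous_on UNIV (stretch L \<epsilon>)"
      by (rule DERIV_continuous_on, rule has_field_derivative_at_within, rule stretch_has_derivative[OF L \<epsilon>])
    then have "stretch L \<epsilon> \<in> borel_measurable borel" by (rule borel_measurable_continuous_onI)
    then have "(\<lambda>t. stretch L \<epsilon> t / \<epsilon>) \<in> borel_measurable borel" by simp
    from borel_measurable_snd_lebesgue_on[OF this] show ?thesis unfolding h_def[abs_def] .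
  qed
  have em: "e \<in> borel_measurable Q"
    unfolding e_def[abs_def]
    by (intro borel_measurable_snd_lebesgue_on borel_measurable_continuous_onI smooth_fun_continuous smooth_stretch_deriv L \<epsilon>)
  have omm: "om \<in> borel_measurable Q" unfolding om_def[abs_def] by (rule decay_measurable)
  have km: "k \<in> borel_measurable Q" unfolding k_def[abs_def]
    by (intro borel_measurable_times borel_measurable_const U_space_measurable[OF v D(1)])
  have rm: "r \<in> borel_measurable Q" unfolding r_def[abs_def] by (rule rest_measurable[OF v])
  have qm: "q \<in> borel_measurable Q" unfolding q_def[abs_def] by (intro borel_measurable_times borel_measurable_add omm km rm)
  have Xm: "X \<in> borel_measurable Q" unfolding X_def[abs_def]
    by (intro borel_measurable_times borel_measurable_add borel_measurable_diff omm km rm hm em)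
  have Jq: "J \<epsilon> \<beta> v = (\<integral>\<^sup>+z. ennreal (q z) \<partial>Q)" by (simp add: J_def q_def om_def k_def r_def)
  have qi: "integrable Q q"
    using fin qm q0 by (intro integrableI_nonneg) (auto simp: Jq)
  have Jr: "J \<epsilon> \<beta> v = ennreal (LINT z|Q. q z)"
    unfolding Jq by (rule nn_integral_eq_integral[OF qi]) (simp add: q0)
  have Xb: "AE z in Q. norm (X z) \<le> norm (2 * (L + 1) * q z)"
    using AE_Q_pos
  proof eventually_elim
    case (elim z)
    have "\<bar>(h z + e z) * k z + (h z - e z) * r z\<bar> \<le> \<bar>h z + e z\<bar> * k z + \<bar>h z - e z\<bar> * r z"
      using abs_triangle_ineq[of "(h z + e z) * k z" "(h z - e z) * r z"] k0[of z] r0[of z] by (simp add: abs_mult)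
    also have "\<dots> \<le> (2 * (L + 1)) * k z + (2 * (L + 1)) * r z"
      using h0[OF elim] e0[of z] L by (intro add_mono mult_right_mono k0 r0) auto
    finally have "om z * \<bar>(h z + e z) * k z + (h z - e z) * r z\<bar> \<le> om z * ((2 * (L + 1)) * (k z + r z))"
      using om[of z] by (intro mult_left_mono) (auto simp: algebra_simps)
    then show ?case using om[of z] q0[of z] L
      by (simp add: X_def q_def abs_mult mult.left_commute mult.assoc k0 r0)
  qed
  have Xi: "integrable Q X"
    by (rule Bochner_Integration.integrable_bound[OF integrable_mult_right[OF qi] Xm Xb])
  have key: "(LINT z|Q. X z) \<le> 4 * \<delta> * (L + 1)\<^sup>2 * (LINT z|Q. q z)" if \<delta>: "0 < \<delta>" "\<delta> * (L + 1) \<le> 1" for \<delta>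
  proof -
    \<comment> \<open>L + 1 dominates both \<eta> / \<epsilon> and \<eta>' for positive times, so m
      bounds both perturbation parameters.\<close>
    define m where "m = \<delta> * (L + 1)"
    define Y where "Y z = q z - \<delta> * X z + 4 * m\<^sup>2 * q z" for z
    have Yi: "integrable Q Y" unfolding Y_def[abs_def] using qi Xi by auto
    let ?\<psi> = "\<lambda>s. s + \<delta> * stretch L \<epsilon> s" and ?d = "\<lambda>s. 1 + \<delta> * stretch_deriv L \<epsilon> s"
    note tc = stretch_time_change[OF L \<epsilon> \<delta>(1)]
    define W where "W z = exp (- ?\<psi> (snd z) / \<epsilon>) / \<epsilon> * (\<epsilon> * dt_sq D v z / ?d (snd z) + ?d (snd z) * rest \<beta> v z)" for z
    have W0: "0 \<le> W z" for z
    proof -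
      define d where "d = ?d (snd z)"
      have "0 < d" unfolding d_def using mult_nonneg_nonneg[of \<delta> "stretch_deriv L \<epsilon> (snd z)"] \<delta> stretch_deriv_bounds(1)[OF L \<epsilon>, of "snd z"] by linarith
      then show ?thesis unfolding W_def d_def[symmetric]
        by (intro mult_nonneg_nonneg add_nonneg_nonneg divide_nonneg_nonneg rest_nonneg dt_sq_nonneg) (use \<epsilon> \<beta> in auto)
    qed
    have WY: "AE z in Q. W z \<le> Y z"
      using AE_Q_pos
    proof eventually_elim
      case (elim z)
      define a b where "a = \<delta> * h z" and "b = \<delta> * e z"
      have a: "0 \<le> a" "a \<le> m" and b: "0 \<le> b" "b \<le> m"
        using h0[OF elim] e0[of z] \<delta> by (auto simp: a_def b_def m_def intro!: mult_left_mono)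
      have m1: "m \<le> 1" using \<delta> by (simp add: m_def)
      have "exp (- ?\<psi> (snd z) / \<epsilon>) / \<epsilon> = om z * exp (- a)"
        using \<epsilon> by (simp add: om_def a_def h_def exp_add[symmetric] diff_divide_distrib)
      then have "W z = om z * (exp (- a) / (1 + b) * k z + exp (- a) * (1 + b) * r z)"
        unfolding W_def by (simp add: k_def r_def b_def e_def algebra_simps)
      also have "\<dots> \<le> om z * ((1 - a - b + 4 * m\<^sup>2) * k z + (1 - a + b + 4 * m\<^sup>2) * r z)"
        using om[of z] inner_variation_factor[OF a b m1]
        by (intro mult_left_mono add_mono mult_right_mono k0 r0) auto
      also have "\<dots> = Y z"
        by (simp add: Y_def q_def X_def a_def b_def algebra_simps)
      finally show ?case .
    qed
    have Y0: "AE z in Q. 0 \<le> Y z" using WY by eventually_elim (use W0 order_trans in blast)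
    have "J \<epsilon> \<beta> v \<le> (\<integral>\<^sup>+z. ennreal (W z) \<partial>Q)"
      using min[OF tc] unfolding J_bwd[OF tc v \<epsilon>] W_def .
    also have "\<dots> \<le> (\<integral>\<^sup>+z. ennreal (Y z) \<partial>Q)"
      by (rule nn_integral_mono_AE) (use WY in \<open>auto elim!: eventually_mono intro: ennreal_leI\<close>)
    also have "\<dots> = ennreal (LINT z|Q. Y z)" by (rule nn_integral_eq_integral[OF Yi Y0])
    finally have "(LINT z|Q. q z) \<le> (LINT z|Q. Y z)"
      unfolding Jr by (subst (asm) ennreal_le_iff) (use Y0 in \<open>auto intro: integral_nonneg_AE\<close>)
    also have "\<dots> = (LINT z|Q. q z) - \<delta> * (LINT z|Q. X z) + 4 * m\<^sup>2 * (LINT z|Q. q z)"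
      unfolding Y_def[abs_def] using qi Xi by simp
    finally have "\<delta> * (LINT z|Q. X z) \<le> \<delta> * (4 * \<delta> * (L + 1)\<^sup>2 * (LINT z|Q. q z))"
      by (simp add: m_def power_mult_distrib power2_eq_square mult.assoc mult.left_commute)
    then show ?thesis using \<delta>(1) by (rule mult_left_le_imp_le)
  qed
  have Iq: "0 \<le> (LINT z|Q. q z)" using q0 by (simp add: integral_nonneg)
  have X0: "(LINT z|Q. X z) \<le> 0"
  proof (rule field_le_epsilon)
    fix d :: real assume d: "0 < d"
    define N where "N = 4 * (L + 1)\<^sup>2 * ((LINT z|Q. q z) + 1)"
    have N: "0 < N" using L Iq by (simp add: N_def add_nonneg_pos)
    \<comment> \<open>The first bound keeps m <= 1, as the expansion requires; the second makes the
      remainder at most d.\<close>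
    define \<delta> where "\<delta> = min (1 / (L + 1)) (d / N)"
    have \<delta>: "0 < \<delta>" "\<delta> \<le> 1 / (L + 1)" "\<delta> \<le> d / N" using L d N by (simp_all add: \<delta>_def)
    have "\<delta> * (L + 1) \<le> 1" using \<delta>(2) L by (simp add: pos_le_divide_eq)
    from key[OF \<delta>(1) this] have "(LINT z|Q. X z) \<le> \<delta> * (4 * (L + 1)\<^sup>2 * (LINT z|Q. q z))"
      by (simp add: mult.assoc mult.left_commute)
    also have "\<dots> \<le> \<delta> * N" unfolding N_def using \<delta>(1) by (intro mult_left_mono) auto
    also have "\<dots> \<le> d" using \<delta>(3) N by (simp add: pos_le_divide_eq)
    finally show "(LINT z|Q. X z) \<le> 0 + d" by simp
  qed
  \<comment> \<open>Adding s times q turns X into a nonnegative integrand: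
    \<open>energy_weight\<close> multiplies k + r, and k keeps the extra factor 2 e. Since s <= 1,
    the cost is at most the energy.\<close>
  define s where "s = L / (1 + L)"
  have s: "0 \<le> s" "s \<le> 1" using L by (simp_all add: s_def)
  define Z where "Z z = X z + s * q z" for z
  have Zi: "integrable Q Z" unfolding Z_def[abs_def] using qi Xi by auto
  have Ze: "Z z = decay \<epsilon> z * (energy_weight L \<epsilon> (snd z) * (\<epsilon> * dt_sq D v z + rest \<beta> v z)
      + 2 * stretch_deriv L \<epsilon> (snd z) * (\<epsilon> * dt_sq D v z))" for z
  proof -
    have "Z z = om z * ((h z - e z + s) * (k z + r z) + 2 * e z * k z)"
      by (simp add: Z_def X_def q_def algebra_simps)
    then show ?thesis by (simp add: om_def h_def e_def s_def k_def r_def energy_weight_def)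
  qed
  have Z0: "AE z in Q. 0 \<le> Z z"
    using AE_Q_pos
  proof eventually_elim
    case (elim z)
    have "0 \<le> energy_weight L \<epsilon> (snd z)" using elim by (intro energy_weight_nonneg[OF L \<epsilon>]) simp
    then show ?case unfolding Ze using \<epsilon> k0[of z] r0[of z] stretch_deriv_bounds(1)[OF L \<epsilon>, of "snd z"]
      by (intro mult_nonneg_nonneg add_nonneg_nonneg dt_sq_nonneg) (auto simp: k_def r_def)
  qed
  have "(\<integral>\<^sup>+z. ennreal (Z z) \<partial>Q) = ennreal (LINT z|Q. Z z)" by (rule nn_integral_eq_integral[OF Zi Z0])
  also have "(LINT z|Q. Z z) = (LINT z|Q. X z) + s * (LINT z|Q. q z)"
    unfolding Z_def[abs_def] using qi Xi by simp
  also have "ennreal \<dots> \<le> ennreal (LINT z|Q. q z)"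
    using X0 mult_right_mono[OF s(2) Iq] by (intro ennreal_leI) simp
  finally show ?thesis unfolding Ze Jr .
qed

end

subsection \<open>A priori estimates\<close>

locale minimizer = lagrangian D A F M
  for D :: "'a::euclidean_space set" and A :: "real^'k^'k" and F :: "'k \<Rightarrow> real \<Rightarrow> real" and M :: real +
  fixes \<epsilon> \<beta> :: real and v :: "'a \<times> real \<Rightarrow> real^'k"
  assumes v: "v \<in> U_space D" and fin: "J \<epsilon> \<beta> v < \<infinity>" and \<epsilon>: "0 < \<epsilon>" and \<beta>: "0 < \<beta>"
    and min: "time_change \<psi> \<phi> \<psi>' c C \<Longrightarrow> J \<epsilon> \<beta> v \<le> J \<epsilon> \<beta> (\<lambda>z. v (time_change.bwd \<phi> z))"
begin

definition density :: "real \<Rightarrow> 'a \<times> real \<Rightarrow> real" where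
  "density L z = decay \<epsilon> z * (energy_weight L \<epsilon> (snd z) * (\<epsilon> * dt_sq D v z + rest \<beta> v z)
      + 2 * stretch_deriv L \<epsilon> (snd z) * (\<epsilon> * dt_sq D v z))"

definition total :: "'a \<times> real \<Rightarrow> real" where
  "total z = \<epsilon> * dt_sq D v z + rest \<beta> v z"

lemma total_nonneg: "0 \<le> total z"
  using \<epsilon> \<beta> by (simp add: total_def dt_sq_nonneg rest_nonneg)

lemma total_measurable: "total \<in> borel_measurable Q"
  unfolding total_def[abs_def]
  by (intro borel_measurable_add rest_measurable[OF v] borel_measurable_const borel_measurable_times
      U_space_measurable[OF v D(1)])

lemma density_integral: "0 < L \<Longrightarrow> (\<integral>\<^sup>+z. ennreal (density L z) \<partial>Q) \<le> J \<epsilon> \<beta> v"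
  unfolding density_def by (rule inner_variation[OF v fin \<epsilon> \<beta> _ min])

lemma density_measurable:
  assumes L: "0 < L"
  shows "density L \<in> borel_measurable Q"
proof -
  have c: "continuous_on UNIV (stretch_deriv L \<epsilon>)" by (rule smooth_fun_continuous[OF smooth_stretch_deriv[OF L \<epsilon>]])
  have c': "continuous_on UNIV (stretch L \<epsilon>)"
    by (rule DERIV_continuous_on, rule has_field_derivative_at_within, rule stretch_has_derivative[OF L \<epsilon>])
  have m: "stretch_deriv L \<epsilon> \<in> borel_measurable borel" "stretch L \<epsilon> \<in> borel_measurable borel"
    using c c' by (auto intro: borel_measurable_continuous_onI)
  then have "energy_weight L \<epsilon> \<in> borel_measurable borel" unfolding energy_weight_def[abs_def] by simp
  then have w: "(\<lambda>z. energy_weight L \<epsilon> (snd z)) \<in> borel_measurable Q" by (rule borel_measurable_snd_lebesgue_on)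
  have s: "(\<lambda>z. stretch_deriv L \<epsilon> (snd z)) \<in> borel_measurable Q" by (rule borel_measurable_snd_lebesgue_on[OF m(1)])
  note o = decay_measurable[of \<epsilon> "halfcyl D"]
  show ?thesis
    unfolding density_def[abs_def]
    by (intro borel_measurable_times[OF o] borel_measurable_add borel_measurable_times w s
        rest_measurable[OF v] borel_measurable_const U_space_measurable[OF v D(1)])
qed

lemma density_ge:
  assumes L: "0 < L" and t: "0 < snd z"
  shows "decay \<epsilon> z * (energy_weight L \<epsilon> (snd z) * total z) \<le> density L z"
    "exp (- snd z / \<epsilon>) * (2 * stretch_deriv L \<epsilon> (snd z) * dt_sq D v z) \<le> density L z"
    "0 \<le> density L z"
proof -
  have 1: "0 \<le> energy_weight L \<epsilon> (snd z) * total z"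
    using energy_weight_nonneg[OF L \<epsilon>, of "snd z"] t total_nonneg[of z] by simp
  have 2: "0 \<le> 2 * stretch_deriv L \<epsilon> (snd z) * (\<epsilon> * dt_sq D v z)"
    using stretch_deriv_bounds(1)[OF L \<epsilon>, of "snd z"] \<epsilon> by (simp add: dt_sq_nonneg)
  have o: "0 \<le> decay \<epsilon> z" using \<epsilon> by simp
  have d: "density L z = decay \<epsilon> z * (energy_weight L \<epsilon> (snd z) * total z
      + 2 * stretch_deriv L \<epsilon> (snd z) * (\<epsilon> * dt_sq D v z))" by (simp add: density_def total_def)
  show "decay \<epsilon> z * (energy_weight L \<epsilon> (snd z) * total z) \<le> density L z"
    unfolding d using 2 o by (intro mult_left_mono) auto
  have "decay \<epsilon> z * (2 * stretch_deriv L \<epsilon> (snd z) * (\<epsilon> * dt_sq D v z)) \<le> density L z"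
    unfolding d using 1 o by (intro mult_left_mono) auto
  then show "exp (- snd z / \<epsilon>) * (2 * stretch_deriv L \<epsilon> (snd z) * dt_sq D v z) \<le> density L z"
    using \<epsilon> by (simp add: mult.left_commute)
  show "0 \<le> density L z" unfolding d by (rule mult_nonneg_nonneg[OF o add_nonneg_nonneg[OF 1 2]])
qed

text \<open>On the first cell the energy itself suffices; on the cell starting at \<open>n \<epsilon>\<close> the weight is
  comparable to 1 for \<open>L = exp n / 2\<close>.\<close>
lemma cell_estimate:
  "(\<integral>\<^sup>+z. ennreal (total z) * indicator {real n * \<epsilon>..real (Suc n) * \<epsilon>} (snd z) \<partial>Q) \<le> ennreal (27 * \<epsilon>) * J \<epsilon> \<beta> v"
proof -
  let ?I = "{real n * \<epsilon>..real (Suc n) * \<epsilon>}"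
  \<comment> \<open>g is the weighted energy density itself for n = 0 and \<open>density L\<close>
    otherwise; for n = 0 already the factor 3 in place of 27 would compensate the weight.\<close>
  have "\<exists>g. g \<in> borel_measurable Q \<and> (\<integral>\<^sup>+z. ennreal (g z) \<partial>Q) \<le> J \<epsilon> \<beta> v \<and>
      (\<forall>z. 0 < snd z \<longrightarrow> snd z \<in> ?I \<longrightarrow> total z \<le> 27 * \<epsilon> * g z)"
  proof (cases "n = 0")
    case True
    let ?g = "\<lambda>z. decay \<epsilon> z * total z"
    have "total z \<le> 27 * \<epsilon> * ?g z" if "snd z \<in> ?I" for z
    proof -
      have "snd z / \<epsilon> \<le> 1" using that True \<epsilon> by (simp add: pos_divide_le_eq)
      then have "exp (- 1) \<le> exp (- snd z / \<epsilon>)" by simp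
      moreover have "1 \<le> 3 * exp (- 1 :: real)" using exp_le by (simp add: exp_minus field_simps)
      ultimately have "1 \<le> 27 * exp (- snd z / \<epsilon>)" using exp_gt_zero[of "- 1 :: real"] by linarith
      from mult_right_mono[OF this total_nonneg[of z]] show ?thesis using \<epsilon> by simp
    qed
    moreover have "?g \<in> borel_measurable Q" unfolding total_def by (rule J_measurable[OF v])
    moreover have "(\<integral>\<^sup>+z. ennreal (?g z) \<partial>Q) \<le> J \<epsilon> \<beta> v" by (simp add: J_def total_def)
    ultimately show ?thesis by blast
  next
    case False
    define L :: real where "L = exp (real n) / 2"
    have L0: "0 < L" by (simp add: L_def)
    have "exp 1 \<le> exp (real n)" using False by simp
    moreover have "2 \<le> exp (1 :: real)" using exp_ge_add_one_self[of "1 :: real"] by simp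
    ultimately have "2 \<le> exp (real n)" by linarith
    then have L1: "1 \<le> L" by (simp add: L_def)
    have "total z \<le> 27 * \<epsilon> * density L z" if p: "0 < snd z" and I: "snd z \<in> ?I" for z
    proof -
      define y where "y = exp (snd z / \<epsilon>)"
      have s: "real n \<le> snd z / \<epsilon>" "snd z / \<epsilon> \<le> real n + 1"
        using I \<epsilon> by (simp_all add: pos_le_divide_eq pos_divide_le_eq algebra_simps)
      have y1: "2 * L \<le> y" using s(1) by (simp add: L_def y_def)
      have "y \<le> exp (real n + 1)" using s(2) by (simp add: y_def)
      also have "\<dots> \<le> exp (real n) * 3" unfolding exp_add using exp_le by (intro mult_left_mono) auto
      finally have y2: "y \<le> 6 * L" by (simp add: L_def)
      have y0: "0 < y" by (simp add: y_def)
      have "y \<le> 27 * energy_weight L \<epsilon> (snd z)"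
        using energy_weight_lower[OF L0 \<epsilon> _ _ L1, of "snd z"] y1 y2 by (simp add: y_def)
      then have "1 \<le> 27 * (energy_weight L \<epsilon> (snd z) / y)" using y0 by (simp add: pos_le_divide_eq)
      from mult_right_mono[OF this total_nonneg[of z]]
      have "total z \<le> 27 * \<epsilon> * (decay \<epsilon> z * (energy_weight L \<epsilon> (snd z) * total z))"
        using \<epsilon> by (simp add: y_def exp_minus field_simps)
      also have "\<dots> \<le> 27 * \<epsilon> * density L z"
        using density_ge(1)[OF L0 p] \<epsilon> by (intro mult_left_mono) auto
      finally show ?thesis .
    qed
    then show ?thesis using density_measurable[OF L0] density_integral[OF L0] by blast
  qed
  then obtain g where g: "g \<in> borel_measurable Q" "(\<integral>\<^sup>+z. ennreal (g z) \<partial>Q) \<le> J \<epsilon> \<beta> v"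
    "\<And>z. 0 < snd z \<Longrightarrow> snd z \<in> ?I \<Longrightarrow> total z \<le> 27 * \<epsilon> * g z" by blast
  have "(\<integral>\<^sup>+z. ennreal (total z) * indicator ?I (snd z) \<partial>Q) \<le> (\<integral>\<^sup>+z. ennreal (27 * \<epsilon>) * ennreal (g z) \<partial>Q)"
  proof (rule nn_integral_mono_AE)
    show "AE z in Q. ennreal (total z) * indicator ?I (snd z) \<le> ennreal (27 * \<epsilon>) * ennreal (g z)"
      using AE_Q_pos
    proof eventually_elim
      case (elim z)
      show ?case
      proof (cases "snd z \<in> ?I")
        case True
        have "ennreal (total z) \<le> ennreal (27 * \<epsilon> * g z)" by (rule ennreal_leI[OF g(3)[OF elim True]])
        also have "\<dots> = ennreal (27 * \<epsilon>) * ennreal (g z)" using \<epsilon> by (intro ennreal_mult') simp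
        finally show ?thesis using True by simp
      qed simp
    qed
  qed
  also have "\<dots> = ennreal (27 * \<epsilon>) * (\<integral>\<^sup>+z. ennreal (g z) \<partial>Q)"
    by (rule nn_integral_cmult) (rule measurable_compose[OF g(1) measurable_ennreal])
  also have "\<dots> \<le> ennreal (27 * \<epsilon>) * J \<epsilon> \<beta> v" by (rule mult_left_mono[OF g(2)]) simp
  finally show ?thesis .
qed

text \<open>For L = exp n the bound of \<open>stretch_deriv_lower\<close> holds up to time n
  \<epsilon>, with constants free of n, so monotone convergence reaches all times. The factor 2 is 4
  / 2: four from that lemma, and \<open>density\<close> contains \<eta>' twice.\<close>

lemma time_derivative_estimate: "(\<integral>\<^sup>+z. ennreal (dt_sq D v z) \<partial>Q) \<le> ennreal 2 * J \<epsilon> \<beta> v"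
proof -
  define f where "f n z = ennreal (dt_sq D v z) * indicator {..real n * \<epsilon>} (snd z)" for n :: nat and z :: "'a \<times> real"
  have le: "(\<integral>\<^sup>+z. f n z \<partial>Q) \<le> ennreal 2 * J \<epsilon> \<beta> v" for n
  proof -
    define L :: real where "L = exp (real n)"
    have L0: "0 < L" by (simp add: L_def)
    have "(\<integral>\<^sup>+z. f n z \<partial>Q) \<le> (\<integral>\<^sup>+z. ennreal 2 * ennreal (density L z) \<partial>Q)"
    proof (rule nn_integral_mono_AE)
      show "AE z in Q. f n z \<le> ennreal 2 * ennreal (density L z)"
        using AE_Q_pos
      proof eventually_elim
        case (elim z)
        show ?case
        proof (cases "snd z \<le> real n * \<epsilon>")
          case True
          define y where "y = exp (snd z / \<epsilon>)"
          have y0: "0 < y" by (simp add: y_def)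
          have "snd z / \<epsilon> \<le> real n" using True \<epsilon> by (simp add: pos_divide_le_eq)
          then have "y \<le> 4 * stretch_deriv L \<epsilon> (snd z)"
            using stretch_deriv_lower[OF L0 \<epsilon>, of "snd z"] by (simp add: y_def L_def)
          then have "1 \<le> 4 * (stretch_deriv L \<epsilon> (snd z) / y)" using y0 by (simp add: pos_le_divide_eq)
          from mult_right_mono[OF this dt_sq_nonneg[of D v z]]
          have "dt_sq D v z \<le> 2 * (exp (- snd z / \<epsilon>) * (2 * stretch_deriv L \<epsilon> (snd z) * dt_sq D v z))"
            by (simp add: y_def exp_minus field_simps)
          also have "\<dots> \<le> 2 * density L z"
            using density_ge(2)[OF L0 elim] by (intro mult_left_mono) auto
          finally have "ennreal (dt_sq D v z) \<le> ennreal (2 * density L z)" by (rule ennreal_leI)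
          also have "\<dots> = ennreal 2 * ennreal (density L z)" by (intro ennreal_mult') simp
          finally show ?thesis using True by (simp add: f_def)
        qed (simp add: f_def)
      qed
    qed
    also have "\<dots> = ennreal 2 * (\<integral>\<^sup>+z. ennreal (density L z) \<partial>Q)"
      by (rule nn_integral_cmult) (rule measurable_compose[OF density_measurable[OF L0] measurable_ennreal])
    also have "\<dots> \<le> ennreal 2 * J \<epsilon> \<beta> v" by (rule mult_left_mono[OF density_integral[OF L0]]) simp
    finally show ?thesis .
  qed
  have fm: "f n \<in> borel_measurable Q" for n
  proof -
    have i: "(\<lambda>t. indicator {..real n * \<epsilon>} t :: real) \<in> borel_measurable borel" by simp
    have "(\<lambda>z. dt_sq D v z * indicator {..real n * \<epsilon>} (snd z)) \<in> borel_measurable Q"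
      by (intro borel_measurable_times U_space_measurable[OF v D(1)] borel_measurable_snd_lebesgue_on[OF i])
    from measurable_compose[OF this measurable_ennreal]
    show ?thesis unfolding f_def by (rule measurable_cong[THEN iffD1, rotated]) (simp add: indicator_def)
  qed
  have inc: "incseq f"
  proof (rule incseq_SucI, rule le_funI)
    fix n and z :: "'a \<times> real"
    have "real n * \<epsilon> \<le> real (Suc n) * \<epsilon>" using \<epsilon> by (simp add: mult_right_mono)
    then have "snd z \<le> real n * \<epsilon> \<Longrightarrow> snd z \<le> real (Suc n) * \<epsilon>" by linarith
    then show "f n z \<le> f (Suc n) z" unfolding f_def by (simp only: indicator_def atMost_iff split: if_split) simp
  qed
  have "(\<integral>\<^sup>+z. ennreal (dt_sq D v z) \<partial>Q) \<le> (\<integral>\<^sup>+z. (SUP n. f n z) \<partial>Q)"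
  proof (rule nn_integral_mono)
    fix z :: "'a \<times> real"
    obtain n where "snd z / \<epsilon> < real n" using reals_Archimedean2 by blast
    then have "snd z \<le> real n * \<epsilon>" using \<epsilon> by (simp add: pos_divide_less_eq)
    then have "ennreal (dt_sq D v z) = f n z" by (simp add: f_def)
    also have "\<dots> \<le> (SUP n. f n z)" by (rule SUP_upper) simp
    finally show "ennreal (dt_sq D v z) \<le> (SUP n. f n z)" .
  qed
  also have "\<dots> = (SUP n. \<integral>\<^sup>+z. f n z \<partial>Q)" by (rule nn_integral_monotone_convergence_SUP[OF inc fm])
  also have "\<dots> \<le> ennreal 2 * J \<epsilon> \<beta> v" by (rule SUP_least) (rule le)
  finally show ?thesis .
qed

text \<open>The window meets at most T / \<epsilon> + 2 <= 3 T / \<epsilon> cells, as T >=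
  \<epsilon>, and each carries at most 27 \<epsilon> times J. The remaining factor 2 in 162 = 2 * 3
  * 27 compensates the \<beta> / 2 in \<open>rest\<close>.\<close>

lemma window_estimate:
  assumes \<tau>: "0 \<le> \<tau>" and T: "\<epsilon> \<le> T"
  shows "(\<integral>\<^sup>+z. ennreal (grad_sq D v z + \<beta> * competition A (v z)) * indicator {\<tau><..<\<tau> + T} (snd z) \<partial>Q)
    \<le> ennreal (162 * T) * J \<epsilon> \<beta> v"
proof -
  define N where "N = {nat \<lfloor>\<tau> / \<epsilon>\<rfloor>..nat \<lfloor>(\<tau> + T) / \<epsilon>\<rfloor>}"
  let ?c = "\<lambda>n z. ennreal (total z) * indicator {real n * \<epsilon>..real (Suc n) * \<epsilon>} (snd z)"
  have cm: "?c n \<in> borel_measurable Q" for n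
  proof -
    have i: "(\<lambda>t. indicator {real n * \<epsilon>..real (Suc n) * \<epsilon>} t :: real) \<in> borel_measurable borel" by simp
    have "(\<lambda>z. total z * indicator {real n * \<epsilon>..real (Suc n) * \<epsilon>} (snd z)) \<in> borel_measurable Q"
      by (intro borel_measurable_times total_measurable borel_measurable_snd_lebesgue_on[OF i])
    from measurable_compose[OF this measurable_ennreal]
    show ?thesis by (rule measurable_cong[THEN iffD1, rotated]) (simp add: indicator_def)
  qed
  have "(\<integral>\<^sup>+z. ennreal (grad_sq D v z + \<beta> * competition A (v z)) * indicator {\<tau><..<\<tau> + T} (snd z) \<partial>Q)
    \<le> (\<integral>\<^sup>+z. ennreal 2 * (\<Sum>n\<in>N. ?c n z) \<partial>Q)"
  proof (rule nn_integral_mono)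
    fix z
    show "ennreal (grad_sq D v z + \<beta> * competition A (v z)) * indicator {\<tau><..<\<tau> + T} (snd z) \<le> ennreal 2 * (\<Sum>n\<in>N. ?c n z)"
    proof (cases "snd z \<in> {\<tau><..<\<tau> + T}")
      case True
      define n where "n = nat \<lfloor>snd z / \<epsilon>\<rfloor>"
      have "0 \<le> snd z / \<epsilon>" using True \<tau> \<epsilon> by simp
      then have n: "real n \<le> snd z / \<epsilon>" "snd z / \<epsilon> < real n + 1"
        unfolding n_def using floor_correct[of "snd z / \<epsilon>"] by simp_all
      have "\<tau> / \<epsilon> \<le> snd z / \<epsilon>" "snd z / \<epsilon> \<le> (\<tau> + T) / \<epsilon>" using True \<epsilon> by (simp_all add: divide_right_mono)
      then have nN: "n \<in> N" unfolding N_def n_def by (simp add: nat_mono floor_mono)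
      have nI: "snd z \<in> {real n * \<epsilon>..real (Suc n) * \<epsilon>}"
        using n \<epsilon> by (simp add: pos_le_divide_eq pos_divide_less_eq algebra_simps)
      have "grad_sq D v z + \<beta> * competition A (v z) \<le> 2 * total z"
        using \<epsilon> dt_sq_nonneg[of D v z] grad_sq_nonneg[of D v z] pot_nonneg[of "v z"]
        by (simp add: total_def rest_def)
      then have "ennreal (grad_sq D v z + \<beta> * competition A (v z)) \<le> ennreal (2 * total z)" by (rule ennreal_leI)
      also have "\<dots> = ennreal 2 * ennreal (total z)" by (intro ennreal_mult') simp
      also have "ennreal (total z) = ?c n z" using nI by simp
      also have "ennreal 2 * ?c n z \<le> ennreal 2 * (\<Sum>n\<in>N. ?c n z)"
        by (rule mult_left_mono[OF member_le_sum[OF nN]]) (auto simp: N_def)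
      finally show ?thesis using True by simp
    qed simp
  qed
  also have "\<dots> = ennreal 2 * (\<Sum>n\<in>N. \<integral>\<^sup>+z. ?c n z \<partial>Q)"
    using cm by (subst nn_integral_cmult) (auto simp only: nn_integral_sum intro!: borel_measurable_sum)
  also have "\<dots> \<le> ennreal 2 * (\<Sum>n\<in>N. ennreal (27 * \<epsilon>) * J \<epsilon> \<beta> v)"
    by (intro mult_left_mono sum_mono cell_estimate) simp
  also have "\<dots> = ennreal (2 * (real (card N) * (27 * \<epsilon>))) * J \<epsilon> \<beta> v"
  proof -
    have "ennreal (2 * (real (card N) * (27 * \<epsilon>))) = ennreal 2 * (ennreal (real (card N)) * ennreal (27 * \<epsilon>))"
      by (subst ennreal_mult', simp, subst ennreal_mult', simp, rule refl)
    moreover have "(\<Sum>n\<in>N. ennreal (27 * \<epsilon>) * J \<epsilon> \<beta> v) = ennreal (real (card N)) * (ennreal (27 * \<epsilon>) * J \<epsilon> \<beta> v)"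
      by (simp add: ennreal_of_nat_eq_real_of_nat)
    ultimately show ?thesis by (simp only: mult.assoc)
  qed
  also have "\<dots> \<le> ennreal (162 * T) * J \<epsilon> \<beta> v"
  proof (intro mult_right_mono ennreal_leI)
    have a: "0 \<le> \<tau> / \<epsilon>" "\<tau> / \<epsilon> \<le> (\<tau> + T) / \<epsilon>" using \<tau> \<epsilon> T by (simp_all add: divide_right_mono)
    have "real (card N) \<le> real (nat \<lfloor>(\<tau> + T) / \<epsilon>\<rfloor>) + 1 - real (nat \<lfloor>\<tau> / \<epsilon>\<rfloor>)"
      using nat_mono[OF floor_mono[OF a(2)]] by (simp add: N_def of_nat_diff)
    moreover have "real (nat \<lfloor>(\<tau> + T) / \<epsilon>\<rfloor>) \<le> (\<tau> + T) / \<epsilon>" using order_trans[OF a] by simp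
    moreover have "\<tau> / \<epsilon> - 1 \<le> real (nat \<lfloor>\<tau> / \<epsilon>\<rfloor>)" using a(1) floor_correct[of "\<tau> / \<epsilon>"] by simp
    ultimately have "real (card N) \<le> (\<tau> + T) / \<epsilon> - \<tau> / \<epsilon> + 2" by linarith
    then have "real (card N) \<le> T / \<epsilon> + 2" by (simp add: add_divide_distrib)
    then have "real (card N) * \<epsilon> \<le> (T / \<epsilon> + 2) * \<epsilon>" using \<epsilon> by (intro mult_right_mono) auto
    also have "\<dots> = T + 2 * \<epsilon>" using \<epsilon> by (simp add: distrib_right)
    also have "\<dots> \<le> 3 * T" using T by simp
    finally show "2 * (real (card N) * (27 * \<epsilon>)) \<le> 162 * T" by (simp add: mult.commute)
  qed simp
  finally show ?thesis .
qed

end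

text \<open>The monotonicity is given on open half-lines, so the comparison points are - 1 and 2,
  and compactness is used on the larger interval between them.\<close>

lemma bounded_above_of_mono_antimono:
  fixes f :: "real \<Rightarrow> real"
  assumes c: "continuous_on UNIV f" and m: "mono_on {..<0} f" "antimono_on {1<..} f"
  obtains B where "\<And>y. f y \<le> B"
proof -
  have "compact (f ` {-1..2})"
    by (intro compact_continuous_image continuous_on_subset[OF c]) auto
  then have "bounded (f ` {-1..2})" by (rule compact_imp_bounded)
  then obtain B where "\<forall>x\<in>f ` {-1..2}. norm x \<le> B" unfolding bounded_iff by blast
  then have B: "y \<in> {-1..2} \<Longrightarrow> \<bar>f y\<bar> \<le> B" for y by simp
  have "f y \<le> B" for y
  proof -
    consider "y < - 1" | "- 1 \<le> y" "y \<le> 2" | "2 < y" by linarith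
    then show ?thesis
    proof cases
      case 1
      then have "f y \<le> f (- 1)" by (intro mono_onD[OF m(1)]) auto
      then show ?thesis using B[of "- 1"] by simp
    next
      case 2
      then show ?thesis using B[of y] by simp
    next
      case 3
      then have "f y \<le> f 2" by (intro monotone_onD[OF m(2), simplified]) auto
      then show ?thesis using B[of 2] by simp
    qed
  qed
  then show thesis by (rule that)
qed

theorem theorem2p2:
  fixes \<Omega> :: "(real^'n) set"
    and A :: "real^'k^'k"
    and F :: "'k \<Rightarrow> real \<Rightarrow> real"
    and v0 g0 :: "real^'n \<Rightarrow> real^'k"
    and U0 :: "((real^'n) \<times> real \<Rightarrow> real^'k) set"
  assumes "bounded_smooth_domain \<Omega>"
    and "CARD('k) \<ge> 2"
    and "transpose A = A"
    and "\<And>i. A $ i $ i = 0"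
    and "\<And>i j. i \<noteq> j \<Longrightarrow> A $ i $ j > 0"
    and "\<And>i. continuous_on UNIV (F i)"
    and "\<And>i. F i differentiable_on {0..<1}"
    and "\<And>i. mono_on {..<0} (F i)"
    and "\<And>i. antimono_on {1<..} (F i)"
    and "\<And>i. (F i has_real_derivative 0) (at 0 within {0..<1})"
    and "\<And>i. (\<lambda>x. v0 x $ i) \<in> H1 \<Omega>"
    and "\<And>i. AE x in lebesgue_on \<Omega>. 0 \<le> v0 x $ i \<and> v0 x $ i \<le> 1"
    and "\<And>i j. i \<noteq> j \<Longrightarrow> AE x in lebesgue_on \<Omega>. v0 x $ i * v0 x $ j = 0"
    and "\<And>i. has_boundary_trace \<Omega> (\<lambda>x. v0 x $ i) (\<lambda>x. g0 x $ i)"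
    and "U0 = U_init_bdry \<Omega> v0 g0 \<or> U0 = U_init \<Omega> v0"
  shows "\<exists>C::real. \<forall>\<epsilon> \<beta> v. 0 < \<epsilon> \<and> \<epsilon> < 1 \<and> 0 < \<beta> \<and>
           is_arg_min (energy \<Omega> A F \<epsilon> \<beta>) (\<lambda>w. w \<in> U0) v \<longrightarrow>
         (\<forall>\<tau>\<ge>0. \<forall>T\<ge>\<epsilon>.
            (\<integral>\<^sup>+ z \<in> \<Omega> \<times> {\<tau><..<\<tau> + T}.
               ennreal (grad_sq \<Omega> v z + \<beta> * competition A (v z)) \<partial>lebesgue)
              \<le> ennreal (C * T)) \<and>
         esssup (lebesgue_on (\<Omega> \<times> {0<..})) (\<lambda>z. ereal (norm (v z))) \<le> ereal C \<and>
         (\<integral>\<^sup>+ z \<in> \<Omega> \<times> {0<..}. ennreal (dt_sq \<Omega> v z) \<partial>lebesgue) \<le> ennreal C"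
proof -
  note A0 = assms(4) and Apos = assms(5) and Fc = assms(6) and Fm = assms(8,9) and H = assms(11)
    and bd = assms(12) and seg = assms(13) and tr = assms(14)
  have D: "open \<Omega>" "bounded \<Omega>" using assms(1) by (auto simp: bounded_smooth_domain_def)
  have "\<exists>B. \<forall>y. F i y \<le> B" for i
    using bounded_above_of_mono_antimono[OF Fc Fm] by metis
  then obtain B where B: "\<And>i y. F i y \<le> B i" by metis
  define M where "M = (\<Sum>i\<in>UNIV. \<bar>B i\<bar>)"
  have FM: "F i y \<le> M" for i y
  proof -
    have "\<bar>B i\<bar> \<le> M" unfolding M_def by (rule member_le_sum) auto
    then show ?thesis using B[of i y] by linarith
  qed
  interpret lagrangian \<Omega> A F M
  proof
    show "open \<Omega>" "bounded \<Omega>" by (rule D)+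
    show "0 \<le> A $ i $ j" for i j
      using A0[of i] Apos[of i j] by (cases "i = j") auto
    show "continuous_on UNIV (F i)" "F i y \<le> M" for i y by (rule Fc FM)+
    show "0 \<le> M" by (simp add: M_def sum_nonneg)
  qed
  obtain c where c: "initial_energy v0 = ennreal c" "0 \<le> c"
    using initial_energy_finite[OF H bd] by (cases "initial_energy v0") auto
  have U: "U0 \<subseteq> U_init \<Omega> v0" using assms(15) unfolding U_init_bdry_def by blast
  have Us: "U0 \<subseteq> U_space \<Omega>" using U by (auto simp: U_init_def)
  have U1: "(\<lambda>z. v0 (fst z)) \<in> U0"
    using assms(15) U_init_fst[OF D(1) tr] unfolding U_init_bdry_def by blast
  have v0t: "AE x in lebesgue_on \<Omega>. trunc (v0 x $ i) = v0 x $ i" for i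
    using bd[of i] by eventually_elim (simp add: trunc_id)
  note T = trunc_has_derivative trunc_deriv_continuous trunc_deriv_abs(1) trunc_id[of 0, simplified]
  have U2: "(\<lambda>z. \<chi> i. trunc (v z $ i)) \<in> U0" if "v \<in> U0" for v
    using assms(15)
  proof
    assume e: "U0 = U_init_bdry \<Omega> v0 g0"
    from that show ?thesis unfolding e by (rule U_init_bdry_chain[OF _ D(1) tr T v0t])
  next
    assume e: "U0 = U_init \<Omega> v0"
    from that show ?thesis unfolding e by (rule U_init_chain[OF _ D(1) T v0t])
  qed
  have U3: "(\<lambda>z. v (time_change.bwd \<phi> z)) \<in> U0" if v: "v \<in> U0" and tc: "time_change \<psi> \<phi> \<psi>' k K" for v \<psi> \<phi> \<psi>' k K
    using assms(15)
  proof
    assume e: "U0 = U_init_bdry \<Omega> v0 g0"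
    from v show ?thesis unfolding e by (rule time_change.U_init_bdry_bwd[OF tc _ D(1)])
  next
    assume e: "U0 = U_init \<Omega> v0"
    from v show ?thesis unfolding e by (rule time_change.U_init_bwd[OF tc _ D(1)])
  qed
  \<comment> \<open>The three summands serve the three claims: 162 c the time windows, 2 c the time
    derivative, and CARD('k) the norm, which is at most the sum of components in [0, 1]. The initial
    energy c involves neither \<epsilon> nor \<beta>.\<close>
  define C where "C = 162 * c + 2 * c + real CARD('k)"
  have C: "162 * c \<le> C" "2 * c \<le> C" "real CARD('k) \<le> C" using c by (simp_all add: C_def)
  show ?thesis
  proof (intro exI[of _ C] allI impI, elim conjE)
    fix \<epsilon> \<beta> :: real and v
    assume \<epsilon>: "0 < \<epsilon>" and \<beta>: "0 < \<beta>" and m: "is_arg_min (energy \<Omega> A F \<epsilon> \<beta>) (\<lambda>w. w \<in> U0) v"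
    have vU: "v \<in> U0" using m by (simp add: is_arg_min_def)
    have vi: "v \<in> U_init \<Omega> v0" and vs: "v \<in> U_space \<Omega>" using vU U Us by auto
    note le = arg_min_J_le[OF m _ Us \<epsilon> \<beta>]
    have Jc: "J \<epsilon> \<beta> v \<le> ennreal c"
      using le[OF U1] J_initial[OF H seg A0 \<epsilon>, of \<beta>] c(1) by simp
    then have fin: "J \<epsilon> \<beta> v < \<infinity>" by (simp add: le_less_trans)
    interpret minimizer \<Omega> A F M \<epsilon> \<beta> v
    proof
      show "J \<epsilon> \<beta> v \<le> J \<epsilon> \<beta> (\<lambda>z. v (time_change.bwd \<phi> z))" if "time_change \<psi> \<phi> \<psi>' k K" for \<psi> \<phi> \<psi>' k K
        by (rule le[OF U3[OF vU that]])
    qed (use vs fin \<epsilon> \<beta> in auto)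
    have restrict: "(\<integral>\<^sup>+z. g z \<partial>Q) = (\<integral>\<^sup>+z. g z * indicator (halfcyl \<Omega>) z \<partial>lebesgue)" for g :: "(real^'n) \<times> real \<Rightarrow> ennreal"
      using Q_sets by (intro nn_integral_restrict_space) simp
    show "(\<forall>\<tau>\<ge>0. \<forall>T\<ge>\<epsilon>. (\<integral>\<^sup>+ z \<in> \<Omega> \<times> {\<tau><..<\<tau> + T}. ennreal (grad_sq \<Omega> v z + \<beta> * competition A (v z)) \<partial>lebesgue) \<le> ennreal (C * T)) \<and>
         esssup (lebesgue_on (\<Omega> \<times> {0<..})) (\<lambda>z. ereal (norm (v z))) \<le> ereal C \<and>
         (\<integral>\<^sup>+ z \<in> \<Omega> \<times> {0<..}. ennreal (dt_sq \<Omega> v z) \<partial>lebesgue) \<le> ennreal C"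
    proof (intro conjI allI impI)
      fix \<tau> T :: real assume \<tau>: "0 \<le> \<tau>" and T: "\<epsilon> \<le> T"
      have "(\<integral>\<^sup>+ z \<in> \<Omega> \<times> {\<tau><..<\<tau> + T}. ennreal (grad_sq \<Omega> v z + \<beta> * competition A (v z)) \<partial>lebesgue)
        = (\<integral>\<^sup>+z. ennreal (grad_sq \<Omega> v z + \<beta> * competition A (v z)) * indicator {\<tau><..<\<tau> + T} (snd z) \<partial>Q)"
        unfolding restrict
      proof (rule nn_integral_cong)
        fix z
        show "ennreal (grad_sq \<Omega> v z + \<beta> * competition A (v z)) * indicator (\<Omega> \<times> {\<tau><..<\<tau> + T}) z
          = ennreal (grad_sq \<Omega> v z + \<beta> * competition A (v z)) * indicator {\<tau><..<\<tau> + T} (snd z) * indicator (halfcyl \<Omega>) z"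
          using \<tau> by (auto simp: indicator_def mem_Times_iff)
      qed
      also have "\<dots> \<le> ennreal (162 * T) * J \<epsilon> \<beta> v" by (rule window_estimate[OF \<tau> T])
      also have "\<dots> \<le> ennreal (162 * T) * ennreal c" by (rule mult_left_mono[OF Jc]) simp
      also have "\<dots> = ennreal (162 * c * T)" using \<epsilon> T c by (simp add: ennreal_mult[symmetric] mult.commute mult.left_commute)
      also have "\<dots> \<le> ennreal (C * T)" using \<epsilon> T C(1) by (intro ennreal_leI mult_right_mono) auto
      finally show "(\<integral>\<^sup>+ z \<in> \<Omega> \<times> {\<tau><..<\<tau> + T}. ennreal (grad_sq \<Omega> v z + \<beta> * competition A (v z)) \<partial>lebesgue) \<le> ennreal (C * T)" .
    next
      have b: "AE z in Q. 0 \<le> v z $ i \<and> v z $ i \<le> 1" for i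
        by (rule minimizer_bounds[OF vi fin \<epsilon> \<beta> le[OF U2[OF vU]] le_trunc[OF Fm] bd])
      have "AE z in Q. \<forall>i\<in>UNIV. 0 \<le> v z $ i \<and> v z $ i \<le> 1" by (subst AE_finite_all, simp, intro ballI, rule b)
      then have "AE z in Q. ereal (norm (v z)) \<le> ereal C"
      proof eventually_elim
        case (elim z)
        have "norm (v z) \<le> (\<Sum>i\<in>UNIV. \<bar>v z $ i\<bar>)" by (rule norm_le_l1_cart)
        also have "\<dots> \<le> (\<Sum>i\<in>(UNIV :: 'k set). 1)" using elim by (intro sum_mono) auto
        also have "\<dots> \<le> C" using C(3) by simp
        finally show ?case by simp
      qed
      moreover have "(\<lambda>z. ereal (norm (v z))) \<in> borel_measurable Q"
        unfolding norm_vec_def L2_set_def real_norm_def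
        by (intro borel_measurable_ereal measurable_compose[OF _ borel_measurable_sqrt] borel_measurable_sum
            borel_measurable_power borel_measurable_abs U_space_measurable[OF vs D(1)])
      ultimately show "esssup Q (\<lambda>z. ereal (norm (v z))) \<le> ereal C" by (intro esssup_I)
    next
      have "(\<integral>\<^sup>+ z \<in> \<Omega> \<times> {0<..}. ennreal (dt_sq \<Omega> v z) \<partial>lebesgue) \<le> ennreal 2 * J \<epsilon> \<beta> v"
        using time_derivative_estimate unfolding restrict .
      also have "\<dots> \<le> ennreal 2 * ennreal c" by (rule mult_left_mono[OF Jc]) simp
      also have "\<dots> = ennreal (2 * c)" by (rule ennreal_mult'[symmetric]) simp
      also have "\<dots> \<le> ennreal C" using C(2) by (rule ennreal_leI)
      finally show "(\<integral>\<^sup>+ z \<in> \<Omega> \<times> {0<..}. ennreal (dt_sq \<Omega> v z) \<partial>lebesgue) \<le> ennreal C" .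
    qed
  qed
qed

end
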